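(* Let $1<q\le\alpha\le p\le\infty$. There exists a constant $C>0$ such that $$\|Mf\|_{q,p,\alpha}\le C\,\|f\|_{q,p,\alpha}\qquad\text{for all } f\in L^q_{loc}(\mu),$$ where $M$ is the Dunkl-type Hardy–Littlewood maximal operator on $\mathbb R$.
   Context: Fix a real number $\kappa>-1/2$. Let $\mu$ be the measure on $\mathbb R$ given by $d\mu(x)=\left(2^{\kappa+1}\Gamma(\kappa+1)\right)^{-1}|x|^{2\kappa+1}dx$; $L^p(\mu)$ ($1\le p\le\infty$) is the corresponding Lebesgue space with norm $\|\cdot\|_p$, and $L^0(\mu)$ is the space of $\mu$-a.e. equivalence classes of complex-valued $\mu$-measurable functions on $\mathbb R$. Convention: $1/\infty=0$. Dunkl translation. Let $j_\kappa(z)=\Gamma(\kappa+1)\sum_{n\ge0}\frac{(-1)^nz^{2n}}{n!\,2^{2n}\Gamma(n+\kappa+1)}$ and let $\mathfrak E(z)=j_\kappa(iz)+\frac{z}{2(\kappa+1)}j_{\kappa+1}(iz)$, $z\in\mathbb C$ (the Dunkl kernel). The Dunkl transform is $\mathcal F f(\lambda)=\int_{\mathbb R}\mathfrak E(-i\lambda x)f(x)\,d\mu(x)$ for $f\in L^1(\mu)$, and it extends uniquely to an isometric isomorphism of $L^2(\mu)$. For $y\in\mathbb R$ the generalized (Dunkl) translation $\tau_y$ is defined on $L^2(\mu)$ by $\mathcal F(\tau_yf)(x)=\mathfrak E(ixy)\mathcal F(f)(x)$, and it extends to a bounded operator on every $L^p(\mu)$, $p\ge1$. Balls. $B_r=B(0,r)=(-r,r)$,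 and for $x\ne0$, $B(x,r)=\{y\in\mathbb R:\max\{0,|x|-r\}<|y|<|x|+r\}$. The function $\tau_x\chi_{B_r}$ satisfies $0\le\tau_x\chi_{B_r}\le1$ and is supported in $B(x,r)$. For a nonnegative measurable $g$, the integral $\int_{\mathbb R}(\tau_yg)\chi_{B_r}\,d\mu$ is understood as $\int_{\mathbb R}g(x)\,\tau_{-y}\chi_{B_r}(x)\,d\mu(x)\in[0,\infty]$. Norms. For $1\le q,p\le\infty$, $r>0$ and $f\in L^0(\mu)$, with the $L^p(\mu)$-norm taken in the variable $y$, put $${}_r\|f\|_{q,p}=\Big\|\Big[\int_{\mathbb R}(\tau_y|f|^q)(x)\chi_{B_r}(x)\,d\mu(x)\Big]^{1/q}\Big\|_p\ (q<\infty),\qquad {}_r\|f\|_{\infty,p}=\big\|\,\|f\chi_{B(y,r)}\|_\infty\big\|_p .$$ For $1\le q\le\alpha\le p\le\infty$ put $\|f\|_{q,p,\alpha}=\sup_{r>0}\mu(B_r)^{\frac1\alpha-\frac1q-\frac1p}\ {}_r\|f\|_{q,p}\in[0,\infty]$. Maximal operator. $Mf(x)=\sup_{r>0}\mu(B(0,r))^{-1}\int_{B(0,r)}\tau_x|f|(y)\,d\mu(y)$, $x\in\mathbb R$. $L^q_{loc}(\mu)$ denotes the functions that are in $L^q$ with respect to $\mu$ on every compact subset of $\mathbb R$. *)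

theory Defs
  imports "HOL-Probability.Essential_Supremum" "HOL-Analysis.Analysis"
begin

text \<open>
  Exponents in \<open>[1, \<infinity>]\<close> have type \<^typ>\<open>ennreal\<close>, where \<open>1 / \<infinity> = 0\<close>. Since the maximal function
  may take the value \<open>\<infinity>\<close> and all norms below depend only on absolute values, the norms are defined
  on functions with values in \<^typ>\<open>ennreal\<close>; the norm of a complex function \<open>f\<close> is that of \<open>|f|\<close>.
\<close>

definition ennreal_powr :: "ennreal \<Rightarrow> real \<Rightarrow> ennreal" where
  "ennreal_powr a s = (if a = \<infinity> then \<infinity> else ennreal (enn2real a powr s))"
  \<comment> \<open>used only with \<open>s > 0\<close>, where \<open>\<infinity>\<^sup>s = \<infinity>\<close> and \<open>0\<^sup>s = 0\<close>\<close>

abbreviation absval :: "(real \<Rightarrow> complex) \<Rightarrow> real \<Rightarrow> ennreal" where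
  "absval f \<equiv> \<lambda>x. ennreal (cmod (f x))"

definition Lnorm :: "'a measure \<Rightarrow> ennreal \<Rightarrow> ('a \<Rightarrow> ennreal) \<Rightarrow> ennreal" where
  "Lnorm M p g =
     (if p = \<infinity> then esssup M g
      else ennreal_powr (\<integral>\<^sup>+x. ennreal_powr (g x) (enn2real p) \<partial>M) (1 / enn2real p))"

definition Lspace :: "real measure \<Rightarrow> ennreal \<Rightarrow> (real \<Rightarrow> complex) set" where
  "Lspace M p = {f \<in> borel_measurable M. Lnorm M p (absval f) < \<infinity>}"

definition Lspace_loc :: "real measure \<Rightarrow> ennreal \<Rightarrow> (real \<Rightarrow> complex) set" where
  "Lspace_loc M p =
     {f \<in> borel_measurable M. \<forall>K. compact K \<longrightarrow> Lnorm M p (\<lambda>x. absval f x * indicator K x) < \<infinity>}"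

definition dunkl_measure :: "real \<Rightarrow> real measure" where
  "dunkl_measure \<kappa> =
     density lborel (\<lambda>x. ennreal (\<bar>x\<bar> powr (2 * \<kappa> + 1) / (2 powr (\<kappa> + 1) * Gamma (\<kappa> + 1))))"

definition bessel_j :: "real \<Rightarrow> complex \<Rightarrow> complex" where
  "bessel_j \<kappa> z = complex_of_real (Gamma (\<kappa> + 1)) *
     (\<Sum>n. (-1) ^ n * z ^ (2 * n) /
        complex_of_real (fact n * 2 ^ (2 * n) * Gamma (real n + \<kappa> + 1)))"

definition dunkl_kernel :: "real \<Rightarrow> complex \<Rightarrow> complex" where
  "dunkl_kernel \<kappa> z =
     bessel_j \<kappa> (\<i> * z) + z / (2 * (complex_of_real \<kappa> + 1)) * bessel_j (\<kappa> + 1) (\<i> * z)"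

definition dunkl_transform :: "real \<Rightarrow> (real \<Rightarrow> complex) \<Rightarrow> real \<Rightarrow> complex" where
  "dunkl_transform \<kappa> f l =
     (\<integral>x. dunkl_kernel \<kappa> (- \<i> * complex_of_real (l * x)) * f x \<partial>dunkl_measure \<kappa>)"

text \<open>
  The extension of the transform from \<open>L\<^sup>1 \<inter> L\<^sup>2\<close> to \<open>L\<^sup>2\<close>, given by its graph: the closure in
  \<open>L\<^sup>2 \<times> L\<^sup>2\<close> of the graph of the integral transform. Values are determined almost everywhere.
\<close>

definition dunkl_transform_L2 :: "real \<Rightarrow> (real \<Rightarrow> complex) \<Rightarrow> (real \<Rightarrow> complex) \<Rightarrow> bool" where
  "dunkl_transform_L2 \<kappa> f g \<longleftrightarrow>
     (let M = dunkl_measure \<kappa> in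
      f \<in> Lspace M 2 \<and> g \<in> Lspace M 2 \<and>
      (\<exists>s. (\<forall>n. s n \<in> Lspace M 1 \<inter> Lspace M 2) \<and>
           (\<lambda>n. Lnorm M 2 (absval (\<lambda>x. s n x - f x))) \<longlonglongrightarrow> 0 \<and>
           (\<lambda>n. Lnorm M 2 (absval (\<lambda>x. dunkl_transform \<kappa> (s n) x - g x))) \<longlonglongrightarrow> 0))"

text \<open>
  For \<open>f \<in> L\<^sup>2\<close>, a representative of the almost-everywhere class of the translate of \<open>f\<close> by \<open>y\<close>.
\<close>

definition dunkl_translation :: "real \<Rightarrow> real \<Rightarrow> (real \<Rightarrow> complex) \<Rightarrow> real \<Rightarrow> complex" where
  "dunkl_translation \<kappa> y f =
     (SOME h. \<exists>Ff Fh. dunkl_transform_L2 \<kappa> f Ff \<and> dunkl_transform_L2 \<kappa> h Fh \<and>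
        (AE x in dunkl_measure \<kappa>. Fh x = dunkl_kernel \<kappa> (\<i> * complex_of_real (x * y)) * Ff x))"

definition dunkl_ball :: "real \<Rightarrow> real \<Rightarrow> real set" where
  "dunkl_ball x r =
     (if x = 0 then {-r<..<r} else {y. max 0 (\<bar>x\<bar> - r) < \<bar>y\<bar> \<and> \<bar>y\<bar> < \<bar>x\<bar> + r})"

text \<open>
  The integral over \<open>B(0, r)\<close> of the translate by \<open>y\<close> of a nonnegative function \<open>g\<close>, with the
  translation moved to the indicator function of the ball. The translated indicator has values in
  \<open>[0, 1]\<close> almost everywhere, so \<^const>\<open>Re\<close> and \<^const>\<open>ennreal\<close> only change its type.
\<close>

definition translate_integral :: "real \<Rightarrow> real \<Rightarrow> (real \<Rightarrow> ennreal) \<Rightarrow> real \<Rightarrow> ennreal" where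
  "translate_integral \<kappa> y g r =
     (\<integral>\<^sup>+x. g x * ennreal (Re (dunkl_translation \<kappa> (- y) (indicator (dunkl_ball 0 r)) x))
        \<partial>dunkl_measure \<kappa>)"

definition amalgam_norm_at :: "real \<Rightarrow> real \<Rightarrow> ennreal \<Rightarrow> ennreal \<Rightarrow> (real \<Rightarrow> ennreal) \<Rightarrow> ennreal" where
  "amalgam_norm_at \<kappa> r q p g =
     Lnorm (dunkl_measure \<kappa>) p
       (\<lambda>y. if q = \<infinity> then Lnorm (dunkl_measure \<kappa>) \<infinity> (\<lambda>x. g x * indicator (dunkl_ball y r) x)
            else ennreal_powr
                   (translate_integral \<kappa> y (\<lambda>x. ennreal_powr (g x) (enn2real q)) r)
                   (1 / enn2real q))"

definition amalgam_norm :: "real \<Rightarrow> ennreal \<Rightarrow> ennreal \<Rightarrow> ennreal \<Rightarrow> (real \<Rightarrow> ennreal) \<Rightarrow> ennreal" where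
  "amalgam_norm \<kappa> q p \<alpha> g =
     (SUP r\<in>{0<..}.
        ennreal (measure (dunkl_measure \<kappa>) (dunkl_ball 0 r)
                   powr (enn2real (1 / \<alpha>) - enn2real (1 / q) - enn2real (1 / p))) *
        amalgam_norm_at \<kappa> r q p g)"

definition dunkl_maximal :: "real \<Rightarrow> (real \<Rightarrow> complex) \<Rightarrow> real \<Rightarrow> ennreal" where
  "dunkl_maximal \<kappa> f x =
     (SUP r\<in>{0<..}.
        translate_integral \<kappa> x (absval f) r / emeasure (dunkl_measure \<kappa>) (dunkl_ball 0 r))"

end

theory Submission
  imports Defs "HOL-Probability.Sinc_Integral"
begin

text \<open>
  By a product formula for the Dunkl kernel, the translate by \<open>y\<close> of the indicator function of \<open>B(0, r)\<close> is
  \<open>x \<mapsto> \<integral> (1 + t) 1[x\<^sup>2 + y\<^sup>2 - 2xyt < r\<^sup>2] d\<omega>(t)\<close>, where \<open>\<omega>\<close> is the probability measure with density proportional to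
  \<open>(1 - t\<^sup>2)\<^bsup>\<kappa> - 1/2\<^esup>\<close> on \<open>(-1, 1)\<close>: both functions have the same transform, and the transform is injective on \<open>L\<^sup>2\<close>
  because the functions \<open>exp(-bx\<^sup>2)\<close> and \<open>x exp(-bx\<^sup>2)\<close> are total. Hence the translate is at most
  \<open>C (r / (|y| + r))\<^bsup>2\<kappa> + 1\<^esup>\<close> on the annulus \<open>A(y, r) = {x. | |x| - |y| | < r}\<close>, vanishes outside, and summed
  with the translate by \<open>- y\<close> it is at least \<open>c (r / (|y| + r))\<^bsup>2\<kappa> + 1\<^esup>\<close> on \<open>A(y, r/2)\<close>. All quantities
  are thus comparable to averages of \<open>F(x) = max |f(x)| |f(-x)|\<close> over annuli.

  Let \<open>N\<close> be the uncentred maximal operator of \<open>\<mu>\<close>, bounded on \<open>L\<^sup>s(\<mu>)\<close> for \<open>s > 1\<close>, and let \<open>G(z)\<close> be the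
  average of \<open>F\<close> over \<open>A(z, r)\<close>. For \<open>x \<in> A(y, r)\<close>, splitting the radii at \<open>r\<close> gives
  \<open>Mf(x) \<le> C (N(F 1[A(y, 2r)])(x) + N(G)(y))\<close>. The first term is handled by the boundedness of \<open>N\<close> on \<open>L\<^sup>q\<close>
  for each \<open>y\<close>, the second by its boundedness on \<open>L\<^sup>p\<close> and Jensen's inequality for \<open>G\<close>, so the norm of \<open>Mf\<close> at
  scale \<open>r\<close> is controlled by the norm of \<open>f\<close> at scale \<open>4r\<close>.
\<close>

section \<open>The Dunkl kernel on the imaginary axis\<close>

text \<open>The translation in the statement is a \<open>SOME\<close> choice in \<open>L2\<close>,
  cut out by a transform that is itself the closure of a graph. Everything known about it comes from
  two properties of that graph: it is single-valued and injective. Both rest on the multiplication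
  formula (the integral of \<open>fourier f * g\<close> is that of \<open>f * fourier g\<close>)
  tested on Gaussians, a family that the transform maps to itself up to constants. For the explicit
  candidate to lie on the graph, its transform has to be square integrable; the decay estimate for
  Bessel functions serves this purpose. Replacing |f| by the even F costs only a constant: the outer
  norm is invariant under y -> -y, and the factor 1 + t for y and 1 - t for -y add up to 2, so that
  the two translates together see the whole annulus. The scale 4r arises from two doublings:
  localization enlarges the annulus to radius 2r, and a translate of radius R is bounded below on
  the annulus of radius R/2. The powers of the volumes of the balls of radius r and 4r are
  comparable by doubling, with a constant independent of r.\<close>

definition bessel_coeff :: "real \<Rightarrow> nat \<Rightarrow> real" where
  "bessel_coeff c n = (- 1 / 4) ^ n / (fact n * pochhammer c n)"

text \<open>Up to normalization this is \<open>\<^sub>0F\<^sub>1\<close>, so that \<open>j\<^sub>\<kappa>(t)\<close> is the value at \<open>t\<^sup>2\<close> with \<open>c = \<kappa> + 1\<close>.\<close>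

definition bessel_sq :: "real \<Rightarrow> real \<Rightarrow> real" where
  "bessel_sq c X = (\<Sum>n. bessel_coeff c n * X ^ n)"

lemma bessel_coeff_0 [simp]: "bessel_coeff c 0 = 1"
  by (simp add: bessel_coeff_def)

lemma bessel_coeff_Suc:
  "bessel_coeff c (Suc n) = - bessel_coeff c n / (4 * real (Suc n) * (c + real n))"
  by (simp add: bessel_coeff_def pochhammer_Suc)

lemma bessel_coeff_Suc':
  "bessel_coeff c (Suc n) = - bessel_coeff (c + 1) n / (4 * real (Suc n) * c)"
  by (simp add: bessel_coeff_def pochhammer_rec)

lemma summable_bessel_sq:
  assumes "c > 0"
  shows "summable (\<lambda>n. bessel_coeff c n * X ^ n)"
\<comment> \<open>From this index on |X| \<le> n c, which bounds the quotient of consecutive terms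
  by 1/4.\<close>
proof (rule summable_ratio_test[where c = "1/2" and N = "nat \<lceil>\<bar>X\<bar> / c\<rceil>"])
  fix n :: nat
  assume "n \<ge> nat \<lceil>\<bar>X\<bar> / c\<rceil>"
  then have "real n \<ge> \<bar>X\<bar> / c"
    by linarith
  then have "\<bar>X\<bar> \<le> real n * c"
    using assms by (simp add: field_simps)
  also have "\<dots> \<le> real (Suc n) * (c + real n)"
    using assms by (intro mult_mono) auto
  finally have *: "\<bar>X\<bar> \<le> real (Suc n) * (c + real n)" .
  have pos: "real (Suc n) * (c + real n) > 0"
    using assms by auto
  have eq: "norm (bessel_coeff c (Suc n) * X ^ Suc n) =
      (\<bar>X\<bar> / (4 * (real (Suc n) * (c + real n)))) * norm (bessel_coeff c n * X ^ n)"
    using assms by (simp add: bessel_coeff_Suc abs_mult power_abs field_simps)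
  show "norm (bessel_coeff c (Suc n) * X ^ Suc n) \<le> 1 / 2 * norm (bessel_coeff c n * X ^ n)"
    unfolding eq using * pos by (intro mult_right_mono) (auto simp: field_simps)
qed simp

lemma summable_norm_bessel_sq:
  assumes "c > 0"
  shows "summable (\<lambda>n. norm (bessel_coeff c n * X ^ n))"
  by (rule powser_insidea[OF summable_bessel_sq[OF assms, of "\<bar>X\<bar> + 1"]]) auto

lemma bessel_sq_sums: "c > 0 \<Longrightarrow> (\<lambda>n. bessel_coeff c n * X ^ n) sums bessel_sq c X"
  unfolding bessel_sq_def using summable_bessel_sq by (rule summable_sums)

lemma bessel_sq_0 [simp]: "bessel_sq c 0 = 1"
  by (simp add: bessel_sq_def powser_zero)

text \<open>Termwise differentiation raises the parameter: n + 1 times the coefficient n + 1 for c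
  is -1/(4c) times the coefficient n for c + 1. In the variable x with X = x^2 this is the classical
  rule for the derivative of J_\<nu>(x) / x^\<nu>, with \<nu> = c - 1.\<close>

lemma DERIV_bessel_sq:
  assumes "c > 0"
  shows "(bessel_sq c has_real_derivative (- bessel_sq (c + 1) X / (4 * c))) (at X)"
proof -
  have "((\<lambda>X. \<Sum>n. bessel_coeff c n * X ^ n) has_real_derivative
      (\<Sum>n. diffs (bessel_coeff c) n * X ^ n)) (at X)"
    by (rule termdiffs_strong_converges_everywhere) (rule summable_bessel_sq[OF assms])
  moreover have "(\<lambda>n. diffs (bessel_coeff c) n * X ^ n) = (\<lambda>n. - 1 / (4 * c) * (bessel_coeff (c + 1) n * X ^ n))"
    using assms by (auto simp: diffs_def bessel_coeff_Suc' field_simps simp del: of_nat_Suc)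
  moreover have "(\<Sum>n. - 1 / (4 * c) * (bessel_coeff (c + 1) n * X ^ n)) = - bessel_sq (c + 1) X / (4 * c)"
    using assms by (subst suminf_mult) (auto simp: bessel_sq_def intro!: summable_bessel_sq)
  ultimately show ?thesis
    unfolding bessel_sq_def[abs_def] by simp
qed

lemma DERIV_bessel_sq_compose [derivative_intros]:
  assumes "c > 0" and "(g has_real_derivative g') (at x within s)"
  shows "((\<lambda>x. bessel_sq c (g x)) has_real_derivative (- bessel_sq (c + 1) (g x) / (4 * c)) * g') (at x within s)"
  by (rule DERIV_chain2[OF DERIV_bessel_sq[OF assms(1)] assms(2)])

lemma continuous_on_bessel_sq: "c > 0 \<Longrightarrow> continuous_on S (bessel_sq c)"
  by (intro continuous_at_imp_continuous_on ballI DERIV_isCont[OF DERIV_bessel_sq])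

lemma continuous_on_bessel_sq_compose [continuous_intros]:
  "c > 0 \<Longrightarrow> continuous_on S g \<Longrightarrow> continuous_on S (\<lambda>x. bessel_sq c (g x))"
  by (rule continuous_on_compose2[OF continuous_on_bessel_sq]) auto

lemma borel_measurable_bessel_sq [measurable]:
  "c > 0 \<Longrightarrow> bessel_sq c \<in> borel_measurable borel"
  by (intro borel_measurable_continuous_onI continuous_on_bessel_sq)

text \<open>The three-term recurrence of Bessel functions, checked coefficient by coefficient.
  Together with the derivative rule it carries the Bessel differential equation: the parameter c + 2
  produced by two differentiations is expressed through c and c + 1.\<close>

lemma bessel_sq_contiguous:
  assumes "c > 0"
  shows "bessel_sq c X = bessel_sq (c + 1) X - X / (4 * c * (c + 1)) * bessel_sq (c + 2) X"
proof -
  have coeff: "bessel_coeff c (Suc n) = bessel_coeff (c + 1) (Suc n) - bessel_coeff (c + 2) n / (4 * c * (c + 1))" for n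
  proof -
    define b where "b = bessel_coeff (c + 2) n"
    have eq: "bessel_coeff (c + 1) (Suc n) = - b / (4 * real (Suc n) * (c + 1))"
      by (simp add: bessel_coeff_Suc' b_def add.assoc)
    have "\<beta> = b * d / k" if "- \<beta> / (4 * S * d) = - b / (4 * S * k)" "S > 0" "d > 0" "k > 0" for \<beta> S d k :: real
      using that by (simp add: field_simps)
    from this[OF eq[unfolded bessel_coeff_Suc]]
    have "bessel_coeff (c + 1) n = b * (c + 1 + real n) / (c + 1)"
      using assms by simp
    then have "bessel_coeff c (Suc n) = - (b * (c + 1 + real n) / (c + 1)) / (4 * real (Suc n) * c)"
      by (simp add: bessel_coeff_Suc')
    then show ?thesis
    proof -
      have "- (b * (c + S) / k) / (4 * S * c) = - b / (4 * S * k) - b / (4 * c * k)" if "k > 0" "S > 0" for S k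
        using that assms by (simp add: field_simps)
      from this[of "c + 1" "real (Suc n)"] show ?thesis
        using \<open>bessel_coeff c (Suc n) = _\<close> eq assms by (simp add: b_def add_ac)
    qed
  qed
  have s: "(\<lambda>n. bessel_coeff a (Suc n) * X ^ n * X) sums (bessel_sq a X - 1)" if "a > 0" for a
    using sums_Suc_iff[of "\<lambda>n. bessel_coeff a n * X ^ n" "bessel_sq a X - 1"] bessel_sq_sums[OF that, of X]
    by (simp add: mult_ac)
  have "(\<lambda>n. bessel_coeff (c + 1) (Suc n) * X ^ n * X - X / (4 * c * (c + 1)) * (bessel_coeff (c + 2) n * X ^ n))
      sums (bessel_sq (c + 1) X - 1 - X / (4 * c * (c + 1)) * bessel_sq (c + 2) X)"
    using assms by (intro sums_diff sums_mult s bessel_sq_sums) auto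
  moreover have "(\<lambda>n. bessel_coeff (c + 1) (Suc n) * X ^ n * X - X / (4 * c * (c + 1)) * (bessel_coeff (c + 2) n * X ^ n))
     = (\<lambda>n. bessel_coeff c (Suc n) * X ^ n * X)"
    by (auto simp: coeff algebra_simps)
  ultimately have "bessel_sq (c + 1) X - 1 - X / (4 * c * (c + 1)) * bessel_sq (c + 2) X = bessel_sq c X - 1"
    using s[OF assms] sums_unique2 by metis
  then show ?thesis by simp
qed

lemma bessel_sq_contiguous':
  assumes "c > 0"
  shows "X * bessel_sq (c + 2) X = 4 * c * (c + 1) * (bessel_sq (c + 1) X - bessel_sq c X)"
proof -
  have "bessel_sq (c + 1) X - bessel_sq c X = X / (4 * c * (c + 1)) * bessel_sq (c + 2) X"
    using bessel_sq_contiguous[OF assms, of X] by simp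
  then show ?thesis using assms by simp
qed

text \<open>The Dunkl kernel at \<i> t, with c = \<kappa> + 1. The model is c = 1/2, where the two
  components are cos t and sin t.\<close>

definition dunkl_wave :: "real \<Rightarrow> real \<Rightarrow> complex" where
  "dunkl_wave c t = Complex (bessel_sq c (t\<^sup>2)) (t / (2 * c) * bessel_sq (c + 1) (t\<^sup>2))"

lemma Re_dunkl_wave [simp]: "Re (dunkl_wave c t) = bessel_sq c (t\<^sup>2)"
  and Im_dunkl_wave [simp]: "Im (dunkl_wave c t) = t / (2 * c) * bessel_sq (c + 1) (t\<^sup>2)"
  by (simp_all add: dunkl_wave_def)

lemma dunkl_wave_0 [simp]: "dunkl_wave c 0 = 1"
  by (simp add: complex_eq_iff)

lemma bessel_j_of_real:
  assumes "\<kappa> > - 1"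
  shows "bessel_j \<kappa> (complex_of_real t) = complex_of_real (bessel_sq (\<kappa> + 1) (t\<^sup>2))"
proof -
  have Gp: "Gamma (\<kappa> + 1) > 0" using assms by (intro Gamma_real_pos) auto
  have G: "Gamma (real n + \<kappa> + 1) = pochhammer (\<kappa> + 1) n * Gamma (\<kappa> + 1)" for n
  proof -
    have "\<kappa> + 1 \<notin> \<int>\<^sub>\<le>\<^sub>0" using assms by (auto elim!: nonpos_Ints_cases)
    then show ?thesis
      using pochhammer_Gamma[of "\<kappa> + 1" n] Gp by (simp add: add_ac)
  qed
  have "(\<lambda>n. of_real (bessel_coeff (\<kappa> + 1) n * (t\<^sup>2) ^ n) :: complex) sums of_real (bessel_sq (\<kappa> + 1) (t\<^sup>2))"
    using assms by (intro sums_of_real bessel_sq_sums) auto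
  then have "(\<lambda>n. of_real (1 / Gamma (\<kappa> + 1)) * of_real (bessel_coeff (\<kappa> + 1) n * (t\<^sup>2) ^ n) :: complex) sums (of_real (1 / Gamma (\<kappa> + 1)) * of_real (bessel_sq (\<kappa> + 1) (t\<^sup>2)))"
    by (rule sums_mult)
  moreover have "(\<lambda>n. of_real (1 / Gamma (\<kappa> + 1)) * of_real (bessel_coeff (\<kappa> + 1) n * (t\<^sup>2) ^ n) :: complex) =
     (\<lambda>n. (-1) ^ n * complex_of_real t ^ (2 * n) / complex_of_real (fact n * 2 ^ (2 * n) * Gamma (real n + \<kappa> + 1)))"
    unfolding G bessel_coeff_def
  proof (rule ext)
    fix n :: nat
    have "(- (1 / 4)) ^ n = (- 1) ^ n / (4 ^ n :: complex)"
      using power_divide[of "- 1 :: complex" 4 n] by simp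
    then show "of_real (1 / Gamma (\<kappa> + 1)) * of_real ((- 1 / 4) ^ n / (fact n * pochhammer (\<kappa> + 1) n) * (t\<^sup>2) ^ n) =
        (-1) ^ n * complex_of_real t ^ (2 * n) / complex_of_real (fact n * 2 ^ (2 * n) * (pochhammer (\<kappa> + 1) n * Gamma (\<kappa> + 1)))"
      by (simp add: power_mult)
  qed
  ultimately have "(\<Sum>n. (-1) ^ n * complex_of_real t ^ (2 * n) / complex_of_real (fact n * 2 ^ (2 * n) * Gamma (real n + \<kappa> + 1)))
      = of_real (1 / Gamma (\<kappa> + 1)) * of_real (bessel_sq (\<kappa> + 1) (t\<^sup>2))"
    by (simp add: sums_iff)
  then show ?thesis
    unfolding bessel_j_def using Gp by simp
qed

lemma dunkl_kernel_imaginary: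
  assumes "\<kappa> > - 1"
  shows "dunkl_kernel \<kappa> (\<i> * complex_of_real t) = dunkl_wave (\<kappa> + 1) t"
    and "dunkl_kernel \<kappa> (- \<i> * complex_of_real t) = dunkl_wave (\<kappa> + 1) (- t)"
proof -
  have *: "dunkl_kernel \<kappa> (\<i> * complex_of_real t) = dunkl_wave (\<kappa> + 1) t" for t
  proof -
    have e: "\<i> * (\<i> * complex_of_real t) = complex_of_real (- t)"
      by (simp flip: mult.assoc)
    have "dunkl_kernel \<kappa> (\<i> * complex_of_real t) = complex_of_real (bessel_sq (\<kappa> + 1) (t\<^sup>2)) +
        \<i> * complex_of_real t / complex_of_real (2 * (\<kappa> + 1)) * complex_of_real (bessel_sq (\<kappa> + 1 + 1) (t\<^sup>2))"
      unfolding dunkl_kernel_def e using assms by (simp only: bessel_j_of_real) (simp add: bessel_j_of_real)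
    also have "\<dots> = dunkl_wave (\<kappa> + 1) t"
      by (simp add: dunkl_wave_def Complex_eq del: of_real_add of_real_mult flip: of_real_divide of_real_mult mult.assoc times_divide_eq_right)
    finally show ?thesis .
  qed
  show "dunkl_kernel \<kappa> (\<i> * complex_of_real t) = dunkl_wave (\<kappa> + 1) t" by (rule *)
  show "dunkl_kernel \<kappa> (- \<i> * complex_of_real t) = dunkl_wave (\<kappa> + 1) (- t)"
    using *[of "- t"] by simp
qed

lemma continuous_on_dunkl_wave [continuous_intros]:
  "c > 0 \<Longrightarrow> continuous_on S g \<Longrightarrow> continuous_on S (\<lambda>x. dunkl_wave c (g x))"
  unfolding dunkl_wave_def Complex_eq by (intro continuous_intros) auto

lemma borel_measurable_dunkl_wave [measurable]:
  "c > 0 \<Longrightarrow> dunkl_wave c \<in> borel_measurable borel"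
  by (intro borel_measurable_continuous_onI continuous_intros)

text \<open>The energy \<open>p\<^sup>2 + p'\<^sup>2\<close> of a solution of \<open>p'' + (2c - 1) p' / x + p = 0\<close> decreases.\<close>

lemma norm_dunkl_wave_le:
  assumes "c > 1 / 2"
  shows "norm (dunkl_wave c t) \<le> 1"
proof -
  define E where "E = (\<lambda>x. (bessel_sq c (x\<^sup>2))\<^sup>2 + (x / (2 * c) * bessel_sq (c + 1) (x\<^sup>2))\<^sup>2)"
  have "E y \<le> E 0" if "y \<ge> 0" for y
  proof (rule DERIV_nonpos_imp_nonincreasing[OF that])
    fix x :: real assume x: "0 \<le> x" "x \<le> y"
    define A B where "A = bessel_sq (c + 1) (x\<^sup>2)" and "B = bessel_sq c (x\<^sup>2)"
    define b k where "b = bessel_sq (c + 2) (x\<^sup>2)" and "k = c + 1"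
    have k: "k > 0" using assms by (simp add: k_def)
    \<comment> \<open>The recurrence eliminates \<open>b\<close>, so that the derivative of the
      energy becomes a quadratic form in \<open>A\<close> and \<open>B\<close>. The mixed terms
      cancel, and a multiple of the square of \<open>A\<close> remains, whose sign is decided by c >
      1/2.\<close>
    have con: "x\<^sup>2 * b = 4 * c * k * (A - B)"
      using bessel_sq_contiguous'[of c "x\<^sup>2"] assms by (simp add: A_def B_def b_def k_def)
    have "(E has_real_derivative (2 * B * (- A / (4 * c) * (2 * x)) + 2 * (x / (2 * c) * A) *
        (1 / (2 * c) * A + x / (2 * c) * (- b / (4 * k) * (2 * x))))) (at x)"
    proof -
      have dB: "((\<lambda>x. bessel_sq c (x\<^sup>2)) has_real_derivative (- A / (4 * c) * (2 * x))) (at x)"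
        unfolding A_def using assms by (auto intro!: derivative_eq_intros)
      have dA: "((\<lambda>x. bessel_sq (c + 1) (x\<^sup>2)) has_real_derivative (- b / (4 * k) * (2 * x))) (at x)"
        unfolding b_def k_def using assms by (auto intro!: derivative_eq_intros simp: add.assoc)
      show ?thesis
        unfolding E_def
        by (rule DERIV_cong[OF DERIV_add[OF DERIV_power[OF dB, where n = 2]
              DERIV_power[OF DERIV_mult[OF DERIV_cdivide[OF DERIV_ident] dA], where n = 2]]])
          (simp add: A_def B_def algebra_simps)
    qed
    also have "(2 * B * (- A / (4 * c) * (2 * x)) + 2 * (x / (2 * c) * A) *
        (1 / (2 * c) * A + x / (2 * c) * (- b / (4 * k) * (2 * x))))
      = - (x * B * A / c) + x / c * A * (A / (2 * c) - (x\<^sup>2 * b) / (4 * c * k))"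
      using assms k by (simp add: field_simps power2_eq_square)
    also have "\<dots> = - (x * A\<^sup>2 * (2 * c - 1) / (2 * c\<^sup>2))"
      unfolding con using assms k by (simp add: field_simps power2_eq_square)
    finally have "(E has_real_derivative - (x * A\<^sup>2 * (2 * c - 1) / (2 * c\<^sup>2))) (at x)" .
    moreover have "- (x * A\<^sup>2 * (2 * c - 1) / (2 * c\<^sup>2)) \<le> 0"
      using assms x by simp
    ultimately show "\<exists>y. (E has_real_derivative y) (at x) \<and> y \<le> 0" by blast
  qed
  from this[of "\<bar>t\<bar>"] have "E \<bar>t\<bar> \<le> 1" by (simp add: E_def)
  then have "(norm (dunkl_wave c t))\<^sup>2 \<le> 1"
    by (simp add: E_def cmod_power2 power_mult_distrib power_divide)
  then show ?thesis using power2_le_imp_le[of "norm (dunkl_wave c t)" 1] by simp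
qed

lemma abs_bessel_sq_le:
  assumes "c > 1 / 2" "X \<ge> 0"
  shows "\<bar>bessel_sq c X\<bar> \<le> 1"
  using abs_Re_le_cmod[of "dunkl_wave c (sqrt X)"] norm_dunkl_wave_le[OF assms(1), of "sqrt X"] assms(2) by simp

text \<open>Liouville's normal form \<open>u'' + (1 - (c\<^sup>2 - 1/4) / x\<^sup>2) u = 0\<close>, with \<open>u = x\<^bsup>c + 1/2\<^esup> J(x\<^sup>2)\<close>, has the
  decreasing energy \<open>u\<^sup>2 + u'\<^sup>2 / (1 - (c\<^sup>2 - 1/4) / x\<^sup>2)\<close>.\<close>

lemma bessel_sq_decay:
  assumes "c > 1 / 2"
  obtains C where "C > 0" "\<And>x. x > 0 \<Longrightarrow> x powr (c + 1 / 2) * \<bar>bessel_sq (c + 1) (x\<^sup>2)\<bar> \<le> C"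
proof -
  define m where "m = c\<^sup>2 - 1 / 4"
  have "(1/2)^2 < c^2" using assms by (intro power_strict_mono) auto
  then have m: "m > 0" by (simp add: m_def power2_eq_square)
  define A B where "A = (\<lambda>x. bessel_sq (c + 1) (x\<^sup>2))" and "B = (\<lambda>x. bessel_sq c (x\<^sup>2))"
  \<comment> \<open>\<open>v\<close> is the derivative of \<open>u\<close>, written without the
    function of parameter c + 2. Differentiating it again uses only the two first-order rules
    \<open>dA\<close> and \<open>dB\<close>.\<close>
  define u v where "u = (\<lambda>x. x powr (c + 1 / 2) * A x)"
    and "v = (\<lambda>x. x powr (c - 1 / 2) * ((1 / 2 - c) * A x + 2 * c * B x))"
  \<comment> \<open>Beyond \<open>X\<close> the coefficient 1 - m / x^2 is positive, as the energy
    requires.\<close>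
  define X where "X = sqrt m + 1"
  define E where "E = (\<lambda>x. (u x)\<^sup>2 + (v x)\<^sup>2 / (1 - m / x\<^sup>2))"
  have dA: "(A has_real_derivative (2 * c * (B x - A x) / x)) (at x)" if "x > 0" for x
  proof -
    have con: "x\<^sup>2 * bessel_sq (c + 2) (x\<^sup>2) = 4 * c * (c + 1) * (A x - B x)"
      using bessel_sq_contiguous'[of c "x\<^sup>2"] assms by (simp add: A_def B_def)
    have "(A has_real_derivative (- bessel_sq (c + 2) (x\<^sup>2) / (4 * (c + 1)) * (2 * x))) (at x)"
      unfolding A_def using assms by (auto intro!: derivative_eq_intros simp: add.assoc)
    also have "- bessel_sq (c + 2) (x\<^sup>2) / (4 * (c + 1)) * (2 * x) = - (x\<^sup>2 * bessel_sq (c + 2) (x\<^sup>2)) / (2 * (c + 1) * x)"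
    proof -
      have "- b / (4 * k) * (2 * x) = - (x\<^sup>2 * b) / (2 * k * x)" if "k > 0" for b k
        using that \<open>x > 0\<close> by (simp add: field_simps power2_eq_square)
      from this[of "c + 1"] show ?thesis using assms by simp
    qed
    also have "- (x\<^sup>2 * bessel_sq (c + 2) (x\<^sup>2)) / (2 * (c + 1) * x) = 2 * c * (B x - A x) / x"
    proof -
      have "- (4 * c * k * (A x - B x)) / (2 * k * x) = 2 * c * (B x - A x) / x" if "k > 0" for k
        using \<open>x > 0\<close> that by (simp add: field_simps)
      from this[of "c + 1"] show ?thesis unfolding con using assms by simp
    qed
    finally show ?thesis .
  qed
  have dB: "(B has_real_derivative (- (x / (2 * c)) * A x)) (at x)" for x
    unfolding B_def A_def using assms by (auto intro!: derivative_eq_intros)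
  have pw: "x powr (c + 1 / 2) = x powr (c - 1 / 2) * x" "x powr (c - 3 / 2) = x powr (c - 1 / 2) / x" if "x > 0" for x
    using that powr_add[of x "c - 1/2" 1] powr_diff[of x "c - 1/2" 1] by (simp_all add: add.commute diff_diff_eq)
  have du: "(u has_real_derivative v x) (at x)" if "x > 0" for x
  proof -
    have "(u has_real_derivative ((c + 1 / 2) * x powr (c - 1 / 2) * A x + (2 * c * (B x - A x) / x) * x powr (c + 1 / 2))) (at x)"
      unfolding u_def using that by (auto intro!: derivative_eq_intros dA)
    also have "((c + 1 / 2) * x powr (c - 1 / 2) * A x + (2 * c * (B x - A x) / x) * x powr (c + 1 / 2)) = v x"
      unfolding v_def pw[OF that] using that by (simp add: field_simps)
    finally show ?thesis .
  qed
  have dv: "(v has_real_derivative - ((1 - m / x\<^sup>2) * u x)) (at x)" if "x > 0" for x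
  proof -
    have "(v has_real_derivative ((c - 1 / 2) * x powr (c - 3 / 2) * ((1 / 2 - c) * A x + 2 * c * B x) +
       ((1 / 2 - c) * (2 * c * (B x - A x) / x) + 2 * c * (- (x / (2 * c)) * A x)) * x powr (c - 1 / 2))) (at x)"
      unfolding v_def using that by (auto intro!: derivative_eq_intros dA dB)
    also have "((c - 1 / 2) * x powr (c - 3 / 2) * ((1 / 2 - c) * A x + 2 * c * B x) +
       ((1 / 2 - c) * (2 * c * (B x - A x) / x) + 2 * c * (- (x / (2 * c)) * A x)) * x powr (c - 1 / 2))
        = - ((1 - m / x\<^sup>2) * u x)"
    proof -
      have "(c - 1 / 2) * (P / x) * ((1 / 2 - c) * a + 2 * c * b) +
         ((1 / 2 - c) * (2 * c * (b - a) / x) + 2 * c * (- (x / (2 * c)) * a)) * P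
        = - ((1 - m / x\<^sup>2) * (P * x * a))" for P a b
      proof -
        have "(c - 1 / 2) * (P / x) * ((1 / 2 - c) * a + 2 * c * b) + ((1 / 2 - c) * (2 * c * (b - a) / x) + 2 * c * (- (x / (2 * c)) * a)) * P
          = P / x * ((c - 1 / 2) * ((1 / 2 - c) * a + 2 * c * b) + (1 / 2 - c) * (2 * c * (b - a)) - x\<^sup>2 * a)"
        proof -
          have e: "2 * c * (- (x / (2 * c)) * a) = - (x * a)" using assms by simp
          have e2: "x * a * P = P / x * (x\<^sup>2 * a)" using that by (simp add: power2_eq_square)
          have "s * (P / x) * S + (t / x + - (x * a)) * P = P / x * (s * S + t) - x * a * P" for s S t
            by (simp add: algebra_simps)
          then show ?thesis unfolding e e2 by (simp only: right_diff_distrib times_divide_eq_right)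
        qed
        also have "\<dots> = P / x * ((m - x\<^sup>2) * a)"
          by (simp add: m_def algebra_simps power2_eq_square)
        also have "\<dots> = - ((1 - m / x\<^sup>2) * (P * x * a))"
          using that by (simp add: field_simps power2_eq_square)
        finally show ?thesis .
      qed
      then show ?thesis unfolding u_def pw[OF that] .
    qed
    finally show ?thesis .
  qed
  have Qp: "1 - m / x\<^sup>2 > 0" if "x \<ge> X" for x
  proof -
    have "sqrt m < x" "0 \<le> sqrt m" using that m by (auto simp: X_def)
    then have "(sqrt m)\<^sup>2 < x\<^sup>2" by (intro power_strict_mono) auto
    then show ?thesis using m by (simp add: divide_simps)
  qed
  have Xp: "X > 0" using m by (simp add: X_def add_pos_pos)
  have dec: "E x \<le> E X" if "x \<ge> X" for x
  proof (rule DERIV_nonpos_imp_nonincreasing[OF that])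
    fix x assume x: "X \<le> x"
    then have x0: "x > 0" using Xp by linarith
    define Q where "Q = 1 - m / x\<^sup>2"
    have Q: "Q > 0" using Qp[OF x] by (simp add: Q_def)
    define D where "D = 2 * m / x ^ 3"
    have dQ: "((\<lambda>x. 1 - m / x\<^sup>2) has_real_derivative D) (at x)"
      using x0 unfolding D_def by (auto intro!: derivative_eq_intros simp: field_simps power2_eq_square power3_eq_cube)
    have D: "D \<ge> 0" using m x0 by (simp add: D_def)
    have "(E has_real_derivative (2 * u x * v x + ((2 * v x * (- (Q * u x))) * Q - (v x)\<^sup>2 * D) / (Q * Q))) (at x)"
      unfolding E_def Q_def using Q[THEN less_imp_neq]
      by (intro DERIV_cong[OF DERIV_add[OF DERIV_power[OF du[OF x0], of 2]
            DERIV_divide[OF DERIV_power[OF dv[OF x0], of 2] dQ]]])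
        (simp_all add: Q_def)
    also have "(2 * u x * v x + ((2 * v x * (- (Q * u x))) * Q - (v x)\<^sup>2 * D) / (Q * Q))
        = - ((v x)\<^sup>2 * D / (Q * Q))"
      using Q by (simp add: field_simps)
    finally have "(E has_real_derivative - ((v x)\<^sup>2 * D / (Q * Q))) (at x)" .
    moreover have "- ((v x)\<^sup>2 * D / (Q * Q)) \<le> 0"
      using Q D by simp
    ultimately show "\<exists>y. (E has_real_derivative y) (at x) \<and> y \<le> 0" by blast
  qed
  \<comment> \<open>The first summand bounds |u| where the energy decreases. The second bounds x
    powr (c + 1/2) for x < X, where the Bessel factor is at most 1 in absolute value.\<close>
  define C where "C = sqrt (E X) + X powr (c + 1 / 2)"
  have EX: "E X \<ge> 0" using Qp[of X] by (simp add: E_def)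
  have Cp: "C > 0" using EX Xp by (simp add: C_def add_nonneg_pos)
  have "x powr (c + 1 / 2) * \<bar>bessel_sq (c + 1) (x\<^sup>2)\<bar> \<le> C" if "x > 0" for x
  proof (cases "x \<ge> X")
    case True
    have "(u x)\<^sup>2 \<le> E x" using Qp[OF True] by (simp add: E_def)
    also have "\<dots> \<le> E X" using dec[OF True] .
    finally have "\<bar>u x\<bar> \<le> sqrt (E X)" by (simp add: real_le_rsqrt)
    then show ?thesis using Xp unfolding C_def u_def A_def by (simp add: abs_mult add_increasing2)
  next
    case False
    have "x powr (c + 1 / 2) * \<bar>bessel_sq (c + 1) (x\<^sup>2)\<bar> \<le> X powr (c + 1 / 2) * 1"
      using that False assms by (intro mult_mono powr_mono2 abs_bessel_sq_le) auto
    then show ?thesis using EX unfolding C_def by (simp add: add_increasing)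
  qed
  with Cp show ?thesis using that by blast
qed

section \<open>Powers and norms of extended nonnegative functions\<close>

lemma ennreal_powr_ennreal [simp]: "x \<ge> 0 \<Longrightarrow> ennreal_powr (ennreal x) s = ennreal (x powr s)"
  by (simp add: ennreal_powr_def)

lemma ennreal_powr_numeral [simp]: "ennreal_powr (numeral n) s = ennreal (numeral n powr s)"
  using ennreal_powr_ennreal[of "numeral n" s] by simp

lemma ennreal_powr_top [simp]: "ennreal_powr top s = top"
  by (simp add: ennreal_powr_def)

lemma ennreal_powr_0 [simp]: "ennreal_powr 0 s = 0"
  by (simp add: ennreal_powr_def)

lemma ennreal_powr_1 [simp]: "ennreal_powr a 1 = a"
  by (cases a) auto

lemma ennreal_powr_mono:
  assumes "a \<le> b" "s \<ge> 0"
  shows "ennreal_powr a s \<le> ennreal_powr b s"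
  using assms by (cases a; cases b) (auto intro!: ennreal_leI powr_mono2 simp: top_unique)

lemma ennreal_powr_mult:
  "ennreal_powr (a * b) s = ennreal_powr a s * ennreal_powr b s"
proof (cases a; cases b)
  fix x y assume "a = ennreal x" "0 \<le> x" "b = ennreal y" "0 \<le> y"
  then show ?thesis by (simp add: powr_mult flip: ennreal_mult')
next
  fix x assume "a = ennreal x" "0 \<le> x" "b = top"
  then show ?thesis by (cases "x = 0") (auto simp: ennreal_mult_top)
next
  fix y assume "b = ennreal y" "0 \<le> y" "a = top"
  then show ?thesis by (cases "y = 0") (auto simp: ennreal_top_mult)
qed simp

lemma ennreal_powr_powr: "ennreal_powr (ennreal_powr a s) t = ennreal_powr a (s * t)"
  by (cases a) (auto simp: powr_powr)

lemma ennreal_powr_powr_inverse: "s > 0 \<Longrightarrow> ennreal_powr (ennreal_powr a s) (1 / s) = a"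
  "s > 0 \<Longrightarrow> ennreal_powr (ennreal_powr a (1 / s)) s = a"
  by (simp_all add: ennreal_powr_powr)

lemma ennreal_powr_max:
  "s \<ge> 0 \<Longrightarrow> ennreal_powr (max a b) s = max (ennreal_powr a s) (ennreal_powr b s)"
  using ennreal_powr_mono[of a b s] ennreal_powr_mono[of b a s] by (auto simp: max_def)

text \<open>Passing through twice the maximum treats convex and concave powers alike; the bound is
  applied with exponents q, p > 1 and with their reciprocals.\<close>

lemma ennreal_powr_add_le:
  assumes "s \<ge> 0"
  shows "ennreal_powr (a + b) s \<le> ennreal (2 powr s) * (ennreal_powr a s + ennreal_powr b s)"
proof -
  have "a + b \<le> 2 * max a b"
    by (simp add: mult_2 add_mono)
  then have "ennreal_powr (a + b) s \<le> ennreal_powr (ennreal 2 * max a b) s"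
    using assms by (intro ennreal_powr_mono) auto
  also have "\<dots> = ennreal (2 powr s) * max (ennreal_powr a s) (ennreal_powr b s)"
    using assms by (simp only: ennreal_powr_mult ennreal_powr_max) simp
  also have "\<dots> \<le> ennreal (2 powr s) * (ennreal_powr a s + ennreal_powr b s)"
    by (intro mult_left_mono) (auto simp: max_def)
  finally show ?thesis .
qed

lemma ennreal_powr_Suc: "s > 0 \<Longrightarrow> a * ennreal_powr a s = ennreal_powr a (s + 1)"
  by (cases a) (auto simp: powr_add ennreal_mult_top simp flip: ennreal_mult' ennreal_mult'')

lemma borel_measurable_ennreal_powr [measurable (raw)]:
  assumes [measurable]: "f \<in> borel_measurable M"
  shows "(\<lambda>x. ennreal_powr (f x) s) \<in> borel_measurable M"
  unfolding ennreal_powr_def by measurable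

section \<open>The uncentred maximal function on the line\<close>

text \<open>Since the averages are uncentred, an interval that witnesses a large value at x does so
  at each of its points. Superlevel sets are therefore open, hence measurable, and covered by the
  witnesses themselves, which makes the weak type bound available for every Borel measure on the
  line.\<close>

definition maximal_fn :: "real measure \<Rightarrow> (real \<Rightarrow> ennreal) \<Rightarrow> real \<Rightarrow> ennreal" where
  "maximal_fn \<nu> F x = (SUP (a, b)\<in>{(a, b). a < x \<and> x < b}.
     (\<integral>\<^sup>+y\<in>{a<..<b}. F y \<partial>\<nu>) / emeasure \<nu> {a<..<b})"

lemma maximal_fn_ge:
  "a < x \<Longrightarrow> x < b \<Longrightarrow> (\<integral>\<^sup>+y\<in>{a<..<b}. F y \<partial>\<nu>) / emeasure \<nu> {a<..<b} \<le> maximal_fn \<nu> F x"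
  unfolding maximal_fn_def by (rule SUP_upper2[of "(a, b)"]) auto

lemma less_maximal_fnE:
  assumes "l < maximal_fn \<nu> F x"
  obtains a b where "a < x" "x < b" "l < (\<integral>\<^sup>+y\<in>{a<..<b}. F y \<partial>\<nu>) / emeasure \<nu> {a<..<b}"
  using assms unfolding maximal_fn_def less_SUP_iff by auto

lemma open_maximal_fn_greater: "open {x. l < maximal_fn \<nu> F x}"
proof (subst open_subopen, intro ballI)
  fix x assume "x \<in> {x. l < maximal_fn \<nu> F x}"
  then obtain a b where ab: "a < x" "x < b" "l < (\<integral>\<^sup>+y\<in>{a<..<b}. F y \<partial>\<nu>) / emeasure \<nu> {a<..<b}"
    by (auto elim: less_maximal_fnE)
  then have "{a<..<b} \<subseteq> {x. l < maximal_fn \<nu> F x}"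
    by (auto intro: less_le_trans[OF _ maximal_fn_ge])
  with ab show "\<exists>T. open T \<and> x \<in> T \<and> T \<subseteq> {x. l < maximal_fn \<nu> F x}"
    by (intro exI[of _ "{a<..<b}"]) auto
qed

lemma borel_measurable_maximal_fn: "maximal_fn \<nu> F \<in> borel_measurable borel"
  by (rule borel_measurableI_greater) (simp add: borel_open[OF open_maximal_fn_greater])

text \<open>In a subfamily of minimal size with the same union, a point lies in at most two intervals:
  among the intervals around it, those reaching farthest to the left and to the right cover the others.\<close>

lemma intervals_overlap_le_2:
  fixes S :: "(real \<times> real) set"
  assumes "finite S"
  obtains T where "T \<subseteq> S" "(\<Union>(a, b)\<in>T. {a<..<b}) = (\<Union>(a, b)\<in>S. {a<..<b})"
    "\<And>x. card {(a, b) \<in> T. x \<in> {a<..<b}} \<le> 2"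
proof -
  define U :: "(real \<times> real) set \<Rightarrow> real set" where "U = (\<lambda>T. \<Union>(a, b)\<in>T. {a<..<b})"
  obtain T where T: "T \<subseteq> S \<and> U T = U S" and min: "\<And>T'. T' \<subseteq> S \<and> U T' = U S \<Longrightarrow> card T \<le> card T'"
    using exists_least_iff[of "\<lambda>n. \<exists>T\<subseteq>S. U T = U S \<and> card T = n"]
    by (metis (no_types, lifting) linorder_not_less order_refl)
  have finT: "finite T" using T assms finite_subset by blast
  have "card {(a, b) \<in> T. x \<in> {a<..<b}} \<le> 2" for x
  proof (rule ccontr)
    define Tx where "Tx = {(a, b) \<in> T. x \<in> {a<..<b}}"
    assume "\<not> card {(a, b) \<in> T. x \<in> {a<..<b}} \<le> 2"
    then have c: "card Tx > 2" by (simp add: Tx_def)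
    have fin: "finite Tx" using finT by (rule rev_finite_subset) (auto simp: Tx_def)
    have ne: "Tx \<noteq> {}" using c by auto
    obtain L where L: "L \<in> Tx" "\<And>I. I \<in> Tx \<Longrightarrow> fst L \<le> fst I"
    proof -
      have "Min (fst ` Tx) \<in> fst ` Tx" using fin ne by (intro Min_in) auto
      then obtain L where "Min (fst ` Tx) = fst L" "L \<in> Tx" by (rule imageE)
      note L = this
      show ?thesis using fin by (intro that[of L] L(2)) (simp flip: L(1))
    qed
    obtain R where R: "R \<in> Tx" "\<And>I. I \<in> Tx \<Longrightarrow> snd I \<le> snd R"
    proof -
      have "Max (snd ` Tx) \<in> snd ` Tx" using fin ne by (intro Max_in) auto
      then obtain R where R: "Max (snd ` Tx) = snd R" "R \<in> Tx" by (rule imageE)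
      show ?thesis using fin by (intro that[of R] R(2)) (simp flip: R(1))
    qed
    have "card {L, R} \<le> 2" by (simp add: card_insert_if)
    then have "\<not> Tx \<subseteq> {L, R}" using c card_mono[of "{L, R}" Tx] by auto
    then obtain K where K: "K \<in> Tx" "K \<noteq> L" "K \<noteq> R" by auto
    \<comment> \<open>All three intervals contain x: the part of \<open>K\<close> to the left of x
      lies in \<open>L\<close>, the part to the right in \<open>R\<close>.\<close>
    have sub: "{fst K<..<snd K} \<subseteq> {fst L<..<snd L} \<union> {fst R<..<snd R}"
      using L(1) R(1) K(1) L(2)[OF K(1)] R(2)[OF K(1)] by (auto simp: Tx_def)
    have "U (T - {K}) = U T"
    proof
      show "U (T - {K}) \<subseteq> U T" by (auto simp: U_def)
      show "U T \<subseteq> U (T - {K})"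
      proof
        fix y assume "y \<in> U T"
        then obtain I where I: "I \<in> T" "y \<in> {fst I<..<snd I}" by (auto simp: U_def)
        have "\<exists>J\<in>T - {K}. y \<in> {fst J<..<snd J}"
        proof (cases "I = K")
          case True
          then have "y \<in> {fst L<..<snd L} \<or> y \<in> {fst R<..<snd R}" using I sub by auto
          moreover have "L \<in> T - {K}" "R \<in> T - {K}" using L(1) R(1) K by (auto simp: Tx_def)
          ultimately show ?thesis by auto
        qed (use I in auto)
        then show "y \<in> U (T - {K})" by (force simp: U_def)
      qed
    qed
    then have "card T \<le> card (T - {K})" using T by (intro min) auto
    moreover have "card (T - {K}) < card T"
      using K(1) finT by (intro card_Diff1_less) (auto simp: Tx_def)
    ultimately show False by simp
  qed
  then show ?thesis using that T by (auto simp: U_def)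
qed

text \<open>After thinning to overlap at most 2, the integrals over the intervals add up to at most
  twice the total integral, while the union is unchanged.\<close>

lemma emeasure_finite_intervals_le:
  fixes \<nu> :: "real measure" and S :: "(real \<times> real) set"
  assumes sets [measurable_cong]: "sets \<nu> = sets borel" and [measurable]: "F \<in> borel_measurable borel"
    and "finite S"
    and l: "\<And>a b. (a, b) \<in> S \<Longrightarrow> l * emeasure \<nu> {a<..<b} \<le> (\<integral>\<^sup>+y\<in>{a<..<b}. F y \<partial>\<nu>)"
  shows "l * emeasure \<nu> (\<Union>(a, b)\<in>S. {a<..<b}) \<le> 2 * (\<integral>\<^sup>+y. F y \<partial>\<nu>)"
proof -
  obtain T where T: "T \<subseteq> S" "(\<Union>(a, b)\<in>T. {a<..<b}) = (\<Union>(a, b)\<in>S. {a<..<b})"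
    and card: "\<And>x. card {(a, b) \<in> T. x \<in> {a<..<b}} \<le> 2"
    using intervals_overlap_le_2[OF \<open>finite S\<close>] by blast
  have finT: "finite T" using T(1) assms(3) finite_subset by blast
  have "emeasure \<nu> (\<Union>(a, b)\<in>T. {a<..<b}) \<le> (\<Sum>(a, b)\<in>T. emeasure \<nu> {a<..<b})"
  proof -
    have "(\<lambda>(a, b). {a<..<b}) ` T \<subseteq> sets \<nu>" by (auto simp: sets)
    from emeasure_subadditive_finite[OF finT this] show ?thesis by (simp add: split_def)
  qed
  from mult_left_mono[OF this, of l]
  have "l * emeasure \<nu> (\<Union>(a, b)\<in>S. {a<..<b}) \<le> (\<Sum>(a, b)\<in>T. l * emeasure \<nu> {a<..<b})"
    unfolding T(2)[symmetric] by (simp add: sum_distrib_left split_def)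
  also have "\<dots> \<le> (\<Sum>(a, b)\<in>T. (\<integral>\<^sup>+y\<in>{a<..<b}. F y \<partial>\<nu>))"
    using T(1) by (intro sum_mono) (auto intro!: l)
  also have "\<dots> = (\<integral>\<^sup>+y. (\<Sum>(a, b)\<in>T. F y * indicator {a<..<b} y) \<partial>\<nu>)"
    unfolding split_def by (rule nn_integral_sum[symmetric]) auto
  also have "\<dots> \<le> (\<integral>\<^sup>+y. 2 * F y \<partial>\<nu>)"
  proof (rule nn_integral_mono)
    fix y
    have eq: "(\<Sum>(a, b)\<in>T. F y * indicator {a<..<b} y) = F y * (\<Sum>I\<in>T. indicator {I. y \<in> {fst I<..<snd I}} I)"
      by (simp add: sum_distrib_left split_def indicator_def)
    have "(\<Sum>I\<in>T. indicator {I. y \<in> {fst I<..<snd I}} I :: ennreal) = of_nat (card {(a, b) \<in> T. y \<in> {a<..<b}})"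
    proof -
      have "(\<Sum>I\<in>T. indicator {I. y \<in> {fst I<..<snd I}} I :: ennreal) = of_nat (card (T \<inter> {I. y \<in> {fst I<..<snd I}}))"
        by (simp add: indicator_def sum.If_cases finT)
      also have "T \<inter> {I. y \<in> {fst I<..<snd I}} = {(a, b) \<in> T. y \<in> {a<..<b}}" by auto
      finally show ?thesis .
    qed
    also have "\<dots> \<le> of_nat 2" using card[of y] by (intro of_nat_mono)
    finally show "(\<Sum>(a, b)\<in>T. F y * indicator {a<..<b} y) \<le> 2 * F y"
      unfolding eq by (subst (2) mult.commute) (intro mult_left_mono, simp_all)
  qed
  also have "\<dots> = 2 * (\<integral>\<^sup>+y. F y \<partial>\<nu>)" by (simp add: nn_integral_cmult)
  finally show ?thesis .
qed

text \<open>The superlevel set is covered by intervals with large average. Lindelof's theorem makes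
  the cover countable, continuity from below makes it finite, and the finite case is a covering
  argument.\<close>

lemma maximal_fn_weak_type:
  assumes sets [measurable_cong]: "sets \<nu> = sets borel" and F [measurable]: "F \<in> borel_measurable borel"
  shows "l * emeasure \<nu> {x. l < maximal_fn \<nu> F x} \<le> 2 * (\<integral>\<^sup>+y. F y \<partial>\<nu>)"
proof -
  define S where "S = {(a, b). l * emeasure \<nu> {a<..<b} \<le> (\<integral>\<^sup>+y\<in>{a<..<b}. F y \<partial>\<nu>)}"
  define \<F> where "\<F> = (\<lambda>(a, b). {a<..<b}) ` S"
  have sub: "{x. l < maximal_fn \<nu> F x} \<subseteq> \<Union>\<F>"
  proof
    fix x assume "x \<in> {x. l < maximal_fn \<nu> F x}"
    then obtain a b where ab: "a < x" "x < b" and less: "l < (\<integral>\<^sup>+y\<in>{a<..<b}. F y \<partial>\<nu>) / emeasure \<nu> {a<..<b}"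
      by (auto elim: less_maximal_fnE)
    \<comment> \<open>The condition is stated as a product: on an interval of measure 0 its left
      side vanishes, and otherwise the denominator can be cleared.\<close>
    have "l * emeasure \<nu> {a<..<b} \<le> (\<integral>\<^sup>+y\<in>{a<..<b}. F y \<partial>\<nu>)"
    proof (rule ccontr)
      assume *: "\<not> ?thesis"
      then have "emeasure \<nu> {a<..<b} > 0" by (auto simp: zero_less_iff_neq_zero)
      then have "(\<integral>\<^sup>+y\<in>{a<..<b}. F y \<partial>\<nu>) / emeasure \<nu> {a<..<b} \<le> l"
        using * by (intro divide_le_posI_ennreal) (auto simp: mult.commute)
      with less show False by simp
    qed
    then show "x \<in> \<Union>\<F>" using ab by (auto simp: \<F>_def S_def intro!: bexI[of _ "(a, b)"])
  qed
  obtain \<F>' where \<F>': "\<F>' \<subseteq> \<F>" "countable \<F>'" "\<Union>\<F>' = \<Union>\<F>"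
  proof -
    have "\<And>S. S \<in> \<F> \<Longrightarrow> open S" by (auto simp: \<F>_def)
    from Lindelof[of \<F>, OF this] that show ?thesis by metis
  qed
  obtain S' where S': "S' \<subseteq> S" "countable S'" "\<F>' = (\<lambda>(a, b). {a<..<b}) ` S'"
    using countable_subset_image[of \<F>' "\<lambda>(a, b). {a<..<b}" S] \<F>' by (auto simp: \<F>_def)
  show ?thesis
  proof (cases "S' = {}")
    case True
    then have "{x. l < maximal_fn \<nu> F x} = {}" using sub \<F>'(3) S'(3) by auto
    then show ?thesis by (simp only:) simp
  next
    case False
    define I where "I = from_nat_into S'"
    have I: "range I = S'" using False S'(2) by (simp add: I_def)
    define U where "U = (\<lambda>n. \<Union>(a, b)\<in>I ` {..<n::nat}. {a<..<b})"
    have inc: "incseq U" unfolding incseq_def U_def by (intro allI impI UN_mono image_mono) auto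
    have U: "(\<Union>n. U n) = \<Union>\<F>"
    proof -
      have "(\<Union>n. U n) = (\<Union>(a, b)\<in>range I. {a<..<b})"
      proof
        show "(\<Union>n. U n) \<subseteq> (\<Union>(a, b)\<in>range I. {a<..<b})"
          unfolding U_def split_def by blast
        show "(\<Union>(a, b)\<in>range I. {a<..<b}) \<subseteq> (\<Union>n. U n)"
        proof
          fix x assume "x \<in> (\<Union>(a, b)\<in>range I. {a<..<b})"
          then obtain n where "x \<in> {fst (I n)<..<snd (I n)}" by (auto simp: split_def)
          then have "x \<in> U (Suc n)" unfolding U_def split_def by (intro UN_I[of "I n"]) auto
          then show "x \<in> (\<Union>n. U n)" by blast
        qed
      qed
      then show ?thesis unfolding I \<F>'(3)[symmetric] S'(3) by simp
    qed
    have Um: "U n \<in> sets \<nu>" for n unfolding sets U_def split_def by (intro borel_open open_UN) auto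
    have "l * emeasure \<nu> {x. l < maximal_fn \<nu> F x} \<le> l * emeasure \<nu> (\<Union>n. U n)"
      using sub unfolding U by (intro mult_left_mono emeasure_mono) (use Um in \<open>auto simp flip: U\<close>)
    also have "\<dots> = l * (SUP n. emeasure \<nu> (U n))"
      using inc Um by (subst SUP_emeasure_incseq) auto
    also have "\<dots> = (SUP n. l * emeasure \<nu> (U n))"
      by (simp add: SUP_mult_left_ennreal)
    also have "\<dots> \<le> 2 * (\<integral>\<^sup>+y. F y \<partial>\<nu>)"
      unfolding U_def using I S'(1)
      by (intro SUP_least emeasure_finite_intervals_le sets F) (auto simp: S_def)
    finally show ?thesis .
  qed
qed

text \<open>The part of F where F \<le> t/2 contributes at most t/2 to any average, so the other
  part must contribute more than t/2. The threshold is written as t < 2 F to stay clear of division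
  in \<open>ennreal\<close>.\<close>

lemma maximal_fn_truncate:
  assumes sets [measurable_cong]: "sets \<nu> = sets borel" and [measurable]: "F \<in> borel_measurable borel"
    and t: "t > 0" and less: "ennreal t < maximal_fn \<nu> F x"
  shows "ennreal (t / 2) < maximal_fn \<nu> (\<lambda>y. F y * indicator {y. ennreal t < 2 * F y} y) x"
proof -
  obtain a b where ab: "a < x" "x < b" and l: "ennreal t < (\<integral>\<^sup>+y\<in>{a<..<b}. F y \<partial>\<nu>) / emeasure \<nu> {a<..<b}"
    using less by (auto elim: less_maximal_fnE)
  define G where "G = (\<lambda>y. F y * indicator {y. ennreal t < 2 * F y} y)"
  have [measurable]: "G \<in> borel_measurable borel" by (simp add: G_def)
  have FG: "F y \<le> G y + ennreal (t / 2)" for y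
  proof (cases "ennreal t < 2 * F y")
    case False
    then have "2 * F y \<le> 2 * ennreal (t / 2)" using t by (simp add: ennreal_mult''[symmetric, of _ 2] flip: ennreal_numeral ennreal_mult)
    then show ?thesis by (simp add: mult_le_cancel_left add_increasing ennreal_mult_le_mult_iff)
  qed (simp add: G_def)
  have "(\<integral>\<^sup>+y\<in>{a<..<b}. F y \<partial>\<nu>) \<le> (\<integral>\<^sup>+y. G y * indicator {a<..<b} y + ennreal (t / 2) * indicator {a<..<b} y \<partial>\<nu>)"
    using FG by (intro nn_integral_mono) (auto split: split_indicator)
  also have "\<dots> = (\<integral>\<^sup>+y\<in>{a<..<b}. G y \<partial>\<nu>) + ennreal (t / 2) * emeasure \<nu> {a<..<b}"
    by (subst nn_integral_add) (auto simp: nn_integral_cmult)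
  finally have "(\<integral>\<^sup>+y\<in>{a<..<b}. F y \<partial>\<nu>) / emeasure \<nu> {a<..<b} \<le>
      (\<integral>\<^sup>+y\<in>{a<..<b}. G y \<partial>\<nu>) / emeasure \<nu> {a<..<b} + ennreal (t / 2) * emeasure \<nu> {a<..<b} / emeasure \<nu> {a<..<b}"
    by (metis (no_types) add_divide_distrib_ennreal divide_right_mono_ennreal)
  also have "\<dots> \<le> maximal_fn \<nu> G x + ennreal (t / 2)"
  proof (intro add_mono maximal_fn_ge ab)
    show "ennreal (t / 2) * emeasure \<nu> {a<..<b} / emeasure \<nu> {a<..<b} \<le> ennreal (t / 2)"
      by (cases "emeasure \<nu> {a<..<b} = 0") (auto intro!: divide_le_posI_ennreal simp: zero_less_iff_neq_zero mult.commute)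
  qed
  finally have "ennreal (t / 2) + ennreal (t / 2) < maximal_fn \<nu> G x + ennreal (t / 2)"
    using l t by (simp flip: ennreal_plus)
  then show ?thesis unfolding G_def[symmetric] by simp
qed

text \<open>Stated for a single value X, so that it can be inserted under an integral and Tonelli's
  theorem yields the formula for functions. For X = \<infinity> the integral exceeds n^s for every
  n, hence is infinite.\<close>

lemma nn_integral_layer_cake:
  assumes "s > 0"
  shows "(\<integral>\<^sup>+t. ennreal (s * t powr (s - 1)) * indicator {t. 0 < t \<and> ennreal t < X} t \<partial>lborel) = ennreal_powr X s"
proof -
  have fin: "(\<integral>\<^sup>+t. ennreal (s * t powr (s - 1)) * indicator {0<..<x} t \<partial>lborel) = ennreal (x powr s)" if "x \<ge> 0" for x
  proof -
    have "((\<lambda>t. s * t powr (s - 1)) has_integral s * (x powr (s - 1 + 1) / (s - 1 + 1))) {0..x}"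
      using assms that by (intro has_integral_mult_right has_integral_powr_from_0) auto
    then have "(\<integral>\<^sup>+t. ennreal (indicator {0..x} t * (s * t powr (s - 1))) \<partial>lborel) = ennreal (x powr s)"
      using assms by (subst nn_integral_has_integral_lebesgue) auto
    moreover have "(\<integral>\<^sup>+t. ennreal (s * t powr (s - 1)) * indicator {0<..<x} t \<partial>lborel) =
        (\<integral>\<^sup>+t. ennreal (indicator {0..x} t * (s * t powr (s - 1))) \<partial>lborel)"
      using AE_lborel_singleton[of 0] AE_lborel_singleton[of x]
      by (intro nn_integral_cong_AE) (auto split: split_indicator)
    ultimately show ?thesis by simp
  qed
  show ?thesis
  proof (cases X)
    case (real x)
    then have "{t. 0 < t \<and> ennreal t < X} = {0<..<x}" by (auto simp: ennreal_less_iff)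
    then show ?thesis using fin real by simp
  next
    case top
    have "ennreal (real n powr s) \<le> (\<integral>\<^sup>+t. ennreal (s * t powr (s - 1)) * indicator {t. 0 < t \<and> ennreal t < X} t \<partial>lborel)" for n
      unfolding fin[of "real n", simplified, symmetric] top
      by (intro nn_integral_mono) (auto split: split_indicator)
    note ge = this
    have "(\<integral>\<^sup>+t. ennreal (s * t powr (s - 1)) * indicator {t. 0 < t \<and> ennreal t < X} t \<partial>lborel) = top"
    proof (rule ccontr)
      assume "\<not> ?thesis"
      then obtain r where r: "r \<ge> 0" "(\<integral>\<^sup>+t. ennreal (s * t powr (s - 1)) * indicator {t. 0 < t \<and> ennreal t < X} t \<partial>lborel) = ennreal r"
        by (cases "\<integral>\<^sup>+t. ennreal (s * t powr (s - 1)) * indicator {t. 0 < t \<and> ennreal t < X} t \<partial>lborel") auto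
      obtain n where n: "r powr (1 / s) < real n" using reals_Archimedean2 by blast
      have "r = (r powr (1 / s)) powr s" using assms r by (simp add: powr_powr)
      also have "\<dots> < real n powr s" using n assms by (intro powr_less_mono2) auto
      finally show False using ge[of n] r by simp
    qed
    then show ?thesis using top by simp
  qed
qed

text \<open>Marcinkiewicz interpolation between the weak type bound and boundedness on bounded
  functions. In the constant, one factor 2 comes from the weak type bound, one from the level t/2,
  and the integral of t^(p-2) over 0 < t < 2F supplies (2F)^(p-1) / (p-1).\<close>

lemma maximal_fn_strong_type:
  assumes "sigma_finite_measure \<nu>" and sets [measurable_cong]: "sets \<nu> = sets borel"
    and F [measurable]: "F \<in> borel_measurable borel" and p: "p > 1"
  shows "(\<integral>\<^sup>+x. ennreal_powr (maximal_fn \<nu> F x) p \<partial>\<nu>)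
    \<le> ennreal (4 * p / (p - 1) * 2 powr (p - 1)) * (\<integral>\<^sup>+x. ennreal_powr (F x) p \<partial>\<nu>)"
proof -
  interpret \<nu>: sigma_finite_measure \<nu> by fact
  interpret P: pair_sigma_finite \<nu> lborel ..
  define M where "M = maximal_fn \<nu> F"
  have [measurable]: "M \<in> borel_measurable borel" unfolding M_def by (rule borel_measurable_maximal_fn)
  have "(\<integral>\<^sup>+x. ennreal_powr (M x) p \<partial>\<nu>) =
      (\<integral>\<^sup>+x. (\<integral>\<^sup>+t. ennreal (p * t powr (p - 1)) * indicator {t. 0 < t \<and> ennreal t < M x} t \<partial>lborel) \<partial>\<nu>)"
    using p by (subst nn_integral_layer_cake) auto
  also have "\<dots> = (\<integral>\<^sup>+t. (\<integral>\<^sup>+x. ennreal (p * t powr (p - 1)) * indicator {t. 0 < t \<and> ennreal t < M x} t \<partial>\<nu>) \<partial>lborel)"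
    by (rule P.Fubini'[symmetric]) measurable
  also have "\<dots> \<le> (\<integral>\<^sup>+t. (\<integral>\<^sup>+x. ennreal (4 * p * t powr (p - 2)) * (F x * indicator {t. 0 < t \<and> ennreal t < 2 * F x} t) \<partial>\<nu>) \<partial>lborel)"
  proof (rule nn_integral_mono)
    fix t :: real
    show "(\<integral>\<^sup>+x. ennreal (p * t powr (p - 1)) * indicator {t. 0 < t \<and> ennreal t < M x} t \<partial>\<nu>)
        \<le> (\<integral>\<^sup>+x. ennreal (4 * p * t powr (p - 2)) * (F x * indicator {t. 0 < t \<and> ennreal t < 2 * F x} t) \<partial>\<nu>)"
    proof (cases "t > 0")
      case t: True
      define G where "G = (\<lambda>y. F y * indicator {y. ennreal t < 2 * F y} y)"
      have [measurable]: "G \<in> borel_measurable borel" by (simp add: G_def)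
      \<comment> \<open>Splits off the factor t/2, the level at which the weak type inequality is
        applied to the truncation.\<close>
      have pt: "p * t powr (p - 1) = 2 * p * t powr (p - 2) * (t / 2)"
        using t powr_add[of t "p - 2" 1] by simp
      have "(\<integral>\<^sup>+x. ennreal (p * t powr (p - 1)) * indicator {t. 0 < t \<and> ennreal t < M x} t \<partial>\<nu>)
          = (\<integral>\<^sup>+x. ennreal (p * t powr (p - 1)) * indicator {x. ennreal t < M x} x \<partial>\<nu>)"
        using t by (intro nn_integral_cong) (auto split: split_indicator)
      also have "\<dots> = ennreal (p * t powr (p - 1)) * emeasure \<nu> {x. ennreal t < M x}"
        by (subst nn_integral_cmult_indicator) auto
      also have "\<dots> \<le> ennreal (p * t powr (p - 1)) * emeasure \<nu> {x. ennreal (t / 2) < maximal_fn \<nu> G x}"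
        using maximal_fn_truncate[OF sets F t] open_maximal_fn_greater[of "ennreal (t / 2)" \<nu> G]
        by (intro mult_left_mono emeasure_mono) (auto simp: G_def M_def sets)
      also have "\<dots> = ennreal (2 * p * t powr (p - 2)) * (ennreal (t / 2) * emeasure \<nu> {x. ennreal (t / 2) < maximal_fn \<nu> G x})"
        unfolding pt using p t by (subst ennreal_mult) (auto simp: mult_ac)
      also have "\<dots> \<le> ennreal (2 * p * t powr (p - 2)) * (2 * (\<integral>\<^sup>+x. G x \<partial>\<nu>))"
        by (intro mult_left_mono maximal_fn_weak_type sets) auto
      also have "\<dots> = ennreal (4 * p * t powr (p - 2)) * (\<integral>\<^sup>+x. G x \<partial>\<nu>)"
      proof -
        have "ennreal (4 * p * t powr (p - 2)) = ennreal (2 * p * t powr (p - 2)) * 2"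
          using p t by (subst ennreal_numeral[symmetric], subst ennreal_mult[symmetric]) (auto simp: mult_ac)
        then show ?thesis by (simp add: mult_ac)
      qed
      also have "\<dots> = (\<integral>\<^sup>+x. ennreal (4 * p * t powr (p - 2)) * (F x * indicator {t. 0 < t \<and> ennreal t < 2 * F x} t) \<partial>\<nu>)"
        unfolding G_def using t by (subst nn_integral_cmult[symmetric]) (auto intro!: nn_integral_cong split: split_indicator)
      finally show ?thesis .
    qed simp
  qed
  also have "\<dots> = (\<integral>\<^sup>+x. (\<integral>\<^sup>+t. ennreal (4 * p * t powr (p - 2)) * (F x * indicator {t. 0 < t \<and> ennreal t < 2 * F x} t) \<partial>lborel) \<partial>\<nu>)"
    by (rule P.Fubini') measurable
  also have "\<dots> = (\<integral>\<^sup>+x. ennreal (4 * p / (p - 1) * 2 powr (p - 1)) * ennreal_powr (F x) p \<partial>\<nu>)"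
  proof (rule nn_integral_cong)
    fix x
    have e: "ennreal (4 * p * t powr (p - 2)) = ennreal (4 * p / (p - 1)) * ennreal ((p - 1) * t powr (p - 1 - 1))" for t
    proof -
      have "4 * p * t powr (p - 2) = 4 * p / (p - 1) * ((p - 1) * t powr (p - 1 - 1))" using p by simp
      then show ?thesis using p by (simp only:) (rule ennreal_mult, auto)
    qed
    have ac: "a * b * (c * d) = a * c * (b * d)" for a b c d :: ennreal by (simp only: mult_ac)
    have "(\<integral>\<^sup>+t. ennreal (4 * p * t powr (p - 2)) * (F x * indicator {t. 0 < t \<and> ennreal t < 2 * F x} t) \<partial>lborel) =
       (\<integral>\<^sup>+t. ennreal (4 * p / (p - 1)) * F x * (ennreal ((p - 1) * t powr (p - 1 - 1)) * indicator {t. 0 < t \<and> ennreal t < 2 * F x} t) \<partial>lborel)"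
      by (simp only: e ac)
    also have "\<dots> = ennreal (4 * p / (p - 1)) * F x * ennreal_powr (2 * F x) (p - 1)"
      using p by (subst nn_integral_cmult, measurable) (subst nn_integral_layer_cake, auto)
    also have "ennreal_powr (2 * F x) (p - 1) = ennreal (2 powr (p - 1)) * ennreal_powr (F x) (p - 1)"
      by (simp add: ennreal_powr_mult)
    also have "ennreal (4 * p / (p - 1)) * F x * (ennreal (2 powr (p - 1)) * ennreal_powr (F x) (p - 1)) =
       ennreal (4 * p / (p - 1)) * ennreal (2 powr (p - 1)) * (F x * ennreal_powr (F x) (p - 1))"
      by (simp only: mult_ac)
    also have "F x * ennreal_powr (F x) (p - 1) = ennreal_powr (F x) p"
      using p by (subst ennreal_powr_Suc) auto
    also have "ennreal (4 * p / (p - 1)) * ennreal (2 powr (p - 1)) = ennreal (4 * p / (p - 1) * 2 powr (p - 1))"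
      using p by (subst ennreal_mult) auto
    finally show "(\<integral>\<^sup>+t. ennreal (4 * p * t powr (p - 2)) * (F x * indicator {t. 0 < t \<and> ennreal t < 2 * F x} t) \<partial>lborel) =
       ennreal (4 * p / (p - 1) * 2 powr (p - 1)) * ennreal_powr (F x) p" .
  qed
  also have "\<dots> = ennreal (4 * p / (p - 1) * 2 powr (p - 1)) * (\<integral>\<^sup>+x. ennreal_powr (F x) p \<partial>\<nu>)"
    by (subst nn_integral_cmult) auto
  finally show ?thesis unfolding M_def .
qed

section \<open>The product formula\<close>

lemma nn_integral_uminus_lborel:
  fixes f :: "real \<Rightarrow> ennreal"
  assumes "f \<in> borel_measurable borel"
  shows "(\<integral>\<^sup>+x. f (- x) \<partial>lborel) = (\<integral>\<^sup>+x. f x \<partial>lborel)"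
  using nn_integral_real_affine[OF assms, of "- 1" 0] by simp

text \<open>The Chu-Vandermonde identity for n + (c + k - 1) over k, divided by n! and the
  Pochhammer symbol. The case distinction excludes the terms in which the natural subtraction n - p
  would be cut off at 0.\<close>

lemma vandermonde_reciprocal:
  fixes c :: real
  assumes "c > 0"
  shows "(\<Sum>p\<le>k. (if p \<le> n then 1 / (fact (k - p) * fact (n - p) * fact p * pochhammer c p) else 0))
    = pochhammer (c + real n) k / (fact k * fact n * pochhammer c k)"
proof -
  have pos: "pochhammer c i > 0" for i using assms by (rule pochhammer_pos)
  have "pochhammer (c + real n) k / fact k = (real n + (c + real k - 1)) gchoose k"
    unfolding gbinomial_pochhammer' by (simp add: algebra_simps)
  also have "\<dots> = (\<Sum>p\<le>k. (real n gchoose p) * ((c + real k - 1) gchoose (k - p)))"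
    by (simp add: gbinomial_Vandermonde[symmetric] atLeast0AtMost)
  also have "\<dots> = (\<Sum>p\<le>k. (if p \<le> n then 1 / (fact (k - p) * fact (n - p) * fact p * pochhammer c p) else 0) * (fact n * pochhammer c k))"
  proof (rule sum.cong[OF refl])
    fix p assume p: "p \<in> {..k}"
    have g: "(c + real k - 1) gchoose (k - p) = pochhammer (c + real p) (k - p) / fact (k - p)"
      unfolding gbinomial_pochhammer' using p by (simp add: of_nat_diff)
    have c: "pochhammer c k = pochhammer c p * pochhammer (c + real p) (k - p)"
      using p by (intro pochhammer_product) auto
    show "(real n gchoose p) * ((c + real k - 1) gchoose (k - p)) =
      (if p \<le> n then 1 / (fact (k - p) * fact (n - p) * fact p * pochhammer c p) else 0) * (fact n * pochhammer c k)"
    proof (cases "p \<le> n")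
      case True
      then have "real n gchoose p = fact n / (fact p * fact (n - p))"
        by (simp add: binomial_gbinomial[symmetric] binomial_fact)
      then show ?thesis using True pos[of p] unfolding g c by simp
    next
      case False
      then have "real n gchoose p = 0" by (simp add: binomial_gbinomial[symmetric] binomial_eq_0)
      then show ?thesis using False by simp
    qed
  qed
  also have "\<dots> = (\<Sum>p\<le>k. (if p \<le> n then 1 / (fact (k - p) * fact (n - p) * fact p * pochhammer c p) else 0)) * (fact n * pochhammer c k)"
    by (rule sum_distrib_right[symmetric])
  finally have eq: "pochhammer (c + real n) k / fact k =
    (\<Sum>p\<le>k. (if p \<le> n then 1 / (fact (k - p) * fact (n - p) * fact p * pochhammer c p) else 0)) * (fact n * pochhammer c k)" .
  have "S = X / (a * b * P)" if "X / a = S * (b * P)" "a \<noteq> 0" "b \<noteq> 0" "P \<noteq> 0" for S X a b P :: real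
    using that by (simp add: field_simps)
  from this[OF eq] show ?thesis using pos[of k] by simp
qed

lemma sum_even_indices:
  fixes f :: "nat \<Rightarrow> real"
  assumes "\<And>l. odd l \<Longrightarrow> f l = 0"
  shows "(\<Sum>l\<le>m. f l) = (\<Sum>p\<le>m. if 2 * p \<le> m then f (2 * p) else 0)"
proof -
  have "(\<Sum>l\<le>m. f l) = (\<Sum>l\<in>{l. l \<le> m \<and> even l}. f l)"
    by (rule sum.mono_neutral_right) (auto simp: assms)
  also have "\<dots> = (\<Sum>p\<in>{p. 2 * p \<le> m}. f (2 * p))"
    by (rule sum.reindex_bij_witness[of _ "\<lambda>p. 2 * p" "\<lambda>l. l div 2"]) auto
  also have "\<dots> = (\<Sum>p\<le>m. if 2 * p \<le> m then f (2 * p) else 0)"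
    by (rule sum.mono_neutral_cong_left) auto
  finally show ?thesis .
qed

text \<open>The algebraic core of the product formula: with \<open>\<tau>\<close> the moments of the
  angular measure, the m-th term of the series at u^2 + v^2 - 2uvt integrates to the m-th term of
  the Cauchy product of the series at u^2 and v^2.\<close>

lemma bessel_coeff_moments:
  fixes \<tau> :: "nat \<Rightarrow> real" and c U V :: real
  assumes c: "c > 0"
    and odd: "\<And>l. odd l \<Longrightarrow> \<tau> l = 0"
    and even: "\<And>p. \<tau> (2 * p) = fact (2 * p) / (4 ^ p * fact p * pochhammer c p)"
  shows "bessel_coeff c m * (\<Sum>l\<le>m. real (m choose l) * (u\<^sup>2 + v\<^sup>2) ^ (m - l) * (- 2 * u * v) ^ l * \<tau> l) =
    (\<Sum>k\<le>m. (bessel_coeff c k * (u\<^sup>2) ^ k) * (bessel_coeff c (m - k) * (v\<^sup>2) ^ (m - k)))"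
proof -
  have pos: "pochhammer c i > 0" for i using c by (rule pochhammer_pos)
  \<comment> \<open>\<open>T p k\<close> is the contribution of the moment of order 2p to the
    monomial with u^(2k) and v^(2(m-k)). Summed over k it gives back the binomial expansion, summed
    over p it is a Vandermonde sum.\<close>
  define T where "T = (\<lambda>p k. if p \<le> k \<and> p \<le> m - k then
     fact m / (fact (k - p) * fact (m - k - p) * fact p * pochhammer c p) * ((u\<^sup>2) ^ k * (v\<^sup>2) ^ (m - k)) else 0)"
  have "(\<Sum>l\<le>m. real (m choose l) * (u\<^sup>2 + v\<^sup>2) ^ (m - l) * (- 2 * u * v) ^ l * \<tau> l)
     = (\<Sum>p\<le>m. if 2 * p \<le> m then real (m choose (2 * p)) * (u\<^sup>2 + v\<^sup>2) ^ (m - 2 * p) * (- 2 * u * v) ^ (2 * p) * \<tau> (2 * p) else 0)"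
    by (rule sum_even_indices) (simp add: odd)
  also have "\<dots> = (\<Sum>p\<le>m. \<Sum>k\<le>m. T p k)"
  proof (rule sum.cong[OF refl])
    fix p assume "p \<in> {..m}"
    show "(if 2 * p \<le> m then real (m choose (2 * p)) * (u\<^sup>2 + v\<^sup>2) ^ (m - 2 * p) * (- 2 * u * v) ^ (2 * p) * \<tau> (2 * p) else 0) = (\<Sum>k\<le>m. T p k)"
    proof (cases "2 * p \<le> m")
      case False
      then have "T p k = 0" if "k \<le> m" for k using that by (auto simp: T_def)
      then show ?thesis using False by simp
    next
      case True
      have "(\<Sum>k\<le>m. T p k) = (\<Sum>k\<in>{k. p \<le> k \<and> k + p \<le> m}. T p k)"
        by (rule sum.mono_neutral_right) (auto simp: T_def)
      also have "\<dots> = (\<Sum>i\<le>m - 2 * p. T p (i + p))"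
        using True by (intro sum.reindex_bij_witness[of _ "\<lambda>i. i + p" "\<lambda>k. k - p"]) auto
      also have "\<dots> = (\<Sum>i\<le>m - 2 * p. fact m / (fact (m - 2 * p) * fact p * pochhammer c p) * (u\<^sup>2 * v\<^sup>2) ^ p *
          (real ((m - 2 * p) choose i) * (u\<^sup>2) ^ i * (v\<^sup>2) ^ (m - 2 * p - i)))"
      proof (rule sum.cong[OF refl])
        fix i assume i: "i \<in> {..m - 2 * p}"
        have 1: "m - (i + p) = p + (m - 2 * p - i)" "m - (i + p) - p = m - 2 * p - i" using i True by auto
        have 2: "p \<le> m - (i + p)" using 1 by simp
        have "real ((m - 2 * p) choose i) = fact (m - 2 * p) / (fact i * fact (m - 2 * p - i))"
          using i by (subst binomial_fact) auto
        then show "T p (i + p) = fact m / (fact (m - 2 * p) * fact p * pochhammer c p) * (u\<^sup>2 * v\<^sup>2) ^ p *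
          (real ((m - 2 * p) choose i) * (u\<^sup>2) ^ i * (v\<^sup>2) ^ (m - 2 * p - i))"
          unfolding T_def using 2 by (simp add: 1 power_add power_mult_distrib mult_ac)
      qed
      also have "\<dots> = fact m / (fact (m - 2 * p) * fact p * pochhammer c p) * (u\<^sup>2 * v\<^sup>2) ^ p * (u\<^sup>2 + v\<^sup>2) ^ (m - 2 * p)"
        by (subst binomial_ring) (simp add: sum_distrib_left)
      also have "\<dots> = real (m choose (2 * p)) * (u\<^sup>2 + v\<^sup>2) ^ (m - 2 * p) * (- 2 * u * v) ^ (2 * p) * \<tau> (2 * p)"
      proof -
        have 1: "real (m choose (2 * p)) = fact m / (fact (2 * p) * fact (m - 2 * p))"
          using True by (subst binomial_fact) auto
        have 2: "(- 2 * u * v) ^ (2 * p) = 4 ^ p * (u\<^sup>2 * v\<^sup>2) ^ p"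
          by (simp add: power_mult power_mult_distrib)
        have cancel: "a / (b * d * e) * X * Y = a / (f * b) * Y * (g * X) * (f / (g * d * e))"
          if "f \<noteq> 0" "g \<noteq> 0" for a b d e f g X Y :: real using that by (simp add: mult_ac)
        show ?thesis unfolding 1 2 even by (rule cancel) auto
      qed
      finally show ?thesis using True by simp
    qed
  qed
  also have "\<dots> = (\<Sum>k\<le>m. \<Sum>p\<le>m. T p k)" by (rule sum.swap)
  finally have eq: "(\<Sum>l\<le>m. real (m choose l) * (u\<^sup>2 + v\<^sup>2) ^ (m - l) * (- 2 * u * v) ^ l * \<tau> l) = (\<Sum>k\<le>m. \<Sum>p\<le>m. T p k)" .
  show ?thesis unfolding eq
  proof (subst sum_distrib_left, rule sum.cong[OF refl])
    fix k assume k: "k \<in> {..m}"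
    have "(\<Sum>p\<le>m. T p k) = (\<Sum>p\<le>k. T p k)"
      using k by (intro sum.mono_neutral_right) (auto simp: T_def)
    also have "\<dots> = (\<Sum>p\<le>k. (if p \<le> m - k then 1 / (fact (k - p) * fact (m - k - p) * fact p * pochhammer c p) else 0) * (fact m * ((u\<^sup>2) ^ k * (v\<^sup>2) ^ (m - k))))"
      by (rule sum.cong) (auto simp: T_def)
    also have "\<dots> = pochhammer (c + real (m - k)) k / (fact k * fact (m - k) * pochhammer c k) * (fact m * ((u\<^sup>2) ^ k * (v\<^sup>2) ^ (m - k)))"
      unfolding sum_distrib_right[symmetric] vandermonde_reciprocal[OF c] ..
    finally have s: "(\<Sum>p\<le>m. T p k) = pochhammer (c + real (m - k)) k / (fact k * fact (m - k) * pochhammer c k) * (fact m * ((u\<^sup>2) ^ k * (v\<^sup>2) ^ (m - k)))" .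
    have pm: "pochhammer c m = pochhammer c (m - k) * pochhammer (c + real (m - k)) k"
      using k pochhammer_product[of "m - k" m c] by simp
    have e: "(- 1 / 4 :: real) ^ m = (- 1 / 4) ^ k * (- 1 / 4) ^ (m - k)"
      using k by (simp flip: power_add)
    have p2: "pochhammer (c + real (m - k)) k > 0" using c by (intro pochhammer_pos) auto
    have cancel: "E1 * E2 / (F * (P1 * P2)) * (P2 / (a * b * P3) * (F * (X * Y))) = E1 / (a * P3) * X * (E2 / (b * P1) * Y)"
      if "F \<noteq> 0" "P2 \<noteq> 0" for E1 E2 F P1 P2 P3 a b X Y :: real using that by (simp add: mult_ac)
    show "bessel_coeff c m * (\<Sum>p\<le>m. T p k) = (bessel_coeff c k * (u\<^sup>2) ^ k) * (bessel_coeff c (m - k) * (v\<^sup>2) ^ (m - k))"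
      unfolding s bessel_coeff_def e pm by (rule cancel) (use p2 in auto)
  qed
qed

text \<open>Both half-lines contribute equally, and |x| is half the derivative of x^2. The
  substitution is made on compact intervals and passes to the half-line by continuity from
  below.\<close>

lemma nn_integral_square:
  fixes \<psi> :: "real \<Rightarrow> ennreal"
  assumes [measurable]: "\<psi> \<in> borel_measurable borel"
  shows "(\<integral>\<^sup>+x. ennreal \<bar>x\<bar> * \<psi> (x\<^sup>2) \<partial>lborel) = (\<integral>\<^sup>+X. \<psi> X * indicator {0<..} X \<partial>lborel)"
proof -
  define f where "f = (\<lambda>x. \<psi> (x\<^sup>2) * ennreal (2 * x))"
  have [measurable]: "f \<in> borel_measurable borel" by (simp add: f_def)
  have step: "emeasure (density lborel \<psi>) {0..(real n)\<^sup>2} = emeasure (density lborel f) {0..real n}" for n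
  proof (cases "n = 0")
    case False
    have "set_nn_integral lborel {0\<^sup>2..(real n)\<^sup>2} \<psi> = (\<integral>\<^sup>+x\<in>{0..real n}. \<psi> (x\<^sup>2) * ennreal (2 * x) \<partial>lborel)"
      by (rule nn_integral_substitution_aux[where g = "\<lambda>x. x\<^sup>2" and g' = "\<lambda>x. 2 * x"])
        (use False in \<open>auto intro!: derivative_eq_intros continuous_intros\<close>)
    then show ?thesis by (simp add: emeasure_density f_def)
  qed (simp add: emeasure_density f_def nn_integral_null_set[of "{0::real}" lborel \<open>_\<close>])
  have U: "(\<Union>n. {0..(real n)\<^sup>2}) = {0..}" "(\<Union>n. {0..real n}) = {0..}"
  proof -
    have "\<exists>n. x \<le> (real n)\<^sup>2" for x
    proof -
      obtain n where n: "x \<le> real n" using real_arch_simple by blast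
      have "real n \<le> (real n)\<^sup>2" by (cases n) (auto simp: power2_eq_square)
      then show ?thesis using n order_trans by blast
    qed
    then show "(\<Union>n. {0..(real n)\<^sup>2}) = {0..}" by auto
    show "(\<Union>n. {0..real n}) = {0..}" by (auto simp: real_arch_simple)
  qed
  have "emeasure (density lborel \<psi>) {0..} = (SUP n. emeasure (density lborel \<psi>) {0..(real n)\<^sup>2})"
    unfolding U(1)[symmetric] by (rule SUP_emeasure_incseq[symmetric]) (auto simp: incseq_def intro: power_mono order_trans)
  also have "\<dots> = (SUP n. emeasure (density lborel f) {0..real n})" by (simp only: step)
  also have "\<dots> = emeasure (density lborel f) {0..}"
    unfolding U(2)[symmetric] by (rule SUP_emeasure_incseq) (auto simp: incseq_def)
  finally have main: "(\<integral>\<^sup>+X. \<psi> X * indicator {0..} X \<partial>lborel) = (\<integral>\<^sup>+x. f x * indicator {0..} x \<partial>lborel)"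
    by (simp add: emeasure_density)
  define g where "g = (\<lambda>x. ennreal \<bar>x\<bar> * \<psi> (x\<^sup>2))"
  have [measurable]: "g \<in> borel_measurable borel" by (simp add: g_def)
  have "(\<integral>\<^sup>+x. g x \<partial>lborel) = (\<integral>\<^sup>+x. g x * indicator {0..} x + g (- x) * indicator {0..} (- x) \<partial>lborel)"
    using AE_lborel_singleton[of 0] by (intro nn_integral_cong_AE) (auto simp: g_def split: split_indicator)
  also have "\<dots> = (\<integral>\<^sup>+x. g x * indicator {0..} x \<partial>lborel) + (\<integral>\<^sup>+x. g (- x) * indicator {0..} (- x) \<partial>lborel)"
    by (rule nn_integral_add) auto
  also have "(\<integral>\<^sup>+x. g (- x) * indicator {0..} (- x) \<partial>lborel) = (\<integral>\<^sup>+x. g x * indicator {0..} x \<partial>lborel)"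
    by (rule nn_integral_uminus_lborel) auto
  also have "(\<integral>\<^sup>+x. g x * indicator {0..} x \<partial>lborel) + (\<integral>\<^sup>+x. g x * indicator {0..} x \<partial>lborel)
     = (\<integral>\<^sup>+x. f x * indicator {0..} x \<partial>lborel)"
  proof -
    have "g x + g x = f x" if "x \<ge> 0" for x
    proof -
      have "ennreal (2 * x) = ennreal x + ennreal x" using that by (simp flip: ennreal_plus)
      then show ?thesis using that by (simp add: f_def g_def distrib_left mult.commute[of "ennreal x"])
    qed
    then show ?thesis
      by (subst nn_integral_add[symmetric]) (auto intro!: nn_integral_cong split: split_indicator)
  qed
  also have "\<dots> = (\<integral>\<^sup>+X. \<psi> X * indicator {0<..} X \<partial>lborel)"
    unfolding main[symmetric] using AE_lborel_singleton[of 0] by (intro nn_integral_cong_AE) (auto split: split_indicator)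
  finally show ?thesis unfolding g_def .
qed

section \<open>The weighted measure on the line and the angular probability measure\<close>

locale dunkl =
  fixes \<kappa> :: real
  assumes kappa: "\<kappa> > - 1 / 2"
begin

abbreviation "\<mu> \<equiv> dunkl_measure \<kappa>"

definition "D = 2 powr (\<kappa> + 1) * Gamma (\<kappa> + 1)"

lemma D_pos: "D > 0"
  using kappa by (auto simp: D_def intro!: Gamma_real_pos)

lemma mu_def: "\<mu> = density lborel (\<lambda>x. ennreal (\<bar>x\<bar> powr (2 * \<kappa> + 1) / D))"
  by (simp add: dunkl_measure_def D_def)

lemma sets_mu [measurable_cong, simp]: "sets \<mu> = sets borel"
  and space_mu [simp]: "space \<mu> = UNIV"
  by (simp_all add: mu_def)

lemma borel_measurable_mu [simp]: "borel_measurable \<mu> = borel_measurable borel"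
  by (rule measurable_cong_sets) auto

lemma nn_integral_mu:
  assumes "f \<in> borel_measurable borel"
  shows "(\<integral>\<^sup>+x. f x \<partial>\<mu>) = (\<integral>\<^sup>+x. ennreal (\<bar>x\<bar> powr (2 * \<kappa> + 1) / D) * f x \<partial>lborel)"
  unfolding mu_def using assms by (subst nn_integral_density) auto

lemma AE_mu_iff:
  assumes "Measurable.pred borel P"
  shows "(AE x in \<mu>. P x) \<longleftrightarrow> (AE x in lborel. P x)"
proof -
  have "(AE x in \<mu>. P x) \<longleftrightarrow> (AE x in lborel. 0 < ennreal (\<bar>x\<bar> powr (2 * \<kappa> + 1) / D) \<longrightarrow> P x)"
    unfolding mu_def by (rule AE_density) auto
  also have "\<dots> \<longleftrightarrow> (AE x in lborel. P x)"
  proof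
    assume "AE x in lborel. 0 < ennreal (\<bar>x\<bar> powr (2 * \<kappa> + 1) / D) \<longrightarrow> P x"
    with AE_lborel_singleton[of 0] show "AE x in lborel. P x"
      by eventually_elim (use D_pos in auto)
  qed (auto elim: eventually_mono)
  finally show ?thesis .
qed

lemma AE_mu_nonzero: "AE x in \<mu>. x \<noteq> 0"
  using AE_lborel_singleton[of 0] by (subst AE_mu_iff) auto

sublocale mu: sigma_finite_measure \<mu>
  unfolding mu_def by (subst sigma_finite_measure.sigma_finite_iff_density_finite[OF sigma_finite_lborel]) auto

lemma distr_mu_uminus: "distr \<mu> borel uminus = \<mu>"
proof (rule measure_eqI)
  fix A :: "real set" assume "A \<in> sets (distr \<mu> borel uminus)"
  then have [measurable]: "A \<in> sets borel" by simp
  have "emeasure (distr \<mu> borel uminus) A = (\<integral>\<^sup>+x. indicator A (- x) \<partial>\<mu>)"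
    by (simp flip: nn_integral_indicator add: nn_integral_distr)
  also have "\<dots> = (\<integral>\<^sup>+x. ennreal (\<bar>- x\<bar> powr (2 * \<kappa> + 1) / D) * indicator A (- x) \<partial>lborel)"
    by (subst nn_integral_mu) auto
  also have "\<dots> = (\<integral>\<^sup>+x. ennreal (\<bar>x\<bar> powr (2 * \<kappa> + 1) / D) * indicator A x \<partial>lborel)"
    by (rule nn_integral_uminus_lborel) auto
  also have "\<dots> = emeasure \<mu> A" by (subst nn_integral_mu[symmetric]) auto
  finally show "emeasure (distr \<mu> borel uminus) A = emeasure \<mu> A" .
qed simp

lemma nn_integral_mu_uminus:
  assumes "f \<in> borel_measurable borel"
  shows "(\<integral>\<^sup>+x. f (- x) \<partial>\<mu>) = (\<integral>\<^sup>+x. f x \<partial>\<mu>)"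
  using assms by (subst distr_mu_uminus[symmetric]) (simp add: nn_integral_distr)

lemma integral_mu_uminus:
  fixes f :: "real \<Rightarrow> 'a::{banach, second_countable_topology}"
  assumes "f \<in> borel_measurable borel"
  shows "(\<integral>x. f (- x) \<partial>\<mu>) = (\<integral>x. f x \<partial>\<mu>)"
  using assms by (subst (2) distr_mu_uminus[symmetric]) (simp add: integral_distr)

definition w :: "real \<Rightarrow> real" where
  "w t = (1 - t\<^sup>2) powr (\<kappa> - 1 / 2) * indicator {-1<..<1} t"

lemma w_measurable [measurable]: "w \<in> borel_measurable borel"
  unfolding w_def[abs_def] by measurable

lemma w_nonneg: "w t \<ge> 0" by (simp add: w_def)

lemma w_minus: "w (- t) = w t" by (auto simp: w_def split: split_indicator)

text \<open>In 1 - t^2 = (1 + t)(1 - t) the first factor lies between 1 and 2. The absolute value in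
  the exponent covers both signs of \<kappa> - 1/2.\<close>

lemma w_bounds:
  assumes "0 \<le> t" "t < 1"
  shows "w t \<le> 2 powr \<bar>\<kappa> - 1 / 2\<bar> * (1 - t) powr (\<kappa> - 1 / 2)"
    and "w t \<ge> 2 powr - \<bar>\<kappa> - 1 / 2\<bar> * (1 - t) powr (\<kappa> - 1 / 2)"
proof -
  have eq: "w t = (1 + t) powr (\<kappa> - 1 / 2) * (1 - t) powr (\<kappa> - 1 / 2)"
    using assms by (simp add: w_def powr_mult[symmetric] power2_eq_square algebra_simps)
  have "(1 + t) powr (\<kappa> - 1 / 2) \<le> (1 + t) powr \<bar>\<kappa> - 1 / 2\<bar>"
    using assms by (intro powr_mono) auto
  also have "\<dots> \<le> 2 powr \<bar>\<kappa> - 1 / 2\<bar>" using assms by (intro powr_mono2) auto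
  finally show "w t \<le> 2 powr \<bar>\<kappa> - 1 / 2\<bar> * (1 - t) powr (\<kappa> - 1 / 2)"
    unfolding eq by (intro mult_right_mono) auto
  have "2 powr - \<bar>\<kappa> - 1 / 2\<bar> \<le> (1 + t) powr - \<bar>\<kappa> - 1 / 2\<bar>"
    using assms by (intro powr_mono2') auto
  also have "\<dots> \<le> (1 + t) powr (\<kappa> - 1 / 2)" using assms by (intro powr_mono) auto
  finally show "w t \<ge> 2 powr - \<bar>\<kappa> - 1 / 2\<bar> * (1 - t) powr (\<kappa> - 1 / 2)"
    unfolding eq by (intro mult_right_mono) auto
qed

text \<open>A cap t > 1 - \<delta> has weight of order \<delta>^(\<kappa> + 1/2). With \<delta> = 1
  this gives the finiteness of the total weight; with \<delta> of order (r / (|y| + r))^2 it will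
  give the size of the translated ball.\<close>

lemma nn_integral_cap_powr:
  assumes "0 \<le> \<delta>"
  shows "(\<integral>\<^sup>+t. ennreal ((1 - t) powr (\<kappa> - 1 / 2)) * indicator {1 - \<delta><..<1} t \<partial>lborel) = ennreal (\<delta> powr (\<kappa> + 1 / 2) / (\<kappa> + 1 / 2))"
proof -
  define s where "s = \<kappa> + 1 / 2"
  have s: "s > 0" using kappa by (simp add: s_def)
  have "(\<integral>\<^sup>+t. ennreal ((1 - t) powr (\<kappa> - 1 / 2)) * indicator {1 - \<delta><..<1} t \<partial>lborel) =
      (\<integral>\<^sup>+t. ennreal (t powr (s - 1)) * indicator {0<..<\<delta>} t \<partial>lborel)"
    by (subst nn_integral_real_affine[where c = "- 1" and t = 1])
      (auto intro!: nn_integral_cong simp: s_def split: split_indicator)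
  also have "\<dots> = (\<integral>\<^sup>+t. ennreal (1 / s) * (ennreal (s * t powr (s - 1)) * indicator {t. 0 < t \<and> ennreal t < ennreal \<delta>} t) \<partial>lborel)"
    using s assms by (intro nn_integral_cong) (auto simp: ennreal_less_iff simp flip: ennreal_mult split: split_indicator)
  also have "\<dots> = ennreal (1 / s) * ennreal_powr (ennreal \<delta>) s"
    by (subst nn_integral_cmult) (auto simp: nn_integral_layer_cake[OF s])
  also have "\<dots> = ennreal (\<delta> powr s / s)" using s assms by (simp flip: ennreal_mult)
  finally show ?thesis by (simp add: s_def)
qed

lemma nn_integral_cap_le:
  assumes "0 \<le> \<delta>" "\<delta> \<le> 1"
  shows "(\<integral>\<^sup>+t. ennreal (w t) * indicator {1 - \<delta><..<1} t \<partial>lborel) \<le> ennreal (2 powr \<bar>\<kappa> - 1 / 2\<bar> / (\<kappa> + 1 / 2) * \<delta> powr (\<kappa> + 1 / 2))"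
proof -
  have "(\<integral>\<^sup>+t. ennreal (w t) * indicator {1 - \<delta><..<1} t \<partial>lborel) \<le>
    (\<integral>\<^sup>+t. ennreal (2 powr \<bar>\<kappa> - 1 / 2\<bar>) * (ennreal ((1 - t) powr (\<kappa> - 1 / 2)) * indicator {1 - \<delta><..<1} t) \<partial>lborel)"
    using assms by (intro nn_integral_mono) (auto intro!: ennreal_leI w_bounds simp flip: ennreal_mult split: split_indicator)
  also have "\<dots> = ennreal (2 powr \<bar>\<kappa> - 1 / 2\<bar>) * ennreal (\<delta> powr (\<kappa> + 1 / 2) / (\<kappa> + 1 / 2))"
    using assms(1) by (subst nn_integral_cmult) (auto simp: nn_integral_cap_powr)
  also have "\<dots> = ennreal (2 powr \<bar>\<kappa> - 1 / 2\<bar> / (\<kappa> + 1 / 2) * \<delta> powr (\<kappa> + 1 / 2))"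
    using kappa by (simp flip: ennreal_mult)
  finally show ?thesis .
qed

lemma nn_integral_cap_ge:
  assumes "0 \<le> \<delta>" "\<delta> \<le> 1"
  shows "(\<integral>\<^sup>+t. ennreal (w t) * indicator {1 - \<delta><..<1} t \<partial>lborel) \<ge> ennreal (2 powr - \<bar>\<kappa> - 1 / 2\<bar> / (\<kappa> + 1 / 2) * \<delta> powr (\<kappa> + 1 / 2))"
proof -
  have "ennreal (2 powr - \<bar>\<kappa> - 1 / 2\<bar> / (\<kappa> + 1 / 2) * \<delta> powr (\<kappa> + 1 / 2)) =
    ennreal (2 powr - \<bar>\<kappa> - 1 / 2\<bar>) * ennreal (\<delta> powr (\<kappa> + 1 / 2) / (\<kappa> + 1 / 2))"
    using kappa by (simp flip: ennreal_mult)
  also have "\<dots> = (\<integral>\<^sup>+t. ennreal (2 powr - \<bar>\<kappa> - 1 / 2\<bar>) * (ennreal ((1 - t) powr (\<kappa> - 1 / 2)) * indicator {1 - \<delta><..<1} t) \<partial>lborel)"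
    using assms(1) by (subst nn_integral_cmult) (auto simp: nn_integral_cap_powr)
  also have "\<dots> \<le> (\<integral>\<^sup>+t. ennreal (w t) * indicator {1 - \<delta><..<1} t \<partial>lborel)"
    using assms by (intro nn_integral_mono) (auto intro!: ennreal_leI w_bounds simp flip: ennreal_mult split: split_indicator)
  finally show ?thesis .
qed

definition "W = enn2real (\<integral>\<^sup>+t. ennreal (w t) \<partial>lborel)"

lemma W_pos: "W > 0"
  and nn_integral_w: "(\<integral>\<^sup>+t. ennreal (w t) \<partial>lborel) = ennreal W"
proof -
  have "(\<integral>\<^sup>+t. ennreal (w t) \<partial>lborel) = (\<integral>\<^sup>+t. ennreal (w t) * indicator {0<..<1} t + ennreal (w (- t)) * indicator {0<..<1} (- t) \<partial>lborel)"
    using AE_lborel_singleton[of 0] by (intro nn_integral_cong_AE) (auto simp: w_def split: split_indicator)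
  also have "\<dots> = (\<integral>\<^sup>+t. ennreal (w t) * indicator {0<..<1} t \<partial>lborel) + (\<integral>\<^sup>+t. ennreal (w (- t)) * indicator {0<..<1} (- t) \<partial>lborel)"
    by (rule nn_integral_add) auto
  also have "(\<integral>\<^sup>+t. ennreal (w (- t)) * indicator {0<..<1} (- t) \<partial>lborel) = (\<integral>\<^sup>+t. ennreal (w t) * indicator {0<..<1} t \<partial>lborel)"
    by (rule nn_integral_uminus_lborel) auto
  finally have eq: "(\<integral>\<^sup>+t. ennreal (w t) \<partial>lborel) = 2 * (\<integral>\<^sup>+t. ennreal (w t) * indicator {0<..<1} t \<partial>lborel)"
    by (simp add: mult_2)
  have "(\<integral>\<^sup>+t. ennreal (w t) * indicator {0<..<1} t \<partial>lborel) < \<infinity>"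
    using nn_integral_cap_le[of 1] by (auto intro: le_less_trans)
  then have fin: "(\<integral>\<^sup>+t. ennreal (w t) \<partial>lborel) < \<infinity>" unfolding eq by (simp add: ennreal_mult_less_top)
  have "0 < ennreal (2 powr - \<bar>\<kappa> - 1 / 2\<bar> / (\<kappa> + 1 / 2) * 1 powr (\<kappa> + 1 / 2))" using kappa by simp
  also have "\<dots> \<le> (\<integral>\<^sup>+t. ennreal (w t) * indicator {0<..<1} t \<partial>lborel)"
    using nn_integral_cap_ge[of 1] by simp
  finally have "0 < (\<integral>\<^sup>+t. ennreal (w t) \<partial>lborel)" unfolding eq by (simp add: ennreal_zero_less_mult_iff)
  then show "W > 0" using fin by (simp add: W_def enn2real_positive_iff)
  show "(\<integral>\<^sup>+t. ennreal (w t) \<partial>lborel) = ennreal W" using fin by (simp add: W_def)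
qed

definition \<omega> :: "real measure" where
  "\<omega> = density lborel (\<lambda>t. ennreal (w t / W))"

lemma sets_omega [measurable_cong, simp]: "sets \<omega> = sets borel"
  and space_omega [simp]: "space \<omega> = UNIV"
  by (simp_all add: \<omega>_def)

lemma nn_integral_omega:
  assumes "f \<in> borel_measurable borel"
  shows "(\<integral>\<^sup>+t. f t \<partial>\<omega>) = (\<integral>\<^sup>+t. ennreal (w t / W) * f t \<partial>lborel)"
  unfolding \<omega>_def using assms by (subst nn_integral_density) auto

sublocale omega: prob_space \<omega>
proof
  have "emeasure \<omega> (space \<omega>) = (\<integral>\<^sup>+t. ennreal (1 / W) * ennreal (w t) \<partial>lborel)"
    using W_pos w_nonneg by (simp add: \<omega>_def emeasure_density flip: ennreal_mult)
  also have "\<dots> = 1" using W_pos by (subst nn_integral_cmult) (auto simp: nn_integral_w simp flip: ennreal_mult)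
  finally show "emeasure \<omega> (space \<omega>) = 1" .
qed

lemma AE_omega: "AE t in \<omega>. - 1 < t \<and> t < 1"
  unfolding \<omega>_def by (subst AE_density) (auto simp: w_def split: split_indicator)

lemma distr_omega_uminus: "distr \<omega> borel uminus = \<omega>"
proof (rule measure_eqI)
  fix A :: "real set" assume "A \<in> sets (distr \<omega> borel uminus)"
  then have [measurable]: "A \<in> sets borel" by simp
  have "emeasure (distr \<omega> borel uminus) A = (\<integral>\<^sup>+x. indicator A (- x) \<partial>\<omega>)"
    by (simp flip: nn_integral_indicator add: nn_integral_distr)
  also have "\<dots> = (\<integral>\<^sup>+x. ennreal (w (- x) / W) * indicator A (- x) \<partial>lborel)"
    by (subst nn_integral_omega) (auto simp: w_minus)
  also have "\<dots> = (\<integral>\<^sup>+x. ennreal (w x / W) * indicator A x \<partial>lborel)"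
    by (rule nn_integral_uminus_lborel) auto
  also have "\<dots> = emeasure \<omega> A" by (subst nn_integral_omega[symmetric]) auto
  finally show "emeasure (distr \<omega> borel uminus) A = emeasure \<omega> A" .
qed simp

lemma integrable_omega_bounded:
  fixes f :: "real \<Rightarrow> 'a::{banach, second_countable_topology}"
  assumes "f \<in> borel_measurable borel" "\<And>t. - 1 < t \<Longrightarrow> t < 1 \<Longrightarrow> norm (f t) \<le> B"
  shows "integrable \<omega> f"
  using AE_omega by (intro omega.integrable_const_bound[of _ B]) (use assms in auto)

lemma integral_omega:
  assumes "f \<in> borel_measurable borel"
  shows "(\<integral>t. f t \<partial>\<omega>) = (\<integral>t. w t / W * f t \<partial>lborel)"
  unfolding \<omega>_def using assms W_pos w_nonneg by (subst integral_density) auto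

definition "moment j = (\<integral>t. t ^ j \<partial>\<omega>)"

lemma integrable_power: "integrable \<omega> (\<lambda>t. t ^ j)"
  by (rule integrable_omega_bounded[where B = 1]) (auto simp: power_abs intro!: power_le_one)

lemma moment_0: "moment 0 = 1"
  using omega.prob_space by (simp add: moment_def)

lemma moment_odd:
  assumes "odd j"
  shows "moment j = 0"
proof -
  have "moment j = (\<integral>t. (- t) ^ j \<partial>\<omega>)"
    unfolding moment_def by (subst distr_omega_uminus[symmetric]) (simp add: integral_distr)
  also have "\<dots> = - moment j" using assms by (simp add: moment_def)
  finally show ?thesis by simp
qed

text \<open>The function t^(j+1) (1 - t^2)^(\<kappa> + 1/2) vanishes at both ends, so its derivative
  integrates to 0. That derivative is \<open>w\<close> times the polynomial
  \<open>g\<close>.\<close>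

lemma moment_recurrence: "(real j + 1) * moment j = (real j + 2 * \<kappa> + 2) * moment (j + 2)"
proof -
  define f where "f = (\<lambda>t. t ^ (j + 1) * (1 - t\<^sup>2) powr (\<kappa> + 1 / 2))"
  define g where "g = (\<lambda>t. (real j + 1) * t ^ j - (real j + 2 * \<kappa> + 2) * t ^ (j + 2))"
  have [measurable]: "g \<in> borel_measurable borel" by (simp add: g_def)
  have "((\<lambda>t. w t * g t) has_integral f 1 - f (- 1)) {- 1..1}"
  \<comment> \<open>The derivative is taken in the open interval only: for \<kappa> < 1/2 the weight
    is unbounded near the ends.\<close>
  proof (rule fundamental_theorem_of_calculus_interior)
    have "1 - t\<^sup>2 \<ge> 0" if "t \<in> {- 1..1}" for t :: real
      using that by (simp add: abs_square_le_1 abs_le_iff)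
    then show "continuous_on {- 1..1} f"
      unfolding f_def using kappa by (intro continuous_intros continuous_on_powr') auto
    fix t :: real assume t: "t \<in> {- 1<..<1}"
    then have t1: "1 - t\<^sup>2 > 0" by (simp add: abs_square_less_1 abs_less_iff)
    have pw: "(1 - t\<^sup>2) powr (\<kappa> + 1 / 2) = (1 - t\<^sup>2) * (1 - t\<^sup>2) powr (\<kappa> - 1 / 2)"
      using t1 powr_add[of "1 - t\<^sup>2" 1 "\<kappa> - 1 / 2"] by (simp add: add.commute)
    have "(f has_real_derivative (real (j + 1) * t ^ j) * (1 - t\<^sup>2) powr (\<kappa> + 1 / 2) +
       ((\<kappa> + 1 / 2) * (1 - t\<^sup>2) powr (\<kappa> - 1 / 2) * (- (2 * t))) * t ^ (j + 1)) (at t)"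
    proof -
      have dp: "((\<lambda>t. t ^ (j + 1)) has_real_derivative real (j + 1) * t ^ j) (at t)"
        using DERIV_pow[of "j + 1" t] by simp
      have dq: "((\<lambda>t. (1 - t\<^sup>2) powr (\<kappa> + 1 / 2)) has_real_derivative (\<kappa> + 1 / 2) * (1 - t\<^sup>2) powr (\<kappa> - 1 / 2) * (- (2 * t))) (at t)"
        using t1 by (auto intro!: derivative_eq_intros)
      show ?thesis unfolding f_def by (rule DERIV_mult[OF dp dq])
    qed
    also have "(real (j + 1) * t ^ j) * (1 - t\<^sup>2) powr (\<kappa> + 1 / 2) +
       ((\<kappa> + 1 / 2) * (1 - t\<^sup>2) powr (\<kappa> - 1 / 2) * (- (2 * t))) * t ^ (j + 1) = w t * g t"
      unfolding pw g_def w_def using t by (simp add: algebra_simps power2_eq_square)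
    finally show "(f has_vector_derivative w t * g t) (at t)"
      by (simp add: has_real_derivative_iff_has_vector_derivative)
  qed simp
  then have "((\<lambda>t. if t \<in> {- 1..1} then w t * g t else 0) has_integral 0) UNIV"
    unfolding has_integral_restrict_UNIV by (simp add: f_def)
  moreover have "(\<lambda>t. if t \<in> {- 1..1} then w t * g t else 0) = (\<lambda>t. w t * g t)"
    by (auto simp: w_def split: split_indicator)
  ultimately have 1: "((\<lambda>t. w t * g t) has_integral 0) UNIV" by simp
  have "integrable \<omega> g" unfolding g_def by (intro Bochner_Integration.integrable_diff integrable_mult_right integrable_power)
  then have "integrable lborel (\<lambda>t. w t / W * g t)"
    unfolding \<omega>_def using W_pos w_nonneg by (subst (asm) integrable_density) auto
  then have "integrable lborel (\<lambda>t. W * (w t / W * g t))" by (rule integrable_mult_right)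
  then have "integrable lborel (\<lambda>t. w t * g t)" using W_pos by (simp add: mult.assoc)
  then have "((\<lambda>t. w t * g t) has_integral (\<integral>t. w t * g t \<partial>lborel)) UNIV" by (rule has_integral_integral_lborel)
  with 1 have "(\<integral>t. w t * g t \<partial>lborel) = 0" by (metis has_integral_unique)
  then have "(\<integral>t. g t \<partial>\<omega>) = 0" by (simp add: integral_omega)
  moreover have "(\<integral>t. g t \<partial>\<omega>) = (real j + 1) * moment j - (real j + 2 * \<kappa> + 2) * moment (j + 2)"
    unfolding g_def moment_def
    by (subst Bochner_Integration.integral_diff, (intro integrable_mult_right integrable_power)+, simp only: integral_mult_right_zero)
  ultimately show ?thesis by simp
qed

lemma moment_even: "moment (2 * p) = fact (2 * p) / (4 ^ p * fact p * pochhammer (\<kappa> + 1) p)"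
proof (induction p)
  case (Suc p)
  define M F P :: real where "M = moment (2 * Suc p)" and "F = fact (2 * p)" and "P = pochhammer (\<kappa> + 1) p"
  have P: "P > 0" unfolding P_def using kappa by (intro pochhammer_pos) auto
  have k: "\<kappa> + 1 + real p > 0" using kappa by linarith
  have "(2 * real p + 1) * moment (2 * p) = 2 * (\<kappa> + 1 + real p) * M"
    using moment_recurrence[of "2 * p"] by (simp add: M_def algebra_simps)
  then have "(2 * real p + 1) * (F / (4 ^ p * fact p * P)) = 2 * (\<kappa> + 1 + real p) * M"
    unfolding Suc.IH F_def P_def .
  then have "M = (2 * real p + 1) * (F / (4 ^ p * fact p * P)) / (2 * (\<kappa> + 1 + real p))"
    using k by (simp add: field_simps)
  also have "\<dots> = (2 * (real p + 1) * (2 * real p + 1)) * F / (4 * 4 ^ p * ((real p + 1) * fact p) * (P * (\<kappa> + 1 + real p)))"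
  proof -
    have "a * (F / (q * f * P)) / (2 * d) = (2 * e * a) * F / (4 * q * (e * f) * (P * d))"
      if "e \<noteq> 0" for a q f d e :: real using that by (simp add: mult_ac)
    note cancel = this
    show ?thesis by (rule cancel) simp
  qed
  finally show ?case
    by (simp add: M_def F_def P_def pochhammer_Suc algebra_simps)
qed (simp add: moment_0)

text \<open>Law of cosines: the expression is the square of the third side of a triangle with sides
  |u| and |v|, the sign of uv being absorbed into the angle.\<close>

lemma triangle_bounds:
  assumes "- 1 < t" "t < (1::real)"
  shows "0 \<le> u\<^sup>2 + v\<^sup>2 - 2 * u * v * t" "u\<^sup>2 + v\<^sup>2 - 2 * u * v * t \<le> (\<bar>u\<bar> + \<bar>v\<bar>)\<^sup>2"
    "u\<^sup>2 + v\<^sup>2 - 2 * u * v * t \<ge> (\<bar>u\<bar> - \<bar>v\<bar>)\<^sup>2"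
proof -
  have "\<bar>u * v * t\<bar> \<le> \<bar>u\<bar> * \<bar>v\<bar>" using assms by (auto simp: abs_mult intro!: mult_left_le)
  then have "u * v * t \<le> \<bar>u\<bar> * \<bar>v\<bar>" "- (u * v * t) \<le> \<bar>u\<bar> * \<bar>v\<bar>" by linarith+
  then show "u\<^sup>2 + v\<^sup>2 - 2 * u * v * t \<le> (\<bar>u\<bar> + \<bar>v\<bar>)\<^sup>2"
    and *: "u\<^sup>2 + v\<^sup>2 - 2 * u * v * t \<ge> (\<bar>u\<bar> - \<bar>v\<bar>)\<^sup>2"
    by (simp_all only: power2_sum power2_diff power2_abs)
  show "0 \<le> u\<^sup>2 + v\<^sup>2 - 2 * u * v * t" using * zero_le_power2[of "\<bar>u\<bar> - \<bar>v\<bar>"] by linarith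
qed

text \<open>Gegenbauer's product formula. The series is integrated term by term, dominated by the
  absolute series at (|u| + |v|)^2, and the result is recognized as a Cauchy product.\<close>

lemma bessel_product:
  "(\<integral>t. bessel_sq (\<kappa> + 1) (u\<^sup>2 + v\<^sup>2 - 2 * u * v * t) \<partial>\<omega>) = bessel_sq (\<kappa> + 1) (u\<^sup>2) * bessel_sq (\<kappa> + 1) (v\<^sup>2)"
proof -
  define c where "c = \<kappa> + 1"
  have c: "c > 0" using kappa by (simp add: c_def)
  define s where "s = (\<lambda>t. u\<^sup>2 + v\<^sup>2 - 2 * u * v * t)"
  define R where "R = (\<bar>u\<bar> + \<bar>v\<bar>)\<^sup>2"
  have [measurable]: "s \<in> borel_measurable borel" by (simp add: s_def)
  have bnd: "\<bar>s t\<bar> \<le> R" if "- 1 < t" "t < 1" for t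
    using triangle_bounds[OF that] by (auto simp: s_def R_def)
  have int: "integrable \<omega> (\<lambda>t. bessel_coeff c m * s t ^ m)" for m
    by (rule integrable_omega_bounded[where B = "\<bar>bessel_coeff c m\<bar> * R ^ m"])
      (auto simp: abs_mult power_abs intro!: mult_left_mono power_mono bnd)
  have sm: "summable (\<lambda>m. \<bar>bessel_coeff c m\<bar> * R ^ m)"
    using summable_norm_bessel_sq[OF c, of R] by (simp add: abs_mult R_def)
  have "(\<lambda>m. \<integral>t. bessel_coeff c m * s t ^ m \<partial>\<omega>) sums (\<integral>t. (\<Sum>m. bessel_coeff c m * s t ^ m) \<partial>\<omega>)"
  proof (rule sums_integral[OF int])
    show "AE t in \<omega>. summable (\<lambda>m. norm (bessel_coeff c m * s t ^ m))"
      by (intro AE_I2 summable_norm_bessel_sq c)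
    show "summable (\<lambda>m. \<integral>t. norm (bessel_coeff c m * s t ^ m) \<partial>\<omega>)"
    proof (rule summable_comparison_test'[OF sm, of 0])
      fix m
      have "(\<integral>t. norm (bessel_coeff c m * s t ^ m) \<partial>\<omega>) \<le> (\<integral>t. \<bar>bessel_coeff c m\<bar> * R ^ m \<partial>\<omega>)"
        using AE_omega
        by (intro integral_mono_AE integrable_norm int, simp)
          (auto simp: abs_mult power_abs intro!: mult_left_mono power_mono bnd)
      then show "norm (\<integral>t. norm (bessel_coeff c m * s t ^ m) \<partial>\<omega>) \<le> \<bar>bessel_coeff c m\<bar> * R ^ m"
        using omega.prob_space by simp
    qed
  qed
  moreover have "(\<integral>t. bessel_coeff c m * s t ^ m \<partial>\<omega>) =
     (\<Sum>k\<le>m. (bessel_coeff c k * (u\<^sup>2) ^ k) * (bessel_coeff c (m - k) * (v\<^sup>2) ^ (m - k)))" for m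
  proof -
    have "s t ^ m = (\<Sum>l\<le>m. real (m choose l) * (u\<^sup>2 + v\<^sup>2) ^ (m - l) * (- 2 * u * v) ^ l * t ^ l)" for t
    proof -
      have "s t ^ m = ((- 2 * u * v * t) + (u\<^sup>2 + v\<^sup>2)) ^ m" by (simp add: s_def)
      also have "\<dots> = (\<Sum>l\<le>m. real (m choose l) * (- 2 * u * v * t) ^ l * (u\<^sup>2 + v\<^sup>2) ^ (m - l))" by (rule binomial_ring)
      also have "\<dots> = (\<Sum>l\<le>m. real (m choose l) * (u\<^sup>2 + v\<^sup>2) ^ (m - l) * (- 2 * u * v) ^ l * t ^ l)"
        by (intro sum.cong refl) (simp only: power_mult_distrib mult_ac)
      finally show ?thesis .
    qed
    then have "(\<integral>t. bessel_coeff c m * s t ^ m \<partial>\<omega>) = bessel_coeff c m * (\<Sum>l\<le>m. real (m choose l) * (u\<^sup>2 + v\<^sup>2) ^ (m - l) * (- 2 * u * v) ^ l * moment l)"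
      by (simp only: integral_mult_right_zero moment_def)
        (subst Bochner_Integration.integral_sum, auto intro!: integrable_mult_right integrable_power)
    also have "\<dots> = (\<Sum>k\<le>m. (bessel_coeff c k * (u\<^sup>2) ^ k) * (bessel_coeff c (m - k) * (v\<^sup>2) ^ (m - k)))"
      using c moment_odd moment_even by (intro bessel_coeff_moments) (auto simp: c_def)
    finally show ?thesis .
  qed
  ultimately have "(\<lambda>m. \<Sum>k\<le>m. (bessel_coeff c k * (u\<^sup>2) ^ k) * (bessel_coeff c (m - k) * (v\<^sup>2) ^ (m - k))) sums
     (\<integral>t. bessel_sq c (s t) \<partial>\<omega>)" by (simp add: bessel_sq_def)
  moreover have "(\<lambda>m. \<Sum>k\<le>m. (bessel_coeff c k * (u\<^sup>2) ^ k) * (bessel_coeff c (m - k) * (v\<^sup>2) ^ (m - k))) sums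
     (bessel_sq c (u\<^sup>2) * bessel_sq c (v\<^sup>2))"
    unfolding bessel_sq_def by (intro Cauchy_product_sums summable_norm_bessel_sq c)
  ultimately show ?thesis unfolding s_def c_def by (rule sums_unique2)
qed

text \<open>Supplies the dominating constant when the product formula is differentiated under the
  integral. The nonnegative half-line is convex and is where the derivative has a uniform
  bound.\<close>

lemma bessel_sq_lipschitz:
  assumes "X \<ge> 0" "Y \<ge> 0"
  shows "\<bar>bessel_sq (\<kappa> + 1) X - bessel_sq (\<kappa> + 1) Y\<bar> \<le> 1 / (4 * (\<kappa> + 1)) * \<bar>X - Y\<bar>"
proof -
  have "norm (bessel_sq (\<kappa> + 1) X - bessel_sq (\<kappa> + 1) Y) \<le> 1 / (4 * (\<kappa> + 1)) * norm (X - Y)"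
  proof (rule field_differentiable_bound[of "{0..}"])
    fix z :: real assume z: "z \<in> {0..}"
    show "(bessel_sq (\<kappa> + 1) has_field_derivative (- bessel_sq (\<kappa> + 2) z / (4 * (\<kappa> + 1)))) (at z within {0..})"
    proof -
      have "(bessel_sq (\<kappa> + 1) has_field_derivative (- bessel_sq (\<kappa> + 2) z / (4 * (\<kappa> + 1)))) (at z)"
        using DERIV_bessel_sq[of "\<kappa> + 1" z] kappa by (simp add: add.assoc)
      then show ?thesis by (rule has_field_derivative_at_within)
    qed
    have "\<bar>bessel_sq (\<kappa> + 2) z\<bar> \<le> 1" using kappa z by (intro abs_bessel_sq_le) auto
    then show "norm (- bessel_sq (\<kappa> + 2) z / (4 * (\<kappa> + 1))) \<le> 1 / (4 * (\<kappa> + 1))"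
      using kappa by (auto simp: divide_right_mono)
  qed (use assms in auto)
  then show ?thesis by simp
qed

text \<open>The derivative of the even product formula in v: the third side squared has derivative
  2v - 2ut, and the parameter rises by one. Differentiation under the integral is dominated
  convergence along the increments 1/(n+1).\<close>

lemma bessel_product_odd:
  "(\<integral>t. (v - u * t) * bessel_sq (\<kappa> + 2) (u\<^sup>2 + v\<^sup>2 - 2 * u * v * t) \<partial>\<omega>) = v * bessel_sq (\<kappa> + 2) (v\<^sup>2) * bessel_sq (\<kappa> + 1) (u\<^sup>2)"
proof -
  define c where "c = \<kappa> + 1"
  have c: "c > 1 / 2" and c1: "c + 1 = \<kappa> + 2" using kappa by (auto simp: c_def)
  define S where "S = (\<lambda>x t. u\<^sup>2 + x\<^sup>2 - 2 * u * x * t)"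
  have [measurable]: "S x \<in> borel_measurable borel" for x by (simp add: S_def)
  have [measurable]: "bessel_sq c \<in> borel_measurable borel" "bessel_sq (c + 1) \<in> borel_measurable borel"
    using c by (auto intro: borel_measurable_bessel_sq)
  define h where "h = (\<lambda>n. inverse (real (Suc n)))"
  have h: "h n > 0" "h n \<le> 1" for n by (auto simp: h_def inverse_le_1_iff)
  have h0: "filterlim h (at 0) sequentially"
    using LIMSEQ_inverse_real_of_nat by (intro filterlim_atI) (auto simp: h_def)
  define q where "q = (\<lambda>n t. (bessel_sq c (S (v + h n) t) - bessel_sq c (S v t)) / h n)"
  define q' where "q' = (\<lambda>t. - bessel_sq (c + 1) (S v t) / (4 * c) * (2 * v - 2 * u * t))"
  have Snn: "S x t \<ge> 0" if "- 1 < t" "t < 1" for x t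
    using triangle_bounds(1)[OF that] by (simp add: S_def)
  have int: "integrable \<omega> (\<lambda>t. bessel_sq c (S x t))" for x
    by (rule integrable_omega_bounded[where B = 1]) (auto intro!: abs_bessel_sq_le c Snn)
  have "(\<lambda>n. \<integral>t. q n t \<partial>\<omega>) \<longlonglongrightarrow> (\<integral>t. q' t \<partial>\<omega>)"
  proof (rule integral_dominated_convergence)
    show "q' \<in> borel_measurable \<omega>" "\<And>n. q n \<in> borel_measurable \<omega>"
      by (simp_all add: q_def q'_def)
    show "integrable \<omega> (\<lambda>_. 1 / (4 * c) * (2 * \<bar>v\<bar> + 1 + 2 * \<bar>u\<bar>))" by simp
    show "AE t in \<omega>. (\<lambda>n. q n t) \<longlonglongrightarrow> q' t"
    proof (rule AE_I2)
      fix t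
      have "((\<lambda>x. bessel_sq c (S x t)) has_real_derivative q' t) (at v)"
        unfolding S_def q'_def using c by (auto intro!: derivative_eq_intros)
      then have "((\<lambda>h. (bessel_sq c (S (v + h) t) - bessel_sq c (S v t)) / h) \<longlongrightarrow> q' t) (at 0)"
        by (rule DERIV_D)
      from filterlim_compose[OF this h0] show "(\<lambda>n. q n t) \<longlonglongrightarrow> q' t" by (simp add: q_def)
    qed
    fix n
    show "AE t in \<omega>. norm (q n t) \<le> 1 / (4 * c) * (2 * \<bar>v\<bar> + 1 + 2 * \<bar>u\<bar>)"
      using AE_omega
    proof eventually_elim
      fix t :: real assume t: "- 1 < t \<and> t < 1"
      have "\<bar>bessel_sq c (S (v + h n) t) - bessel_sq c (S v t)\<bar> \<le> 1 / (4 * c) * \<bar>S (v + h n) t - S v t\<bar>"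
        unfolding c_def using t by (intro bessel_sq_lipschitz Snn) auto
      also have "S (v + h n) t - S v t = h n * (2 * v + h n - 2 * u * t)"
        by (simp add: S_def algebra_simps power2_eq_square)
      also have "\<bar>h n * (2 * v + h n - 2 * u * t)\<bar> \<le> h n * (2 * \<bar>v\<bar> + 1 + 2 * \<bar>u\<bar>)"
      proof -
        have "\<bar>u * t\<bar> \<le> \<bar>u\<bar>" using t by (auto simp: abs_mult intro!: mult_left_le)
        then have "\<bar>2 * v + h n - 2 * u * t\<bar> \<le> 2 * \<bar>v\<bar> + 1 + 2 * \<bar>u\<bar>" using h[of n] by (auto simp: abs_if split: if_splits)
        then show ?thesis using h[of n] by (simp add: abs_mult)
      qed
      finally have "\<bar>bessel_sq c (S (v + h n) t) - bessel_sq c (S v t)\<bar> \<le> 1 / (4 * c) * (h n * (2 * \<bar>v\<bar> + 1 + 2 * \<bar>u\<bar>))"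
        using c by (simp add: divide_right_mono)
      then show "norm (q n t) \<le> 1 / (4 * c) * (2 * \<bar>v\<bar> + 1 + 2 * \<bar>u\<bar>)"
        unfolding q_def using h[of n] by (simp add: divide_le_eq mult_ac)
    qed
  qed
  moreover have "(\<lambda>n. \<integral>t. q n t \<partial>\<omega>) \<longlonglongrightarrow> bessel_sq c (u\<^sup>2) * (- bessel_sq (c + 1) (v\<^sup>2) / (4 * c) * (2 * v))"
  proof -
    have "((\<lambda>x. bessel_sq c (u\<^sup>2) * bessel_sq c (x\<^sup>2)) has_real_derivative
        bessel_sq c (u\<^sup>2) * (- bessel_sq (c + 1) (v\<^sup>2) / (4 * c) * (2 * v))) (at v)"
      using c by (auto intro!: derivative_eq_intros)
    from filterlim_compose[OF DERIV_D[OF this] h0]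
    have "(\<lambda>n. (bessel_sq c (u\<^sup>2) * bessel_sq c ((v + h n)\<^sup>2) - bessel_sq c (u\<^sup>2) * bessel_sq c (v\<^sup>2)) / h n)
        \<longlonglongrightarrow> bessel_sq c (u\<^sup>2) * (- bessel_sq (c + 1) (v\<^sup>2) / (4 * c) * (2 * v))" .
    moreover have "(\<integral>t. q n t \<partial>\<omega>) = (bessel_sq c (u\<^sup>2) * bessel_sq c ((v + h n)\<^sup>2) - bessel_sq c (u\<^sup>2) * bessel_sq c (v\<^sup>2)) / h n" for n
      unfolding q_def using int bessel_product[of u] by (simp add: S_def c_def)
    ultimately show ?thesis by simp
  qed
  ultimately have "(\<integral>t. q' t \<partial>\<omega>) = bessel_sq c (u\<^sup>2) * (- bessel_sq (c + 1) (v\<^sup>2) / (4 * c) * (2 * v))"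
    by (rule LIMSEQ_unique)
  moreover have "q' t = - 1 / (2 * c) * ((v - u * t) * bessel_sq (c + 1) (S v t))" for t
  proof -
    have e: "2 * v - 2 * u * t = 2 * (v - u * t)" by simp
    show ?thesis unfolding q'_def e using c by (simp add: field_simps del: right_diff_distrib left_diff_distrib)
  qed
  ultimately have "- 1 / (2 * c) * (\<integral>t. (v - u * t) * bessel_sq (c + 1) (S v t) \<partial>\<omega>) = - 1 / (2 * c) * (v * bessel_sq (c + 1) (v\<^sup>2) * bessel_sq c (u\<^sup>2))"
    by (simp only: integral_mult_right_zero) (simp add: mult_ac)
  then show ?thesis using c by (simp add: S_def c1 c_def add.assoc)
qed

section \<open>Polar coordinates on the half-plane\<close>

abbreviation "\<PP> \<equiv> \<mu> \<Otimes>\<^sub>M \<omega>"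

sublocale P: pair_sigma_finite \<mu> \<omega> ..

text \<open>The half-plane with the measure \<open>B\<^bsup>\<kappa> - 1/2\<^esup> da dB\<close>, where \<open>B\<close> is the square of the distance to the axis;
  \<open>(x t, x\<^sup>2 (1 - t\<^sup>2))\<close> are polar coordinates in which the Dunkl translation becomes a shift of \<open>a\<close>.\<close>

definition Q :: "(real \<times> real) measure" where
  "Q = density (lborel \<Otimes>\<^sub>M lborel) (\<lambda>(a, B). ennreal (indicator {0<..} B * B powr (\<kappa> - 1 / 2) / (D * W)))"

lemma sets_Q [measurable_cong, simp]: "sets Q = sets (borel \<Otimes>\<^sub>M borel)"
  by (simp add: Q_def cong: sets_pair_measure_cong)

lemma nn_integral_Q:
  assumes [measurable]: "\<phi> \<in> borel_measurable (borel \<Otimes>\<^sub>M borel)"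
  shows "(\<integral>\<^sup>+z. \<phi> z \<partial>Q) = (\<integral>\<^sup>+a. (\<integral>\<^sup>+B. ennreal (indicator {0<..} B * B powr (\<kappa> - 1 / 2) / (D * W)) * \<phi> (a, B) \<partial>lborel) \<partial>lborel)"
  unfolding Q_def
  by (subst nn_integral_density) (auto simp: lborel.nn_integral_fst[symmetric] split_def cong: sets_pair_measure_cong)

text \<open>For fixed x one substitutes a = x t, then for fixed a, X = x^2, and finally B = X - a^2.
  The map is two-to-one, since (x, t) and (-x, -t) have the same image; the substitution X = x^2
  over the whole line accounts for both preimages.\<close>

lemma nn_integral_polar:
  assumes \<phi> [measurable]: "\<phi> \<in> borel_measurable (borel \<Otimes>\<^sub>M borel)"
  shows "(\<integral>\<^sup>+z. \<phi> (fst z * snd z, (fst z)\<^sup>2 * (1 - (snd z)\<^sup>2)) \<partial>\<PP>) = (\<integral>\<^sup>+z. \<phi> z \<partial>Q)"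
proof -
  define \<psi> where "\<psi> = (\<lambda>a X. (if a\<^sup>2 < X then ennreal ((X - a\<^sup>2) powr (\<kappa> - 1 / 2) / (D * W)) else 0) * \<phi> (a, X - a\<^sup>2))"
  have [measurable]: "(\<lambda>(a, X). \<psi> a X) \<in> borel_measurable (borel \<Otimes>\<^sub>M borel)"
    unfolding \<psi>_def by measurable
  have "(\<integral>\<^sup>+z. \<phi> (fst z * snd z, (fst z)\<^sup>2 * (1 - (snd z)\<^sup>2)) \<partial>\<PP>) =
      (\<integral>\<^sup>+x. (\<integral>\<^sup>+t. \<phi> (x * t, x\<^sup>2 * (1 - t\<^sup>2)) \<partial>\<omega>) \<partial>\<mu>)"
    using omega.nn_integral_fst[of "\<lambda>z. \<phi> (fst z * snd z, (fst z)\<^sup>2 * (1 - (snd z)\<^sup>2))" \<mu>] by simp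
  also have "\<dots> = (\<integral>\<^sup>+x. ennreal (\<bar>x\<bar> powr (2 * \<kappa> + 1) / D) * (\<integral>\<^sup>+t. \<phi> (x * t, x\<^sup>2 * (1 - t\<^sup>2)) \<partial>\<omega>) \<partial>lborel)"
    by (rule nn_integral_mu) measurable
  also have "\<dots> = (\<integral>\<^sup>+x. ennreal (\<bar>x\<bar> powr (2 * \<kappa> + 1) / D) * (\<integral>\<^sup>+t. ennreal (w t / W) * \<phi> (x * t, x\<^sup>2 * (1 - t\<^sup>2)) \<partial>lborel) \<partial>lborel)"
    by (intro nn_integral_cong arg_cong2[where f = "(*)"] refl nn_integral_omega) measurable
  also have "\<dots> = (\<integral>\<^sup>+x. (\<integral>\<^sup>+a. ennreal \<bar>x\<bar> * \<psi> a (x\<^sup>2) \<partial>lborel) \<partial>lborel)"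
  proof (rule nn_integral_cong_AE)
    show "AE x in lborel. ennreal (\<bar>x\<bar> powr (2 * \<kappa> + 1) / D) * (\<integral>\<^sup>+t. ennreal (w t / W) * \<phi> (x * t, x\<^sup>2 * (1 - t\<^sup>2)) \<partial>lborel) =
        (\<integral>\<^sup>+a. ennreal \<bar>x\<bar> * \<psi> a (x\<^sup>2) \<partial>lborel)"
      using AE_lborel_singleton[of 0]
    proof eventually_elim
      fix x :: real assume x: "x \<noteq> 0"
      define g where "g = (\<lambda>a. ennreal (w (a / x) / W) * \<phi> (a, x\<^sup>2 - a\<^sup>2))"
      have [measurable]: "g \<in> borel_measurable borel" by (simp add: g_def)
      have e: "ennreal (\<bar>x\<bar> powr (2 * \<kappa> + 1) / D) = ennreal (\<bar>x\<bar> powr (2 * \<kappa>) / D) * ennreal \<bar>x\<bar>"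
        using x D_pos by (subst ennreal_mult[symmetric]) (auto simp: powr_add)
      have "(\<integral>\<^sup>+t. ennreal (w t / W) * \<phi> (x * t, x\<^sup>2 * (1 - t\<^sup>2)) \<partial>lborel) = (\<integral>\<^sup>+t. g (0 + x * t) \<partial>lborel)"
        using x by (intro nn_integral_cong) (simp add: g_def algebra_simps power2_eq_square)
      then have "ennreal (\<bar>x\<bar> powr (2 * \<kappa> + 1) / D) * (\<integral>\<^sup>+t. ennreal (w t / W) * \<phi> (x * t, x\<^sup>2 * (1 - t\<^sup>2)) \<partial>lborel)
         = ennreal (\<bar>x\<bar> powr (2 * \<kappa>) / D) * (\<integral>\<^sup>+a. g a \<partial>lborel)"
        unfolding e using x by (subst nn_integral_real_affine[of g x 0]) (auto simp: mult.assoc)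
      also have "\<dots> = (\<integral>\<^sup>+a. ennreal (\<bar>x\<bar> powr (2 * \<kappa>) / D) * g a \<partial>lborel)"
        by (subst nn_integral_cmult) auto
      also have "\<dots> = (\<integral>\<^sup>+a. ennreal \<bar>x\<bar> * \<psi> a (x\<^sup>2) \<partial>lborel)"
      proof (rule nn_integral_cong)
        fix a :: real
        \<comment> \<open>By homogeneity |x|^(2\<kappa> - 1) w(a / x) is (x^2 - a^2)^(\<kappa> -
          1/2) inside |a| < |x|, and both sides vanish outside. The factor |x| is kept for the
          substitution X = x^2.\<close>
        have "\<bar>x\<bar> powr (2 * \<kappa>) / D * (w (a / x) / W) = \<bar>x\<bar> * (indicator {a\<^sup>2<..} (x\<^sup>2) * (x\<^sup>2 - a\<^sup>2) powr (\<kappa> - 1 / 2) / (D * W))"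
        proof (cases "\<bar>a\<bar> < \<bar>x\<bar>")
          case True
          then have 1: "a / x \<in> {- 1<..<1}" using x by (auto simp: abs_if divide_simps split: if_splits)
          have 2: "a\<^sup>2 < x\<^sup>2" using power_strict_mono[OF True, of 2] by simp
          have "1 - (a / x)\<^sup>2 = (x\<^sup>2 - a\<^sup>2) / x\<^sup>2" using x by (simp add: field_simps)
          then have "w (a / x) = (x\<^sup>2 - a\<^sup>2) powr (\<kappa> - 1 / 2) / (x\<^sup>2) powr (\<kappa> - 1 / 2)"
            using 1 2 by (simp add: w_def powr_divide)
          also have "(x\<^sup>2) powr (\<kappa> - 1 / 2) = \<bar>x\<bar> powr (2 * \<kappa>) / \<bar>x\<bar>"
          proof -
            have "(x\<^sup>2) powr (\<kappa> - 1 / 2) = \<bar>x\<bar> powr (2 * \<kappa> - 1)"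
              using powr_powr[of "\<bar>x\<bar>" 2 "\<kappa> - 1 / 2"] x by (simp add: algebra_simps)
            then show ?thesis using x by (simp add: powr_diff)
          qed
          finally show ?thesis using 2 x by (simp add: field_simps)
        next
          case False
          then have "a / x \<notin> {- 1<..<1}" using x by (auto simp: abs_if divide_simps split: if_splits)
          moreover have "\<not> a\<^sup>2 < x\<^sup>2" using False abs_le_square_iff[of x a] by auto
          ultimately show ?thesis by (simp add: w_def)
        qed
        then have "ennreal (\<bar>x\<bar> powr (2 * \<kappa>) / D) * ennreal (w (a / x) / W) =
            ennreal \<bar>x\<bar> * (if a\<^sup>2 < x\<^sup>2 then ennreal ((x\<^sup>2 - a\<^sup>2) powr (\<kappa> - 1 / 2) / (D * W)) else 0)"
          using D_pos W_pos w_nonneg by (simp flip: ennreal_mult)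
        then show "ennreal (\<bar>x\<bar> powr (2 * \<kappa>) / D) * g a = ennreal \<bar>x\<bar> * \<psi> a (x\<^sup>2)"
          unfolding g_def \<psi>_def by (simp only: mult.assoc[symmetric])
      qed
      finally show "ennreal (\<bar>x\<bar> powr (2 * \<kappa> + 1) / D) * (\<integral>\<^sup>+t. ennreal (w t / W) * \<phi> (x * t, x\<^sup>2 * (1 - t\<^sup>2)) \<partial>lborel) =
        (\<integral>\<^sup>+a. ennreal \<bar>x\<bar> * \<psi> a (x\<^sup>2) \<partial>lborel)" .
    qed
  qed
  also have "\<dots> = (\<integral>\<^sup>+a. (\<integral>\<^sup>+x. ennreal \<bar>x\<bar> * \<psi> a (x\<^sup>2) \<partial>lborel) \<partial>lborel)"
    by (rule lborel_pair.Fubini'[symmetric]) measurable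
  also have "\<dots> = (\<integral>\<^sup>+a. (\<integral>\<^sup>+X. \<psi> a X * indicator {0<..} X \<partial>lborel) \<partial>lborel)"
    by (intro nn_integral_cong nn_integral_square) measurable
  also have "\<dots> = (\<integral>\<^sup>+a. (\<integral>\<^sup>+B. ennreal (indicator {0<..} B * B powr (\<kappa> - 1 / 2) / (D * W)) * \<phi> (a, B) \<partial>lborel) \<partial>lborel)"
  proof (rule nn_integral_cong)
    fix a :: real
    have "(\<integral>\<^sup>+X. \<psi> a X * indicator {0<..} X \<partial>lborel) = (\<integral>\<^sup>+B. \<psi> a (a\<^sup>2 + 1 * B) * indicator {0<..} (a\<^sup>2 + 1 * B) \<partial>lborel)"
      by (subst nn_integral_real_affine[where c = 1 and t = "a\<^sup>2"]) auto
    also have "\<dots> = (\<integral>\<^sup>+B. ennreal (indicator {0<..} B * B powr (\<kappa> - 1 / 2) / (D * W)) * \<phi> (a, B) \<partial>lborel)"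
      by (intro nn_integral_cong) (auto simp: \<psi>_def add_nonneg_pos split: split_indicator)
    finally show "(\<integral>\<^sup>+X. \<psi> a X * indicator {0<..} X \<partial>lborel) = (\<integral>\<^sup>+B. ennreal (indicator {0<..} B * B powr (\<kappa> - 1 / 2) / (D * W)) * \<phi> (a, B) \<partial>lborel)" .
  qed
  also have "\<dots> = (\<integral>\<^sup>+z. \<phi> z \<partial>Q)" by (rule nn_integral_Q[symmetric]) measurable
  finally show ?thesis .
qed

definition polar :: "real \<times> real \<Rightarrow> real \<times> real" where
  "polar z = (fst z * snd z, (fst z)\<^sup>2 * (1 - (snd z)\<^sup>2))"

lemma polar_measurable [measurable]: "polar \<in> borel \<Otimes>\<^sub>M borel \<rightarrow>\<^sub>M borel \<Otimes>\<^sub>M borel"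
  unfolding polar_def[abs_def] by measurable

lemma distr_polar: "distr \<PP> (borel \<Otimes>\<^sub>M borel) polar = Q"
proof (rule measure_eqI)
  fix A assume "A \<in> sets (distr \<PP> (borel \<Otimes>\<^sub>M borel) polar)"
  then have [measurable]: "A \<in> sets (borel \<Otimes>\<^sub>M borel)" by simp
  have "emeasure (distr \<PP> (borel \<Otimes>\<^sub>M borel) polar) A = (\<integral>\<^sup>+z. indicator A (polar z) \<partial>\<PP>)"
    by (simp flip: nn_integral_indicator add: nn_integral_distr)
  also have "\<dots> = (\<integral>\<^sup>+z. indicator A z \<partial>Q)"
    unfolding polar_def by (rule nn_integral_polar) measurable
  finally show "emeasure (distr \<PP> (borel \<Otimes>\<^sub>M borel) polar) A = emeasure Q A" by simp
qed simp

text \<open>The density of \<open>Q\<close> depends on B alone, and Lebesgue measure in a is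
  translation invariant. This is the one place where translation acts as an ordinary shift.\<close>

lemma distr_Q_shift: "distr Q (borel \<Otimes>\<^sub>M borel) (\<lambda>z. (fst z + y, snd z)) = Q"
proof (rule measure_eqI)
  fix A assume "A \<in> sets (distr Q (borel \<Otimes>\<^sub>M borel) (\<lambda>z. (fst z + y, snd z)))"
  then have [measurable]: "A \<in> sets (borel \<Otimes>\<^sub>M borel)" by simp
  define F where "F = (\<lambda>a. \<integral>\<^sup>+B. ennreal (indicator {0<..} B * B powr (\<kappa> - 1 / 2) / (D * W)) * indicator A (a, B) \<partial>lborel)"
  have [measurable]: "F \<in> borel_measurable borel" unfolding F_def by measurable
  have "emeasure (distr Q (borel \<Otimes>\<^sub>M borel) (\<lambda>z. (fst z + y, snd z))) A = (\<integral>\<^sup>+z. indicator A (fst z + y, snd z) \<partial>Q)"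
    by (simp flip: nn_integral_indicator add: nn_integral_distr)
  also have "\<dots> = (\<integral>\<^sup>+a. F (a + y) \<partial>lborel)" unfolding F_def by (subst nn_integral_Q) auto
  also have "\<dots> = (\<integral>\<^sup>+a. F a \<partial>lborel)"
    using nn_integral_real_affine[of F 1 y] by (simp add: add.commute)
  also have "\<dots> = (\<integral>\<^sup>+z. indicator A z \<partial>Q)" unfolding F_def by (subst nn_integral_Q) auto
  finally show "emeasure (distr Q (borel \<Otimes>\<^sub>M borel) (\<lambda>z. (fst z + y, snd z))) A = emeasure Q A" by simp
qed simp

lemma distr_PP_uminus: "distr \<PP> (borel \<Otimes>\<^sub>M borel) (\<lambda>z. (- fst z, - snd z)) = \<PP>"
proof -
  have "sigma_finite_measure (distr \<omega> borel uminus)"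
    unfolding distr_omega_uminus by (rule omega.sigma_finite_measure_axioms)
  from pair_measure_distr[OF _ _ this, of uminus \<mu> borel] show ?thesis
    by (simp add: distr_omega_uminus distr_mu_uminus split_def)
qed

lemma emeasure_mu_interval: "emeasure \<mu> {- R<..<R} < \<infinity>"
proof -
  have "emeasure \<mu> {- R<..<R} = (\<integral>\<^sup>+x. ennreal (\<bar>x\<bar> powr (2 * \<kappa> + 1) / D) * indicator {- R<..<R} x \<partial>lborel)"
    by (subst nn_integral_mu[symmetric]) auto
  also have "\<dots> \<le> (\<integral>\<^sup>+x. ennreal (\<bar>R\<bar> powr (2 * \<kappa> + 1) / D) * indicator {- R<..<R} x \<partial>lborel)"
    using kappa D_pos by (intro nn_integral_mono) (auto intro!: ennreal_leI divide_right_mono powr_mono2 split: split_indicator)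
  also have "\<dots> < \<infinity>" using emeasure_bounded_finite[of "{- R<..<R}"] by (subst nn_integral_cmult) (auto simp: ennreal_mult_less_top)
  finally show ?thesis .
qed

lemma integrable_PP_bounded:
  fixes f :: "real \<times> real \<Rightarrow> 'a::{banach, second_countable_topology}"
  assumes f: "f \<in> borel_measurable (borel \<Otimes>\<^sub>M borel)"
    and bnd: "\<And>x t. norm (f (x, t)) \<le> C * indicator {- R<..<R} x"
  shows "integrable \<PP> f"
proof (rule Bochner_Integration.integrable_bound)
  have "emeasure \<PP> ({- R<..<R} \<times> UNIV) < \<infinity>"
    using emeasure_mu_interval[of R] omega.emeasure_space_1
    by (subst omega.emeasure_pair_measure_Times) (auto simp: ennreal_mult_less_top)
  then have "integrable \<PP> (indicator ({- R<..<R} \<times> UNIV) :: _ \<Rightarrow> real)"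
    by (intro integrable_real_indicator) auto
  then show "integrable \<PP> (\<lambda>z. C * indicator ({- R<..<R} \<times> UNIV) z)" by (rule integrable_mult_right)
  show "AE z in \<PP>. norm (f z) \<le> norm (C * indicator ({- R<..<R} \<times> UNIV) z)"
  proof (rule AE_I2)
    fix z :: "real \<times> real"
    have "norm (f z) \<le> C * indicator ({- R<..<R} \<times> UNIV) z"
      using bnd[of "fst z" "snd z"] by (simp add: indicator_def mem_Times_iff)
    then show "norm (f z) \<le> norm (C * indicator ({- R<..<R} \<times> UNIV) z)" by simp
  qed
qed (use f in simp)

section \<open>The translate of the indicator function of a ball\<close>

definition ball_translate :: "real \<Rightarrow> real \<Rightarrow> real \<Rightarrow> real" where
  "ball_translate r y x = (\<integral>t. (1 + t) * indicator {t. - 1 < t \<and> t < 1 \<and> x\<^sup>2 + y\<^sup>2 - 2 * x * y * t < r\<^sup>2} t \<partial>\<omega>)"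

lemma ball_translate_measurable2 [measurable]:
  "(\<lambda>(y, x). ball_translate r y x) \<in> borel_measurable (borel \<Otimes>\<^sub>M borel)"
  unfolding ball_translate_def split_def by measurable

lemma ball_translate_measurable [measurable]: "ball_translate r y \<in> borel_measurable borel"
  unfolding ball_translate_def by measurable

lemma ball_translate_nonneg: "ball_translate r y x \<ge> 0"
  unfolding ball_translate_def by (intro integral_nonneg_AE AE_I2) (auto split: split_indicator)

lemma integrable_ball_translate:
  "integrable \<omega> (\<lambda>t. (1 + t) * indicator {t. - 1 < t \<and> t < 1 \<and> x\<^sup>2 + y\<^sup>2 - 2 * x * y * t < r\<^sup>2} t)"
  by (rule integrable_omega_bounded[where B = 2]) (auto split: split_indicator)

lemma ennreal_ball_translate:
  "ennreal (ball_translate r y x) = (\<integral>\<^sup>+t. ennreal ((1 + t) * indicator {t. - 1 < t \<and> t < 1 \<and> x\<^sup>2 + y\<^sup>2 - 2 * x * y * t < r\<^sup>2} t) \<partial>\<omega>)"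
  unfolding ball_translate_def
  by (rule nn_integral_eq_integral[symmetric, OF integrable_ball_translate]) (auto split: split_indicator)

lemma ball_translate_le_1: "ball_translate r y x \<le> 1"
proof -
  have "ball_translate r y x \<le> (\<integral>t. 1 + t \<partial>\<omega>)"
    unfolding ball_translate_def using AE_omega integrable_power[of 1]
    by (intro integral_mono_AE integrable_ball_translate) (auto split: split_indicator)
  also have "\<dots> = 1" using moment_odd[of 1] integrable_power[of 1] omega.prob_space by (simp add: moment_def)
  finally show ?thesis .
qed

lemma ball_translate_eq_0:
  assumes "r > 0" "\<bar>\<bar>x\<bar> - \<bar>y\<bar>\<bar> \<ge> r"
  shows "ball_translate r y x = 0"
proof -
  have empty: "{t. - 1 < t \<and> t < 1 \<and> x\<^sup>2 + y\<^sup>2 - 2 * x * y * t < r\<^sup>2} = {}"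
  proof -
    have "r\<^sup>2 \<le> (\<bar>x\<bar> - \<bar>y\<bar>)\<^sup>2" using assms by (simp add: power2_le_iff_abs_le flip: abs_le_square_iff)
    then show ?thesis using triangle_bounds(3)[of _ x y] by (auto simp: not_less intro: order_trans)
  qed
  then show ?thesis unfolding ball_translate_def empty by simp
qed

text \<open>Exhibits the indicator itself as the member y = 0 of the family of translates, so that
  both are covered by the same statements about the transform.\<close>

lemma ball_translate_0:
  assumes "r > 0"
  shows "ball_translate r 0 x = indicator {- r<..<r} x"
proof (cases "\<bar>x\<bar> < r")
  case True
  then have "x\<^sup>2 < r\<^sup>2" using abs_square_less_1 power_strict_mono[of "\<bar>x\<bar>" r 2] by simp
  then have "ball_translate r 0 x = (\<integral>t. (1 + t) * indicator {- 1<..<1} t \<partial>\<omega>)"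
    unfolding ball_translate_def by (intro Bochner_Integration.integral_cong) (auto split: split_indicator)
  also have "\<dots> = (\<integral>t. 1 + t \<partial>\<omega>)"
    using AE_omega by (intro integral_cong_AE) auto
  also have "\<dots> = 1" using moment_odd[of 1] integrable_power[of 1] omega.prob_space by (simp add: moment_def)
  finally show ?thesis using True by (auto simp: abs_less_iff)
next
  case False
  then show ?thesis using ball_translate_eq_0[OF assms, of x 0] assms by (auto simp: indicator_def)
qed

end

lemma square_less_square_iff:
  fixes x r :: real
  assumes "r > 0"
  shows "x\<^sup>2 < r\<^sup>2 \<longleftrightarrow> \<bar>x\<bar> < r"
  using abs_le_square_iff[of r x] assms by (metis abs_of_pos linorder_not_le)

lemma exp_power_series_sums: "(\<lambda>n. y ^ n / fact n) sums exp (y :: real)"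
  using exp_converges[of y] by (simp add: divide_inverse_commute)

section \<open>The transform of the translated ball\<close>

context dunkl begin

lemma measurable_bessel [measurable]:
  "bessel_sq (\<kappa> + 1) \<in> borel_measurable borel" "bessel_sq (\<kappa> + 2) \<in> borel_measurable borel"
  "dunkl_wave (\<kappa> + 1) \<in> borel_measurable borel"
  using kappa by (auto intro!: borel_measurable_bessel_sq borel_measurable_dunkl_wave)

text \<open>An extension of the kernel to the half-plane, where a is the coordinate along the axis
  and X the squared distance to the origin. It is affine in a, and a = x, X = x^2 returns the kernel
  on the line.\<close>

definition half_plane_wave :: "real \<Rightarrow> real \<Rightarrow> real \<Rightarrow> complex" where
  "half_plane_wave l a X = complex_of_real (bessel_sq (\<kappa> + 1) (l\<^sup>2 * X)) -
     \<i> * complex_of_real (a * (l / (2 * (\<kappa> + 1)) * bessel_sq (\<kappa> + 2) (l\<^sup>2 * X)))"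

lemma half_plane_wave_measurable [measurable]:
  "(\<lambda>(a, X). half_plane_wave l a X) \<in> borel_measurable (borel \<Otimes>\<^sub>M borel)"
  unfolding half_plane_wave_def split_def by measurable

lemma half_plane_wave_diag: "half_plane_wave l x (x\<^sup>2) = dunkl_wave (\<kappa> + 1) (- (l * x))"
  by (simp add: half_plane_wave_def complex_eq_iff power_mult_distrib add.assoc)

text \<open>The points x and -x with weights (1 + t)/2 and (1 - t)/2 have barycentre x t, and the
  wave is affine in its first coordinate. This explains the factor 1 + t in the translate.\<close>

lemma half_plane_wave_average:
  "((1 + complex_of_real t) * half_plane_wave l x X + (1 - complex_of_real t) * half_plane_wave l (- x) X) / 2
    = half_plane_wave l (x * t) X"
proof -
  have *: "((1 + T) * (P - \<i> * (x * q)) + (1 - T) * (P - \<i> * (- x * q))) / 2 = P - \<i> * (x * T * q)" for T P x q :: complex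
    by (simp add: algebra_simps add_divide_distrib diff_divide_distrib)
  show ?thesis unfolding half_plane_wave_def by (simp only: of_real_mult of_real_minus) (rule *)
qed

lemma norm_half_plane_wave:
  assumes "X \<ge> 0"
  shows "norm (half_plane_wave l a X) \<le> 1 + \<bar>a\<bar> * \<bar>l\<bar> / (2 * (\<kappa> + 1))"
proof -
  have b: "\<bar>bessel_sq (\<kappa> + 1) (l\<^sup>2 * X)\<bar> \<le> 1" "\<bar>bessel_sq (\<kappa> + 2) (l\<^sup>2 * X)\<bar> \<le> 1"
    using kappa assms by (auto intro!: abs_bessel_sq_le)
  have "norm (half_plane_wave l a X) \<le> \<bar>bessel_sq (\<kappa> + 1) (l\<^sup>2 * X)\<bar> + \<bar>a * (l / (2 * (\<kappa> + 1)) * bessel_sq (\<kappa> + 2) (l\<^sup>2 * X))\<bar>"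
    unfolding half_plane_wave_def by (rule order_trans[OF norm_triangle_ineq4]) (simp only: norm_mult[of \<i>] norm_ii norm_of_real mult_1_left order_refl)
  also have "\<bar>a * (l / (2 * (\<kappa> + 1)) * bessel_sq (\<kappa> + 2) (l\<^sup>2 * X))\<bar> = \<bar>a\<bar> * \<bar>l\<bar> / (2 * (\<kappa> + 1)) * \<bar>bessel_sq (\<kappa> + 2) (l\<^sup>2 * X)\<bar>"
    using kappa by (simp add: abs_mult)
  also have "\<dots> \<le> \<bar>a\<bar> * \<bar>l\<bar> / (2 * (\<kappa> + 1)) * 1"
    using b kappa by (intro mult_left_mono) auto
  finally show ?thesis using b by simp
qed

text \<open>With u = -lx and v = ly, the real part is the even product formula and the imaginary
  part the odd one. The mean of the shifted wave thus factors into the wave at y and an even Bessel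
  function of x.\<close>

lemma half_plane_wave_mean:
  "(\<integral>t. half_plane_wave l (x * t + y) (x\<^sup>2 + y\<^sup>2 + 2 * x * y * t) \<partial>\<omega>)
    = complex_of_real (bessel_sq (\<kappa> + 1) ((l * x)\<^sup>2)) * dunkl_wave (\<kappa> + 1) (- (l * y))"
proof -
  define u v where "u = - (l * x)" and "v = l * y"
  define S where "S = (\<lambda>t. u\<^sup>2 + v\<^sup>2 - 2 * u * v * t)"
  have [measurable]: "S \<in> borel_measurable borel" by (simp add: S_def)
  have Snn: "S t \<ge> 0" if "- 1 < t" "t < 1" for t
    using triangle_bounds(1)[OF that] by (simp add: S_def)
  have S: "l\<^sup>2 * (x\<^sup>2 + y\<^sup>2 + 2 * x * y * t) = S t" for t
    by (simp add: S_def u_def v_def algebra_simps power2_eq_square)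
  have i1: "integrable \<omega> (\<lambda>t. bessel_sq (\<kappa> + 1) (S t))"
    using kappa by (intro integrable_omega_bounded[where B = 1]) (auto intro!: abs_bessel_sq_le Snn)
  have i2: "integrable \<omega> (\<lambda>t. (v - u * t) * bessel_sq (\<kappa> + 2) (S t))"
  proof (rule integrable_omega_bounded[where B = "\<bar>v\<bar> + \<bar>u\<bar>"])
    fix t :: real assume t: "- 1 < t" "t < 1"
    have "\<bar>u * t\<bar> \<le> \<bar>u\<bar>" using t by (auto simp: abs_mult intro!: mult_left_le)
    then have "\<bar>v - u * t\<bar> * \<bar>bessel_sq (\<kappa> + 2) (S t)\<bar> \<le> (\<bar>v\<bar> + \<bar>u\<bar>) * 1"
      using t kappa by (intro mult_mono abs_bessel_sq_le Snn) auto
    then show "norm ((v - u * t) * bessel_sq (\<kappa> + 2) (S t)) \<le> \<bar>v\<bar> + \<bar>u\<bar>" by (simp add: abs_mult)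
  qed simp
  have "half_plane_wave l (x * t + y) (x\<^sup>2 + y\<^sup>2 + 2 * x * y * t) =
      complex_of_real (bessel_sq (\<kappa> + 1) (S t)) - \<i> / complex_of_real (2 * (\<kappa> + 1)) * complex_of_real ((v - u * t) * bessel_sq (\<kappa> + 2) (S t))" for t
    unfolding half_plane_wave_def S by (simp add: u_def v_def complex_eq_iff field_simps)
  then have "(\<integral>t. half_plane_wave l (x * t + y) (x\<^sup>2 + y\<^sup>2 + 2 * x * y * t) \<partial>\<omega>) =
     (\<integral>t. complex_of_real (bessel_sq (\<kappa> + 1) (S t)) - \<i> / complex_of_real (2 * (\<kappa> + 1)) * complex_of_real ((v - u * t) * bessel_sq (\<kappa> + 2) (S t)) \<partial>\<omega>)"
    by simp
  also have "\<dots> = complex_of_real (\<integral>t. bessel_sq (\<kappa> + 1) (S t) \<partial>\<omega>) - \<i> / complex_of_real (2 * (\<kappa> + 1)) * complex_of_real (\<integral>t. (v - u * t) * bessel_sq (\<kappa> + 2) (S t) \<partial>\<omega>)"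
    by (subst Bochner_Integration.integral_diff, intro integrable_of_real i1, intro integrable_mult_right integrable_of_real i2)
      (simp only: integral_mult_right_zero integral_complex_of_real)
  also have "\<dots> = complex_of_real (bessel_sq (\<kappa> + 1) ((l * x)\<^sup>2)) * dunkl_wave (\<kappa> + 1) (- (l * y))"
    unfolding S_def bessel_product bessel_product_odd
    by (simp add: u_def v_def complex_eq_iff add.assoc)
  finally show ?thesis .
qed

text \<open>In the half-plane the translate becomes the indicator of a half-disc centred at y on the
  axis. Shifting the half-disc to the origin moves the dependence on y into the wave, whose angular
  mean factors.\<close>

theorem transform_ball_translate:
  assumes r: "r > 0"
  shows "(\<integral>x. dunkl_wave (\<kappa> + 1) (- (l * x)) * complex_of_real (ball_translate r y x) \<partial>\<mu>) =
    dunkl_wave (\<kappa> + 1) (- (l * y)) * complex_of_real (\<integral>x. indicator {- r<..<r} x * bessel_sq (\<kappa> + 1) ((l * x)\<^sup>2) \<partial>\<mu>)"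
proof -
  define R where "R = r + \<bar>y\<bar>"
  \<comment> \<open>Points with x = 0 are left out because they are mapped to the axis B = 0, which
    is not part of the half-plane; they form a null set.\<close>
  define \<xi> :: "real \<times> real \<Rightarrow> real" where
    "\<xi> = (\<lambda>z. indicator {z. fst z \<noteq> 0 \<and> - 1 < snd z \<and> snd z < 1 \<and> (fst z)\<^sup>2 + y\<^sup>2 - 2 * fst z * y * snd z < r\<^sup>2} z)"
  define \<Phi> where "\<Phi> = (\<lambda>z. complex_of_real ((1 + snd z) * \<xi> z) * dunkl_wave (\<kappa> + 1) (- (l * fst z)))"
  define G where "G = (\<lambda>z. complex_of_real (indicator {z. 0 < snd z \<and> (fst z - y)\<^sup>2 + snd z < r\<^sup>2} z) * half_plane_wave l (fst z) ((fst z)\<^sup>2 + snd z))"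
  have [measurable]: "\<xi> \<in> borel_measurable (borel \<Otimes>\<^sub>M borel)" unfolding \<xi>_def by measurable
  have [measurable]: "\<Phi> \<in> borel_measurable (borel \<Otimes>\<^sub>M borel)" unfolding \<Phi>_def by measurable
  have [measurable]: "G \<in> borel_measurable (borel \<Otimes>\<^sub>M borel)" unfolding G_def by measurable
  have pos_iff: "0 < x\<^sup>2 * (1 - t\<^sup>2) \<longleftrightarrow> x \<noteq> 0 \<and> - 1 < t \<and> t < 1" for x t :: real
    by (auto simp: zero_less_mult_iff abs_square_less_1 abs_less_iff)
  have polar1: "(x * t - y)\<^sup>2 + x\<^sup>2 * (1 - t\<^sup>2) = x\<^sup>2 + y\<^sup>2 - 2 * x * y * t" for x t
    by (simp add: algebra_simps power2_eq_square)
  have polar2: "(x * t)\<^sup>2 + x\<^sup>2 * (1 - t\<^sup>2) = x\<^sup>2" for x t :: real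
    by (simp add: algebra_simps power2_eq_square)
  have polar3: "(x * t + y)\<^sup>2 + x\<^sup>2 * (1 - t\<^sup>2) = x\<^sup>2 + y\<^sup>2 + 2 * x * y * t" for x t
    by (simp add: algebra_simps power2_eq_square)
  have int\<Phi>: "integrable \<PP> \<Phi>"
  proof (rule integrable_PP_bounded[where C = 2 and R = R])
    fix x t :: real
    show "norm (\<Phi> (x, t)) \<le> 2 * indicator {- R<..<R} x"
    proof (cases "\<xi> (x, t) = 0")
      case False
      then have t: "- 1 < t" "t < 1" and *: "x\<^sup>2 + y\<^sup>2 - 2 * x * y * t < r\<^sup>2" by (auto simp: \<xi>_def indicator_def split: if_splits)
      have "(\<bar>x\<bar> - \<bar>y\<bar>)\<^sup>2 < r\<^sup>2" using triangle_bounds(3)[OF t, where u = x and v = y] * by linarith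
      then have "\<bar>x\<bar> - \<bar>y\<bar> < r" using r power2_less_imp_less by fastforce
      then have x: "x \<in> {- R<..<R}" by (auto simp: R_def)
      have "norm (\<Phi> (x, t)) = (1 + t) * norm (dunkl_wave (\<kappa> + 1) (- (l * x)))"
      proof -
        have "\<xi> (x, t) = 1" using False by (auto simp: \<xi>_def indicator_def split: if_splits)
        then show ?thesis using t by (simp only: \<Phi>_def fst_conv snd_conv norm_mult norm_of_real) simp
      qed
      also have "\<dots> \<le> 2 * 1" using t kappa by (intro mult_mono norm_dunkl_wave_le) auto
      finally show ?thesis using x by simp
    qed (simp add: \<Phi>_def)
  qed simp
  have intG: "integrable \<PP> (\<lambda>z. G (fst (polar z) + y, snd (polar z)))"
  proof (rule integrable_PP_bounded[where C = "1 + R * \<bar>l\<bar> / (2 * (\<kappa> + 1))" and R = r])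
    fix x t :: real
    show "norm (G (fst (polar (x, t)) + y, snd (polar (x, t)))) \<le> (1 + R * \<bar>l\<bar> / (2 * (\<kappa> + 1))) * indicator {- r<..<r} x"
    proof (cases "x \<noteq> 0 \<and> - 1 < t \<and> t < 1 \<and> x\<^sup>2 < r\<^sup>2")
      case True
      have x: "\<bar>x\<bar> < r" using True r by (metis power2_abs power2_less_imp_less less_imp_le)
      have "\<bar>x * t\<bar> \<le> \<bar>x\<bar>" using True by (auto simp: abs_mult intro!: mult_left_le)
      then have a: "\<bar>x * t + y\<bar> \<le> R" using x by (auto simp: R_def)
      have "norm (G (fst (polar (x, t)) + y, snd (polar (x, t)))) \<le> norm (half_plane_wave l (x * t + y) (x\<^sup>2 + y\<^sup>2 + 2 * x * y * t))"
        by (simp add: G_def polar_def polar3 norm_mult indicator_def)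
      also have "\<dots> \<le> 1 + \<bar>x * t + y\<bar> * \<bar>l\<bar> / (2 * (\<kappa> + 1))"
        using triangle_bounds(1)[of t "- x" y] True by (intro norm_half_plane_wave) auto
      also have "\<dots> \<le> 1 + R * \<bar>l\<bar> / (2 * (\<kappa> + 1))"
        using a kappa by (intro add_left_mono divide_right_mono mult_right_mono) auto
      finally show ?thesis using x by (simp add: abs_less_iff)
    next
      case False
      then have "G (fst (polar (x, t)) + y, snd (polar (x, t))) = 0"
        using pos_iff[of x t] polar2[of x t] by (auto simp: G_def polar_def indicator_def)
      then show ?thesis using kappa r by (auto simp: R_def indicator_def)
    qed
  qed (simp add: polar_def)
  have "(\<integral>x. dunkl_wave (\<kappa> + 1) (- (l * x)) * complex_of_real (ball_translate r y x) \<partial>\<mu>) = (\<integral>x. (\<integral>t. \<Phi> (x, t) \<partial>\<omega>) \<partial>\<mu>)"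
  proof (rule integral_cong_AE)
    show "AE x in \<mu>. dunkl_wave (\<kappa> + 1) (- (l * x)) * complex_of_real (ball_translate r y x) = (\<integral>t. \<Phi> (x, t) \<partial>\<omega>)"
      using AE_mu_nonzero
    proof eventually_elim
      fix x :: real assume "x \<noteq> 0"
      then have "ball_translate r y x = (\<integral>t. (1 + t) * \<xi> (x, t) \<partial>\<omega>)"
        unfolding ball_translate_def \<xi>_def by (intro Bochner_Integration.integral_cong) (auto simp: indicator_def)
      then have "complex_of_real (ball_translate r y x) = (\<integral>t. complex_of_real ((1 + t) * \<xi> (x, t)) \<partial>\<omega>)"
        by (simp only: integral_complex_of_real)
      then show "dunkl_wave (\<kappa> + 1) (- (l * x)) * complex_of_real (ball_translate r y x) = (\<integral>t. \<Phi> (x, t) \<partial>\<omega>)"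
        unfolding \<Phi>_def fst_conv snd_conv integral_mult_left_zero by (simp only: mult.commute)
    qed
  qed auto
  also have "\<dots> = (\<integral>z. \<Phi> z \<partial>\<PP>)" by (rule P.integral_fst'[OF int\<Phi>])
  \<comment> \<open>The reflection (x, t) -> (-x, -t) preserves the measure and the polar
    coordinates. Averaging over it turns the integrand into a function of those coordinates.\<close>
  also have "\<dots> = (\<integral>z. (\<Phi> z + \<Phi> (- fst z, - snd z)) / 2 \<partial>\<PP>)"
  proof -
    have "(\<integral>z. \<Phi> (- fst z, - snd z) \<partial>\<PP>) = (\<integral>z. \<Phi> z \<partial>\<PP>)"
      by (subst (2) distr_PP_uminus[symmetric], subst integral_distr) auto
    moreover have "integrable \<PP> (\<lambda>z. \<Phi> (- fst z, - snd z))"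
      using int\<Phi> by (subst (asm) distr_PP_uminus[symmetric], subst (asm) integrable_distr_eq) auto
    ultimately show ?thesis using int\<Phi> by simp
  qed
  also have "\<dots> = (\<integral>z. G (polar z) \<partial>\<PP>)"
  proof (intro Bochner_Integration.integral_cong refl)
    fix z :: "real \<times> real"
    obtain x t where z: "z = (x, t)" by (cases z)
    have "(\<Phi> z + \<Phi> (- fst z, - snd z)) / 2 = complex_of_real (\<xi> z) *
       (((1 + complex_of_real t) * half_plane_wave l x (x\<^sup>2) + (1 - complex_of_real t) * half_plane_wave l (- x) (x\<^sup>2)) / 2)"
      using half_plane_wave_diag[of l x] half_plane_wave_diag[of l "- x"]
      by (auto simp: z \<Phi>_def \<xi>_def indicator_def)
    also have "\<dots> = complex_of_real (\<xi> z) * half_plane_wave l (x * t) (x\<^sup>2)"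
      unfolding half_plane_wave_average ..
    also have "\<dots> = G (polar z)"
      using pos_iff[of x t] polar1[of x t] polar2[of x t] by (auto simp: z G_def polar_def \<xi>_def indicator_def)
    finally show "(\<Phi> z + \<Phi> (- fst z, - snd z)) / 2 = G (polar z)" .
  qed
  also have "\<dots> = (\<integral>z. G z \<partial>Q)"
    unfolding distr_polar[symmetric] by (subst integral_distr) auto
  \<comment> \<open>After the shift the half-disc is centred at 0; its condition x^2 < r^2 is free
    of t, and the inner integral is a mean of the wave alone.\<close>
  also have "\<dots> = (\<integral>z. G (fst z + y, snd z) \<partial>Q)"
    by (subst distr_Q_shift[of y, symmetric], subst integral_distr) auto
  also have "\<dots> = (\<integral>z. G (fst (polar z) + y, snd (polar z)) \<partial>\<PP>)"
    unfolding distr_polar[symmetric] by (subst integral_distr) auto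
  also have "\<dots> = (\<integral>x. (\<integral>t. G (fst (polar (x, t)) + y, snd (polar (x, t))) \<partial>\<omega>) \<partial>\<mu>)"
    by (rule P.integral_fst'[OF intG, symmetric])
  also have "\<dots> = (\<integral>x. dunkl_wave (\<kappa> + 1) (- (l * y)) * complex_of_real (indicator {- r<..<r} x * bessel_sq (\<kappa> + 1) ((l * x)\<^sup>2)) \<partial>\<mu>)"
  proof (rule integral_cong_AE)
    show "AE x in \<mu>. (\<integral>t. G (fst (polar (x, t)) + y, snd (polar (x, t))) \<partial>\<omega>) =
        dunkl_wave (\<kappa> + 1) (- (l * y)) * complex_of_real (indicator {- r<..<r} x * bessel_sq (\<kappa> + 1) ((l * x)\<^sup>2))"
      using AE_mu_nonzero
    proof eventually_elim
      fix x :: real assume x: "x \<noteq> 0"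
      have ind: "indicator {- r<..<r} x = (if x\<^sup>2 < r\<^sup>2 then 1 else 0 :: real)"
        unfolding square_less_square_iff[OF r] by (auto simp: indicator_def)
      have "(\<integral>t. G (fst (polar (x, t)) + y, snd (polar (x, t))) \<partial>\<omega>) =
        (\<integral>t. complex_of_real (indicator {- r<..<r} x) * half_plane_wave l (x * t + y) (x\<^sup>2 + y\<^sup>2 + 2 * x * y * t) \<partial>\<omega>)"
      proof (rule integral_cong_AE)
        show "AE t in \<omega>. G (fst (polar (x, t)) + y, snd (polar (x, t))) =
           complex_of_real (indicator {- r<..<r} x) * half_plane_wave l (x * t + y) (x\<^sup>2 + y\<^sup>2 + 2 * x * y * t)"
          using AE_omega
        proof eventually_elim
          fix t :: real assume t: "- 1 < t \<and> t < 1"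
          have "0 < x\<^sup>2 * (1 - t\<^sup>2)" using pos_iff[of x t] t x by blast
          then show "G (fst (polar (x, t)) + y, snd (polar (x, t))) =
           complex_of_real (indicator {- r<..<r} x) * half_plane_wave l (x * t + y) (x\<^sup>2 + y\<^sup>2 + 2 * x * y * t)"
            unfolding ind by (simp add: G_def polar_def polar2 polar3)
        qed
      qed (auto simp: polar_def)
      also have "\<dots> = dunkl_wave (\<kappa> + 1) (- (l * y)) * complex_of_real (indicator {- r<..<r} x * bessel_sq (\<kappa> + 1) ((l * x)\<^sup>2))"
        unfolding integral_mult_right_zero half_plane_wave_mean by (simp add: mult_ac)
      finally show "(\<integral>t. G (fst (polar (x, t)) + y, snd (polar (x, t))) \<partial>\<omega>) =
        dunkl_wave (\<kappa> + 1) (- (l * y)) * complex_of_real (indicator {- r<..<r} x * bessel_sq (\<kappa> + 1) ((l * x)\<^sup>2))" .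
    qed
  qed (auto simp: polar_def)
  also have "\<dots> = dunkl_wave (\<kappa> + 1) (- (l * y)) * complex_of_real (\<integral>x. indicator {- r<..<r} x * bessel_sq (\<kappa> + 1) ((l * x)\<^sup>2) \<partial>\<mu>)"
    by (simp only: integral_mult_right_zero integral_complex_of_real)
  finally show ?thesis .
qed

section \<open>Transforms of Gaussians\<close>

lemma nn_integral_gaussian_powr:
  assumes a: "a > 0" and b: "b > 0"
  shows "(\<integral>\<^sup>+x. ennreal (\<bar>x\<bar> powr (2 * a - 1) * exp (- b * x\<^sup>2)) \<partial>lborel) = ennreal (Gamma a / b powr a)"
proof -
  define \<psi> where "\<psi> = (\<lambda>X. ennreal (X powr (a - 1) * exp (- b * X)))"
  have [measurable]: "\<psi> \<in> borel_measurable borel" by (simp add: \<psi>_def)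
  define g where "g = (\<lambda>t::real. ennreal (indicat_real {0..} t * t powr (a - 1) / exp t))"
  have [measurable]: "g \<in> borel_measurable borel" by (simp add: g_def)
  have "(\<integral>\<^sup>+x. ennreal (\<bar>x\<bar> powr (2 * a - 1) * exp (- b * x\<^sup>2)) \<partial>lborel) = (\<integral>\<^sup>+x. ennreal \<bar>x\<bar> * \<psi> (x\<^sup>2) \<partial>lborel)"
  proof (intro nn_integral_cong)
    fix x :: real
    have "\<bar>x\<bar> powr (2 * a - 1) = \<bar>x\<bar> * (x\<^sup>2) powr (a - 1)"
    proof (cases "x = 0")
      case False
      have "(x\<^sup>2) powr (a - 1) = \<bar>x\<bar> powr (2 * a - 2)"
        using powr_powr[of "\<bar>x\<bar>" 2 "a - 1"] False by (simp add: algebra_simps)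
      then show ?thesis using False powr_add[of "\<bar>x\<bar>" 1 "2 * a - 2"] by simp
    qed simp
    then show "ennreal (\<bar>x\<bar> powr (2 * a - 1) * exp (- b * x\<^sup>2)) = ennreal \<bar>x\<bar> * \<psi> (x\<^sup>2)"
      by (simp add: \<psi>_def mult.assoc flip: ennreal_mult)
  qed
  also have "\<dots> = (\<integral>\<^sup>+X. \<psi> X * indicator {0<..} X \<partial>lborel)" by (rule nn_integral_square) simp
  also have "\<dots> = (\<integral>\<^sup>+X. ennreal (b powr (1 - a)) * g (0 + b * X) \<partial>lborel)"
  proof (intro nn_integral_cong)
    fix X :: real
    have "X powr (a - 1) = b powr (1 - a) * (b * X) powr (a - 1)" if "X > 0"
      using that b by (simp add: powr_mult flip: powr_add mult.assoc)
    then show "\<psi> X * indicator {0<..} X = ennreal (b powr (1 - a)) * g (0 + b * X)"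
      using b by (cases "X = 0") (auto simp: \<psi>_def g_def exp_minus field_simps zero_le_mult_iff simp flip: ennreal_mult split: split_indicator)
  qed
  also have "\<dots> = ennreal (b powr (1 - a)) * (\<integral>\<^sup>+X. g (0 + b * X) \<partial>lborel)"
    by (rule nn_integral_cmult) simp
  also have "\<dots> = ennreal (b powr - a) * (ennreal b * (\<integral>\<^sup>+X. g (0 + b * X) \<partial>lborel))"
    using b powr_add[of b "- a" 1] by (simp add: ennreal_mult mult.assoc add.commute flip: mult.assoc)
  also have "ennreal b * (\<integral>\<^sup>+X. g (0 + b * X) \<partial>lborel) = ennreal (Gamma a)"
    using nn_integral_real_affine[of g b 0] b Gamma_conv_nn_integral_real[OF a] by (simp add: g_def)
  also have "ennreal (b powr - a) * ennreal (Gamma a) = ennreal (Gamma a / b powr a)"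
    using a Gamma_real_pos[OF a] by (simp add: powr_minus field_simps flip: ennreal_mult)
  finally show ?thesis .
qed

text \<open>Weber's integral. Each term of the Bessel series integrates to a Gamma quotient whose
  Pochhammer symbol cancels that of the coefficient, leaving the exponential series. The series of
  absolute values sums in the same way with the opposite sign in the exponent.\<close>

lemma gaussian_bessel:
  assumes a: "a > 0" and b: "b > 0"
  shows "(\<integral>x. \<bar>x\<bar> powr (2 * a - 1) * exp (- b * x\<^sup>2) * bessel_sq a ((l * x)\<^sup>2) \<partial>lborel) =
    Gamma a / b powr a * exp (- l\<^sup>2 / (4 * b))"
proof -
  define f where "f = (\<lambda>n x. \<bar>x\<bar> powr (2 * a - 1) * exp (- b * x\<^sup>2) * (bessel_coeff a n * ((l * x)\<^sup>2) ^ n))"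
  have [measurable]: "f n \<in> borel_measurable borel" for n by (simp add: f_def)
  have Ga: "Gamma (a + real n) = pochhammer a n * Gamma a" for n
  proof -
    have "a \<notin> \<int>\<^sub>\<le>\<^sub>0" using a by (auto elim!: nonpos_Ints_cases)
    then show ?thesis using pochhammer_Gamma[of a n] Gamma_real_pos[OF a] by simp
  qed
  define m where "m = (\<lambda>n. (l\<^sup>2) ^ n * (Gamma (a + real n) / b powr (a + real n)))"
  have pw: "\<bar>x\<bar> powr (2 * a - 1) * (x\<^sup>2) ^ n = \<bar>x\<bar> powr (2 * (a + real n) - 1)" if "x \<noteq> 0" for x :: real and n
  proof -
    have "(x\<^sup>2) ^ n = \<bar>x\<bar> powr (real (2 * n))"
      using that by (subst powr_realpow) (auto simp: power_mult)
    then show ?thesis by (simp add: algebra_simps flip: powr_add)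
  qed
  have nn: "(\<integral>\<^sup>+x. ennreal (\<bar>x\<bar> powr (2 * a - 1) * exp (- b * x\<^sup>2) * ((l * x)\<^sup>2) ^ n) \<partial>lborel) = ennreal (m n)" for n
  proof -
    have "(\<integral>\<^sup>+x. ennreal (\<bar>x\<bar> powr (2 * a - 1) * exp (- b * x\<^sup>2) * ((l * x)\<^sup>2) ^ n) \<partial>lborel) =
        (\<integral>\<^sup>+x. ennreal ((l\<^sup>2) ^ n) * ennreal (\<bar>x\<bar> powr (2 * (a + real n) - 1) * exp (- b * x\<^sup>2)) \<partial>lborel)"
      using AE_lborel_singleton[of 0]
    proof (intro nn_integral_cong_AE, eventually_elim)
      fix x :: real assume "x \<noteq> 0"
      from pw[OF this, of n, symmetric] show "ennreal (\<bar>x\<bar> powr (2 * a - 1) * exp (- b * x\<^sup>2) * ((l * x)\<^sup>2) ^ n) =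
          ennreal ((l\<^sup>2) ^ n) * ennreal (\<bar>x\<bar> powr (2 * (a + real n) - 1) * exp (- b * x\<^sup>2))"
        by (simp add: power_mult_distrib mult_ac flip: ennreal_mult)
    qed
    also have "\<dots> = ennreal (m n)"
    proof -
      have G: "Gamma (a + real n) > 0" using a by (intro Gamma_real_pos) auto
      show ?thesis
        using a b G by (subst nn_integral_cmult, simp, subst nn_integral_gaussian_powr) (auto simp: m_def simp flip: ennreal_mult)
    qed
    finally show ?thesis .
  qed
  have mnn: "m n \<ge> 0" for n using a by (auto simp: m_def intro!: mult_nonneg_nonneg divide_nonneg_nonneg less_imp_le[OF Gamma_real_pos])
  have base: "integrable lborel (\<lambda>x. \<bar>x\<bar> powr (2 * a - 1) * exp (- b * x\<^sup>2) * ((l * x)\<^sup>2) ^ n)"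
    "(\<integral>x. \<bar>x\<bar> powr (2 * a - 1) * exp (- b * x\<^sup>2) * ((l * x)\<^sup>2) ^ n \<partial>lborel) = m n" for n
    using nn_integral_eq_integrable[of "\<lambda>x. \<bar>x\<bar> powr (2 * a - 1) * exp (- b * x\<^sup>2) * ((l * x)\<^sup>2) ^ n" lborel "m n"] nn[of n] mnn[of n]
    by auto
  have f_eq: "f n x = bessel_coeff a n * (\<bar>x\<bar> powr (2 * a - 1) * exp (- b * x\<^sup>2) * ((l * x)\<^sup>2) ^ n)" for n x
    by (simp add: f_def)
  have intf: "integrable lborel (f n)" for n unfolding f_eq by (intro integrable_mult_right base)
  have val: "bessel_coeff a n * m n = Gamma a / b powr a * ((- l\<^sup>2 / (4 * b)) ^ n / fact n)" for n
  proof -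
    have p: "pochhammer a n > 0" using a by (rule pochhammer_pos)
    have e1: "b powr (a + real n) = b powr a * b ^ n" using b by (simp add: powr_add powr_realpow)
    have e2: "(- l\<^sup>2 / (4 * b)) ^ n = (- 1 / 4) ^ n * (l\<^sup>2) ^ n / b ^ n"
      unfolding power_mult_distrib[symmetric] power_divide[symmetric] by simp
    have "A / (F * P) * (L * (P * G / (B * C))) = G / B * (A * L / C / F)" if "P \<noteq> 0" for A F P L G B C :: real
      using that by (simp add: mult_ac)
    then show ?thesis unfolding bessel_coeff_def m_def Ga e1 e2 using p by (simp add: mult_ac)
  qed
  have "(\<lambda>n. \<integral>x. f n x \<partial>lborel) sums (\<integral>x. (\<Sum>n. f n x) \<partial>lborel)"
  proof (rule sums_integral[OF intf])
    show "AE x in lborel. summable (\<lambda>n. norm (f n x))"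
    proof (rule AE_I2)
      fix x
      show "summable (\<lambda>n. norm (f n x))"
        unfolding f_def norm_mult[of "\<bar>x\<bar> powr (2 * a - 1) * exp (- b * x\<^sup>2)"]
        by (intro summable_mult summable_norm_bessel_sq a)
    qed
    have "(\<integral>x. norm (f n x) \<partial>lborel) = Gamma a / b powr a * ((l\<^sup>2 / (4 * b)) ^ n / fact n)" for n
    proof -
      have "(\<integral>x. norm (f n x) \<partial>lborel) = (\<integral>x. \<bar>bessel_coeff a n\<bar> * (\<bar>x\<bar> powr (2 * a - 1) * exp (- b * x\<^sup>2) * ((l * x)\<^sup>2) ^ n) \<partial>lborel)"
        unfolding f_eq by (simp add: abs_mult)
      also have "\<dots> = \<bar>bessel_coeff a n * m n\<bar>" using mnn[of n] by (simp only: integral_mult_right_zero base(2)) (simp add: abs_mult)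
      also have "\<dots> = Gamma a / b powr a * ((l\<^sup>2 / (4 * b)) ^ n / fact n)"
        unfolding val using b Gamma_real_pos[OF a] by (simp add: abs_mult power_abs)
      finally show ?thesis .
    qed
    note eq = this
    have "summable (\<lambda>n. (l\<^sup>2 / (4 * b)) ^ n / fact n)"
      by (rule sums_summable[OF exp_power_series_sums])
    then show "summable (\<lambda>n. \<integral>x. norm (f n x) \<partial>lborel)"
      unfolding eq by (rule summable_mult)
  qed
  moreover have "(\<integral>x. f n x \<partial>lborel) = Gamma a / b powr a * ((- l\<^sup>2 / (4 * b)) ^ n / fact n)" for n
    unfolding f_eq integral_mult_right_zero base(2) val ..
  moreover have "(\<Sum>n. f n x) = \<bar>x\<bar> powr (2 * a - 1) * exp (- b * x\<^sup>2) * bessel_sq a ((l * x)\<^sup>2)" for x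
    unfolding f_def bessel_sq_def by (rule suminf_mult) (rule summable_bessel_sq[OF a])
  ultimately have "(\<lambda>n. Gamma a / b powr a * ((- l\<^sup>2 / (4 * b)) ^ n / fact n)) sums
     (\<integral>x. \<bar>x\<bar> powr (2 * a - 1) * exp (- b * x\<^sup>2) * bessel_sq a ((l * x)\<^sup>2) \<partial>lborel)" by simp
  moreover have "(\<lambda>n. Gamma a / b powr a * ((- l\<^sup>2 / (4 * b)) ^ n / fact n)) sums (Gamma a / b powr a * exp (- l\<^sup>2 / (4 * b)))"
    by (intro sums_mult exp_power_series_sums)
  ultimately show ?thesis by (rule sums_unique2)
qed

end

text \<open>On a compact interval, vanishing moments give vanishing integrals against polynomials,
  against continuous functions by Weierstrass approximation, and against indicators of closed sets
  by dominated convergence. Closed sets are stable under intersection and generate the Borel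
  sets.\<close>

lemma AE_zero_of_moments:
  fixes k :: "real \<Rightarrow> real"
  assumes "finite_measure N" and sets: "sets N = sets borel" and supp: "AE s in N. s \<in> {0..1}"
    and k: "integrable N k" and mom: "\<And>n. (\<integral>s. k s * s ^ n \<partial>N) = 0"
  shows "AE s in N. k s = 0"
proof -
  interpret N: finite_measure N by fact
  have [measurable_cong]: "sets N = sets borel" by fact
  have [measurable]: "k \<in> borel_measurable borel" using k by (simp add: integrable_iff_bounded measurable_cong_sets[OF sets refl])
  have int: "integrable N (\<lambda>s. k s * g s)" if [measurable]: "g \<in> borel_measurable borel" and "\<And>s::real. s \<in> {0..1} \<Longrightarrow> \<bar>g s\<bar> \<le> C" for g :: "real \<Rightarrow> real" and C
  proof (rule Bochner_Integration.integrable_bound)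
    show "integrable N (\<lambda>s. C * k s)" using k by simp
    show "AE s in N. norm (k s * g s) \<le> norm (C * k s)"
      using supp
    proof eventually_elim
      fix s :: real assume "s \<in> {0..1}"
      then have "\<bar>g s\<bar> \<le> C" by (rule that)
      then have "\<bar>g s\<bar> * \<bar>k s\<bar> \<le> \<bar>C\<bar> * \<bar>k s\<bar>" by (intro mult_right_mono) auto
      then show "norm (k s * g s) \<le> norm (C * k s)" by (simp add: abs_mult mult.commute)
    qed
  qed measurable
  have intp: "integrable N (\<lambda>s. k s * s ^ n)" for n
    by (rule int[where C = 1]) (auto simp: power_abs intro!: power_le_one)
  have cont: "(\<integral>s. k s * \<psi> s \<partial>N) = 0" if \<psi>: "continuous_on UNIV \<psi>" for \<psi>
  proof (rule ccontr)
    assume ne: "\<not> ?thesis"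
    have [measurable]: "\<psi> \<in> borel_measurable borel" using \<psi> by (rule borel_measurable_continuous_onI)
    have "compact (\<psi> ` {0..1})" using \<psi> by (intro compact_continuous_image continuous_on_subset[OF \<psi>]) auto
    then obtain B where B: "\<And>s::real. s \<in> {0..1} \<Longrightarrow> \<bar>\<psi> s\<bar> \<le> B"
      using compact_imp_bounded bounded_iff by (metis imageI real_norm_def)
    define K where "K = (\<integral>s. \<bar>k s\<bar> \<partial>N)"
    have "K \<ge> 0" by (simp add: K_def)
    \<comment> \<open>With K + 1 in the denominator the accuracy is defined even for K = 0, and the
      approximation error e K stays strictly below the integral that it is meant to bound.\<close>
    define e where "e = \<bar>\<integral>s. k s * \<psi> s \<partial>N\<bar> / (K + 1)"
    have e: "e > 0" using ne \<open>K \<ge> 0\<close> by (simp add: e_def)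
    have c01: "continuous_on {0..1} \<psi>" using \<psi> continuous_on_subset by blast
    obtain g where g: "real_polynomial_function g" "\<And>s::real. s \<in> {0..1} \<Longrightarrow> \<bar>\<psi> s - g s\<bar> < e"
      by (rule Stone_Weierstrass_real_polynomial_function[OF compact_Icc c01 e]) blast
    obtain a n where g_eq: "g = (\<lambda>s. \<Sum>i\<le>n. a i * s ^ i)"
      using g(1) by (auto simp: real_polynomial_function_iff_sum)
    have ig: "integrable N (\<lambda>s. k s * g s)" "(\<integral>s. k s * g s \<partial>N) = 0"
    proof -
      have eq: "k s * g s = (\<Sum>i\<le>n. a i * (k s * s ^ i))" for s
        unfolding g_eq sum_distrib_left by (simp add: mult_ac)
      show "integrable N (\<lambda>s. k s * g s)" unfolding eq by (intro Bochner_Integration.integrable_sum integrable_mult_right intp)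
      show "(\<integral>s. k s * g s \<partial>N) = 0" unfolding eq
        by (subst Bochner_Integration.integral_sum) (auto intro!: integrable_mult_right intp simp: mom)
    qed
    have i\<psi>: "integrable N (\<lambda>s. k s * \<psi> s)" by (rule int[OF _ B]) measurable
    have "\<bar>\<integral>s. k s * \<psi> s \<partial>N\<bar> = \<bar>\<integral>s. k s * \<psi> s - k s * g s \<partial>N\<bar>"
      using ig i\<psi> by simp
    also have "\<dots> \<le> (\<integral>s. e * \<bar>k s\<bar> \<partial>N)"
    proof (rule integral_abs_bound[THEN order_trans], rule integral_mono_AE)
      show "integrable N (\<lambda>s. \<bar>k s * \<psi> s - k s * g s\<bar>)" using ig i\<psi> by simp
      show "integrable N (\<lambda>s. e * \<bar>k s\<bar>)" using k by simp
      show "AE s in N. \<bar>k s * \<psi> s - k s * g s\<bar> \<le> e * \<bar>k s\<bar>"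
        using supp
      proof eventually_elim
        fix s :: real assume "s \<in> {0..1}"
        from g(2)[OF this] have "\<bar>\<psi> s - g s\<bar> * \<bar>k s\<bar> \<le> e * \<bar>k s\<bar>" by (intro mult_right_mono) auto
        then show "\<bar>k s * \<psi> s - k s * g s\<bar> \<le> e * \<bar>k s\<bar>"
          by (simp add: mult.commute flip: abs_mult left_diff_distrib right_diff_distrib)
      qed
    qed
    also have "\<dots> = e * K" by (simp add: K_def)
    also have "\<dots> < e * (K + 1)" using e by simp
    also have "\<dots> = \<bar>\<integral>s. k s * \<psi> s \<partial>N\<bar>" using \<open>K \<ge> 0\<close> by (simp add: e_def)
    finally show False by simp
  qed
  have closed: "(\<integral>s. k s * indicator F s \<partial>N) = 0" if "closed F" for F :: "real set"
  proof (cases "F = {}")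
    case False
    \<comment> \<open>Continuous functions with values in [0, 1] that decrease to the indicator of
      the closed set F.\<close>
    define \<psi> where "\<psi> = (\<lambda>n s. max 0 (1 - real n * infdist s F))"
    have c: "continuous_on UNIV (\<psi> n)" for n unfolding \<psi>_def by (intro continuous_intros)
    have [measurable]: "\<psi> n \<in> borel_measurable borel" for n using c by (rule borel_measurable_continuous_onI)
    have [measurable]: "F \<in> sets borel" using that by simp
    have "(\<lambda>n. \<integral>s. k s * \<psi> n s \<partial>N) \<longlonglongrightarrow> (\<integral>s. k s * indicator F s \<partial>N)"
    proof (rule integral_dominated_convergence)
      show "integrable N (\<lambda>s. \<bar>k s\<bar>)" using k by simp
      show "AE s in N. (\<lambda>n. k s * \<psi> n s) \<longlonglongrightarrow> k s * indicator F s"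
      proof (intro AE_I2 tendsto_mult tendsto_const)
        fix s
        show "(\<lambda>n. \<psi> n s) \<longlonglongrightarrow> indicator F s"
        proof (cases "s \<in> F")
          case True
          then show ?thesis by (simp add: \<psi>_def)
        next
          case s: False
          then have d: "infdist s F > 0" using in_closed_iff_infdist_zero[OF that False] infdist_nonneg[of s F] by (metis less_eq_real_def)
          obtain m where m: "1 / infdist s F < real m" using reals_Archimedean2 by blast
          have "\<psi> n s = 0" if "n \<ge> m" for n
          proof -
            have "1 / infdist s F \<le> real n" using m that by linarith
            then show ?thesis using d by (simp add: \<psi>_def divide_le_eq max_def)
          qed
          then have "eventually (\<lambda>n. \<psi> n s = 0) sequentially" by (auto simp: eventually_sequentially)
          then show ?thesis using s by (simp add: tendsto_eventually)
        qed
      qed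
      fix n
      have "\<bar>\<psi> n s\<bar> \<le> 1" for s using infdist_nonneg[of s F] by (auto simp: \<psi>_def)
      then show "AE s in N. norm (k s * \<psi> n s) \<le> \<bar>k s\<bar>" by (intro AE_I2) (auto simp: abs_mult intro!: mult_left_le)
    qed auto
    then show ?thesis using cont[OF c] by (simp add: LIMSEQ_const_iff)
  qed simp
  \<comment> \<open>The positive and negative parts of the signed measure with density
    \<open>k\<close>, finite because \<open>k\<close> is integrable; the uniqueness theorem for
    measures applies to them.\<close>
  define \<nu>1 \<nu>2 where "\<nu>1 = density N (\<lambda>s. ennreal (k s))" and "\<nu>2 = density N (\<lambda>s. ennreal (- k s))"
  have fin: "(\<integral>\<^sup>+s. ennreal (k s) * indicator A s \<partial>N) < \<infinity>" "(\<integral>\<^sup>+s. ennreal (- k s) * indicator A s \<partial>N) < \<infinity>" for A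
  proof -
    have *: "(\<integral>\<^sup>+s. ennreal \<bar>k s\<bar> \<partial>N) < \<infinity>" using k by (simp add: integrable_iff_bounded)
    show "(\<integral>\<^sup>+s. ennreal (k s) * indicator A s \<partial>N) < \<infinity>"
      by (rule le_less_trans[OF nn_integral_mono *]) (auto intro: ennreal_leI split: split_indicator)
    show "(\<integral>\<^sup>+s. ennreal (- k s) * indicator A s \<partial>N) < \<infinity>"
      by (rule le_less_trans[OF nn_integral_mono *]) (auto intro: ennreal_leI split: split_indicator)
  qed
  have split: "(\<integral>s. k s * indicator A s \<partial>N) = enn2real (emeasure \<nu>1 A) - enn2real (emeasure \<nu>2 A)" if [measurable]: "A \<in> sets borel" for A
  proof -
    have "integrable N (\<lambda>s. k s * indicator A s)" by (rule int[where C = 1]) auto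
    moreover have "ennreal (k s * indicator A s) = ennreal (k s) * indicator A s"
      "ennreal (- (k s * indicator A s)) = ennreal (- k s) * indicator A s" for s by (auto split: split_indicator)
    ultimately show ?thesis unfolding \<nu>1_def \<nu>2_def
      by (subst real_lebesgue_integral_def) (auto simp: emeasure_density sets)
  qed
  have sets12: "sets \<nu>1 = sets borel" "sets \<nu>2 = sets borel" by (simp_all add: \<nu>1_def \<nu>2_def sets)
  have "\<nu>1 = \<nu>2"
  proof (rule measure_eqI_generator_eq[where E = "Collect closed" and \<Omega> = UNIV and A = "\<lambda>_. UNIV"])
    show "Int_stable (Collect closed :: real set set)" by (auto simp: Int_stable_def)
    show "sets \<nu>1 = sigma_sets UNIV (Collect closed)" "sets \<nu>2 = sigma_sets UNIV (Collect closed)"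
      by (simp_all add: sets12 borel_eq_closed)
    fix X :: "real set" assume "X \<in> Collect closed"
    then have X: "closed X" by simp
    then have [measurable]: "X \<in> sets borel" by simp
    have f: "emeasure \<nu>1 X < \<infinity>" "emeasure \<nu>2 X < \<infinity>" using fin[of X] by (simp_all add: \<nu>1_def \<nu>2_def emeasure_density)
    have "enn2real (emeasure \<nu>1 X) = enn2real (emeasure \<nu>2 X)"
      using split[of X] closed[OF X] by simp
    then show "emeasure \<nu>1 X = emeasure \<nu>2 X" using f by (metis ennreal_enn2real infinity_ennreal_def)
  next
    show "emeasure \<nu>1 UNIV \<noteq> \<infinity>" for i :: nat
      using fin(1)[of UNIV] by (simp add: \<nu>1_def emeasure_density)
  qed auto
  then have all: "(\<integral>s. k s * indicator A s \<partial>N) = 0" if "A \<in> sets borel" for A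
    using split[OF that] by simp
  show ?thesis
  proof (rule N.density_zero[OF k])
    fix A assume "A \<in> sets N"
    then show "set_lebesgue_integral N A k = 0"
      using all[of A] by (simp add: set_lebesgue_integral_def sets mult.commute)
  qed
qed

section \<open>Gaussians: their transforms and their totality\<close>

context dunkl begin

lemma integral_mu:
  fixes f :: "real \<Rightarrow> real"
  assumes "f \<in> borel_measurable borel"
  shows "(\<integral>x. f x \<partial>\<mu>) = (\<integral>x. \<bar>x\<bar> powr (2 * \<kappa> + 1) / D * f x \<partial>lborel)"
  unfolding mu_def using assms D_pos by (subst integral_density) auto

lemma integrable_gauss:
  assumes b: "b > 0"
  shows "integrable \<mu> (\<lambda>x. exp (- b * x\<^sup>2))" "integrable \<mu> (\<lambda>x. x\<^sup>2 * exp (- b * x\<^sup>2))"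
proof -
  have G: "Gamma (\<kappa> + 1) > 0" "Gamma (\<kappa> + 2) > 0" using kappa by (auto intro!: Gamma_real_pos)
  have e: "2 * (\<kappa> + 1) - 1 = 2 * \<kappa> + 1" by simp
  have "(\<integral>\<^sup>+x. ennreal (exp (- b * x\<^sup>2)) \<partial>\<mu>) = (\<integral>\<^sup>+x. ennreal (1 / D) * ennreal (\<bar>x\<bar> powr (2 * (\<kappa> + 1) - 1) * exp (- b * x\<^sup>2)) \<partial>lborel)"
    unfolding e using D_pos by (subst nn_integral_mu) (auto intro!: nn_integral_cong simp flip: ennreal_mult)
  also have "\<dots> = ennreal (1 / D) * ennreal (Gamma (\<kappa> + 1) / b powr (\<kappa> + 1))"
    using kappa b by (subst nn_integral_cmult, simp, subst nn_integral_gaussian_powr) auto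
  also have "\<dots> < \<infinity>" by (simp add: ennreal_mult_less_top)
  finally show "integrable \<mu> (\<lambda>x. exp (- b * x\<^sup>2))" by (intro integrableI_nonneg) auto
  have "(\<integral>\<^sup>+x. ennreal (x\<^sup>2 * exp (- b * x\<^sup>2)) \<partial>\<mu>) = (\<integral>\<^sup>+x. ennreal (1 / D) * ennreal (\<bar>x\<bar> powr (2 * (\<kappa> + 2) - 1) * exp (- b * x\<^sup>2)) \<partial>lborel)"
  proof (subst nn_integral_mu, simp, rule nn_integral_cong_AE)
    show "AE x in lborel. ennreal (\<bar>x\<bar> powr (2 * \<kappa> + 1) / D) * ennreal (x\<^sup>2 * exp (- b * x\<^sup>2)) =
        ennreal (1 / D) * ennreal (\<bar>x\<bar> powr (2 * (\<kappa> + 2) - 1) * exp (- b * x\<^sup>2))"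
      using AE_lborel_singleton[of 0]
    proof eventually_elim
      fix x :: real assume "x \<noteq> 0"
      then have "\<bar>x\<bar> powr (2 * (\<kappa> + 2) - 1) = \<bar>x\<bar> powr (2 * \<kappa> + 1) * x\<^sup>2"
        using powr_add[of "\<bar>x\<bar>" "2 * \<kappa> + 1" 2] by (simp add: algebra_simps)
      then show "ennreal (\<bar>x\<bar> powr (2 * \<kappa> + 1) / D) * ennreal (x\<^sup>2 * exp (- b * x\<^sup>2)) =
        ennreal (1 / D) * ennreal (\<bar>x\<bar> powr (2 * (\<kappa> + 2) - 1) * exp (- b * x\<^sup>2))"
        using D_pos by (simp add: mult_ac flip: ennreal_mult)
    qed
  qed
  also have "\<dots> = ennreal (1 / D) * ennreal (Gamma (\<kappa> + 2) / b powr (\<kappa> + 2))"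
    using kappa b by (subst nn_integral_cmult, simp, subst nn_integral_gaussian_powr) auto
  also have "\<dots> < \<infinity>" by (simp add: ennreal_mult_less_top)
  finally show "integrable \<mu> (\<lambda>x. x\<^sup>2 * exp (- b * x\<^sup>2))" by (intro integrableI_nonneg) auto
qed

lemma integrable_gauss1:
  assumes b: "b > 0"
  shows "integrable \<mu> (\<lambda>x. x * exp (- b * x\<^sup>2))"
proof (rule Bochner_Integration.integrable_bound)
  show "integrable \<mu> (\<lambda>x. exp (- b * x\<^sup>2) + x\<^sup>2 * exp (- b * x\<^sup>2))"
    by (intro Bochner_Integration.integrable_add integrable_gauss b)
  show "AE x in \<mu>. norm (x * exp (- b * x\<^sup>2)) \<le> norm (exp (- b * x\<^sup>2) + x\<^sup>2 * exp (- b * x\<^sup>2))"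
  proof (rule AE_I2)
    fix x :: real
    have "0 \<le> (\<bar>x\<bar> - 1)\<^sup>2" by simp
    then have "2 * \<bar>x\<bar> \<le> 1 + x\<^sup>2" by (simp add: power2_diff)
    then have "\<bar>x\<bar> \<le> 1 + x\<^sup>2" by linarith
    then have "\<bar>x\<bar> * exp (- b * x\<^sup>2) \<le> (1 + x\<^sup>2) * exp (- b * x\<^sup>2)" by (intro mult_right_mono) auto
    then show "norm (x * exp (- b * x\<^sup>2)) \<le> norm (exp (- b * x\<^sup>2) + x\<^sup>2 * exp (- b * x\<^sup>2))"
      by (simp add: abs_mult distrib_right)
  qed
qed simp

definition fourier :: "(real \<Rightarrow> complex) \<Rightarrow> real \<Rightarrow> complex" where
  "fourier f l = (\<integral>x. dunkl_wave (\<kappa> + 1) (- (l * x)) * f x \<partial>\<mu>)"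

lemma dunkl_transform_eq: "dunkl_transform \<kappa> f = fourier f"
proof -
  have "\<kappa> > - 1" using kappa by simp
  from dunkl_kernel_imaginary(2)[OF this] show ?thesis
    by (intro ext) (simp only: dunkl_transform_def fourier_def)
qed

lemma integral_mu_symmetrize:
  fixes f :: "real \<Rightarrow> complex"
  assumes f: "integrable \<mu> f"
  shows "(\<integral>x. f x \<partial>\<mu>) = (\<integral>x. (f x + f (- x)) / 2 \<partial>\<mu>)"
proof -
  have m: "f \<in> borel_measurable borel" using f by (simp add: integrable_iff_bounded)
  have "integrable \<mu> (\<lambda>x. f (- x))"
    using f m by (subst (asm) distr_mu_uminus[symmetric], subst (asm) integrable_distr_eq) auto
  then show ?thesis using f integral_mu_uminus[OF m] by simp
qed

lemma integrable_wave_mult: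
  assumes "integrable \<mu> f"
  shows "integrable \<mu> (\<lambda>x. dunkl_wave (\<kappa> + 1) (- (l * x)) * f x)"
proof (rule Bochner_Integration.integrable_bound[OF assms])
  have [measurable]: "f \<in> borel_measurable borel" using assms by (simp add: integrable_iff_bounded)
  show "(\<lambda>x. dunkl_wave (\<kappa> + 1) (- (l * x)) * f x) \<in> borel_measurable \<mu>" by simp
  show "AE x in \<mu>. norm (dunkl_wave (\<kappa> + 1) (- (l * x)) * f x) \<le> norm (f x)"
    using kappa by (intro AE_I2) (auto simp: norm_mult intro!: mult_left_le_one_le norm_dunkl_wave_le)
qed

lemma fourier_gauss:
  assumes b: "b > 0"
  shows "fourier (\<lambda>x. complex_of_real (exp (- b * x\<^sup>2))) l =
    complex_of_real (Gamma (\<kappa> + 1) / (D * b powr (\<kappa> + 1)) * exp (- l\<^sup>2 / (4 * b)))"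
proof -
  have avg: "(dunkl_wave (\<kappa> + 1) (- (l * x)) * complex_of_real (exp (- b * x\<^sup>2)) +
      dunkl_wave (\<kappa> + 1) (- (l * (- x))) * complex_of_real (exp (- b * (- x)\<^sup>2))) / 2
    = complex_of_real (exp (- b * x\<^sup>2) * bessel_sq (\<kappa> + 1) ((l * x)\<^sup>2))" for x
    by (simp add: complex_eq_iff)
  have "fourier (\<lambda>x. complex_of_real (exp (- b * x\<^sup>2))) l = (\<integral>x. complex_of_real (exp (- b * x\<^sup>2) * bessel_sq (\<kappa> + 1) ((l * x)\<^sup>2)) \<partial>\<mu>)"
    unfolding fourier_def
    by (subst integral_mu_symmetrize, intro integrable_wave_mult integrable_of_real integrable_gauss b, simp only: avg)
  also have "\<dots> = complex_of_real (\<integral>x. exp (- b * x\<^sup>2) * bessel_sq (\<kappa> + 1) ((l * x)\<^sup>2) \<partial>\<mu>)"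
    by (rule integral_complex_of_real)
  also have "(\<integral>x. exp (- b * x\<^sup>2) * bessel_sq (\<kappa> + 1) ((l * x)\<^sup>2) \<partial>\<mu>) =
      (\<integral>x. 1 / D * (\<bar>x\<bar> powr (2 * (\<kappa> + 1) - 1) * exp (- b * x\<^sup>2) * bessel_sq (\<kappa> + 1) ((l * x)\<^sup>2)) \<partial>lborel)"
  proof -
    have e: "2 * (\<kappa> + 1) - 1 = 2 * \<kappa> + 1" by simp
    show ?thesis unfolding e by (subst integral_mu) (auto intro!: Bochner_Integration.integral_cong)
  qed
  also have "\<dots> = Gamma (\<kappa> + 1) / (D * b powr (\<kappa> + 1)) * exp (- l\<^sup>2 / (4 * b))"
    unfolding integral_mult_right_zero using kappa b by (subst gaussian_bessel) auto
  finally show ?thesis .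
qed

text \<open>Only the odd part of the kernel survives, and it contributes a second factor x. The
  resulting x^2 raises the weight from \<kappa> to \<kappa> + 1, so that the Gaussian integral
  applies with parameter \<kappa> + 2.\<close>

lemma fourier_gauss1:
  assumes b: "b > 0"
  shows "fourier (\<lambda>x. complex_of_real (x * exp (- b * x\<^sup>2))) l =
    - \<i> * complex_of_real (Gamma (\<kappa> + 2) / (2 * (\<kappa> + 1) * D * b powr (\<kappa> + 2)) * (l * exp (- l\<^sup>2 / (4 * b))))"
proof -
  have avg: "(dunkl_wave (\<kappa> + 1) (- (l * x)) * complex_of_real (x * exp (- b * x\<^sup>2)) +
      dunkl_wave (\<kappa> + 1) (- (l * (- x))) * complex_of_real (- x * exp (- b * (- x)\<^sup>2))) / 2
    = - \<i> * complex_of_real (l / (2 * (\<kappa> + 1)) * (x\<^sup>2 * exp (- b * x\<^sup>2) * bessel_sq (\<kappa> + 2) ((l * x)\<^sup>2)))" for x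
  proof -
    define q where "q = l * x / (2 * (\<kappa> + 1)) * bessel_sq (\<kappa> + 1 + 1) ((l * x)\<^sup>2)"
    have w: "dunkl_wave (\<kappa> + 1) (- (l * x)) = Complex (bessel_sq (\<kappa> + 1) ((l * x)\<^sup>2)) (- q)"
      "dunkl_wave (\<kappa> + 1) (- (l * (- x))) = Complex (bessel_sq (\<kappa> + 1) ((l * x)\<^sup>2)) q"
      by (simp_all add: complex_eq_iff q_def)
    have "q * x = l / (2 * (\<kappa> + 1)) * (x\<^sup>2 * bessel_sq (\<kappa> + 2) ((l * x)\<^sup>2))"
      by (simp add: q_def power2_eq_square add.assoc)
    then have "l / (2 * (\<kappa> + 1)) * (x\<^sup>2 * exp (- b * x\<^sup>2) * bessel_sq (\<kappa> + 2) ((l * x)\<^sup>2)) = q * x * exp (- b * x\<^sup>2)"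
      by simp
    then show ?thesis unfolding w by (simp only:) (simp add: complex_eq_iff)
  qed
  have "fourier (\<lambda>x. complex_of_real (x * exp (- b * x\<^sup>2))) l =
      (\<integral>x. - \<i> * complex_of_real (l / (2 * (\<kappa> + 1)) * (x\<^sup>2 * exp (- b * x\<^sup>2) * bessel_sq (\<kappa> + 2) ((l * x)\<^sup>2))) \<partial>\<mu>)"
    unfolding fourier_def
    by (subst integral_mu_symmetrize, intro integrable_wave_mult integrable_of_real integrable_gauss1 b, simp only: avg)
  also have "\<dots> = - \<i> * complex_of_real (l / (2 * (\<kappa> + 1)) * (\<integral>x. x\<^sup>2 * exp (- b * x\<^sup>2) * bessel_sq (\<kappa> + 2) ((l * x)\<^sup>2) \<partial>\<mu>))"
    by (simp only: integral_mult_right_zero integral_complex_of_real)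
  also have "(\<integral>x. x\<^sup>2 * exp (- b * x\<^sup>2) * bessel_sq (\<kappa> + 2) ((l * x)\<^sup>2) \<partial>\<mu>) =
      (\<integral>x. 1 / D * (\<bar>x\<bar> powr (2 * (\<kappa> + 2) - 1) * exp (- b * x\<^sup>2) * bessel_sq (\<kappa> + 2) ((l * x)\<^sup>2)) \<partial>lborel)"
  proof (subst integral_mu, simp, rule integral_cong_AE)
    show "AE x in lborel. \<bar>x\<bar> powr (2 * \<kappa> + 1) / D * (x\<^sup>2 * exp (- b * x\<^sup>2) * bessel_sq (\<kappa> + 2) ((l * x)\<^sup>2)) =
        1 / D * (\<bar>x\<bar> powr (2 * (\<kappa> + 2) - 1) * exp (- b * x\<^sup>2) * bessel_sq (\<kappa> + 2) ((l * x)\<^sup>2))"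
      using AE_lborel_singleton[of 0]
    proof eventually_elim
      fix x :: real assume "x \<noteq> 0"
      then have e: "\<bar>x\<bar> powr (2 * (\<kappa> + 2) - 1) = \<bar>x\<bar> powr (2 * \<kappa> + 1) * x\<^sup>2"
        using powr_add[of "\<bar>x\<bar>" "2 * \<kappa> + 1" 2] by (simp add: algebra_simps)
      show "\<bar>x\<bar> powr (2 * \<kappa> + 1) / D * (x\<^sup>2 * exp (- b * x\<^sup>2) * bessel_sq (\<kappa> + 2) ((l * x)\<^sup>2)) =
        1 / D * (\<bar>x\<bar> powr (2 * (\<kappa> + 2) - 1) * exp (- b * x\<^sup>2) * bessel_sq (\<kappa> + 2) ((l * x)\<^sup>2))"
        unfolding e by simp
    qed
  qed auto
  also have "\<dots> = Gamma (\<kappa> + 2) / (D * b powr (\<kappa> + 2)) * exp (- l\<^sup>2 / (4 * b))"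
    unfolding integral_mult_right_zero using kappa b by (subst gaussian_bessel) auto
  finally show ?thesis by (simp add: mult_ac)
qed

text \<open>An even function of x is a function of s = exp(-x^2) in (0, 1]. Under this substitution
  the pairing with the Gaussian of parameter n + 1 becomes the n-th moment.\<close>

lemma AE_zero_of_even_moments:
  fixes k :: "real \<Rightarrow> real"
  assumes [measurable]: "k \<in> borel_measurable borel" and even: "\<And>x. k (- x) = k x"
    and int: "integrable \<mu> (\<lambda>x. k x * exp (- x\<^sup>2))"
    and mom: "\<And>b. b > 0 \<Longrightarrow> (\<integral>x. k x * exp (- b * x\<^sup>2) \<partial>\<mu>) = 0"
  shows "AE x in \<mu>. k x = 0"
proof -
  \<comment> \<open>One Gaussian factor is put into the measure, which makes it finite; this is the
    shift between the moment n and the parameter n + 1.\<close>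
  define N where "N = distr (density \<mu> (\<lambda>x. ennreal (exp (- x\<^sup>2)))) borel (\<lambda>x. exp (- x\<^sup>2))"
  define k' where "k' = (\<lambda>s. k (sqrt (- ln s)))"
  have [measurable]: "k' \<in> borel_measurable borel" by (simp add: k'_def)
  have k': "k' (exp (- x\<^sup>2)) = k x" for x using even[of x] by (auto simp: k'_def abs_if)
  have "AE s in N. k' s = 0"
  proof (rule AE_zero_of_moments)
    have "(\<integral>\<^sup>+x. ennreal (exp (- x\<^sup>2)) \<partial>\<mu>) < \<infinity>"
      using integrable_gauss(1)[of 1] by (simp add: integrable_iff_bounded)
    then show "finite_measure N"
      by (intro finite_measureI) (auto simp: N_def emeasure_distr emeasure_density)
    show "AE s in N. s \<in> {0..1}" unfolding N_def
      by (subst AE_distr_iff) (auto simp: AE_density)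
    show "integrable N k'" unfolding N_def
      by (subst integrable_distr_eq, simp, simp, subst integrable_density) (use int in \<open>auto simp: k' mult.commute\<close>)
    fix n
    have "(\<integral>s. k' s * s ^ n \<partial>N) = (\<integral>x. exp (- x\<^sup>2) *\<^sub>R (k x * exp (- x\<^sup>2) ^ n) \<partial>\<mu>)"
      unfolding N_def by (subst integral_distr, simp, simp, subst integral_density) (auto simp: k')
    also have "\<dots> = (\<integral>x. k x * exp (- real (Suc n) * x\<^sup>2) \<partial>\<mu>)"
      by (intro Bochner_Integration.integral_cong) (auto simp: algebra_simps simp flip: exp_of_nat_mult exp_add)
    also have "\<dots> = 0" by (rule mom) simp
    finally show "(\<integral>s. k' s * s ^ n \<partial>N) = 0" .
  qed (simp add: N_def)
  then show ?thesis unfolding N_def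
    by (subst (asm) AE_distr_iff, simp, simp, subst (asm) AE_density) (auto simp: k')
qed

text \<open>The even part of \<open>h\<close> is tested by exp(-bx^2). The odd part, multiplied by
  x, is even and is tested by the same Gaussians through x exp(-bx^2).\<close>

lemma AE_zero_of_gaussian_pairings:
  fixes h :: "real \<Rightarrow> real"
  assumes [measurable]: "h \<in> borel_measurable borel"
    and int: "integrable \<mu> (\<lambda>x. h x * exp (- x\<^sup>2))" "integrable \<mu> (\<lambda>x. h x * (x * exp (- x\<^sup>2)))"
    and mom: "\<And>b. b > 0 \<Longrightarrow> integrable \<mu> (\<lambda>x. h x * exp (- b * x\<^sup>2))" "\<And>b. b > 0 \<Longrightarrow> integrable \<mu> (\<lambda>x. h x * (x * exp (- b * x\<^sup>2)))"
      "\<And>b. b > 0 \<Longrightarrow> (\<integral>x. h x * exp (- b * x\<^sup>2) \<partial>\<mu>) = 0" "\<And>b. b > 0 \<Longrightarrow> (\<integral>x. h x * (x * exp (- b * x\<^sup>2)) \<partial>\<mu>) = 0"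
  shows "AE x in \<mu>. h x = 0"
proof -
  have refl: "integrable \<mu> (\<lambda>x. f (- x))" "(\<integral>x. f (- x) \<partial>\<mu>) = (\<integral>x. f x \<partial>\<mu>)" if "integrable \<mu> f" for f :: "real \<Rightarrow> real"
  proof -
    have m: "f \<in> borel_measurable borel" using that by (simp add: integrable_iff_bounded)
    show "integrable \<mu> (\<lambda>x. f (- x))"
      using that m by (subst (asm) distr_mu_uminus[symmetric], subst (asm) integrable_distr_eq) auto
    show "(\<integral>x. f (- x) \<partial>\<mu>) = (\<integral>x. f x \<partial>\<mu>)" by (rule integral_mu_uminus[OF m])
  qed
  have "AE x in \<mu>. h x + h (- x) = 0"
  proof (rule AE_zero_of_even_moments)
    fix b :: real assume b: "b > 0"
    show "(\<integral>x. (h x + h (- x)) * exp (- b * x\<^sup>2) \<partial>\<mu>) = 0"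
      using mom(3)[OF b] mom(1)[OF b] refl[OF mom(1)[OF b]] by (simp add: distrib_right)
  qed (use int(1) refl(1)[OF int(1)] in \<open>auto simp: distrib_right\<close>)
  moreover have "AE x in \<mu>. x * (h x - h (- x)) = 0"
  proof (rule AE_zero_of_even_moments)
    have e: "x * (h x - h (- x)) * E = h x * (x * E) + h (- x) * (- x * E)" for x E by (simp add: algebra_simps)
    show "integrable \<mu> (\<lambda>x. x * (h x - h (- x)) * exp (- x\<^sup>2))"
      unfolding e using int(2) refl(1)[OF int(2)] by simp
    fix b :: real assume b: "b > 0"
    show "(\<integral>x. x * (h x - h (- x)) * exp (- b * x\<^sup>2) \<partial>\<mu>) = 0"
      unfolding e using mom(4)[OF b] mom(2)[OF b] refl[OF mom(2)[OF b]] by simp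
  qed (auto simp: algebra_simps)
  ultimately show ?thesis using AE_mu_nonzero by eventually_elim auto
qed

section \<open>Square integrable functions\<close>

definition L2 :: "(real \<Rightarrow> complex) \<Rightarrow> bool" where
  "L2 f \<longleftrightarrow> f \<in> borel_measurable borel \<and> (\<integral>\<^sup>+x. (ennreal (cmod (f x)))\<^sup>2 \<partial>\<mu>) < \<infinity>"

lemma ennreal_powr_2: "ennreal_powr a 2 = a\<^sup>2"
  by (cases a) (auto simp: power2_eq_square ennreal_mult ennreal_top_mult)

lemma Lnorm_2: "Lnorm \<mu> 2 g = ennreal_powr (\<integral>\<^sup>+x. (g x)\<^sup>2 \<partial>\<mu>) (1 / 2)"
  by (simp add: Lnorm_def ennreal_powr_2)

lemma Lspace_2_iff: "f \<in> Lspace \<mu> 2 \<longleftrightarrow> L2 f"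
proof -
  have "ennreal_powr a (1 / 2) < \<infinity> \<longleftrightarrow> a < \<infinity>" for a by (cases a) auto
  then show ?thesis by (simp add: Lspace_def L2_def Lnorm_2)
qed

lemma Lspace_1_iff: "f \<in> Lspace \<mu> 1 \<longleftrightarrow> integrable \<mu> f"
  by (simp add: Lspace_def Lnorm_def integrable_iff_bounded)

lemma nn_integral_L2_mult:
  assumes "L2 f" "L2 g"
  shows "(\<integral>\<^sup>+x. ennreal (cmod (f x)) * ennreal (cmod (g x)) \<partial>\<mu>) < \<infinity>"
proof -
  have [measurable]: "f \<in> borel_measurable borel" "g \<in> borel_measurable borel" using assms by (auto simp: L2_def)
  have "(\<integral>\<^sup>+x. ennreal (cmod (f x)) * ennreal (cmod (g x)) \<partial>\<mu>)\<^sup>2 \<le>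
    (\<integral>\<^sup>+x. (ennreal (cmod (f x)))\<^sup>2 \<partial>\<mu>) * (\<integral>\<^sup>+x. (ennreal (cmod (g x)))\<^sup>2 \<partial>\<mu>)"
    by (rule Cauchy_Schwarz_nn_integral) auto
  also have "\<dots> < \<infinity>" using assms by (simp add: L2_def ennreal_mult_less_top)
  finally show ?thesis by (auto simp: power2_eq_square ennreal_mult_less_top)
qed

lemma integrable_L2_mult:
  assumes "L2 f" "L2 g"
  shows "integrable \<mu> (\<lambda>x. f x * g x)"
proof -
  have [measurable]: "f \<in> borel_measurable borel" "g \<in> borel_measurable borel" using assms by (auto simp: L2_def)
  show ?thesis using nn_integral_L2_mult[OF assms]
    by (simp add: integrable_iff_bounded norm_mult ennreal_mult)
qed

text \<open>Cauchy-Schwarz, applied to the difference. The products are assumed integrable, instead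
  of \<open>s n\<close> and \<open>f\<close> square integrable, since the lemma is applied to
  transforms of approximating functions, of which only boundedness and norm convergence are at
  hand.\<close>

lemma L2_tendsto_integral:
  assumes lim: "(\<lambda>n. Lnorm \<mu> 2 (absval (\<lambda>x. s n x - f x))) \<longlonglongrightarrow> 0"
    and [measurable]: "\<And>n. s n \<in> borel_measurable borel" "f \<in> borel_measurable borel"
    and \<phi>: "L2 \<phi>" and int: "\<And>n. integrable \<mu> (\<lambda>x. s n x * \<phi> x)" "integrable \<mu> (\<lambda>x. f x * \<phi> x)"
  shows "(\<lambda>n. \<integral>x. s n x * \<phi> x \<partial>\<mu>) \<longlonglongrightarrow> (\<integral>x. f x * \<phi> x \<partial>\<mu>)"
proof -
  have [measurable]: "\<phi> \<in> borel_measurable borel" using \<phi> by (simp add: L2_def)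
  define I where "I = (\<lambda>n. \<integral>\<^sup>+x. (ennreal (cmod (s n x - f x)))\<^sup>2 \<partial>\<mu>)"
  define K where "K = (\<integral>\<^sup>+x. (ennreal (cmod (\<phi> x)))\<^sup>2 \<partial>\<mu>)"
  have K: "K < \<infinity>" using \<phi> by (simp add: K_def L2_def)
  have sq: "I n = ennreal_powr (I n) (1 / 2) * ennreal_powr (I n) (1 / 2)" for n
    using ennreal_powr_powr_inverse(1)[of 2 "I n"] ennreal_powr_2[of "ennreal_powr (I n) (1 / 2)"] ennreal_powr_powr_inverse(2)[of 2 "I n"]
    by (simp add: power2_eq_square)
  have lim': "(\<lambda>n. ennreal_powr (I n) (1 / 2)) \<longlonglongrightarrow> 0" using lim unfolding Lnorm_2 I_def .
  have I0: "I \<longlonglongrightarrow> 0"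
    using tendsto_mult_ennreal[OF lim' lim'] by (simp flip: sq)
  define a where "a = (\<lambda>n. \<integral>\<^sup>+x. ennreal (cmod (s n x - f x)) * ennreal (cmod (\<phi> x)) \<partial>\<mu>)"
  have a2: "(a n)\<^sup>2 \<le> I n * K" for n
    unfolding a_def I_def K_def by (rule Cauchy_Schwarz_nn_integral) auto
  have "(\<lambda>n. I n * K) \<longlonglongrightarrow> 0 * K"
    using K by (intro tendsto_mult_ennreal I0 tendsto_const) auto
  then have IK: "(\<lambda>n. I n * K) \<longlonglongrightarrow> 0" by simp
  have a_bound: "ennreal (cmod ((\<integral>x. s n x * \<phi> x \<partial>\<mu>) - (\<integral>x. f x * \<phi> x \<partial>\<mu>))) \<le> a n" for n
  proof -
    have "(\<integral>x. s n x * \<phi> x \<partial>\<mu>) - (\<integral>x. f x * \<phi> x \<partial>\<mu>) = (\<integral>x. (s n x - f x) * \<phi> x \<partial>\<mu>)"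
      using int by (simp add: left_diff_distrib)
    also have "ennreal (cmod \<dots>) \<le> (\<integral>\<^sup>+x. ennreal (cmod ((s n x - f x) * \<phi> x)) \<partial>\<mu>)"
    proof (rule integral_norm_bound_ennreal)
      show "integrable \<mu> (\<lambda>x. (s n x - f x) * \<phi> x)" using int by (simp add: left_diff_distrib)
    qed
    also have "\<dots> = a n" by (simp add: a_def norm_mult ennreal_mult)
    finally show ?thesis .
  qed
  have "(\<lambda>n. (cmod ((\<integral>x. s n x * \<phi> x \<partial>\<mu>) - (\<integral>x. f x * \<phi> x \<partial>\<mu>)))\<^sup>2) \<longlonglongrightarrow> 0"
  proof -
    have "(\<lambda>n. ennreal ((cmod ((\<integral>x. s n x * \<phi> x \<partial>\<mu>) - (\<integral>x. f x * \<phi> x \<partial>\<mu>)))\<^sup>2)) \<longlonglongrightarrow> 0"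
    proof (rule tendsto_sandwich[OF _ _ tendsto_const IK])
      show "\<forall>\<^sub>F n in sequentially. ennreal ((cmod ((\<integral>x. s n x * \<phi> x \<partial>\<mu>) - (\<integral>x. f x * \<phi> x \<partial>\<mu>)))\<^sup>2) \<le> I n * K"
      proof (intro always_eventually allI)
        fix n
        have "ennreal ((cmod ((\<integral>x. s n x * \<phi> x \<partial>\<mu>) - (\<integral>x. f x * \<phi> x \<partial>\<mu>)))\<^sup>2) =
           (ennreal (cmod ((\<integral>x. s n x * \<phi> x \<partial>\<mu>) - (\<integral>x. f x * \<phi> x \<partial>\<mu>))))\<^sup>2" by (simp add: ennreal_power)
        also have "\<dots> \<le> (a n)\<^sup>2" using a_bound by (intro power_mono) auto
        finally show "ennreal ((cmod ((\<integral>x. s n x * \<phi> x \<partial>\<mu>) - (\<integral>x. f x * \<phi> x \<partial>\<mu>)))\<^sup>2) \<le> I n * K"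
          using a2 order_trans by blast
      qed
    qed simp
    then show ?thesis
      by (subst (asm) ennreal_0[symmetric], subst (asm) tendsto_ennreal_iff) auto
  qed
  then have "(\<lambda>n. cmod ((\<integral>x. s n x * \<phi> x \<partial>\<mu>) - (\<integral>x. f x * \<phi> x \<partial>\<mu>))) \<longlonglongrightarrow> 0"
    using tendsto_real_sqrt[of "\<lambda>n. (cmod ((\<integral>x. s n x * \<phi> x \<partial>\<mu>) - (\<integral>x. f x * \<phi> x \<partial>\<mu>)))\<^sup>2" 0] by simp
  then show ?thesis by (simp add: LIM_zero_iff tendsto_norm_zero_iff)
qed

lemma borel_measurable_fourier:
  assumes f: "integrable \<mu> f"
  shows "fourier f \<in> borel_measurable borel"
proof -
  have [measurable]: "f \<in> borel_measurable borel" using f by (simp add: integrable_iff_bounded)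
  show ?thesis unfolding fourier_def[abs_def] by measurable
qed

lemma norm_fourier_le:
  assumes f: "integrable \<mu> f"
  shows "norm (fourier f l) \<le> (\<integral>x. norm (f x) \<partial>\<mu>)"
proof -
  have "norm (fourier f l) \<le> (\<integral>x. norm (dunkl_wave (\<kappa> + 1) (- (l * x)) * f x) \<partial>\<mu>)"
    unfolding fourier_def by (rule integral_norm_bound)
  also have "\<dots> \<le> (\<integral>x. norm (f x) \<partial>\<mu>)"
  proof (rule integral_mono)
    show "integrable \<mu> (\<lambda>x. norm (dunkl_wave (\<kappa> + 1) (- (l * x)) * f x))" by (intro integrable_norm integrable_wave_mult f)
    show "integrable \<mu> (\<lambda>x. norm (f x))" using f by (rule integrable_norm)
    show "norm (dunkl_wave (\<kappa> + 1) (- (l * x)) * f x) \<le> norm (f x)" for x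
      using kappa by (auto simp: norm_mult intro!: mult_left_le_one_le norm_dunkl_wave_le)
  qed
  finally show ?thesis .
qed

text \<open>The multiplication formula: the kernel is symmetric in its two arguments and bounded by
  1, so Fubini's theorem applies to integrable functions.\<close>

lemma fourier_exchange:
  assumes f: "integrable \<mu> f" and g: "integrable \<mu> g"
  shows "(\<integral>l. fourier f l * g l \<partial>\<mu>) = (\<integral>x. f x * fourier g x \<partial>\<mu>)"
proof -
  have [measurable]: "f \<in> borel_measurable borel" "g \<in> borel_measurable borel" using f g by (simp_all add: integrable_iff_bounded)
  interpret MM: pair_sigma_finite \<mu> \<mu> ..
  define k where "k = (\<lambda>l x. dunkl_wave (\<kappa> + 1) (- (l * x)) * f x * g l)"
  have [measurable]: "(\<lambda>(l, x). k l x) \<in> borel_measurable (borel \<Otimes>\<^sub>M borel)" unfolding k_def by measurable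
  have kb: "norm (k l x) \<le> norm (f x) * norm (g l)" for l x
    using kappa by (auto simp: k_def norm_mult mult.assoc intro!: mult_left_le_one_le norm_dunkl_wave_le)
  have "integrable (\<mu> \<Otimes>\<^sub>M \<mu>) (\<lambda>(l, x). k l x)"
  proof (rule integrableI_bounded)
    have "(\<integral>\<^sup>+z. ennreal (norm (case z of (l, x) \<Rightarrow> k l x)) \<partial>(\<mu> \<Otimes>\<^sub>M \<mu>)) = (\<integral>\<^sup>+l. (\<integral>\<^sup>+x. ennreal (norm (k l x)) \<partial>\<mu>) \<partial>\<mu>)"
      by (subst mu.nn_integral_fst[symmetric]) (auto cong: measurable_cong_sets sets_pair_measure_cong)
    also have "\<dots> \<le> (\<integral>\<^sup>+l. (\<integral>\<^sup>+x. ennreal (norm (f x)) * ennreal (norm (g l)) \<partial>\<mu>) \<partial>\<mu>)"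
      using kb by (intro nn_integral_mono) (simp flip: ennreal_mult)
    also have "\<dots> = (\<integral>\<^sup>+x. ennreal (norm (f x)) \<partial>\<mu>) * (\<integral>\<^sup>+l. ennreal (norm (g l)) \<partial>\<mu>)"
      by (subst nn_integral_multc, simp) (subst nn_integral_cmult, auto)
    also have "\<dots> < \<infinity>" using f g by (simp add: integrable_iff_bounded ennreal_mult_less_top)
    finally show "(\<integral>\<^sup>+z. ennreal (norm (case z of (l, x) \<Rightarrow> k l x)) \<partial>(\<mu> \<Otimes>\<^sub>M \<mu>)) < \<infinity>" .
  qed (auto cong: measurable_cong_sets sets_pair_measure_cong)
  then have "(\<integral>x. (\<integral>l. k l x \<partial>\<mu>) \<partial>\<mu>) = (\<integral>l. (\<integral>x. k l x \<partial>\<mu>) \<partial>\<mu>)" by (rule MM.Fubini_integral)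
  moreover have "(\<integral>l. k l x \<partial>\<mu>) = f x * fourier g x" for x
  proof -
    have "k l x = f x * (dunkl_wave (\<kappa> + 1) (- (x * l)) * g l)" for l by (simp add: k_def mult_ac)
    then show ?thesis unfolding fourier_def by (simp only: integral_mult_right_zero)
  qed
  moreover have "(\<integral>x. k l x \<partial>\<mu>) = fourier f l * g l" for l
    unfolding k_def fourier_def by (rule integral_mult_left_zero)
  ultimately show ?thesis by simp
qed

section \<open>Uniqueness and injectivity of the transform by pairing with Gaussians\<close>

lemma L2_gauss:
  assumes "b > 0"
  shows "L2 (\<lambda>x. complex_of_real (exp (- b * x\<^sup>2)))" "L2 (\<lambda>x. complex_of_real (x * exp (- b * x\<^sup>2)))"
proof -
  have 1: "(ennreal (cmod (complex_of_real (exp (- b * x\<^sup>2)))))\<^sup>2 = ennreal (norm (exp (- (2 * b) * x\<^sup>2)))" for x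
    by (simp add: ennreal_power flip: exp_of_nat_mult)
  have 2: "(ennreal (cmod (complex_of_real (x * exp (- b * x\<^sup>2)))))\<^sup>2 = ennreal (norm (x\<^sup>2 * exp (- (2 * b) * x\<^sup>2)))" for x
    by (simp add: ennreal_power norm_mult power_mult_distrib flip: exp_of_nat_mult del: of_real_mult of_real_exp)
  show "L2 (\<lambda>x. complex_of_real (exp (- b * x\<^sup>2)))"
    unfolding L2_def 1 using integrable_gauss(1)[of "2 * b"] assms by (auto simp: integrable_iff_bounded)
  show "L2 (\<lambda>x. complex_of_real (x * exp (- b * x\<^sup>2)))"
    unfolding L2_def 2 using integrable_gauss(2)[of "2 * b"] assms by (auto simp: integrable_iff_bounded)
qed

lemma L2_eq_AE:
  assumes f: "L2 f" and g: "L2 g"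
    and eq: "\<And>b. b > 0 \<Longrightarrow> (\<integral>x. f x * complex_of_real (exp (- b * x\<^sup>2)) \<partial>\<mu>) = (\<integral>x. g x * complex_of_real (exp (- b * x\<^sup>2)) \<partial>\<mu>)"
      "\<And>b. b > 0 \<Longrightarrow> (\<integral>x. f x * complex_of_real (x * exp (- b * x\<^sup>2)) \<partial>\<mu>) = (\<integral>x. g x * complex_of_real (x * exp (- b * x\<^sup>2)) \<partial>\<mu>)"
  shows "AE x in \<mu>. f x = g x"
proof -
  have [measurable]: "f \<in> borel_measurable borel" "g \<in> borel_measurable borel" using f g by (auto simp: L2_def)
  define h where "h = (\<lambda>x. f x - g x)"
  have [measurable]: "h \<in> borel_measurable borel" by (simp add: h_def)
  have i: "integrable \<mu> (\<lambda>x. h x * complex_of_real (exp (- b * x\<^sup>2)))" "integrable \<mu> (\<lambda>x. h x * complex_of_real (x * exp (- b * x\<^sup>2)))"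
    and z: "(\<integral>x. h x * complex_of_real (exp (- b * x\<^sup>2)) \<partial>\<mu>) = 0" "(\<integral>x. h x * complex_of_real (x * exp (- b * x\<^sup>2)) \<partial>\<mu>) = 0" if b: "b > 0" for b
    using integrable_L2_mult[OF f L2_gauss(1)[OF b]] integrable_L2_mult[OF g L2_gauss(1)[OF b]]
      integrable_L2_mult[OF f L2_gauss(2)[OF b]] integrable_L2_mult[OF g L2_gauss(2)[OF b]] eq[OF b]
    by (simp_all add: h_def left_diff_distrib del: of_real_mult)
  \<comment> \<open>\<open>T\<close> stands for the real and the imaginary part; both commute with
    multiplication by the real test functions.\<close>
  have part: "AE x in \<mu>. T (h x) = 0"
    if T: "bounded_linear T" and Tr: "\<And>u t. T (u * complex_of_real t) = T u * t" for T :: "complex \<Rightarrow> real"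
  proof -
    have [measurable]: "T \<in> borel_measurable borel"
      by (intro borel_measurable_continuous_onI linear_continuous_on T)
    have i': "integrable \<mu> (\<lambda>x. T (h x) * exp (- b * x\<^sup>2))" "integrable \<mu> (\<lambda>x. T (h x) * (x * exp (- b * x\<^sup>2)))"
      and z': "(\<integral>x. T (h x) * exp (- b * x\<^sup>2) \<partial>\<mu>) = 0" "(\<integral>x. T (h x) * (x * exp (- b * x\<^sup>2)) \<partial>\<mu>) = 0" if b: "b > 0" for b
      using integrable_bounded_linear[OF T i(1)[OF b]] integrable_bounded_linear[OF T i(2)[OF b]]
        integral_bounded_linear[OF T i(1)[OF b]] integral_bounded_linear[OF T i(2)[OF b]] z[OF b]
        bounded_linear.linear[OF T, THEN linear_0]
      unfolding Tr by simp_all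
    show ?thesis
      by (rule AE_zero_of_gaussian_pairings) (use i' z' i'[of 1] in simp_all)
  qed
  have "AE x in \<mu>. Re (h x) = 0" by (rule part) (auto intro: bounded_linear_Re)
  moreover have "AE x in \<mu>. Im (h x) = 0" by (rule part) (auto intro: bounded_linear_Im)
  ultimately show ?thesis by eventually_elim (auto simp: h_def complex_eq_iff)
qed

text \<open>The multiplication formula passes to the closure of the graph because each side is
  continuous along the approximating sequence. Integrability of \<open>\<phi>\<close> is for the
  formula itself, square integrability of \<open>\<phi>\<close> and of its transform for the two
  limits.\<close>

lemma transform_pairing:
  assumes T: "dunkl_transform_L2 \<kappa> f g" and \<phi>: "integrable \<mu> \<phi>" "L2 \<phi>" "L2 (fourier \<phi>)"
  shows "(\<integral>l. g l * \<phi> l \<partial>\<mu>) = (\<integral>x. f x * fourier \<phi> x \<partial>\<mu>)"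
proof -
  obtain s where fg: "L2 f" "L2 g" and s: "\<And>n. integrable \<mu> (s n)" "\<And>n. L2 (s n)"
    and lim: "(\<lambda>n. Lnorm \<mu> 2 (absval (\<lambda>x. s n x - f x))) \<longlonglongrightarrow> 0"
      "(\<lambda>n. Lnorm \<mu> 2 (absval (\<lambda>x. fourier (s n) x - g x))) \<longlonglongrightarrow> 0"
    using T unfolding dunkl_transform_L2_def by (auto simp: Let_def Lspace_2_iff Lspace_1_iff dunkl_transform_eq)
  have m: "f \<in> borel_measurable borel" "g \<in> borel_measurable borel" "s n \<in> borel_measurable borel" "\<phi> \<in> borel_measurable borel" for n
    using fg s \<phi> by (auto simp: L2_def)
  note [measurable] = m borel_measurable_fourier[OF s(1)]
  have "(\<lambda>n. \<integral>x. fourier (s n) x * \<phi> x \<partial>\<mu>) \<longlonglongrightarrow> (\<integral>x. g x * \<phi> x \<partial>\<mu>)"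
  proof (rule L2_tendsto_integral[OF lim(2) _ _ \<phi>(2)])
    fix n
    \<comment> \<open>The transform of \<open>s n\<close> enters as a bounded function, paired with
      the integrable \<open>\<phi>\<close>.\<close>
    show "integrable \<mu> (\<lambda>x. fourier (s n) x * \<phi> x)"
    proof (rule Bochner_Integration.integrable_bound)
      show "integrable \<mu> (\<lambda>x. complex_of_real (\<integral>x. norm (s n x) \<partial>\<mu>) * \<phi> x)" using \<phi> by simp
      show "AE x in \<mu>. norm (fourier (s n) x * \<phi> x) \<le> norm (complex_of_real (\<integral>x. norm (s n x) \<partial>\<mu>) * \<phi> x)"
        using norm_fourier_le[OF s(1), of n] by (intro AE_I2) (auto simp: norm_mult intro!: mult_right_mono)
    qed auto
  qed (use integrable_L2_mult fg \<phi> in auto)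
  moreover have "(\<lambda>n. \<integral>x. s n x * fourier \<phi> x \<partial>\<mu>) \<longlonglongrightarrow> (\<integral>x. f x * fourier \<phi> x \<partial>\<mu>)"
    by (rule L2_tendsto_integral[OF lim(1) _ _ \<phi>(3)]) (use integrable_L2_mult s(2) fg \<phi> in auto)
  moreover have "(\<integral>x. fourier (s n) x * \<phi> x \<partial>\<mu>) = (\<integral>x. s n x * fourier \<phi> x \<partial>\<mu>)" for n
    by (rule fourier_exchange[OF s(1) \<phi>(1)])
  ultimately show ?thesis using LIMSEQ_unique by simp
qed

lemma transform_L2I:
  assumes "integrable \<mu> f" "L2 f" "L2 (fourier f)"
  shows "dunkl_transform_L2 \<kappa> f (fourier f)"
  unfolding dunkl_transform_L2_def Let_def
  using assms by (auto simp: Lspace_2_iff Lspace_1_iff dunkl_transform_eq Lnorm_2 intro!: exI[of _ "\<lambda>_. f"])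

lemma L2_cmult:
  assumes "L2 f"
  shows "L2 (\<lambda>x. c * f x)"
proof -
  have [measurable]: "f \<in> borel_measurable borel" using assms by (auto simp: L2_def)
  have "(\<integral>\<^sup>+x. (ennreal (cmod (c * f x)))\<^sup>2 \<partial>\<mu>) = (\<integral>\<^sup>+x. (ennreal (cmod c))\<^sup>2 * (ennreal (cmod (f x)))\<^sup>2 \<partial>\<mu>)"
    by (simp add: norm_mult ennreal_mult power_mult_distrib)
  also have "\<dots> = (ennreal (cmod c))\<^sup>2 * (\<integral>\<^sup>+x. (ennreal (cmod (f x)))\<^sup>2 \<partial>\<mu>)"
    by (rule nn_integral_cmult) simp
  also have "\<dots> < \<infinity>" using assms by (simp add: L2_def ennreal_mult_less_top ennreal_power)
  finally show ?thesis by (simp add: L2_def)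
qed


text \<open>The parameter 1/(4b) is the one that the transform exchanges with b, so that every
  Gaussian is a nonzero multiple of a transform.\<close>

lemma fourier_gauss_rescaled:
  assumes b: "b > 0"
  obtains C where "C \<noteq> 0" "fourier (\<lambda>x. complex_of_real (exp (- (1 / (4 * b)) * x\<^sup>2))) = (\<lambda>l. C * complex_of_real (exp (- b * l\<^sup>2)))"
proof -
  define b' where "b' = 1 / (4 * b)"
  have b': "b' > 0" and e: "- l\<^sup>2 / (4 * b') = - b * l\<^sup>2" for l using b by (auto simp: b'_def)
  have G: "Gamma (\<kappa> + 1) > 0" using kappa by (intro Gamma_real_pos) auto
  show ?thesis
  proof (rule that[of "complex_of_real (Gamma (\<kappa> + 1) / (D * b' powr (\<kappa> + 1)))"])
    show "complex_of_real (Gamma (\<kappa> + 1) / (D * b' powr (\<kappa> + 1))) \<noteq> 0" using G D_pos b' by simp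
    show "fourier (\<lambda>x. complex_of_real (exp (- (1 / (4 * b)) * x\<^sup>2))) = (\<lambda>l. complex_of_real (Gamma (\<kappa> + 1) / (D * b' powr (\<kappa> + 1))) * complex_of_real (exp (- b * l\<^sup>2)))"
      using fourier_gauss[OF b'] unfolding e b'_def[symmetric] by (simp only: of_real_mult fun_eq_iff) simp
  qed
qed

lemma fourier_gauss1_rescaled:
  assumes b: "b > 0"
  obtains C where "C \<noteq> 0" "fourier (\<lambda>x. complex_of_real (x * exp (- (1 / (4 * b)) * x\<^sup>2))) = (\<lambda>l. C * complex_of_real (l * exp (- b * l\<^sup>2)))"
proof -
  define b' where "b' = 1 / (4 * b)"
  have b': "b' > 0" and e: "- l\<^sup>2 / (4 * b') = - b * l\<^sup>2" for l using b by (auto simp: b'_def)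
  have G: "Gamma (\<kappa> + 2) > 0" using kappa by (intro Gamma_real_pos) auto
  define C where "C = Gamma (\<kappa> + 2) / (2 * (\<kappa> + 1) * D * b' powr (\<kappa> + 2))"
  have "Gamma (\<kappa> + 2) \<noteq> 0" using G by linarith
  then have C: "C \<noteq> 0" using D_pos b' kappa by (simp add: C_def)
  show ?thesis
  proof (rule that[of "- \<i> * complex_of_real C"])
    show "- \<i> * complex_of_real C \<noteq> 0" using C by simp
    show "fourier (\<lambda>x. complex_of_real (x * exp (- (1 / (4 * b)) * x\<^sup>2))) = (\<lambda>l. - \<i> * complex_of_real C * complex_of_real (l * exp (- b * l\<^sup>2)))"
      unfolding b'_def[symmetric]
      by (rule ext, subst fourier_gauss1[OF b'], simp only: e C_def[symmetric]) (simp only: of_real_mult[of C] mult.assoc)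
  qed
qed

lemma gauss_complex_integrable:
  assumes b: "b > 0"
  shows "integrable \<mu> (\<lambda>x. complex_of_real (exp (- b * x\<^sup>2)))" "integrable \<mu> (\<lambda>x. complex_of_real (x * exp (- b * x\<^sup>2)))"
  by (intro integrable_of_real integrable_gauss integrable_gauss1 b)+

text \<open>Writing each Gaussian as a multiple of a transform, the pairing formula expresses the
  Gaussian pairings of \<open>f\<close> through \<open>g\<close>. They depend only on the
  almost-everywhere class of \<open>g\<close>, and the injectivity of the transform is read off from
  this.\<close>

lemma transform_gauss_cong:
  assumes T: "dunkl_transform_L2 \<kappa> f g" "dunkl_transform_L2 \<kappa> f' g'" and eq: "AE x in \<mu>. g x = g' x" and b: "b > 0"
  shows "(\<integral>x. f x * complex_of_real (exp (- b * x\<^sup>2)) \<partial>\<mu>) = (\<integral>x. f' x * complex_of_real (exp (- b * x\<^sup>2)) \<partial>\<mu>)"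
    and "(\<integral>x. f x * complex_of_real (x * exp (- b * x\<^sup>2)) \<partial>\<mu>) = (\<integral>x. f' x * complex_of_real (x * exp (- b * x\<^sup>2)) \<partial>\<mu>)"
proof -
  have b': "1 / (4 * b) > 0" using b by simp
  have [measurable]: "g \<in> borel_measurable borel" "g' \<in> borel_measurable borel"
    using T by (auto simp: dunkl_transform_L2_def Let_def Lspace_2_iff L2_def)
  obtain C where C: "C \<noteq> 0" "fourier (\<lambda>x. complex_of_real (exp (- (1 / (4 * b)) * x\<^sup>2))) = (\<lambda>l. C * complex_of_real (exp (- b * l\<^sup>2)))"
    by (rule fourier_gauss_rescaled[OF b])
  have L: "L2 (fourier (\<lambda>x. complex_of_real (exp (- (1 / (4 * b)) * x\<^sup>2))))" unfolding C(2) by (rule L2_cmult[OF L2_gauss(1)[OF b]])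
  have gg: "(\<integral>l. g l * complex_of_real (exp (- (1 / (4 * b)) * l\<^sup>2)) \<partial>\<mu>) = (\<integral>l. g' l * complex_of_real (exp (- (1 / (4 * b)) * l\<^sup>2)) \<partial>\<mu>)"
  proof (rule integral_cong_AE)
    show "AE l in \<mu>. g l * complex_of_real (exp (- (1 / (4 * b)) * l\<^sup>2)) = g' l * complex_of_real (exp (- (1 / (4 * b)) * l\<^sup>2))"
      using eq by eventually_elim simp
  qed auto
  have "(\<integral>x. f x * (C * complex_of_real (exp (- b * x\<^sup>2))) \<partial>\<mu>) = (\<integral>x. f' x * (C * complex_of_real (exp (- b * x\<^sup>2))) \<partial>\<mu>)"
    using transform_pairing[OF T(1) gauss_complex_integrable(1)[OF b'] L2_gauss(1)[OF b'] L] transform_pairing[OF T(2) gauss_complex_integrable(1)[OF b'] L2_gauss(1)[OF b'] L]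
      gg unfolding C(2) by simp
  then show "(\<integral>x. f x * complex_of_real (exp (- b * x\<^sup>2)) \<partial>\<mu>) = (\<integral>x. f' x * complex_of_real (exp (- b * x\<^sup>2)) \<partial>\<mu>)"
    unfolding mult.left_commute[of _ C] integral_mult_right_zero using C(1) by simp
  obtain C where C: "C \<noteq> 0" "fourier (\<lambda>x. complex_of_real (x * exp (- (1 / (4 * b)) * x\<^sup>2))) = (\<lambda>l. C * complex_of_real (l * exp (- b * l\<^sup>2)))"
    by (rule fourier_gauss1_rescaled[OF b])
  have L: "L2 (fourier (\<lambda>x. complex_of_real (x * exp (- (1 / (4 * b)) * x\<^sup>2))))" unfolding C(2) by (rule L2_cmult[OF L2_gauss(2)[OF b]])
  have gg: "(\<integral>l. g l * complex_of_real (l * exp (- (1 / (4 * b)) * l\<^sup>2)) \<partial>\<mu>) = (\<integral>l. g' l * complex_of_real (l * exp (- (1 / (4 * b)) * l\<^sup>2)) \<partial>\<mu>)"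
  proof (rule integral_cong_AE)
    show "AE l in \<mu>. g l * complex_of_real (l * exp (- (1 / (4 * b)) * l\<^sup>2)) = g' l * complex_of_real (l * exp (- (1 / (4 * b)) * l\<^sup>2))"
      using eq by eventually_elim simp
  qed auto
  have "(\<integral>x. f x * (C * complex_of_real (x * exp (- b * x\<^sup>2))) \<partial>\<mu>) = (\<integral>x. f' x * (C * complex_of_real (x * exp (- b * x\<^sup>2))) \<partial>\<mu>)"
    using transform_pairing[OF T(1) gauss_complex_integrable(2)[OF b'] L2_gauss(2)[OF b'] L] transform_pairing[OF T(2) gauss_complex_integrable(2)[OF b'] L2_gauss(2)[OF b'] L]
      gg unfolding C(2) by simp
  then show "(\<integral>x. f x * complex_of_real (x * exp (- b * x\<^sup>2)) \<partial>\<mu>) = (\<integral>x. f' x * complex_of_real (x * exp (- b * x\<^sup>2)) \<partial>\<mu>)"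
    unfolding mult.left_commute[of _ C] integral_mult_right_zero using C(1) by simp
qed

lemma transform_L2_D:
  assumes "dunkl_transform_L2 \<kappa> f g"
  shows "L2 f" "L2 g"
  using assms by (auto simp: dunkl_transform_L2_def Let_def Lspace_2_iff)

lemma transform_injective:
  assumes "dunkl_transform_L2 \<kappa> f g" "dunkl_transform_L2 \<kappa> f' g'" "AE x in \<mu>. g x = g' x"
  shows "AE x in \<mu>. f x = f' x"
  using transform_L2_D[OF assms(1)] transform_L2_D[OF assms(2)] transform_gauss_cong[OF assms]
  by (intro L2_eq_AE) auto

text \<open>The pairing formula read in the other direction: the Gaussian pairings of
  \<open>g\<close> are pairings of \<open>f\<close> with transforms of Gaussians, hence determined
  by \<open>f\<close>.\<close>

lemma transform_unique:
  assumes T: "dunkl_transform_L2 \<kappa> f g" "dunkl_transform_L2 \<kappa> f g'"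
  shows "AE x in \<mu>. g x = g' x"
proof (rule L2_eq_AE)
  fix b :: real assume b: "b > 0"
  then have b': "1 / (4 * b) > 0" by simp
  have bb: "1 / (4 * (1 / (4 * b))) = b" by simp
  have L: "L2 (fourier (\<lambda>x. complex_of_real (exp (- b * x\<^sup>2))))" "L2 (fourier (\<lambda>x. complex_of_real (x * exp (- b * x\<^sup>2))))"
  proof -
    obtain C where "fourier (\<lambda>x. complex_of_real (exp (- b * x\<^sup>2))) = (\<lambda>l. C * complex_of_real (exp (- (1 / (4 * b)) * l\<^sup>2)))"
      by (rule fourier_gauss_rescaled[OF b', unfolded bb])
    then show "L2 (fourier (\<lambda>x. complex_of_real (exp (- b * x\<^sup>2))))"
      by (simp only:) (rule L2_cmult[OF L2_gauss(1)[OF b']])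
    obtain C where "fourier (\<lambda>x. complex_of_real (x * exp (- b * x\<^sup>2))) = (\<lambda>l. C * complex_of_real (l * exp (- (1 / (4 * b)) * l\<^sup>2)))"
      by (rule fourier_gauss1_rescaled[OF b', unfolded bb])
    then show "L2 (fourier (\<lambda>x. complex_of_real (x * exp (- b * x\<^sup>2))))"
      by (simp only:) (rule L2_cmult[OF L2_gauss(2)[OF b']])
  qed
  show "(\<integral>x. g x * complex_of_real (exp (- b * x\<^sup>2)) \<partial>\<mu>) = (\<integral>x. g' x * complex_of_real (exp (- b * x\<^sup>2)) \<partial>\<mu>)"
    using transform_pairing[OF T(1) gauss_complex_integrable(1)[OF b] L2_gauss(1)[OF b] L(1)] transform_pairing[OF T(2) gauss_complex_integrable(1)[OF b] L2_gauss(1)[OF b] L(1)] by simp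
  show "(\<integral>x. g x * complex_of_real (x * exp (- b * x\<^sup>2)) \<partial>\<mu>) = (\<integral>x. g' x * complex_of_real (x * exp (- b * x\<^sup>2)) \<partial>\<mu>)"
    using transform_pairing[OF T(1) gauss_complex_integrable(2)[OF b] L2_gauss(2)[OF b] L(2)] transform_pairing[OF T(2) gauss_complex_integrable(2)[OF b] L2_gauss(2)[OF b] L(2)] by simp
qed (use transform_L2_D T in auto)

section \<open>Identification of the translate\<close>

lemma integral_even_ball:
  fixes g :: "real \<Rightarrow> real"
  assumes [measurable]: "g \<in> borel_measurable borel" and even: "\<And>x. g (- x) = g x"
    and int: "integrable lborel (\<lambda>x. indicator {0..r} x * g x)"
  shows "(\<integral>x. indicator {- r<..<r} x * g x \<partial>lborel) = 2 * (\<integral>x. indicator {0..r} x * g x \<partial>lborel)"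
proof -
  have r: "(\<integral>x. indicator {0..r} (- x) * g (- x) \<partial>lborel) = (\<integral>x. indicator {0..r} x * g x \<partial>lborel)"
    using lborel_integral_real_affine[of "- 1" "\<lambda>x. indicator {0..r} x * g x" 0] by simp
  have i: "integrable lborel (\<lambda>x. indicator {0..r} (- x) * g (- x))"
    using lborel_integrable_real_affine[OF int, of "- 1" 0] by simp
  have "(\<integral>x. indicator {- r<..<r} x * g x \<partial>lborel) = (\<integral>x. indicator {0..r} x * g x + indicator {0..r} (- x) * g (- x) \<partial>lborel)"
  proof (rule integral_cong_AE)
    show "AE x in lborel. indicator {- r<..<r} x * g x = indicator {0..r} x * g x + indicator {0..r} (- x) * g (- x)"
      using AE_lborel_singleton[of 0] AE_lborel_singleton[of r] AE_lborel_singleton[of "- r"]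
      by eventually_elim (auto simp: even indicator_def)
  qed auto
  also have "\<dots> = 2 * (\<integral>x. indicator {0..r} x * g x \<partial>lborel)" using int i r by simp
  finally show ?thesis .
qed

text \<open>The radial integral has an explicit antiderivative \<open>F\<close>, by the classical
  rule for the derivative of x^\<nu> J_\<nu>(x). The factor 2 comes from the two half-lines.\<close>

lemma integral_ball_bessel:
  assumes r: "r > 0"
  shows "(\<integral>x. indicator {- r<..<r} x * bessel_sq (\<kappa> + 1) ((l * x)\<^sup>2) \<partial>\<mu>) =
    r powr (2 * \<kappa> + 2) / (D * (\<kappa> + 1)) * bessel_sq (\<kappa> + 2) ((l * r)\<^sup>2)"
proof -
  define c where "c = \<kappa> + 1"
  have c: "c > 1 / 2" and c2: "\<kappa> + 2 = c + 1" "2 * \<kappa> + 1 = 2 * c - 1" "2 * \<kappa> + 2 = 2 * c" using kappa by (auto simp: c_def)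
  have [measurable]: "bessel_sq c \<in> borel_measurable borel" unfolding c_def by measurable
  define A B where "A = (\<lambda>x. bessel_sq (c + 1) ((l * x)\<^sup>2))" and "B = (\<lambda>x. bessel_sq c ((l * x)\<^sup>2))"
  define f where "f = (\<lambda>x. \<bar>x\<bar> powr (2 * c - 1) * B x)"
  define F where "F = (\<lambda>x. x powr (2 * c) * A x / (2 * c))"
  have cont: "continuous_on S A" "continuous_on S B" for S
    unfolding A_def B_def using c by (auto intro!: continuous_intros)
  have [measurable]: "f \<in> borel_measurable borel"
    unfolding f_def using cont by (intro borel_measurable_times borel_measurable_continuous_onI[of B]) auto
  have "(f has_integral F r - F 0) {0..r}"
  proof (rule fundamental_theorem_of_calculus_interior)
    show "continuous_on {0..r} F"
      unfolding F_def using c by (intro continuous_intros cont continuous_on_powr') auto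
    fix x assume x: "x \<in> {0<..<r}"
    have con: "(l * x)\<^sup>2 * bessel_sq (c + 2) ((l * x)\<^sup>2) = 4 * c * (c + 1) * (A x - B x)"
      using bessel_sq_contiguous'[of c "(l * x)\<^sup>2"] c by (simp add: A_def B_def)
    have dA: "(A has_real_derivative (2 * c * (B x - A x) / x)) (at x)"
    proof -
      have "(A has_real_derivative (- bessel_sq (c + 2) ((l * x)\<^sup>2) / (4 * (c + 1)) * (2 * (l * x) * l))) (at x)"
        unfolding A_def using c by (auto intro!: derivative_eq_intros simp: add.assoc)
      also have "- bessel_sq (c + 2) ((l * x)\<^sup>2) / (4 * (c + 1)) * (2 * (l * x) * l) = - ((l * x)\<^sup>2 * bessel_sq (c + 2) ((l * x)\<^sup>2)) / (2 * (c + 1) * x)"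
      proof -
        have "- b / (4 * k) * (2 * (l * x) * l) = - ((l * x)\<^sup>2 * b) / (2 * k * x)" if "k > 0" for b k
          using that x by (simp add: field_simps power2_eq_square)
        from this[of "c + 1"] show ?thesis using c by simp
      qed
      also have "\<dots> = 2 * c * (B x - A x) / x"
      proof -
        have "- (4 * c * k * (A x - B x)) / (2 * k * x) = 2 * c * (B x - A x) / x" if "k > 0" for k
          using x that by (simp add: field_simps)
        from this[of "c + 1"] show ?thesis unfolding con using c by simp
      qed
      finally show ?thesis .
    qed
    have dp: "((\<lambda>x. x powr (2 * c)) has_real_derivative (2 * c * x powr (2 * c - 1))) (at x)"
      using x by (auto intro!: derivative_eq_intros)
    have pw: "x powr (2 * c) = x * x powr (2 * c - 1)"
      using x powr_add[of x 1 "2 * c - 1"] by simp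
    have "(F has_real_derivative ((2 * c * x powr (2 * c - 1)) * A x + (2 * c * (B x - A x) / x) * x powr (2 * c)) / (2 * c)) (at x)"
      unfolding F_def by (rule DERIV_cdivide[OF DERIV_mult[OF dp dA]])
    also have "((2 * c * x powr (2 * c - 1)) * A x + (2 * c * (B x - A x) / x) * x powr (2 * c)) / (2 * c) = f x"
      unfolding pw f_def using x c by (simp add: field_simps)
    finally show "(F has_vector_derivative f x) (at x)" by (simp add: has_real_derivative_iff_has_vector_derivative)
  qed (use r in simp)
  moreover have si: "set_integrable lborel {0..r} f"
    unfolding f_def using c by (intro borel_integrable_atLeastAtMost' continuous_intros cont continuous_on_powr') auto
  ultimately have I: "(\<integral>x. indicator {0..r} x * f x \<partial>lborel) = F r"
    using set_borel_integral_eq_integral(2)[OF si] c by (simp add: set_lebesgue_integral_def F_def integral_unique)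
  have "(\<integral>x. indicator {- r<..<r} x * bessel_sq (\<kappa> + 1) ((l * x)\<^sup>2) \<partial>\<mu>) = (\<integral>x. 1 / D * (indicator {- r<..<r} x * f x) \<partial>lborel)"
  proof -
    have m: "(\<lambda>x. indicator {- r<..<r} x * bessel_sq (\<kappa> + 1) ((l * x)\<^sup>2)) \<in> borel_measurable borel" by measurable
    show ?thesis unfolding integral_mu[OF m] unfolding c2 f_def B_def c_def[symmetric]
      by (intro Bochner_Integration.integral_cong refl) simp
  qed
  also have "\<dots> = 1 / D * (2 * F r)"
    using si
  proof -
    have "(\<integral>x. indicator {- r<..<r} x * f x \<partial>lborel) = 2 * (\<integral>x. indicator {0..r} x * f x \<partial>lborel)"
    proof (rule integral_even_ball)
      show "f (- x) = f x" for x by (simp add: f_def B_def)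
      show "integrable lborel (\<lambda>x. indicator {0..r} x * f x)" using si by (simp add: set_integrable_def)
    qed simp
    then show ?thesis by (simp only: I integral_mult_right_zero)
  qed
  also have "\<dots> = r powr (2 * c) / (D * c) * A r" using c D_pos by (simp add: F_def)
  finally show ?thesis unfolding c2 A_def c_def[symmetric] .
qed

text \<open>The decay of order |l|^-(\<kappa> + 3/2) leaves |l|^(-2) after squaring and multiplying
  by the density |l|^(2\<kappa> + 1), which is integrable at infinity. Near 0 the Bessel function is
  bounded by 1.\<close>

lemma L2_ball_transform:
  assumes r: "r > 0"
  shows "L2 (\<lambda>l. complex_of_real (\<integral>x. indicator {- r<..<r} x * bessel_sq (\<kappa> + 1) ((l * x)\<^sup>2) \<partial>\<mu>))"
proof -
  define K where "K = r powr (2 * \<kappa> + 2) / (D * (\<kappa> + 1))"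
  have "\<kappa> + 1 > 1 / 2" using kappa by simp
  from bessel_sq_decay[OF this] obtain C where C: "C > 0" "\<And>x. x > 0 \<Longrightarrow> x powr (\<kappa> + 3 / 2) * \<bar>bessel_sq (\<kappa> + 2) (x\<^sup>2)\<bar> \<le> C"
    by (auto simp: add.assoc)
  define j where "j = (\<lambda>l. bessel_sq (\<kappa> + 2) ((l * r)\<^sup>2))"
  have [measurable]: "j \<in> borel_measurable borel" by (simp add: j_def)
  \<comment> \<open>The maximum covers the bounds 1 for |l| \<le> 1 and the squared decay constant
    over l^2 beyond; the factor 2 pays for replacing both by 1 / (1 + l^2).\<close>
  define E where "E = 2 * max 1 ((C / r powr (\<kappa> + 3 / 2))\<^sup>2)"
  have bound: "\<bar>l\<bar> powr (2 * \<kappa> + 1) * (j l)\<^sup>2 \<le> E * inverse (1 + l\<^sup>2)" for l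
  proof (cases "\<bar>l\<bar> \<le> 1")
    case True
    have "\<bar>l\<bar> powr (2 * \<kappa> + 1) \<le> 1" using True kappa powr_mono2[of "2 * \<kappa> + 1" "\<bar>l\<bar>" 1] by simp
    moreover have "(j l)\<^sup>2 \<le> 1" using abs_bessel_sq_le[of "\<kappa> + 2" "(l * r)\<^sup>2"] kappa by (simp add: j_def abs_square_le_1)
    ultimately have "\<bar>l\<bar> powr (2 * \<kappa> + 1) * (j l)\<^sup>2 \<le> 1 * 1" by (intro mult_mono) auto
    also have "1 * 1 \<le> 2 * inverse (1 + l\<^sup>2)"
    proof -
      have "l\<^sup>2 \<le> 1" using True by (simp add: abs_square_le_1)
      then show ?thesis by (simp add: field_simps add_pos_nonneg)
    qed
    also have "\<dots> \<le> E * inverse (1 + l\<^sup>2)" by (intro mult_right_mono) (auto simp: E_def)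
    finally show ?thesis .
  next
    case False
    then have l: "\<bar>l\<bar> > 1" by simp
    have "(\<bar>l\<bar> * r) powr (\<kappa> + 3 / 2) * \<bar>j l\<bar> \<le> C"
      using C(2)[of "\<bar>l\<bar> * r"] l r by (simp add: j_def power_mult_distrib)
    then have "\<bar>l\<bar> powr (\<kappa> + 3 / 2) * \<bar>j l\<bar> \<le> C / r powr (\<kappa> + 3 / 2)"
      using l r by (simp add: powr_mult field_simps)
    then have "(\<bar>l\<bar> powr (\<kappa> + 3 / 2) * \<bar>j l\<bar>)\<^sup>2 \<le> (C / r powr (\<kappa> + 3 / 2))\<^sup>2"
      by (intro power_mono) auto
    also have "(\<bar>l\<bar> powr (\<kappa> + 3 / 2) * \<bar>j l\<bar>)\<^sup>2 = l\<^sup>2 * (\<bar>l\<bar> powr (2 * \<kappa> + 1) * (j l)\<^sup>2)"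
    proof -
      have "(\<bar>l\<bar> powr (\<kappa> + 3 / 2))\<^sup>2 = \<bar>l\<bar> powr (2 * \<kappa> + 1) * \<bar>l\<bar> powr 2"
      proof -
        have "(\<bar>l\<bar> powr (\<kappa> + 3 / 2))\<^sup>2 = \<bar>l\<bar> powr ((2 * \<kappa> + 1) + 2)"
          unfolding power2_eq_square powr_add[symmetric] by (simp add: algebra_simps)
        then show ?thesis by (simp only: powr_add)
      qed
      then show ?thesis using l by (simp add: power_mult_distrib)
    qed
    finally have "l\<^sup>2 * (\<bar>l\<bar> powr (2 * \<kappa> + 1) * (j l)\<^sup>2) \<le> E / 2" by (simp add: E_def)
    then have "\<bar>l\<bar> powr (2 * \<kappa> + 1) * (j l)\<^sup>2 \<le> E / (2 * l\<^sup>2)"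
      using l by (simp add: field_simps)
    also have "\<dots> \<le> E * inverse (1 + l\<^sup>2)"
    proof -
      have "1 \<le> l\<^sup>2" using abs_le_square_iff[of 1 l] l by simp
      moreover have "E \<ge> 0" by (simp add: E_def)
      moreover have "inverse (2 * l\<^sup>2) \<le> inverse (1 + l\<^sup>2)"
        using \<open>1 \<le> l\<^sup>2\<close> by (intro le_imp_inverse_le) (auto intro: add_pos_nonneg)
      ultimately show ?thesis unfolding divide_inverse by (intro mult_left_mono)
    qed
    finally show ?thesis .
  qed
  have fin: "(\<integral>\<^sup>+l. ennreal (inverse (1 + l\<^sup>2)) \<partial>lborel) < \<infinity>"
  proof -
    have "einterval (- \<infinity>) \<infinity> = UNIV" by (rule einterval_eq_UNIV)
    then have "integrable lborel (\<lambda>l::real. inverse (1 + l\<^sup>2))"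
      using integrable_inverse_1_plus_square by (simp add: set_integrable_def)
    moreover have "norm (inverse (1 + l\<^sup>2)) = inverse (1 + l\<^sup>2)" for l :: real by simp
    ultimately show ?thesis unfolding integrable_iff_bounded by (simp only:)
  qed
  have Kp: "K \<ge> 0" using D_pos kappa by (simp add: K_def)
  have "(\<integral>\<^sup>+l. (ennreal (cmod (complex_of_real (K * j l))))\<^sup>2 \<partial>\<mu>) = (\<integral>\<^sup>+l. ennreal (K\<^sup>2 / D) * ennreal (\<bar>l\<bar> powr (2 * \<kappa> + 1) * (j l)\<^sup>2) \<partial>lborel)"
  proof (subst nn_integral_mu, simp, rule nn_integral_cong)
    fix l :: real
    have "cmod (complex_of_real (K * j l)) = K * \<bar>j l\<bar>" unfolding norm_of_real using Kp by (simp add: abs_mult)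
    then have e: "(ennreal (cmod (complex_of_real (K * j l))))\<^sup>2 = ennreal (K\<^sup>2 * (j l)\<^sup>2)"
      using Kp by (simp only:) (simp add: ennreal_power power_mult_distrib)
    show "ennreal (\<bar>l\<bar> powr (2 * \<kappa> + 1) / D) * (ennreal (cmod (complex_of_real (K * j l))))\<^sup>2 =
        ennreal (K\<^sup>2 / D) * ennreal (\<bar>l\<bar> powr (2 * \<kappa> + 1) * (j l)\<^sup>2)"
      unfolding e using D_pos by (simp add: mult_ac flip: ennreal_mult)
  qed
  also have "\<dots> \<le> (\<integral>\<^sup>+l. ennreal (K\<^sup>2 / D) * (ennreal E * ennreal (inverse (1 + l\<^sup>2))) \<partial>lborel)"
    using bound by (intro nn_integral_mono mult_left_mono) (auto simp: E_def ennreal_leI simp flip: ennreal_mult)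
  also have "\<dots> = ennreal (K\<^sup>2 / D) * (ennreal E * (\<integral>\<^sup>+l. ennreal (inverse (1 + l\<^sup>2)) \<partial>lborel))"
    by (subst nn_integral_cmult, simp, subst nn_integral_cmult) auto
  also have "\<dots> < \<infinity>" using fin by (simp add: ennreal_mult_less_top)
  finally show ?thesis unfolding integral_ball_bessel[OF r] L2_def K_def[symmetric] j_def[symmetric]
    by (auto simp: j_def)
qed

lemma L2_bounded:
  assumes [measurable]: "f \<in> borel_measurable borel" and "\<And>x. norm (f x) \<le> indicator {- R<..<R} x"
  shows "L2 (\<lambda>x. f x)" "integrable \<mu> f"
proof -
  have "(\<integral>\<^sup>+x. (ennreal (cmod (f x)))\<^sup>2 \<partial>\<mu>) \<le> (\<integral>\<^sup>+x. indicator {- R<..<R} x \<partial>\<mu>)"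
  proof (rule nn_integral_mono)
    fix x
    have "cmod (f x) ^ 2 \<le> indicator {- R<..<R} x ^ 2" using assms(2)[of x] by (intro power_mono) auto
    also have "\<dots> = indicat_real {- R<..<R} x" by (simp add: indicator_def)
    finally show "(ennreal (cmod (f x)))\<^sup>2 \<le> indicator {- R<..<R} x"
      by (simp add: ennreal_power) (metis ennreal_indicator ennreal_leI)
  qed
  also have "\<dots> < \<infinity>" using emeasure_mu_interval[of R] by simp
  finally show "L2 (\<lambda>x. f x)" by (simp add: L2_def)
  show "integrable \<mu> f"
  proof (rule Bochner_Integration.integrable_bound)
    show "integrable \<mu> (indicator {- R<..<R} :: real \<Rightarrow> real)"
      using emeasure_mu_interval[of R] by (intro integrable_real_indicator) auto
    show "AE x in \<mu>. norm (f x) \<le> norm (indicator {- R<..<R} x :: real)" using assms(2) by auto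
  qed simp
qed

text \<open>The explicit function is a witness for the choice operator, so the chosen representative
  has the defining property too. The transform of the indicator occurring there agrees almost
  everywhere with the integral transform by uniqueness, and injectivity then identifies the
  representative almost everywhere.\<close>

theorem dunkl_translation_indicator:
  assumes r: "r > 0"
  shows "AE x in \<mu>. dunkl_translation \<kappa> (- y) (indicator (dunkl_ball 0 r)) x = complex_of_real (ball_translate r y x)"
proof -
  define f :: "real \<Rightarrow> real \<Rightarrow> complex" where "f = (\<lambda>y x. complex_of_real (ball_translate r y x))"
  define I where "I = (\<lambda>l. complex_of_real (\<integral>x. indicator {- r<..<r} x * bessel_sq (\<kappa> + 1) ((l * x)\<^sup>2) \<partial>\<mu>))"
  have I: "L2 I" unfolding I_def by (rule L2_ball_transform[OF r])
  have \<xi>: "indicator (dunkl_ball 0 r) = f 0"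
    by (rule ext) (auto simp: f_def ball_translate_0[OF r] dunkl_ball_def indicator_def)
  have bnd: "norm (f y x) \<le> indicator {- (r + \<bar>y\<bar>)<..<r + \<bar>y\<bar>} x" for y x
  proof (cases "\<bar>\<bar>x\<bar> - \<bar>y\<bar>\<bar> \<ge> r")
    case True
    then show ?thesis using ball_translate_eq_0[OF r True] by (simp add: f_def)
  next
    case False
    then have "x \<in> {- (r + \<bar>y\<bar>)<..<r + \<bar>y\<bar>}" by auto
    then show ?thesis using ball_translate_nonneg[of r y x] ball_translate_le_1[of r y x] by (simp add: f_def)
  qed
  have [measurable]: "f y \<in> borel_measurable borel" for y by (simp add: f_def)
  note fL = L2_bounded[OF _ bnd, simplified]
  have F: "fourier (f y) = (\<lambda>l. dunkl_wave (\<kappa> + 1) (- (l * y)) * I l)" for y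
    unfolding fourier_def f_def I_def by (rule ext) (rule transform_ball_translate[OF r])
  have FL: "L2 (fourier (f y))" for y
  proof -
    have [measurable]: "I \<in> borel_measurable borel" using I by (simp add: L2_def)
    have "(\<integral>\<^sup>+l. (ennreal (cmod (dunkl_wave (\<kappa> + 1) (- (l * y)) * I l)))\<^sup>2 \<partial>\<mu>) \<le> (\<integral>\<^sup>+l. (ennreal (cmod (I l)))\<^sup>2 \<partial>\<mu>)"
      using kappa by (intro nn_integral_mono power_mono ennreal_leI) (auto simp: norm_mult intro!: mult_left_le_one_le norm_dunkl_wave_le)
    then show ?thesis using I unfolding F L2_def by (auto intro: le_less_trans)
  qed
  have T: "dunkl_transform_L2 \<kappa> (f y) (fourier (f y))" for y
    by (rule transform_L2I[OF fL(2) fL(1) FL])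
  have "\<kappa> > - 1" using kappa by simp
  note ker = dunkl_kernel_imaginary(1)[OF this]
  have F0: "fourier (f y) l = dunkl_kernel \<kappa> (\<i> * complex_of_real (l * - y)) * fourier (f 0) l" for l
    unfolding ker F by simp
  define h where "h = dunkl_translation \<kappa> (- y) (f 0)"
  have "\<exists>Ff Fh. dunkl_transform_L2 \<kappa> (f 0) Ff \<and> dunkl_transform_L2 \<kappa> h Fh \<and>
        (AE x in \<mu>. Fh x = dunkl_kernel \<kappa> (\<i> * complex_of_real (x * - y)) * Ff x)"
    unfolding h_def dunkl_translation_def
    by (rule someI[of _ "f y"], rule exI[of _ "fourier (f 0)"], rule exI[of _ "fourier (f y)"]) (intro conjI T AE_I2 F0)
  then obtain Ff Fh where *: "dunkl_transform_L2 \<kappa> (f 0) Ff" "dunkl_transform_L2 \<kappa> h Fh"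
    "AE x in \<mu>. Fh x = dunkl_kernel \<kappa> (\<i> * complex_of_real (x * - y)) * Ff x" by blast
  have "AE x in \<mu>. Fh x = fourier (f y) x"
    using *(3) transform_unique[OF *(1) T] by eventually_elim (simp only: F0)
  from transform_injective[OF *(2) T this] show ?thesis
    unfolding \<xi> h_def f_def by simp
qed

section \<open>Size of the translated indicator function\<close>

lemma nn_integral_omega_cap:
  assumes "s = 1 \<or> s = - 1"
  shows "(\<integral>\<^sup>+t. indicator {1 - \<delta><..<1} (s * t) \<partial>\<omega>) = ennreal (1 / W) * (\<integral>\<^sup>+t. ennreal (w t) * indicator {1 - \<delta><..<1} t \<partial>lborel)"
proof -
  have "(\<integral>\<^sup>+t. indicator {1 - \<delta><..<1} (s * t) \<partial>\<omega>) = (\<integral>\<^sup>+t. ennreal (w t / W) * indicator {1 - \<delta><..<1} (s * t) \<partial>lborel)"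
    by (rule nn_integral_omega) measurable
  also have "\<dots> = (\<integral>\<^sup>+t. ennreal (w t / W) * indicator {1 - \<delta><..<1} t \<partial>lborel)"
    using assms
  proof
    assume s: "s = - 1"
    show ?thesis
      using nn_integral_uminus_lborel[of "\<lambda>t. ennreal (w t / W) * indicator {1 - \<delta><..<1} t"] by (simp add: s w_minus)
  qed simp
  also have "\<dots> = (\<integral>\<^sup>+t. ennreal (1 / W) * (ennreal (w t) * indicator {1 - \<delta><..<1} t) \<partial>lborel)"
    using W_pos w_nonneg by (intro nn_integral_cong) (simp add: mult.assoc[symmetric] flip: ennreal_mult)
  also have "\<dots> = ennreal (1 / W) * (\<integral>\<^sup>+t. ennreal (w t) * indicator {1 - \<delta><..<1} t \<partial>lborel)"
    by (rule nn_integral_cmult) simp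
  finally show ?thesis .
qed

text \<open>Splits the squared third side into a radial part and an angular part. The sign s selects
  the end of (-1, 1) at which the angular part becomes small.\<close>

lemma triangle_sgn:
  fixes x y t :: real
  assumes "s = (if x * y \<ge> 0 then 1 else - 1)"
  shows "x\<^sup>2 + y\<^sup>2 - 2 * x * y * t = (\<bar>x\<bar> - \<bar>y\<bar>)\<^sup>2 + 2 * (\<bar>x\<bar> * \<bar>y\<bar>) * (1 - s * t)"
proof -
  have "\<bar>x\<bar> * \<bar>y\<bar> = s * (x * y)" by (simp add: assms flip: abs_mult)
  moreover have "s * s = 1" by (simp add: assms)
  ultimately have "\<bar>x\<bar> * \<bar>y\<bar> * (1 - s * t) = \<bar>x\<bar> * \<bar>y\<bar> - x * y * t"
    by (simp add: right_diff_distrib)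
  then show ?thesis by (simp add: power2_diff)
qed

lemma two_ennreal_mult: "A \<ge> 0 \<Longrightarrow> B \<ge> 0 \<Longrightarrow> 2 * (ennreal A * ennreal B) = ennreal (2 * (A * B))"
  by (simp add: ennreal_mult)

lemma powr_square_cap: "u \<ge> 0 \<Longrightarrow> (u\<^sup>2) powr (\<kappa> + 1 / 2) = u powr (2 * \<kappa> + 1)"
proof -
  assume u: "u \<ge> 0"
  show ?thesis
  proof (cases "u = 0")
    case False
    then have "(u\<^sup>2) powr (\<kappa> + 1 / 2) = (u powr 2) powr (\<kappa> + 1 / 2)" using u by simp
    then show ?thesis by (simp only: powr_powr) (simp add: algebra_simps)
  qed simp
qed

text \<open>If |y| > 2r, then |x| \<ge> |y|/2 in the annulus, and the condition on t forces 1 - st <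
  (r/|y|)^2: the integral runs over a cap of known weight. If |y| \<le> 2r, the trivial bound 1 has
  the right order.\<close>

lemma ball_translate_upper:
  obtains C where "C > 0" "\<And>r x y. r > 0 \<Longrightarrow> ball_translate r y x \<le> C * (r / (\<bar>y\<bar> + r)) powr (2 * \<kappa> + 1)"
proof -
  define a where "a = 2 * \<kappa> + 1"
  have a: "a > 0" using kappa by (simp add: a_def)
  define K0 where "K0 = 2 / W * (2 powr \<bar>\<kappa> - 1 / 2\<bar> / (\<kappa> + 1 / 2))"
  have K0: "K0 > 0" using W_pos kappa by (simp add: K0_def)
  \<comment> \<open>The first summand serves |y| \<le> 2r, where r/(|y| + r) \<ge> 1/3; the second
    serves |y| > 2r, where r/|y| is at most 3/2 of that quotient.\<close>
  define C where "C = 3 powr a + K0 * (3 / 2) powr a"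
  have C: "C > 0" using K0 by (simp add: C_def add_pos_pos)
  have "ball_translate r y x \<le> C * (r / (\<bar>y\<bar> + r)) powr a" if r: "r > 0" for r x y
  proof (cases "\<bar>\<bar>x\<bar> - \<bar>y\<bar>\<bar> \<ge> r")
    case True
    then show ?thesis using ball_translate_eq_0[OF r True] C by simp
  next
    case ann: False
    show ?thesis
    proof (cases "\<bar>y\<bar> \<le> 2 * r")
      case True
      have "1 = 3 powr a * (1 / 3) powr a" by (simp flip: powr_mult)
      also have "\<dots> \<le> C * (r / (\<bar>y\<bar> + r)) powr a"
        using r True a K0 by (intro mult_mono powr_mono2) (auto simp: C_def field_simps)
      finally show ?thesis using ball_translate_le_1[of r y x] by simp
    next
      case False
      define s where "s = (if x * y \<ge> 0 then 1 else - 1 :: real)"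
      have s: "s = 1 \<or> s = - 1" by (simp add: s_def)
      have y: "\<bar>y\<bar> > 0" and x: "\<bar>x\<bar> \<ge> \<bar>y\<bar> / 2" using False r ann by auto
      define \<delta> where "\<delta> = (r / \<bar>y\<bar>)\<^sup>2"
      have ry: "r / \<bar>y\<bar> \<le> 1" using False r y by (simp add: divide_le_eq)
      have \<delta>: "0 \<le> \<delta>" "\<delta> \<le> 1" using ry r y unfolding \<delta>_def by (auto intro!: power_le_one)
      have sub: "1 - \<delta> < s * t" if "x\<^sup>2 + y\<^sup>2 - 2 * x * y * t < r\<^sup>2" "- 1 < t" "t < 1" for t
      proof -
        have "2 * (\<bar>x\<bar> * \<bar>y\<bar>) * (1 - s * t) < r\<^sup>2"
          using that(1) zero_le_power2[of "\<bar>x\<bar> - \<bar>y\<bar>"] unfolding triangle_sgn[OF s_def] by linarith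
        moreover have "\<bar>y\<bar>\<^sup>2 \<le> 2 * (\<bar>x\<bar> * \<bar>y\<bar>)"
        proof -
          have "\<bar>y\<bar> * \<bar>y\<bar> \<le> (2 * \<bar>x\<bar>) * \<bar>y\<bar>" using x by (intro mult_right_mono) auto
          then show ?thesis by (simp only: power2_eq_square mult.assoc)
        qed
        moreover have "s * t < 1" using s that by auto
        ultimately have "\<bar>y\<bar>\<^sup>2 * (1 - s * t) < r\<^sup>2"
          by (smt (verit) mult_right_mono)
        then have "1 - s * t < r\<^sup>2 / \<bar>y\<bar>\<^sup>2" using y by (simp add: pos_less_divide_eq mult.commute)
        then show ?thesis unfolding \<delta>_def power_divide by linarith
      qed
      have "ennreal (ball_translate r y x) \<le> (\<integral>\<^sup>+t. 2 * indicator {1 - \<delta><..<1} (s * t) \<partial>\<omega>)"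
        unfolding ennreal_ball_translate
      proof (rule nn_integral_mono)
        fix t
        show "ennreal ((1 + t) * indicator {t. - 1 < t \<and> t < 1 \<and> x\<^sup>2 + y\<^sup>2 - 2 * x * y * t < r\<^sup>2} t) \<le> 2 * indicator {1 - \<delta><..<1} (s * t)"
        proof (cases "- 1 < t \<and> t < 1 \<and> x\<^sup>2 + y\<^sup>2 - 2 * x * y * t < r\<^sup>2")
          case True
          then have "1 - \<delta> < s * t" using sub by blast
          moreover have "s * t < 1" using s True by (elim disjE) simp_all
          moreover have "ennreal (1 + t) \<le> ennreal 2" using True by (intro ennreal_leI) auto
          ultimately show ?thesis using True by simp
        qed simp
      qed
      also have "\<dots> = 2 * (ennreal (1 / W) * (\<integral>\<^sup>+t. ennreal (w t) * indicator {1 - \<delta><..<1} t \<partial>lborel))"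
        by (subst nn_integral_cmult) (auto simp: nn_integral_omega_cap[OF s])
      also have "\<dots> \<le> 2 * (ennreal (1 / W) * ennreal (2 powr \<bar>\<kappa> - 1 / 2\<bar> / (\<kappa> + 1 / 2) * \<delta> powr (\<kappa> + 1 / 2)))"
        by (intro mult_left_mono nn_integral_cap_le \<delta>) auto
      also have "\<dots> = ennreal (K0 * \<delta> powr (\<kappa> + 1 / 2))"
        using W_pos kappa by (subst two_ennreal_mult) (simp_all add: K0_def)
      finally have K: "ball_translate r y x \<le> K0 * \<delta> powr (\<kappa> + 1 / 2)"
        using K0 by (simp add: ennreal_le_iff)
      have "\<delta> powr (\<kappa> + 1 / 2) = (r / \<bar>y\<bar>) powr a"
        unfolding \<delta>_def a_def using r y by (intro powr_square_cap) auto
      also have "\<dots> \<le> (3 / 2 * (r / (\<bar>y\<bar> + r))) powr a"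
        using r y False a by (intro powr_mono2) (auto simp: field_simps)
      also have "\<dots> = (3 / 2) powr a * (r / (\<bar>y\<bar> + r)) powr a"
        by (rule powr_mult)
      finally have "K0 * \<delta> powr (\<kappa> + 1 / 2) \<le> K0 * ((3 / 2) powr a * (r / (\<bar>y\<bar> + r)) powr a)"
        using K0 by (intro mult_left_mono) auto
      with K have "ball_translate r y x \<le> K0 * (3 / 2) powr a * (r / (\<bar>y\<bar> + r)) powr a"
        by (simp only: mult.assoc)
      also have "\<dots> \<le> C * (r / (\<bar>y\<bar> + r)) powr a" by (intro mult_right_mono) (auto simp: C_def)
      finally show ?thesis .
    qed
  qed
  with C show ?thesis using that unfolding a_def by blast
qed

text \<open>For \<open>x\<close> near \<open>- y\<close> the translate by \<open>y\<close> alone is too small; the sum of the translates by \<open>\<plusminus>y\<close> has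
  a lower bound of the right order on the whole annulus.\<close>

lemma ball_translate_lower:
  obtains c where "c > 0" "\<And>r x y. r > 0 \<Longrightarrow> \<bar>\<bar>x\<bar> - \<bar>y\<bar>\<bar> < r / 2 \<Longrightarrow>
    c * (r / (\<bar>y\<bar> + r)) powr (2 * \<kappa> + 1) \<le> ball_translate r y x + ball_translate r (- y) x"
proof -
  define a where "a = 2 * \<kappa> + 1"
  have a: "a > 0" using kappa by (simp add: a_def)
  define k0 where "k0 = 2 / W * (2 powr - \<bar>\<kappa> - 1 / 2\<bar> / (\<kappa> + 1 / 2))"
  have k0: "k0 > 0" using W_pos kappa by (simp add: k0_def)
  define c where "c = k0 * (3 / 8) powr (\<kappa> + 1 / 2)"
  have c: "c > 0" using k0 by (simp add: c_def)
  have "c * (r / (\<bar>y\<bar> + r)) powr a \<le> ball_translate r y x + ball_translate r (- y) x"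
    if r: "r > 0" and ann: "\<bar>\<bar>x\<bar> - \<bar>y\<bar>\<bar> < r / 2" for r x y
  proof -
    define s where "s = (if x * y \<ge> 0 then 1 else - 1 :: real)"
    have s: "s = 1 \<or> s = - 1" by (simp add: s_def)
    define u where "u = r / (\<bar>y\<bar> + r)"
    have u: "0 \<le> u" "u \<le> 1" using r by (auto simp: u_def)
    \<comment> \<open>The radial part is below r^2/4. The angular part is at most 2 (|y| + r)^2
      \<delta>, and the factor 3/8 makes this 3r^2/4, so that the sum stays below r^2.\<close>
    define \<delta> where "\<delta> = 3 / 8 * u\<^sup>2"
    have "u\<^sup>2 \<le> 1" using u by (auto intro: power_le_one)
    then have \<delta>: "0 \<le> \<delta>" "\<delta> \<le> 1" by (auto simp: \<delta>_def)
    have sub: "x\<^sup>2 + y\<^sup>2 - 2 * x * y * t < r\<^sup>2" if "s * t \<in> {1 - \<delta><..<1}" for t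
    proof -
      have "(\<bar>x\<bar> - \<bar>y\<bar>)\<^sup>2 < (r / 2)\<^sup>2" using ann square_less_square_iff[of "r / 2" "\<bar>x\<bar> - \<bar>y\<bar>"] r by simp
      moreover have "2 * (\<bar>x\<bar> * \<bar>y\<bar>) * (1 - s * t) \<le> 2 * (\<bar>y\<bar> + r)\<^sup>2 * \<delta>"
      proof -
        have "\<bar>x\<bar> \<le> \<bar>y\<bar> + r" using ann r by linarith
        then show ?thesis unfolding power2_eq_square using that r by (intro mult_mono) auto
      qed
      moreover have "2 * (\<bar>y\<bar> + r)\<^sup>2 * \<delta> = 3 / 4 * r\<^sup>2"
        using r by (simp add: \<delta>_def u_def power_divide)
      ultimately show ?thesis unfolding triangle_sgn[OF s_def] by (simp add: power_divide)
    qed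
    define S where "S = {t. - 1 < t \<and> t < 1 \<and> x\<^sup>2 + y\<^sup>2 - 2 * x * y * t < r\<^sup>2}"
    have [measurable]: "S \<in> sets borel" unfolding S_def by measurable
    \<comment> \<open>Reflecting t moves the translate by the opposite parameter to the same set
      \<open>S\<close>, with weight 1 - t in place of 1 + t; the two weights add up to the constant
      2.\<close>
    have 2: "ennreal (ball_translate r (- y) x) = (\<integral>\<^sup>+t. ennreal ((1 - t) * indicator S t) \<partial>\<omega>)"
    proof -
      define g where "g = (\<lambda>t. ennreal ((1 + t) * indicator {t. - 1 < t \<and> t < 1 \<and> x\<^sup>2 + (- y)\<^sup>2 - 2 * x * (- y) * t < r\<^sup>2} t))"
      have [measurable]: "g \<in> borel_measurable borel" unfolding g_def by measurable
      have "ennreal (ball_translate r (- y) x) = (\<integral>\<^sup>+t. g t \<partial>\<omega>)" unfolding g_def by (rule ennreal_ball_translate)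
      also have "\<dots> = (\<integral>\<^sup>+t. g (- t) \<partial>\<omega>)" by (subst distr_omega_uminus[symmetric]) (simp add: nn_integral_distr)
      also have "\<dots> = (\<integral>\<^sup>+t. ennreal ((1 - t) * indicator S t) \<partial>\<omega>)"
        by (intro nn_integral_cong) (auto simp: g_def S_def indicator_def)
      finally show ?thesis .
    qed
    have "ennreal (c * u powr a) = ennreal (k0 * \<delta> powr (\<kappa> + 1 / 2))"
    proof -
      have "(3 / 8 * u\<^sup>2) powr (\<kappa> + 1 / 2) = (3 / 8) powr (\<kappa> + 1 / 2) * u powr a"
        unfolding a_def powr_square_cap[OF u(1), symmetric] by (rule powr_mult)
      then show ?thesis unfolding \<delta>_def c_def by (simp only: mult.assoc)
    qed
    also have "\<dots> = 2 * (ennreal (1 / W) * ennreal (2 powr - \<bar>\<kappa> - 1 / 2\<bar> / (\<kappa> + 1 / 2) * \<delta> powr (\<kappa> + 1 / 2)))"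
      using W_pos kappa by (subst two_ennreal_mult) (simp_all add: k0_def)
    also have "\<dots> \<le> 2 * (ennreal (1 / W) * (\<integral>\<^sup>+t. ennreal (w t) * indicator {1 - \<delta><..<1} t \<partial>lborel))"
      by (intro mult_left_mono nn_integral_cap_ge \<delta>) auto
    also have "\<dots> = (\<integral>\<^sup>+t. 2 * indicator {1 - \<delta><..<1} (s * t) \<partial>\<omega>)"
      by (subst nn_integral_cmult) (auto simp: nn_integral_omega_cap[OF s])
    also have "\<dots> \<le> (\<integral>\<^sup>+t. ennreal ((1 + t) * indicator S t) + ennreal ((1 - t) * indicator S t) \<partial>\<omega>)"
    proof (rule nn_integral_mono)
      fix t
      show "2 * indicator {1 - \<delta><..<1} (s * t) \<le> ennreal ((1 + t) * indicator S t) + ennreal ((1 - t) * indicator S t)"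
      proof (cases "s * t \<in> {1 - \<delta><..<1}")
        case True
        then have "t \<in> S" using sub[of t] s \<delta> by (auto simp: S_def)
        moreover have "ennreal (1 + t) + ennreal (1 - t) = 2" if "- 1 < t" "t < 1"
          using that by (simp flip: ennreal_plus)
        ultimately show ?thesis using True by (auto simp: S_def)
      qed simp
    qed
    also have "\<dots> = ennreal (ball_translate r y x) + ennreal (ball_translate r (- y) x)"
      unfolding 2 unfolding ennreal_ball_translate S_def[symmetric] by (rule nn_integral_add) auto
    also have "\<dots> = ennreal (ball_translate r y x + ball_translate r (- y) x)"
      by (simp add: ennreal_plus ball_translate_nonneg)
    finally show ?thesis unfolding u_def
      by (subst (asm) ennreal_le_iff) (auto simp: ball_translate_nonneg)
  qed
  with c show ?thesis using that unfolding a_def by blast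
qed

text \<open>Left-continuity in the radius, a consequence of the strict inequality against r^2. It
  allows rational radii in the supremum that defines the maximal function.\<close>

lemma ball_translate_SUP:
  assumes s: "incseq s" "s \<longlonglongrightarrow> r" and sr: "\<And>n. 0 < s n" "\<And>n. s n < r"
  shows "ennreal (ball_translate r y x) = (SUP n. ennreal (ball_translate (s n) y x))"
proof -
  have r: "r > 0" using sr(1)[of 0] sr(2)[of 0] by simp
  define f where "f = (\<lambda>n t. ennreal ((1 + t) * indicator {t. - 1 < t \<and> t < 1 \<and> x\<^sup>2 + y\<^sup>2 - 2 * x * y * t < (s n)\<^sup>2} t))"
  have [measurable]: "f n \<in> borel_measurable borel" for n unfolding f_def by measurable
  have sq: "(s m)\<^sup>2 \<le> (s n)\<^sup>2" "(s n)\<^sup>2 < r\<^sup>2" if "m \<le> n" for m n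
    using s(1) sr that by (auto simp: incseq_def intro!: power_mono power_strict_mono less_imp_le[OF sr(1)])
  have inc: "incseq f"
    unfolding incseq_def le_fun_def f_def
    by (intro allI impI ennreal_leI) (auto simp: indicator_def dest: sq(1) intro: less_le_trans)
  have "(SUP n. f n t) = ennreal ((1 + t) * indicator {t. - 1 < t \<and> t < 1 \<and> x\<^sup>2 + y\<^sup>2 - 2 * x * y * t < r\<^sup>2} t)" for t
  proof (rule antisym)
    show "(SUP n. f n t) \<le> ennreal ((1 + t) * indicator {t. - 1 < t \<and> t < 1 \<and> x\<^sup>2 + y\<^sup>2 - 2 * x * y * t < r\<^sup>2} t)"
      unfolding f_def using sq(2) by (intro SUP_least ennreal_leI) (auto simp: indicator_def intro: less_trans)
    show "ennreal ((1 + t) * indicator {t. - 1 < t \<and> t < 1 \<and> x\<^sup>2 + y\<^sup>2 - 2 * x * y * t < r\<^sup>2} t) \<le> (SUP n. f n t)"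
    proof (cases "- 1 < t \<and> t < 1 \<and> x\<^sup>2 + y\<^sup>2 - 2 * x * y * t < r\<^sup>2")
      case True
      have "(\<lambda>n. (s n)\<^sup>2) \<longlonglongrightarrow> r\<^sup>2" using s(2) by (rule tendsto_power)
      then have "eventually (\<lambda>n. x\<^sup>2 + y\<^sup>2 - 2 * x * y * t < (s n)\<^sup>2) sequentially"
        using True by (intro order_tendstoD) auto
      then obtain n where "x\<^sup>2 + y\<^sup>2 - 2 * x * y * t < (s n)\<^sup>2" by (auto simp: eventually_sequentially)
      then have "f n t = ennreal ((1 + t) * indicator {t. - 1 < t \<and> t < 1 \<and> x\<^sup>2 + y\<^sup>2 - 2 * x * y * t < r\<^sup>2} t)"
        using True by (simp add: f_def)
      then show ?thesis by (metis SUP_upper UNIV_I)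
    qed simp
  qed
  then have "ennreal (ball_translate r y x) = (\<integral>\<^sup>+t. (SUP n. f n t) \<partial>\<omega>)"
    unfolding ennreal_ball_translate by simp
  also have "\<dots> = (SUP n. \<integral>\<^sup>+t. f n t \<partial>\<omega>)"
    using inc by (intro nn_integral_monotone_convergence_SUP) auto
  also have "\<dots> = (SUP n. ennreal (ball_translate (s n) y x))"
    unfolding ennreal_ball_translate f_def ..
  finally show ?thesis .
qed

text \<open>An integral sees only the almost-everywhere class, so the arbitrary representative may
  be replaced by the explicit kernel. The parameter -y in the definition is the one that corresponds
  to \<open>ball_translate r y\<close>.\<close>

lemma translate_integral_eq:
  assumes "r > 0"
  shows "translate_integral \<kappa> y g r = (\<integral>\<^sup>+x. g x * ennreal (ball_translate r y x) \<partial>\<mu>)"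
  unfolding translate_integral_def
  by (intro nn_integral_cong_AE) (use dunkl_translation_indicator[OF assms, of y] in \<open>auto elim!: eventually_mono\<close>)

section \<open>Annuli\<close>

definition annulus :: "real \<Rightarrow> real \<Rightarrow> real set" where
  "annulus y r = {z. \<bar>\<bar>z\<bar> - \<bar>y\<bar>\<bar> < r}"

text \<open>Up to constants the measure of the annulus, but an explicit positive real, so that
  dividing and multiplying by it cancels exactly.\<close>

definition vol :: "real \<Rightarrow> real \<Rightarrow> real" where
  "vol y r = r * (\<bar>y\<bar> + r) powr (2 * \<kappa> + 1)"

lemma annulus_measurable [measurable]: "annulus y r \<in> sets borel"
  unfolding annulus_def by measurable

lemma vol_measurable [measurable]: "(\<lambda>y. vol y r) \<in> borel_measurable borel"
  unfolding vol_def by measurable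

lemma annulus_uminus [simp]: "annulus (- y) r = annulus y r" "- z \<in> annulus y r \<longleftrightarrow> z \<in> annulus y r"
  by (auto simp: annulus_def)

lemma annulus_trans: "x \<in> annulus y r \<Longrightarrow> z \<in> annulus x s \<Longrightarrow> z \<in> annulus y (r + s)"
  unfolding annulus_def by simp linarith

lemma annulus_mono: "x \<in> annulus y r \<Longrightarrow> r \<le> s \<Longrightarrow> x \<in> annulus y s"
  unfolding annulus_def by simp

lemma annulus_commute: "x \<in> annulus y r \<longleftrightarrow> y \<in> annulus x r"
  unfolding annulus_def by (simp add: abs_minus_commute)

lemma vol_uminus [simp]: "vol (- y) r = vol y r" by (simp add: vol_def)

lemma vol_pos: "r > 0 \<Longrightarrow> vol y r > 0" by (simp add: vol_def)

lemma vol_ratio: "r > 0 \<Longrightarrow> (r / (\<bar>y\<bar> + r)) powr (2 * \<kappa> + 1) = vol 0 r / vol y r"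
  by (simp add: vol_def powr_divide)

lemma vol_mono_cmult:
  assumes "r > 0" "0 < s" "s \<le> k * r" "\<bar>y\<bar> + s \<le> m * (\<bar>x\<bar> + r)" "m > 0"
  shows "vol y s \<le> k * m powr (2 * \<kappa> + 1) * vol x r"
proof -
  have "vol y s \<le> (k * r) * (m * (\<bar>x\<bar> + r)) powr (2 * \<kappa> + 1)"
    unfolding vol_def using assms kappa by (intro mult_mono powr_mono2) auto
  also have "\<dots> = k * m powr (2 * \<kappa> + 1) * vol x r"
    using assms by (simp add: vol_def powr_mult)
  finally show ?thesis .
qed

lemma emeasure_annulus_le:
  assumes r: "r > 0"
  shows "emeasure \<mu> (annulus y r) \<le> ennreal (4 / D * vol y r)"
proof -
  have "emeasure \<mu> (annulus y r) = (\<integral>\<^sup>+x. ennreal (\<bar>x\<bar> powr (2 * \<kappa> + 1) / D) * indicator (annulus y r) x \<partial>lborel)"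
    by (subst nn_integral_mu[symmetric]) auto
  also have "\<dots> \<le> (\<integral>\<^sup>+x. ennreal ((\<bar>y\<bar> + r) powr (2 * \<kappa> + 1) / D) * indicator ({y - r<..<y + r} \<union> {- y - r<..<- y + r}) x \<partial>lborel)"
  proof (rule nn_integral_mono)
    fix x
    show "ennreal (\<bar>x\<bar> powr (2 * \<kappa> + 1) / D) * indicator (annulus y r) x \<le>
      ennreal ((\<bar>y\<bar> + r) powr (2 * \<kappa> + 1) / D) * indicator ({y - r<..<y + r} \<union> {- y - r<..<- y + r}) x"
    proof (cases "x \<in> annulus y r")
      case True
      then have "\<bar>x\<bar> \<le> \<bar>y\<bar> + r" "x \<in> {y - r<..<y + r} \<union> {- y - r<..<- y + r}" unfolding annulus_def by auto
      then show ?thesis using True kappa D_pos by (auto intro!: ennreal_leI divide_right_mono powr_mono2)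
    qed simp
  qed
  also have "\<dots> = ennreal ((\<bar>y\<bar> + r) powr (2 * \<kappa> + 1) / D) * emeasure lborel ({y - r<..<y + r} \<union> {- y - r<..<- y + r})"
    by (subst nn_integral_cmult_indicator) auto
  also have "\<dots> \<le> ennreal ((\<bar>y\<bar> + r) powr (2 * \<kappa> + 1) / D) * (emeasure lborel {y - r<..<y + r} + emeasure lborel {- y - r<..<- y + r})"
    by (intro mult_left_mono emeasure_subadditive) auto
  also have "\<dots> = ennreal (4 / D * vol y r)"
    using r D_pos by (simp add: vol_def mult_ac flip: ennreal_plus ennreal_mult)
  finally show ?thesis .
qed

definition "cvol = (1 / 2) powr (2 * \<kappa> + 1) / (2 * D)"

lemma cvol_pos: "cvol > 0" using D_pos by (simp add: cvol_def)

text \<open>The outer piece from |y| + r/2 to |y| + r is enough: it has length r/2, and there |x|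
  \<ge> (|y| + r)/2, away from the zero of the weight. These two facts are the origin of
  \<open>cvol\<close>.\<close>

lemma emeasure_annulus_ge:
  assumes r: "r > 0"
  shows "ennreal (cvol * vol y r) \<le> emeasure \<mu> (annulus y r)"
proof -
  have "ennreal (cvol * vol y r) = ennreal ((1 / 2 * (\<bar>y\<bar> + r)) powr (2 * \<kappa> + 1) / D) * emeasure lborel {\<bar>y\<bar> + r / 2<..<\<bar>y\<bar> + r}"
  proof -
    have "(1 / 2 * (\<bar>y\<bar> + r)) powr (2 * \<kappa> + 1) = (1 / 2) powr (2 * \<kappa> + 1) * (\<bar>y\<bar> + r) powr (2 * \<kappa> + 1)"
      by (rule powr_mult)
    then show ?thesis using r D_pos by (simp add: vol_def cvol_def mult_ac flip: ennreal_mult)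
  qed
  also have "\<dots> = (\<integral>\<^sup>+x. ennreal ((1 / 2 * (\<bar>y\<bar> + r)) powr (2 * \<kappa> + 1) / D) * indicator {\<bar>y\<bar> + r / 2<..<\<bar>y\<bar> + r} x \<partial>lborel)"
    by (subst nn_integral_cmult_indicator) auto
  also have "\<dots> \<le> (\<integral>\<^sup>+x. ennreal (\<bar>x\<bar> powr (2 * \<kappa> + 1) / D) * indicator (annulus y r) x \<partial>lborel)"
  proof (rule nn_integral_mono)
    fix x
    show "ennreal ((1 / 2 * (\<bar>y\<bar> + r)) powr (2 * \<kappa> + 1) / D) * indicator {\<bar>y\<bar> + r / 2<..<\<bar>y\<bar> + r} x \<le>
      ennreal (\<bar>x\<bar> powr (2 * \<kappa> + 1) / D) * indicator (annulus y r) x"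
    proof (cases "x \<in> {\<bar>y\<bar> + r / 2<..<\<bar>y\<bar> + r}")
      case True
      then have "\<bar>y\<bar> + r / 2 < x" "x < \<bar>y\<bar> + r" by auto
      then have "1 / 2 * (\<bar>y\<bar> + r) \<le> \<bar>x\<bar>" "x \<in> annulus y r" using r unfolding annulus_def by auto
      then show ?thesis using True r kappa D_pos by (auto intro!: ennreal_leI divide_right_mono powr_mono2)
    qed simp
  qed
  also have "\<dots> = emeasure \<mu> (annulus y r)" by (subst nn_integral_mu[symmetric]) auto
  finally show ?thesis .
qed

lemma dunkl_ball_0: "dunkl_ball 0 r = annulus 0 r"
  by (auto simp: dunkl_ball_def annulus_def)

definition avg :: "(real \<Rightarrow> ennreal) \<Rightarrow> real \<Rightarrow> real \<Rightarrow> ennreal" where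
  "avg F y r = (\<integral>\<^sup>+z. F z * indicator (annulus y r) z \<partial>\<mu>) / ennreal (vol y r)"

lemma annulus_pair_measurable [measurable]: "Measurable.pred (borel \<Otimes>\<^sub>M borel) (\<lambda>z. snd z \<in> annulus (fst z) r)"
  unfolding annulus_def by measurable

lemma avg_measurable [measurable]:
  assumes [measurable]: "F \<in> borel_measurable borel"
  shows "(\<lambda>y. avg F y r) \<in> borel_measurable borel"
proof -
  have "(\<lambda>(y, z). F z * indicator (annulus y r) z) \<in> borel_measurable (borel \<Otimes>\<^sub>M borel)"
    unfolding indicator_def split_def by measurable
  then have "(\<lambda>y. \<integral>\<^sup>+z. F z * indicator (annulus y r) z \<partial>\<mu>) \<in> borel_measurable borel"
    by (intro mu.borel_measurable_nn_integral) (simp cong: measurable_cong_sets sets_pair_measure_cong)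
  then show ?thesis unfolding avg_def by measurable
qed

lemma avg_uminus [simp]: "avg F (- y) r = avg F y r" by (simp add: avg_def)

lemma avg_times_vol:
  assumes "r > 0"
  shows "avg F y r * ennreal (vol y r) = (\<integral>\<^sup>+z. F z * indicator (annulus y r) z \<partial>\<mu>)"
  unfolding avg_def using vol_pos[OF assms, of y]
  by (simp add: ennreal_divide_times)

lemma avg_le_iff:
  assumes "r > 0"
  shows "avg F y r \<le> B \<longleftrightarrow> (\<integral>\<^sup>+z. F z * indicator (annulus y r) z \<partial>\<mu>) \<le> B * ennreal (vol y r)"
proof
  assume "avg F y r \<le> B"
  then show "(\<integral>\<^sup>+z. F z * indicator (annulus y r) z \<partial>\<mu>) \<le> B * ennreal (vol y r)"
    unfolding avg_times_vol[OF assms, symmetric] by (intro mult_right_mono) auto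
next
  assume "(\<integral>\<^sup>+z. F z * indicator (annulus y r) z \<partial>\<mu>) \<le> B * ennreal (vol y r)"
  then show "avg F y r \<le> B" unfolding avg_def using vol_pos[OF assms, of y]
    by (intro divide_le_posI_ennreal) (auto simp: mult.commute)
qed

text \<open>Apart from the null set {0}, the annulus consists of an interval and its mirror image,
  over which the even F has the same integral. Since y is nonzero it lies in one of them, and the
  maximal function at y controls that one.\<close>

lemma avg_le_maximal_fn:
  assumes [measurable]: "F \<in> borel_measurable borel" and even: "\<And>z. F (- z) = F z"
    and r: "r > 0" and y: "y \<noteq> 0"
  shows "avg F y r \<le> ennreal (8 / D) * maximal_fn \<mu> F y"
proof -
  define J where "J = {max 0 (\<bar>y\<bar> - r)<..<\<bar>y\<bar> + r}"
  have [measurable]: "J \<in> sets borel" by (simp add: J_def)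
  define J' where "J' = {- (\<bar>y\<bar> + r)<..<- max 0 (\<bar>y\<bar> - r)}"
  have [measurable]: "J' \<in> sets borel" by (simp add: J'_def)
  have J': "z \<in> J' \<longleftrightarrow> - z \<in> J" for z by (auto simp: J_def J'_def)
  have sub: "J \<subseteq> annulus y r" "J' \<subseteq> annulus y r" by (auto simp: J_def J'_def annulus_def)
  have ref: "(\<integral>\<^sup>+z. F z * indicator J' z \<partial>\<mu>) = (\<integral>\<^sup>+z. F z * indicator J z \<partial>\<mu>)"
    using nn_integral_mu_uminus[of "\<lambda>z. F z * indicator J z"] by (simp add: even J' indicator_def)
  have "(\<integral>\<^sup>+z. F z * indicator (annulus y r) z \<partial>\<mu>) = (\<integral>\<^sup>+z. F z * indicator J z + F z * indicator J' z \<partial>\<mu>)"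
  proof (rule nn_integral_cong_AE)
    show "AE z in \<mu>. F z * indicator (annulus y r) z = F z * indicator J z + F z * indicator J' z"
      using AE_mu_nonzero by eventually_elim (auto simp: indicator_def J_def J'_def annulus_def)
  qed
  also have "\<dots> = (\<integral>\<^sup>+z. F z * indicator J z \<partial>\<mu>) + (\<integral>\<^sup>+z. F z * indicator J' z \<partial>\<mu>)"
    by (rule nn_integral_add) auto
  finally have split: "(\<integral>\<^sup>+z. F z * indicator (annulus y r) z \<partial>\<mu>) = (\<integral>\<^sup>+z. F z * indicator J z \<partial>\<mu>) + (\<integral>\<^sup>+z. F z * indicator J' z \<partial>\<mu>)" .
  have le: "(\<integral>\<^sup>+z. F z * indicator I z \<partial>\<mu>) \<le> maximal_fn \<mu> F y * ennreal (4 / D * vol y r)"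
    if "I = {l<..<u}" "l < y" "y < u" "I \<subseteq> annulus y r" for I l u
  proof -
    have em: "emeasure \<mu> I \<le> ennreal (4 / D * vol y r)"
      using emeasure_annulus_le[OF r, of y] emeasure_mono[OF that(4), of \<mu>] by (auto intro: order_trans)
    have "(\<integral>\<^sup>+z. F z * indicator I z \<partial>\<mu>) \<le> maximal_fn \<mu> F y * emeasure \<mu> I"
    proof (cases "emeasure \<mu> I = 0")
      case True
      then have "(\<integral>\<^sup>+z. F z * indicator I z \<partial>\<mu>) = 0"
        using that(1) by (intro nn_integral_null_set) (auto simp: null_sets_def)
      then show ?thesis by simp
    next
      case False
      have fin: "emeasure \<mu> I \<noteq> top" using em by (auto simp: top_unique)
      have "(\<integral>\<^sup>+z. F z * indicator I z \<partial>\<mu>) = (\<integral>\<^sup>+z. F z * indicator I z \<partial>\<mu>) / emeasure \<mu> I * emeasure \<mu> I"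
        using False fin by (simp add: ennreal_divide_times ennreal_divide_self divide_ennreal_def mult.assoc ennreal_inverse_mult)
          (metis ennreal_divide_self divide_ennreal_def mult.commute mult.right_neutral top.not_eq_extremum zero_less_iff_neq_zero)
      also have "\<dots> \<le> maximal_fn \<mu> F y * emeasure \<mu> I"
        using maximal_fn_ge[OF that(2,3), of \<mu> F] unfolding that(1) by (intro mult_right_mono) auto
      finally show ?thesis .
    qed
    also have "\<dots> \<le> maximal_fn \<mu> F y * ennreal (4 / D * vol y r)" by (intro mult_left_mono em) auto
    finally show ?thesis .
  qed
  have "(\<integral>\<^sup>+z. F z * indicator J z \<partial>\<mu>) \<le> maximal_fn \<mu> F y * ennreal (4 / D * vol y r)"
  proof (cases "y > 0")
    case True
    then show ?thesis using r sub by (intro le[OF J_def]) auto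
  next
    case False
    then show ?thesis using r sub y unfolding ref[symmetric] by (intro le[OF J'_def]) auto
  qed
  then have "(\<integral>\<^sup>+z. F z * indicator (annulus y r) z \<partial>\<mu>) \<le> maximal_fn \<mu> F y * ennreal (4 / D * vol y r) + maximal_fn \<mu> F y * ennreal (4 / D * vol y r)"
    unfolding split ref by (intro add_mono)
  also have "\<dots> = ennreal (8 / D) * maximal_fn \<mu> F y * ennreal (vol y r)"
  proof -
    have "ennreal (4 / D * vol y r) + ennreal (4 / D * vol y r) = ennreal (8 / D) * ennreal (vol y r)"
      using D_pos vol_pos[OF r, of y] by (simp add: add_divide_distrib[symmetric] flip: ennreal_plus ennreal_mult)
    then show ?thesis by (simp add: distrib_left[symmetric] mult_ac)
  qed
  finally show ?thesis unfolding avg_le_iff[OF r] .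
qed

lemma avg_local:
  assumes "x \<in> annulus y r" "s \<le> r"
  shows "avg F x s \<le> avg (\<lambda>z. F z * indicator (annulus y (2 * r)) z) x s"
proof -
  have "z \<in> annulus y (2 * r)" if "z \<in> annulus x s" for z
    using annulus_mono[OF annulus_trans[OF assms(1) that], of "2 * r"] assms(2) by simp
  then show ?thesis unfolding avg_def
    by (intro divide_right_mono_ennreal nn_integral_mono) (auto simp: indicator_def)
qed

text \<open>The doubling constant for passing from \<open>vol x s\<close> to
  \<open>vol y (3 * s)\<close>, divided by the lower bound \<open>d\<close> for the integral of 1 /
  \<open>vol\<close> over an annulus of radius r.\<close>

definition "Cglob = 6 powr (2 * \<kappa> + 1) * 6 / (cvol * (1 / 2) powr (2 * \<kappa> + 1))"

text \<open>Averages over annuli of radius \<open>s \<ge> r\<close> are controlled by averages of the function \<open>avg F _ r\<close>,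
  because \<open>annulus w r\<close> has measure comparable to \<open>vol z r\<close> for each of its points \<open>z\<close>.\<close>

lemma avg_global:
  assumes [measurable]: "F \<in> borel_measurable borel" and x: "x \<in> annulus y r" and r: "r > 0" and s: "r \<le> s"
  shows "avg F x s \<le> ennreal Cglob * avg (\<lambda>z. avg F z r) y (3 * s)"
proof -
  define a where "a = 2 * \<kappa> + 1"
  define d where "d = cvol * (1 / 2) powr a"
  have d: "d > 0" using cvol_pos by (simp add: d_def)
  have s0: "s > 0" using r s by simp
  have inner: "ennreal d \<le> (\<integral>\<^sup>+z. indicator (annulus w r) z / ennreal (vol z r) \<partial>\<mu>)" for w
  proof -
    have "ennreal d = ennreal (1 / (2 powr a * vol w r)) * ennreal (cvol * vol w r)"
      using vol_pos[OF r, of w] cvol_pos by (simp add: d_def powr_divide flip: ennreal_mult)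
    also have "\<dots> \<le> ennreal (1 / (2 powr a * vol w r)) * emeasure \<mu> (annulus w r)"
      by (intro mult_left_mono emeasure_annulus_ge r) auto
    also have "\<dots> = (\<integral>\<^sup>+z. ennreal (1 / (2 powr a * vol w r)) * indicator (annulus w r) z \<partial>\<mu>)"
      by (subst nn_integral_cmult_indicator) auto
    also have "\<dots> \<le> (\<integral>\<^sup>+z. indicator (annulus w r) z / ennreal (vol z r) \<partial>\<mu>)"
    proof (rule nn_integral_mono)
      fix z
      show "ennreal (1 / (2 powr a * vol w r)) * indicator (annulus w r) z \<le> indicator (annulus w r) z / ennreal (vol z r)"
      proof (cases "z \<in> annulus w r")
        case True
        have "vol z r \<le> 1 * 2 powr a * vol w r" unfolding a_def
          using True r by (intro vol_mono_cmult) (auto simp: annulus_def)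
        then have "1 / (2 powr a * vol w r) \<le> 1 / vol z r"
          using vol_pos[OF r, of z] vol_pos[OF r, of w] by (intro divide_left_mono) auto
        moreover have "1 / ennreal (vol z r) = ennreal (1 / vol z r)"
          using divide_ennreal[of 1 "vol z r"] vol_pos[OF r, of z] by simp
        ultimately show ?thesis using True by (simp add: ennreal_leI)
      qed simp
    qed
    finally show ?thesis .
  qed
  have "ennreal d * (\<integral>\<^sup>+w. F w * indicator (annulus x s) w \<partial>\<mu>) = (\<integral>\<^sup>+w. F w * indicator (annulus x s) w * ennreal d \<partial>\<mu>)"
    by (subst nn_integral_multc) (auto simp: mult.commute)
  also have "\<dots> \<le> (\<integral>\<^sup>+w. F w * indicator (annulus x s) w * (\<integral>\<^sup>+z. indicator (annulus w r) z / ennreal (vol z r) \<partial>\<mu>) \<partial>\<mu>)"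
    by (intro nn_integral_mono mult_left_mono inner) auto
  also have "\<dots> = (\<integral>\<^sup>+w. (\<integral>\<^sup>+z. F w * indicator (annulus x s) w * (indicator (annulus w r) z / ennreal (vol z r)) \<partial>\<mu>) \<partial>\<mu>)"
    by (intro nn_integral_cong nn_integral_cmult[symmetric]) simp
  also have "\<dots> \<le> (\<integral>\<^sup>+w. (\<integral>\<^sup>+z. F w * indicator (annulus z r) w / ennreal (vol z r) * indicator (annulus y (3 * s)) z \<partial>\<mu>) \<partial>\<mu>)"
  proof -
    \<comment> \<open>The radii add up to r + s + r, which is at most 3s because r \<le> s.\<close>
    have "w \<in> annulus z r \<and> z \<in> annulus y (3 * s)" if "w \<in> annulus x s" "z \<in> annulus w r" for w z
      using annulus_mono[OF annulus_trans[OF annulus_trans[OF x that(1)] that(2)], of "3 * s"] that(2) annulus_commute s by simp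
    then show ?thesis by (intro nn_integral_mono) (auto simp: indicator_def divide_ennreal_def)
  qed
  also have "\<dots> = (\<integral>\<^sup>+z. (\<integral>\<^sup>+w. F w * indicator (annulus z r) w / ennreal (vol z r) * indicator (annulus y (3 * s)) z \<partial>\<mu>) \<partial>\<mu>)"
  proof -
    interpret MM: pair_sigma_finite \<mu> \<mu> ..
    have "(\<lambda>(w, z). F w * indicator (annulus z r) w / ennreal (vol z r) * indicator (annulus y (3 * s)) z) \<in> borel_measurable (borel \<Otimes>\<^sub>M borel)"
      unfolding indicator_def split_def annulus_def by measurable
    then show ?thesis by (intro MM.Fubini'[symmetric]) (simp cong: measurable_cong_sets sets_pair_measure_cong)
  qed
  also have "\<dots> = (\<integral>\<^sup>+z. avg F z r * indicator (annulus y (3 * s)) z \<partial>\<mu>)"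
    unfolding avg_def by (intro nn_integral_cong) (simp add: nn_integral_multc nn_integral_divide)
  also have "\<dots> = avg (\<lambda>z. avg F z r) y (3 * s) * ennreal (vol y (3 * s))"
    using s0 by (subst avg_times_vol) auto
  also have "\<dots> \<le> avg (\<lambda>z. avg F z r) y (3 * s) * ennreal (6 powr a * 6 * vol x s)"
  proof (intro mult_left_mono ennreal_leI)
    have "vol y (3 * s) \<le> 6 * 6 powr a * vol x s" unfolding a_def
      using x s r by (intro vol_mono_cmult) (auto simp: annulus_def)
    then show "vol y (3 * s) \<le> 6 powr a * 6 * vol x s" by (simp add: mult_ac)
  qed simp
  finally have *: "ennreal d * (\<integral>\<^sup>+w. F w * indicator (annulus x s) w \<partial>\<mu>) \<le> avg (\<lambda>z. avg F z r) y (3 * s) * ennreal (6 powr a * 6 * vol x s)" .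
  have "(\<integral>\<^sup>+w. F w * indicator (annulus x s) w \<partial>\<mu>) = ennreal (1 / d) * (ennreal d * (\<integral>\<^sup>+w. F w * indicator (annulus x s) w \<partial>\<mu>))"
    using d by (simp add: mult.assoc[symmetric] flip: ennreal_mult)
  also have "\<dots> \<le> ennreal (1 / d) * (avg (\<lambda>z. avg F z r) y (3 * s) * ennreal (6 powr a * 6 * vol x s))"
    by (intro mult_left_mono *) auto
  also have "\<dots> = ennreal Cglob * avg (\<lambda>z. avg F z r) y (3 * s) * ennreal (vol x s)"
  proof -
    have "ennreal (1 / d) * ennreal (6 powr a * 6 * vol x s) = ennreal Cglob * ennreal (vol x s)"
      using d vol_pos[OF s0, of x] by (simp add: Cglob_def d_def a_def flip: ennreal_mult)
    note e = this
    show ?thesis unfolding mult.left_commute[of "ennreal (1 / d)"] e by (simp only: mult_ac)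
  qed
  finally show ?thesis unfolding avg_le_iff[OF s0] .
qed

end

lemma ennreal_inverse_antimono:
  fixes a b :: ennreal
  assumes "a \<le> b"
  shows "inverse b \<le> inverse a"
proof (cases "a = 0")
  case False
  then show ?thesis using assms
    by (cases a; cases b) (auto simp: inverse_ennreal top_unique intro!: ennreal_leI le_imp_inverse_le)
qed simp

section \<open>Norm inequalities for functions on the line\<close>

context dunkl begin

text \<open>Measurability of the smaller function matters for p = \<infinity>: the essential
  supremum of a function that is not measurable is \<open>top\<close> by convention.\<close>

lemma Lnorm_mono_AE:
  assumes "f \<in> borel_measurable borel" "AE x in \<mu>. f x \<le> g x"
  shows "Lnorm \<mu> p f \<le> Lnorm \<mu> p g"
proof (cases "p = \<infinity>")
  case True
  then show ?thesis using assms by (simp add: Lnorm_def esssup_AE_mono)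
next
  case False
  have "AE x in \<mu>. ennreal_powr (f x) (enn2real p) \<le> ennreal_powr (g x) (enn2real p)"
    using assms(2) by eventually_elim (rule ennreal_powr_mono, auto)
  then show ?thesis using False by (auto simp: Lnorm_def intro!: ennreal_powr_mono nn_integral_mono_AE)
qed

lemma Lnorm_cmult_le:
  assumes [measurable]: "g \<in> borel_measurable borel" and p: "p > 1"
  shows "Lnorm \<mu> p (\<lambda>x. c * g x) \<le> c * Lnorm \<mu> p g"
proof (cases "p = \<infinity>")
  case True
  have "AE x in \<mu>. c * g x \<le> c * esssup \<mu> g"
    using esssup_AE[of g \<mu>] by eventually_elim (rule mult_left_mono, auto)
  then show ?thesis using True by (simp add: Lnorm_def esssup_I)
next
  case False
  then have "enn2real p > 0" using p by (cases p) (auto simp: ennreal_less_iff simp flip: ennreal_1)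
  then show ?thesis using False
    by (simp add: Lnorm_def ennreal_powr_mult nn_integral_cmult ennreal_powr_powr_inverse)
qed

text \<open>The constant 4 comes from the crude power inequality, applied inside the integral (a
  factor 2 after the root) and to the root itself (a factor at most 2).\<close>

lemma Lnorm_add_le:
  assumes [measurable]: "f \<in> borel_measurable borel" "g \<in> borel_measurable borel" and p: "p > 1"
  shows "Lnorm \<mu> p (\<lambda>x. f x + g x) \<le> 4 * (Lnorm \<mu> p f + Lnorm \<mu> p g)"
proof (cases "p = \<infinity>")
  case True
  have "AE x in \<mu>. f x + g x \<le> esssup \<mu> f + esssup \<mu> g"
    using esssup_AE[of f \<mu>] esssup_AE[of g \<mu>] by eventually_elim (rule add_mono)
  then have "esssup \<mu> (\<lambda>x. f x + g x) \<le> esssup \<mu> f + esssup \<mu> g" by (intro esssup_I) auto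
  also have "\<dots> \<le> 4 * (esssup \<mu> f + esssup \<mu> g)"
    using mult_right_mono[of 1 "4::ennreal" "esssup \<mu> f + esssup \<mu> g"] by simp
  finally show ?thesis using True by (simp add: Lnorm_def)
next
  case False
  define s where "s = enn2real p"
  have s: "s > 1" using False p by (cases p) (auto simp: s_def ennreal_less_iff simp flip: ennreal_1)
  have "(\<integral>\<^sup>+x. ennreal_powr (f x + g x) s \<partial>\<mu>) \<le> (\<integral>\<^sup>+x. ennreal (2 powr s) * (ennreal_powr (f x) s + ennreal_powr (g x) s) \<partial>\<mu>)"
    using s by (intro nn_integral_mono ennreal_powr_add_le) auto
  also have "\<dots> = ennreal (2 powr s) * ((\<integral>\<^sup>+x. ennreal_powr (f x) s \<partial>\<mu>) + (\<integral>\<^sup>+x. ennreal_powr (g x) s \<partial>\<mu>))"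
    by (subst nn_integral_cmult, simp, subst nn_integral_add) auto
  finally have "ennreal_powr (\<integral>\<^sup>+x. ennreal_powr (f x + g x) s \<partial>\<mu>) (1 / s) \<le>
     ennreal_powr (ennreal (2 powr s) * ((\<integral>\<^sup>+x. ennreal_powr (f x) s \<partial>\<mu>) + (\<integral>\<^sup>+x. ennreal_powr (g x) s \<partial>\<mu>))) (1 / s)"
    using s by (intro ennreal_powr_mono) auto
  also have "\<dots> = 2 * ennreal_powr ((\<integral>\<^sup>+x. ennreal_powr (f x) s \<partial>\<mu>) + (\<integral>\<^sup>+x. ennreal_powr (g x) s \<partial>\<mu>)) (1 / s)"
    using s by (simp add: ennreal_powr_mult powr_powr)
  also have "\<dots> \<le> 2 * (ennreal (2 powr (1 / s)) * (ennreal_powr (\<integral>\<^sup>+x. ennreal_powr (f x) s \<partial>\<mu>) (1 / s) + ennreal_powr (\<integral>\<^sup>+x. ennreal_powr (g x) s \<partial>\<mu>) (1 / s)))"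
    using s by (intro mult_left_mono ennreal_powr_add_le) auto
  also have "\<dots> \<le> 2 * (2 * (ennreal_powr (\<integral>\<^sup>+x. ennreal_powr (f x) s \<partial>\<mu>) (1 / s) + ennreal_powr (\<integral>\<^sup>+x. ennreal_powr (g x) s \<partial>\<mu>) (1 / s)))"
  proof (intro mult_left_mono mult_right_mono)
    have "(2::real) powr (1 / s) \<le> 2 powr 1" using s by (intro powr_mono) auto
    then have "ennreal (2 powr (1 / s)) \<le> ennreal 2" by (intro ennreal_leI) simp
    then show "ennreal (2 powr (1 / s)) \<le> 2" by simp
  qed auto
  finally show ?thesis using False by (simp add: Lnorm_def s_def mult.assoc[symmetric])
qed

lemma Lnorm_uminus_le:
  assumes [measurable]: "g \<in> borel_measurable borel"
  shows "Lnorm \<mu> p (\<lambda>x. g (- x)) \<le> Lnorm \<mu> p g"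
proof (cases "p = \<infinity>")
  case True
  have "AE x in distr \<mu> borel uminus. g x \<le> esssup \<mu> g"
    unfolding distr_mu_uminus by (rule esssup_AE)
  then have "AE x in \<mu>. g (- x) \<le> esssup \<mu> g" by (subst (asm) AE_distr_iff) auto
  then show ?thesis using True by (simp add: Lnorm_def esssup_I)
next
  case False
  then show ?thesis
    using nn_integral_mu_uminus[of "\<lambda>x. ennreal_powr (g x) (enn2real p)"] by (simp add: Lnorm_def)
qed

lemma maximal_fn_le_esssup:
  assumes [measurable]: "G \<in> borel_measurable borel"
  shows "maximal_fn \<mu> G x \<le> esssup \<mu> G"
  unfolding maximal_fn_def
proof (rule SUP_least, clarify)
  fix a b
  have "(\<integral>\<^sup>+y\<in>{a<..<b}. G y \<partial>\<mu>) \<le> (\<integral>\<^sup>+y. esssup \<mu> G * indicator {a<..<b} y \<partial>\<mu>)"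
    using esssup_AE[of G \<mu>] by (intro nn_integral_mono_AE) (auto elim!: eventually_mono intro: mult_right_mono)
  also have "\<dots> = esssup \<mu> G * emeasure \<mu> {a<..<b}" by (subst nn_integral_cmult_indicator) auto
  finally show "(\<integral>\<^sup>+y\<in>{a<..<b}. G y \<partial>\<mu>) / emeasure \<mu> {a<..<b} \<le> esssup \<mu> G"
    by (cases "emeasure \<mu> {a<..<b} = 0") (auto intro!: divide_le_posI_ennreal simp: mult.commute zero_less_iff_neq_zero)
qed

lemma Lnorm_maximal_fn_le:
  assumes p: "p > 1"
  obtains C where "C > 0" "\<And>G. G \<in> borel_measurable borel \<Longrightarrow> Lnorm \<mu> p (maximal_fn \<mu> G) \<le> ennreal C * Lnorm \<mu> p G"
proof (cases "p = \<infinity>")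
  case True
  show ?thesis
  proof (rule that[of 1])
    fix G :: "real \<Rightarrow> ennreal" assume [measurable]: "G \<in> borel_measurable borel"
    show "Lnorm \<mu> p (maximal_fn \<mu> G) \<le> ennreal 1 * Lnorm \<mu> p G"
      using True by (simp add: Lnorm_def esssup_I borel_measurable_maximal_fn maximal_fn_le_esssup)
  qed simp
next
  case False
  define s where "s = enn2real p"
  have s: "s > 1" using False p by (cases p) (auto simp: s_def ennreal_less_iff simp flip: ennreal_1)
  define B where "B = 4 * s / (s - 1) * 2 powr (s - 1)"
  have B: "B > 0" using s by (simp add: B_def)
  show ?thesis
  proof (rule that[of "B powr (1 / s)"])
    show "B powr (1 / s) > 0" using B by simp
    fix G :: "real \<Rightarrow> ennreal" assume [measurable]: "G \<in> borel_measurable borel"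
    have "(\<integral>\<^sup>+x. ennreal_powr (maximal_fn \<mu> G x) s \<partial>\<mu>) \<le> ennreal B * (\<integral>\<^sup>+x. ennreal_powr (G x) s \<partial>\<mu>)"
      unfolding B_def by (rule maximal_fn_strong_type[OF mu.sigma_finite_measure_axioms sets_mu _ s]) simp
    then have "ennreal_powr (\<integral>\<^sup>+x. ennreal_powr (maximal_fn \<mu> G x) s \<partial>\<mu>) (1 / s) \<le> ennreal_powr (ennreal B * (\<integral>\<^sup>+x. ennreal_powr (G x) s \<partial>\<mu>)) (1 / s)"
      using s by (intro ennreal_powr_mono) auto
    then show "Lnorm \<mu> p (maximal_fn \<mu> G) \<le> ennreal (B powr (1 / s)) * Lnorm \<mu> p G"
      using False B by (simp add: Lnorm_def ennreal_powr_mult flip: s_def)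
  qed
qed

section \<open>The Dunkl maximal function\<close>

lemma translate_integral_measurable:
  assumes [measurable]: "g \<in> borel_measurable borel" and r: "r > 0"
  shows "(\<lambda>y. translate_integral \<kappa> y g r) \<in> borel_measurable borel"
proof -
  have "(\<lambda>(y, x). g x * ennreal (ball_translate r y x)) \<in> borel_measurable (borel \<Otimes>\<^sub>M borel)"
    unfolding split_def by measurable
  then show ?thesis unfolding translate_integral_eq[OF r]
    by (intro mu.borel_measurable_nn_integral) (simp cong: measurable_cong_sets sets_pair_measure_cong)
qed

text \<open>The supremum may be restricted to rational radii: any r is the limit of an increasing
  sequence of them, along which the numerator increases to its value at r by monotone
  convergence.\<close>

lemma dunkl_maximal_measurable:
  assumes [measurable]: "f \<in> borel_measurable borel"
  shows "dunkl_maximal \<kappa> f \<in> borel_measurable borel"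
proof -
  define q where "q = (\<lambda>r x. translate_integral \<kappa> x (absval f) r / emeasure \<mu> (dunkl_ball 0 r))"
  define R where "R = {r. r \<in> \<rat> \<and> r > (0::real)}"
  have R: "countable R" unfolding R_def by (rule countable_subset[OF _ countable_rat]) auto
  have "dunkl_maximal \<kappa> f = (\<lambda>x. SUP r\<in>R. q r x)"
  proof (rule ext, rule antisym)
    fix x
    show "(SUP r\<in>R. q r x) \<le> dunkl_maximal \<kappa> f x"
      unfolding dunkl_maximal_def q_def by (rule SUP_subset_mono) (auto simp: R_def)
    show "dunkl_maximal \<kappa> f x \<le> (SUP r\<in>R. q r x)"
      unfolding dunkl_maximal_def
    proof (rule SUP_least)
      fix r :: real assume "r \<in> {0<..}"
      then have r: "r > 0" by simp
      obtain s where s: "\<And>n. s n \<in> R" "\<And>n. s n < r" "incseq s" "s \<longlonglongrightarrow> r"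
      proof -
        have step: "\<exists>b. b \<in> R \<and> max a (r - 1 / real (Suc n)) < b \<and> b < r" if "a < r" for a n
        proof -
          have "max (max a 0) (r - 1 / real (Suc n)) < r" using that r by simp
          from Rats_dense_in_real[OF this] show ?thesis by (auto simp: R_def)
        qed
        have "\<exists>s. \<forall>n. (s n \<in> R \<and> r - 1 / real (Suc n) < s n \<and> s n < r) \<and> s n < s (Suc n)"
        proof (rule dependent_nat_choice)
          show "\<exists>x. x \<in> R \<and> r - 1 / real (Suc 0) < x \<and> x < r" using step[of 0 0] r by auto
          fix x n assume "x \<in> R \<and> r - 1 / real (Suc n) < x \<and> x < r"
          then show "\<exists>y. (y \<in> R \<and> r - 1 / real (Suc (Suc n)) < y \<and> y < r) \<and> x < y"
            using step[of x "Suc n"] by auto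
        qed
        then obtain s where s: "\<And>n. s n \<in> R" "\<And>n. r - 1 / real (Suc n) < s n" "\<And>n. s n < r" "\<And>n. s n < s (Suc n)" by blast
        have "s \<longlonglongrightarrow> r"
        proof (rule tendsto_sandwich)
          show "\<forall>\<^sub>F n in sequentially. r - 1 / real (Suc n) \<le> s n" by (intro always_eventually allI less_imp_le s(2))
          show "\<forall>\<^sub>F n in sequentially. s n \<le> r" by (intro always_eventually allI less_imp_le s(3))
          have "(\<lambda>n. r - inverse (real (Suc n))) \<longlonglongrightarrow> r - 0" by (intro tendsto_diff tendsto_const LIMSEQ_inverse_real_of_nat)
          then show "(\<lambda>n. r - 1 / real (Suc n)) \<longlonglongrightarrow> r" by (simp add: inverse_eq_divide)
        qed simp
        moreover have "incseq s" using s(4) by (intro incseq_SucI less_imp_le)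
        ultimately show ?thesis using that s by blast
      qed
      have s0: "s n > 0" for n using s(1)[of n] by (simp add: R_def)
      have mono: "ennreal (ball_translate (s m) x z) \<le> ennreal (ball_translate (s n) x z)" if "m \<le> n" for m n z
      proof -
        have "(s m)\<^sup>2 \<le> (s n)\<^sup>2" by (intro power_mono incseqD[OF s(3) that] less_imp_le[OF s0])
        then show ?thesis unfolding ennreal_ball_translate
          by (intro nn_integral_mono ennreal_leI) (auto simp: indicator_def)
      qed
      have "translate_integral \<kappa> x (absval f) r = (\<integral>\<^sup>+z. (SUP n. absval f z * ennreal (ball_translate (s n) x z)) \<partial>\<mu>)"
        unfolding translate_integral_eq[OF r] ball_translate_SUP[OF s(3,4) s0 s(2)] by (simp add: SUP_mult_left_ennreal)
      also have "\<dots> = (SUP n. translate_integral \<kappa> x (absval f) (s n))"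
        unfolding translate_integral_eq[OF s0]
        by (rule nn_integral_monotone_convergence_SUP) (auto simp: incseq_def le_fun_def intro!: mult_left_mono mono)
      finally have "translate_integral \<kappa> x (absval f) r / emeasure \<mu> (dunkl_ball 0 r) =
          (SUP n. translate_integral \<kappa> x (absval f) (s n) / emeasure \<mu> (dunkl_ball 0 r))"
        unfolding divide_ennreal_def by (simp add: SUP_mult_right_ennreal)
      also have "\<dots> \<le> (SUP r\<in>R. q r x)"
      proof (rule SUP_least)
        fix n
        \<comment> \<open>Passing to the smaller ball in the denominator can only increase the
          quotient, so a supremum over the approximating radii suffices.\<close>
        have "emeasure \<mu> (dunkl_ball 0 (s n)) \<le> emeasure \<mu> (dunkl_ball 0 r)"
          using s(2)[of n] unfolding dunkl_ball_0 by (intro emeasure_mono) (auto simp: annulus_def)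
        then have "translate_integral \<kappa> x (absval f) (s n) / emeasure \<mu> (dunkl_ball 0 r) \<le> q (s n) x"
          unfolding q_def divide_ennreal_def by (intro mult_left_mono) (auto intro: ennreal_inverse_antimono)
        also have "\<dots> \<le> (SUP r\<in>R. q r x)" using s(1) by (rule SUP_upper)
        finally show "translate_integral \<kappa> x (absval f) (s n) / emeasure \<mu> (dunkl_ball 0 r) \<le> (SUP r\<in>R. q r x)" .
      qed
      finally show "translate_integral \<kappa> x (absval f) r / emeasure \<mu> (dunkl_ball 0 r) \<le> (SUP r\<in>R. q r x)" .
    qed
  qed
  moreover have "(\<lambda>x. SUP r\<in>R. q r x) \<in> borel_measurable borel"
  proof (rule borel_measurable_SUP[OF R])
    fix r assume "r \<in> R"
    then have "r > 0" by (simp add: R_def)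
    then have [measurable]: "(\<lambda>x. translate_integral \<kappa> x (absval f) r) \<in> borel_measurable borel"
      by (intro translate_integral_measurable) auto
    show "q r \<in> borel_measurable borel" unfolding q_def by measurable
  qed
  ultimately show ?thesis by simp
qed

text \<open>The maximum, unlike a sum, commutes with powers, and the power of the result is at most
  the sum of the powers at x and -x.\<close>

definition even_max :: "(real \<Rightarrow> complex) \<Rightarrow> real \<Rightarrow> ennreal" where
  "even_max f x = max (absval f x) (absval f (- x))"

lemma even_max_measurable [measurable]:
  assumes [measurable]: "f \<in> borel_measurable borel"
  shows "even_max f \<in> borel_measurable borel"
  unfolding even_max_def[abs_def] by measurable

lemma even_max_uminus [simp]: "even_max f (- x) = even_max f x"
  by (simp add: even_max_def max.commute)

lemma absval_le_even_max: "absval f x \<le> even_max f x"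
  by (simp add: even_max_def)

lemma translate_integral_le:
  obtains C where "C > 0" "\<And>g r y. r > 0 \<Longrightarrow>
    translate_integral \<kappa> y g r \<le> (\<integral>\<^sup>+x. g x * (ennreal (C * vol 0 r / vol y r) * indicator (annulus y r) x) \<partial>\<mu>)"
proof -
  obtain C where C: "C > 0" "\<And>r x y. r > 0 \<Longrightarrow> ball_translate r y x \<le> C * (r / (\<bar>y\<bar> + r)) powr (2 * \<kappa> + 1)"
    by (rule ball_translate_upper) blast
  have "translate_integral \<kappa> y g r \<le> (\<integral>\<^sup>+x. g x * (ennreal (C * vol 0 r / vol y r) * indicator (annulus y r) x) \<partial>\<mu>)" if r: "r > 0" for g r y
    unfolding translate_integral_eq[OF r]
  proof (intro nn_integral_mono mult_left_mono)
    fix x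
    show "ennreal (ball_translate r y x) \<le> ennreal (C * vol 0 r / vol y r) * indicator (annulus y r) x"
    proof (cases "x \<in> annulus y r")
      case True
      then show ?thesis using C(2)[OF r, of y x] by (simp add: vol_ratio[OF r] ennreal_leI)
    next
      case False
      then show ?thesis using ball_translate_eq_0[OF r, of x y] by (simp add: annulus_def)
    qed
  qed simp
  with C(1) show ?thesis using that by blast
qed

text \<open>The upper bound for the translate is proportional to vol 0 r / vol y r on the annulus.
  The numerator cancels against the measure of the ball in the definition of the maximal function,
  and the denominator normalizes the average.\<close>

lemma dunkl_maximal_le_avg:
  obtains C where "C > 0" "\<And>f x. f \<in> borel_measurable borel \<Longrightarrow>
    dunkl_maximal \<kappa> f x \<le> ennreal C * (SUP s\<in>{0<..}. avg (even_max f) x s)"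
proof -
  obtain C where C: "C > 0" "\<And>g r y. r > 0 \<Longrightarrow>
    translate_integral \<kappa> y g r \<le> (\<integral>\<^sup>+x. g x * (ennreal (C * vol 0 r / vol y r) * indicator (annulus y r) x) \<partial>\<mu>)"
    by (rule translate_integral_le) blast
  have "dunkl_maximal \<kappa> f x \<le> ennreal (C / cvol) * (SUP s\<in>{0<..}. avg (even_max f) x s)"
    if [measurable]: "f \<in> borel_measurable borel" for f x
    unfolding dunkl_maximal_def
  proof (rule SUP_least)
    fix r :: real assume "r \<in> {0<..}"
    then have r: "r > 0" by simp
    have v: "vol 0 r > 0" "vol x r > 0" using r by (auto intro: vol_pos)
    have "translate_integral \<kappa> x (absval f) r \<le> (\<integral>\<^sup>+z. absval f z * (ennreal (C * vol 0 r / vol x r) * indicator (annulus x r) z) \<partial>\<mu>)"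
      by (rule C(2)[OF r])
    also have "\<dots> \<le> (\<integral>\<^sup>+z. ennreal (C * vol 0 r / vol x r) * (even_max f z * indicator (annulus x r) z) \<partial>\<mu>)"
      by (intro nn_integral_mono) (auto simp: mult.left_commute intro!: mult_left_mono mult_right_mono absval_le_even_max)
    also have "\<dots> = ennreal (C * vol 0 r / vol x r) * (avg (even_max f) x r * ennreal (vol x r))"
      unfolding avg_times_vol[OF r] by (rule nn_integral_cmult) measurable
    also have "\<dots> = ennreal (cvol * vol 0 r) * (ennreal (C / cvol) * avg (even_max f) x r)"
    proof -
      have "ennreal (C * vol 0 r / vol x r) * ennreal (vol x r) = ennreal (cvol * vol 0 r) * ennreal (C / cvol)"
        using v C(1) cvol_pos by (simp flip: ennreal_mult)
      then show ?thesis by (simp add: mult.assoc[symmetric] mult.commute[of "avg _ _ _"])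
    qed
    also have "\<dots> \<le> emeasure \<mu> (dunkl_ball 0 r) * (ennreal (C / cvol) * avg (even_max f) x r)"
      unfolding dunkl_ball_0 by (intro mult_right_mono emeasure_annulus_ge r) auto
    finally have le: "translate_integral \<kappa> x (absval f) r \<le> emeasure \<mu> (dunkl_ball 0 r) * (ennreal (C / cvol) * avg (even_max f) x r)" .
    have "emeasure \<mu> (dunkl_ball 0 r) > 0"
      unfolding dunkl_ball_0 using emeasure_annulus_ge[OF r, of 0] v cvol_pos by (auto intro: less_le_trans[rotated])
    then have "translate_integral \<kappa> x (absval f) r / emeasure \<mu> (dunkl_ball 0 r) \<le> ennreal (C / cvol) * avg (even_max f) x r"
      using le by (rule divide_le_posI_ennreal)
    also have "\<dots> \<le> ennreal (C / cvol) * (SUP s\<in>{0<..}. avg (even_max f) x s)"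
      using r by (intro mult_left_mono SUP_upper) auto
    finally show "translate_integral \<kappa> x (absval f) r / emeasure \<mu> (dunkl_ball 0 r) \<le> ennreal (C / cvol) * (SUP s\<in>{0<..}. avg (even_max f) x s)" .
  qed
  moreover have "C / cvol > 0" using C(1) cvol_pos by simp
  ultimately show ?thesis using that by blast
qed

text \<open>In the second term x occurs only through the membership in the annulus, so this term is
  a constant for the inner integral over x. The centres are nonzero because annuli are compared with
  intervals around them.\<close>

lemma dunkl_maximal_le:
  obtains C where "C > 0" "\<And>f x y r. f \<in> borel_measurable borel \<Longrightarrow> r > 0 \<Longrightarrow> x \<noteq> 0 \<Longrightarrow> y \<noteq> 0 \<Longrightarrow> x \<in> annulus y r \<Longrightarrow>
    dunkl_maximal \<kappa> f x \<le> ennreal C * (maximal_fn \<mu> (\<lambda>z. even_max f z * indicator (annulus y (2 * r)) z) x + maximal_fn \<mu> (\<lambda>z. avg (even_max f) z r) y)"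
proof -
  obtain C where C: "C > 0" "\<And>f x. f \<in> borel_measurable borel \<Longrightarrow>
    dunkl_maximal \<kappa> f x \<le> ennreal C * (SUP s\<in>{0<..}. avg (even_max f) x s)"
    by (rule dunkl_maximal_le_avg) blast
  define B where "B = (1 + Cglob) * (8 / D)"
  have Cg: "Cglob \<ge> 0" using cvol_pos by (simp add: Cglob_def)
  have B: "B > 0" "8 / D \<le> B" "Cglob * (8 / D) \<le> B"
  proof -
    have "8 / D > 0" "Cglob * (8 / D) \<ge> 0" using D_pos Cg by (simp_all only: zero_less_divide_iff) auto
    then show "B > 0" "8 / D \<le> B" "Cglob * (8 / D) \<le> B" unfolding B_def distrib_right by linarith+
  qed
  have "dunkl_maximal \<kappa> f x \<le> ennreal (C * B) * (maximal_fn \<mu> (\<lambda>z. even_max f z * indicator (annulus y (2 * r)) z) x + maximal_fn \<mu> (\<lambda>z. avg (even_max f) z r) y)"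
    if [measurable]: "f \<in> borel_measurable borel" and r: "r > 0" and x: "x \<noteq> 0" and y: "y \<noteq> 0" and xy: "x \<in> annulus y r" for f x y r
  proof -
    define M1 where "M1 = maximal_fn \<mu> (\<lambda>z. even_max f z * indicator (annulus y (2 * r)) z) x"
    define M2 where "M2 = maximal_fn \<mu> (\<lambda>z. avg (even_max f) z r) y"
    have "(SUP s\<in>{0<..}. avg (even_max f) x s) \<le> ennreal B * (M1 + M2)"
    proof (rule SUP_least)
      fix s :: real assume "s \<in> {0<..}"
      then have s: "s > 0" by simp
      show "avg (even_max f) x s \<le> ennreal B * (M1 + M2)"
      proof (cases "s \<le> r")
        case True
        have "avg (even_max f) x s \<le> avg (\<lambda>z. even_max f z * indicator (annulus y (2 * r)) z) x s"
          by (rule avg_local[OF xy True])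
        also have "\<dots> \<le> ennreal (8 / D) * M1"
          unfolding M1_def using s x by (intro avg_le_maximal_fn) (auto simp: indicator_def)
        also have "\<dots> \<le> ennreal B * (M1 + M2)" using B by (intro mult_mono ennreal_leI) auto
        finally show ?thesis .
      next
        case False
        have "avg (even_max f) x s \<le> ennreal Cglob * avg (\<lambda>z. avg (even_max f) z r) y (3 * s)"
          using False by (intro avg_global[OF _ xy r]) auto
        also have "\<dots> \<le> ennreal Cglob * (ennreal (8 / D) * M2)"
          unfolding M2_def using s y by (intro mult_left_mono avg_le_maximal_fn) auto
        also have "\<dots> = ennreal (Cglob * (8 / D)) * M2"
        proof -
          have "ennreal (Cglob * (8 / D)) = ennreal Cglob * ennreal (8 / D)" using Cg D_pos by (intro ennreal_mult) auto
          then show ?thesis by (simp only: mult.assoc)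
        qed
        also have "\<dots> \<le> ennreal B * (M1 + M2)" using B by (intro mult_mono ennreal_leI) auto
        finally show ?thesis .
      qed
    qed
    then have "dunkl_maximal \<kappa> f x \<le> ennreal C * (ennreal B * (M1 + M2))"
      using C(2)[OF that(1), of x] by (meson mult_left_mono order_trans zero_le)
    then show ?thesis using C(1) B(1) by (simp add: M1_def M2_def ennreal_mult mult.assoc)
  qed
  moreover have "C * B > 0" using C(1) B(1) by simp
  ultimately show ?thesis using that by blast
qed

text \<open>Jensen's inequality up to a constant, since annuli are normalized by \<open>vol\<close>.
  It is obtained from the pointwise bound F \<le> l + l^(1-q) F^q, valid for every l > 0: either F
  \<le> l, or F^(1-q) \<le> l^(1-q).\<close>

lemma avg_power:
  assumes [measurable]: "F \<in> borel_measurable borel" and q: "q > 1" and r: "r > 0"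
  shows "avg F y r \<le> ennreal (4 / D + 1) * ennreal_powr (avg (\<lambda>z. ennreal_powr (F z) q) y r) (1 / q)"
proof (cases "avg (\<lambda>z. ennreal_powr (F z) q) y r")
  case top
  have "ennreal (4 / D + 1) > 0" using D_pos by (simp add: add_pos_pos)
  then show ?thesis unfolding top by (simp add: ennreal_mult_top)
next
  case (real b)
  show ?thesis
  proof (cases "b = 0")
    case True
    have "(\<integral>\<^sup>+z. ennreal_powr (F z) q * indicator (annulus y r) z \<partial>\<mu>) = 0"
      unfolding avg_times_vol[OF r, symmetric] real(2) True by simp
    then have "AE z in \<mu>. ennreal_powr (F z) q * indicator (annulus y r) z = 0"
      by (subst (asm) nn_integral_0_iff_AE) auto
    moreover have "a = 0" if "ennreal_powr a q = 0" for a using that by (cases a) auto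
    ultimately have "AE z in \<mu>. F z * indicator (annulus y r) z = 0" by (auto elim!: eventually_mono)
    then have "(\<integral>\<^sup>+z. F z * indicator (annulus y r) z \<partial>\<mu>) = 0" by (subst nn_integral_0_iff_AE) auto
    then show ?thesis unfolding avg_def by simp
  next
    case False
    then have b: "b > 0" using real by simp
    \<comment> \<open>This choice balances the two terms of the pointwise bound: l^(1-q) b = l. The
      case b = 0 is separate because l must be positive.\<close>
    define l where "l = b powr (1 / q)"
    have l: "l > 0" using b by (simp add: l_def)
    have lb: "l powr (1 - q) * b = l"
    proof -
      have "b = l powr q" using b q by (simp add: l_def powr_powr)
      then show ?thesis using l by (simp flip: powr_add)
    qed
    have F: "F z \<le> ennreal l + ennreal (l powr (1 - q)) * ennreal_powr (F z) q" for z
    proof (cases "F z")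
      case (real x)
      have "x \<le> l + l powr (1 - q) * x powr q"
      proof (cases "x \<le> l")
        case True
        then show ?thesis by (simp add: add_increasing2)
      next
        case False
        then have "x = x powr (1 - q) * x powr q" using l by (simp flip: powr_add)
        also have "\<dots> \<le> l powr (1 - q) * x powr q"
          using False l q by (intro mult_right_mono powr_mono2') auto
        finally show ?thesis using l by simp
      qed
      then show ?thesis using real l by (simp flip: ennreal_mult ennreal_plus)
    qed (use l in \<open>simp add: ennreal_mult_top\<close>)
    have "(\<integral>\<^sup>+z. F z * indicator (annulus y r) z \<partial>\<mu>) \<le>
      (\<integral>\<^sup>+z. ennreal l * indicator (annulus y r) z + ennreal (l powr (1 - q)) * (ennreal_powr (F z) q * indicator (annulus y r) z) \<partial>\<mu>)"
      using F by (intro nn_integral_mono) (auto split: split_indicator)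
    also have "\<dots> = ennreal l * emeasure \<mu> (annulus y r) + ennreal (l powr (1 - q)) * (ennreal b * ennreal (vol y r))"
      unfolding real(2)[symmetric] avg_times_vol[OF r]
      by (subst nn_integral_add, simp, simp, subst nn_integral_cmult_indicator, simp, subst nn_integral_cmult) auto
    also have "\<dots> \<le> ennreal l * ennreal (4 / D * vol y r) + ennreal (l powr (1 - q)) * (ennreal b * ennreal (vol y r))"
      by (intro add_right_mono mult_left_mono emeasure_annulus_le r) auto
    also have "\<dots> = ennreal (l * (4 / D * vol y r) + l powr (1 - q) * b * vol y r)"
      using l b D_pos vol_pos[OF r, of y] by (simp add: mult.assoc flip: ennreal_mult ennreal_plus)
    also have "\<dots> = ennreal (4 / D + 1) * ennreal l * ennreal (vol y r)"
      unfolding lb using l D_pos vol_pos[OF r, of y] by (simp add: algebra_simps flip: ennreal_mult)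
    finally show ?thesis unfolding avg_le_iff[OF r] real(2) l_def using real(1) by simp
  qed
qed

lemma vol_double: "r > 0 \<Longrightarrow> vol y (2 * r) \<le> 2 * 2 powr (2 * \<kappa> + 1) * vol y r"
  by (rule vol_mono_cmult) auto

text \<open>The pointwise bound is integrated against the weight C0 vol 0 r / vol y r on the
  annulus. The local term is integrated over the whole line by the strong type inequality, the
  global term is constant there; in both cases vol y r cancels and vol 0 r remains.\<close>

lemma maximal_translate_integral_le:
  assumes q: "q > 1"
  obtains C where "C > 0" "\<And>f r y. f \<in> borel_measurable borel \<Longrightarrow> r > 0 \<Longrightarrow> y \<noteq> 0 \<Longrightarrow>
    translate_integral \<kappa> y (\<lambda>x. ennreal_powr (dunkl_maximal \<kappa> f x) q) r \<le>
    ennreal C * (ennreal (vol 0 r) * (avg (\<lambda>z. ennreal_powr (even_max f z) q) y (2 * r) +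
      ennreal_powr (maximal_fn \<mu> (\<lambda>z. avg (even_max f) z r) y) q))"
proof -
  obtain C0 where C0: "C0 > 0" "\<And>g r y. r > 0 \<Longrightarrow>
    translate_integral \<kappa> y g r \<le> (\<integral>\<^sup>+x. g x * (ennreal (C0 * vol 0 r / vol y r) * indicator (annulus y r) x) \<partial>\<mu>)"
    by (rule translate_integral_le) blast
  obtain C1 where C1: "C1 > 0" "\<And>f x y r. f \<in> borel_measurable borel \<Longrightarrow> r > 0 \<Longrightarrow> x \<noteq> 0 \<Longrightarrow> y \<noteq> 0 \<Longrightarrow> x \<in> annulus y r \<Longrightarrow>
    dunkl_maximal \<kappa> f x \<le> ennreal C1 * (maximal_fn \<mu> (\<lambda>z. even_max f z * indicator (annulus y (2 * r)) z) x + maximal_fn \<mu> (\<lambda>z. avg (even_max f) z r) y)"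
    by (rule dunkl_maximal_le) blast
  define Cs where "Cs = 4 * q / (q - 1) * 2 powr (q - 1)"
  define C2 where "C2 = C1 powr q * 2 powr q"
  define a where "a = (2::real) powr (2 * \<kappa> + 1)"
  define E where "E = Cs * (2 * a) + 4 / D"
  have Cs: "Cs > 0" using q by (simp add: Cs_def)
  have C2: "C2 > 0" using C1(1) by (simp add: C2_def)
  have a: "a > 0" by (simp add: a_def)
  have E: "E > 0" using Cs a D_pos by (simp add: E_def add_pos_pos)
  have "translate_integral \<kappa> y (\<lambda>x. ennreal_powr (dunkl_maximal \<kappa> f x) q) r \<le>
    ennreal (C2 * C0 * E) * (ennreal (vol 0 r) * (avg (\<lambda>z. ennreal_powr (even_max f z) q) y (2 * r) +
      ennreal_powr (maximal_fn \<mu> (\<lambda>z. avg (even_max f) z r) y) q))"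
    if f [measurable]: "f \<in> borel_measurable borel" and r: "r > 0" and y: "y \<noteq> 0" for f r y
  proof -
    define F1 where "F1 = (\<lambda>z. even_max f z * indicator (annulus y (2 * r)) z)"
    have [measurable]: "F1 \<in> borel_measurable borel" by (simp add: F1_def)
    define M1 where "M1 = maximal_fn \<mu> F1"
    have [measurable]: "M1 \<in> borel_measurable borel" unfolding M1_def by (rule borel_measurable_maximal_fn)
    define M2 where "M2 = maximal_fn \<mu> (\<lambda>z. avg (even_max f) z r) y"
    define A where "A = avg (\<lambda>z. ennreal_powr (even_max f z) q) y (2 * r)"
    define k where "k = C0 * vol 0 r / vol y r"
    have v: "vol 0 r > 0" "vol y r > 0" using r by (auto intro: vol_pos)
    have k: "k > 0" using C0(1) v by (simp add: k_def)
    have pt: "ennreal_powr (dunkl_maximal \<kappa> f x) q \<le> ennreal C2 * (ennreal_powr (M1 x) q + ennreal_powr M2 q)"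
      if "x \<noteq> 0" "x \<in> annulus y r" for x
    proof -
      have "ennreal_powr (dunkl_maximal \<kappa> f x) q \<le> ennreal_powr (ennreal C1 * (M1 x + M2)) q"
        unfolding M1_def M2_def F1_def using q by (intro ennreal_powr_mono C1(2) f r that y) auto
      also have "\<dots> = ennreal (C1 powr q) * ennreal_powr (M1 x + M2) q"
        using C1(1) by (simp add: ennreal_powr_mult)
      also have "\<dots> \<le> ennreal (C1 powr q) * (ennreal (2 powr q) * (ennreal_powr (M1 x) q + ennreal_powr M2 q))"
        using q by (intro mult_left_mono ennreal_powr_add_le) auto
      also have "\<dots> = ennreal C2 * (ennreal_powr (M1 x) q + ennreal_powr M2 q)"
        by (simp add: C2_def ennreal_mult mult.assoc)
      finally show ?thesis .
    qed
    have I1: "(\<integral>\<^sup>+x. ennreal_powr (M1 x) q \<partial>\<mu>) \<le> ennreal (Cs * (2 * a) * vol y r) * A"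
    proof -
      have "(\<integral>\<^sup>+x. ennreal_powr (M1 x) q \<partial>\<mu>) \<le> ennreal Cs * (\<integral>\<^sup>+x. ennreal_powr (F1 x) q \<partial>\<mu>)"
        unfolding M1_def Cs_def by (rule maximal_fn_strong_type[OF mu.sigma_finite_measure_axioms sets_mu _ q]) simp
      also have "(\<integral>\<^sup>+x. ennreal_powr (F1 x) q \<partial>\<mu>) = (\<integral>\<^sup>+z. ennreal_powr (even_max f z) q * indicator (annulus y (2 * r)) z \<partial>\<mu>)"
        by (intro nn_integral_cong) (simp add: F1_def indicator_def)
      also have "\<dots> = A * ennreal (vol y (2 * r))" unfolding A_def using r by (subst avg_times_vol) auto
      also have "ennreal Cs * (A * ennreal (vol y (2 * r))) \<le> ennreal Cs * (A * ennreal (2 * a * vol y r))"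
        unfolding a_def by (intro mult_left_mono ennreal_leI vol_double r) auto
      also have "\<dots> = ennreal (Cs * (2 * a) * vol y r) * A"
      proof -
        have "ennreal (Cs * (2 * a) * vol y r) = ennreal Cs * ennreal (2 * a * vol y r)"
          using Cs a v by (subst ennreal_mult[symmetric]) (auto simp: mult_ac)
        then show ?thesis by (simp only: mult_ac)
      qed
      finally show ?thesis .
    qed
    have "translate_integral \<kappa> y (\<lambda>x. ennreal_powr (dunkl_maximal \<kappa> f x) q) r \<le>
       (\<integral>\<^sup>+x. ennreal_powr (dunkl_maximal \<kappa> f x) q * (ennreal k * indicator (annulus y r) x) \<partial>\<mu>)"
      unfolding k_def by (rule C0(2)[OF r])
    also have "\<dots> \<le> (\<integral>\<^sup>+x. ennreal (C2 * k) * (ennreal_powr (M1 x) q + ennreal_powr M2 q * indicator (annulus y r) x) \<partial>\<mu>)"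
    proof (rule nn_integral_mono_AE)
      show "AE x in \<mu>. ennreal_powr (dunkl_maximal \<kappa> f x) q * (ennreal k * indicator (annulus y r) x) \<le>
          ennreal (C2 * k) * (ennreal_powr (M1 x) q + ennreal_powr M2 q * indicator (annulus y r) x)"
        using AE_mu_nonzero
      proof eventually_elim
        fix x :: real assume x: "x \<noteq> 0"
        show "ennreal_powr (dunkl_maximal \<kappa> f x) q * (ennreal k * indicator (annulus y r) x) \<le>
          ennreal (C2 * k) * (ennreal_powr (M1 x) q + ennreal_powr M2 q * indicator (annulus y r) x)"
        proof (cases "x \<in> annulus y r")
          case True
          have "ennreal_powr (dunkl_maximal \<kappa> f x) q * ennreal k \<le> ennreal C2 * (ennreal_powr (M1 x) q + ennreal_powr M2 q) * ennreal k"
            by (intro mult_right_mono pt x True) auto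
          also have "\<dots> = ennreal (C2 * k) * (ennreal_powr (M1 x) q + ennreal_powr M2 q)"
            using C2 k by (simp add: ennreal_mult mult_ac)
          finally show ?thesis using True by simp
        qed simp
      qed
    qed
    also have "\<dots> = ennreal (C2 * k) * ((\<integral>\<^sup>+x. ennreal_powr (M1 x) q \<partial>\<mu>) + ennreal_powr M2 q * emeasure \<mu> (annulus y r))"
      by (subst nn_integral_cmult, simp, subst nn_integral_add, simp, simp, subst nn_integral_cmult_indicator) auto
    also have "\<dots> \<le> ennreal (C2 * k) * (ennreal (Cs * (2 * a) * vol y r) * A + ennreal_powr M2 q * ennreal (4 / D * vol y r))"
      by (intro mult_left_mono add_mono I1 emeasure_annulus_le r) auto
    also have "\<dots> \<le> ennreal (C2 * k) * (ennreal (E * vol y r) * (A + ennreal_powr M2 q))"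
    proof (rule mult_left_mono)
      have "Cs * (2 * a) * vol y r \<le> E * vol y r" "4 / D * vol y r \<le> E * vol y r"
        using Cs a D_pos v unfolding E_def by (intro mult_right_mono; simp)+
      then have "ennreal (Cs * (2 * a) * vol y r) * A \<le> ennreal (E * vol y r) * A"
        "ennreal_powr M2 q * ennreal (4 / D * vol y r) \<le> ennreal_powr M2 q * ennreal (E * vol y r)"
        by (auto intro!: mult_right_mono mult_left_mono ennreal_leI)
      then show "ennreal (Cs * (2 * a) * vol y r) * A + ennreal_powr M2 q * ennreal (4 / D * vol y r) \<le> ennreal (E * vol y r) * (A + ennreal_powr M2 q)"
        unfolding distrib_left mult.commute[of "ennreal_powr M2 q"] by (rule add_mono)
    qed simp
    also have "\<dots> = ennreal (C2 * C0 * E) * (ennreal (vol 0 r) * (A + ennreal_powr M2 q))"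
    proof -
      have "ennreal (C2 * k) * ennreal (E * vol y r) = ennreal (C2 * C0 * E) * ennreal (vol 0 r)"
      proof -
        have "ennreal (C2 * k) * ennreal (E * vol y r) = ennreal (C2 * k * (E * vol y r))"
          using C2 k E v by (intro ennreal_mult[symmetric]) auto
        also have "C2 * k * (E * vol y r) = C2 * C0 * E * vol 0 r" using v by (simp add: k_def)
        also have "ennreal \<dots> = ennreal (C2 * C0 * E) * ennreal (vol 0 r)"
          using C2 C0(1) E v by (intro ennreal_mult) auto
        finally show ?thesis .
      qed
      then show ?thesis by (simp only: mult.assoc[symmetric])
    qed
    finally show ?thesis unfolding A_def M2_def .
  qed
  moreover have "C2 * C0 * E > 0" using C2 C0(1) E by simp
  ultimately show ?thesis using that by blast
qed

text \<open>The radius 4r is dictated by the lower bound, which holds on the annulus of half the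
  radius and is needed on the one of radius 2r. Symmetry of the annulus lets the values of f at z
  and -z be treated as one integral.\<close>

lemma avg_le_translate_integral:
  assumes q: "q > 1"
  obtains C where "C > 0" "\<And>f r y. f \<in> borel_measurable borel \<Longrightarrow> r > 0 \<Longrightarrow>
    ennreal (vol 0 r) * avg (\<lambda>z. ennreal_powr (even_max f z) q) y (2 * r) \<le>
    ennreal C * (translate_integral \<kappa> y (\<lambda>x. ennreal_powr (absval f x) q) (4 * r) +
      translate_integral \<kappa> (- y) (\<lambda>x. ennreal_powr (absval f x) q) (4 * r))"
proof -
  obtain c where c: "c > 0" "\<And>r x y. r > 0 \<Longrightarrow> \<bar>\<bar>x\<bar> - \<bar>y\<bar>\<bar> < r / 2 \<Longrightarrow>
    c * (r / (\<bar>y\<bar> + r)) powr (2 * \<kappa> + 1) \<le> ball_translate r y x + ball_translate r (- y) x"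
    by (rule ball_translate_lower) blast
  define a where "a = (2::real) powr (2 * \<kappa> + 1)"
  define C where "C = 2 * (2 * a) / c"
  have C: "C > 0" using c(1) by (simp add: C_def a_def)
  have "ennreal (vol 0 r) * avg (\<lambda>z. ennreal_powr (even_max f z) q) y (2 * r) \<le>
    ennreal C * (translate_integral \<kappa> y (\<lambda>x. ennreal_powr (absval f x) q) (4 * r) +
      translate_integral \<kappa> (- y) (\<lambda>x. ennreal_powr (absval f x) q) (4 * r))"
    if f [measurable]: "f \<in> borel_measurable borel" and r: "r > 0" for f r y
  proof -
    have r4: "4 * r > 0" and r2: "2 * r > 0" using r by auto
    define g where "g = (\<lambda>x. ennreal_powr (absval f x) q)"
    have [measurable]: "g \<in> borel_measurable borel" by (simp add: g_def)
    define N where "N = translate_integral \<kappa> y g (4 * r) + translate_integral \<kappa> (- y) g (4 * r)"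
    define k where "k = c * (vol 0 (4 * r) / vol y (4 * r))"
    have v: "vol 0 r > 0" "vol 0 (4 * r) > 0" "vol y (4 * r) > 0" "vol y (2 * r) > 0" using r by (auto intro: vol_pos)
    have k: "k > 0" using c(1) v by (simp add: k_def)
    define I where "I = (\<integral>\<^sup>+z. g z * indicator (annulus y (2 * r)) z \<partial>\<mu>)"
    have kI: "ennreal k * I \<le> N"
    proof -
      have "ennreal k * I = (\<integral>\<^sup>+z. ennreal k * (g z * indicator (annulus y (2 * r)) z) \<partial>\<mu>)"
        unfolding I_def by (rule nn_integral_cmult[symmetric]) measurable
      also have "\<dots> \<le> (\<integral>\<^sup>+z. g z * ennreal (ball_translate (4 * r) y z) + g z * ennreal (ball_translate (4 * r) (- y) z) \<partial>\<mu>)"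
      proof (rule nn_integral_mono)
        fix z
        show "ennreal k * (g z * indicator (annulus y (2 * r)) z) \<le> g z * ennreal (ball_translate (4 * r) y z) + g z * ennreal (ball_translate (4 * r) (- y) z)"
        proof (cases "z \<in> annulus y (2 * r)")
          case True
          then have "k \<le> ball_translate (4 * r) y z + ball_translate (4 * r) (- y) z"
            using c(2)[OF r4, of z y] by (simp add: annulus_def k_def vol_ratio[OF r4])
          then have "ennreal k \<le> ennreal (ball_translate (4 * r) y z) + ennreal (ball_translate (4 * r) (- y) z)"
            by (simp add: ball_translate_nonneg ennreal_leI flip: ennreal_plus)
          then have "g z * ennreal k \<le> g z * (ennreal (ball_translate (4 * r) y z) + ennreal (ball_translate (4 * r) (- y) z))"
            by (rule mult_left_mono) simp
          then show ?thesis using True by (simp add: distrib_left mult.commute)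
        qed simp
      qed
      also have "\<dots> = N"
        unfolding N_def translate_integral_eq[OF r4] by (rule nn_integral_add) measurable
      finally show ?thesis .
    qed
    have "(\<integral>\<^sup>+z. ennreal_powr (even_max f z) q * indicator (annulus y (2 * r)) z \<partial>\<mu>) \<le>
        (\<integral>\<^sup>+z. g z * indicator (annulus y (2 * r)) z + g (- z) * indicator (annulus y (2 * r)) (- z) \<partial>\<mu>)"
      using q by (intro nn_integral_mono) (auto simp: even_max_def g_def ennreal_powr_max indicator_def max_def add_increasing add_increasing2)
    also have "\<dots> = I + (\<integral>\<^sup>+z. g (- z) * indicator (annulus y (2 * r)) (- z) \<partial>\<mu>)"
      unfolding I_def by (rule nn_integral_add) (auto simp: indicator_def)
    also have "(\<integral>\<^sup>+z. g (- z) * indicator (annulus y (2 * r)) (- z) \<partial>\<mu>) = I"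
      unfolding I_def by (rule nn_integral_mu_uminus) simp
    also have "I + I = ennreal (2 / k) * (ennreal k * I)"
    proof -
      have "ennreal (2 / k) * ennreal k = 2" using k by (subst ennreal_mult[symmetric]) auto
      then show ?thesis by (simp only: mult.assoc[symmetric] mult_2)
    qed
    also have "\<dots> \<le> ennreal (2 / k) * N" by (intro mult_left_mono kI) auto
    also have "\<dots> \<le> ennreal (C / vol 0 r * vol y (2 * r)) * N"
    proof (intro mult_right_mono ennreal_leI)
      have 1: "vol y (4 * r) \<le> 2 * a * vol y (2 * r)" using vol_double[OF r2, of y] by (simp add: a_def)
      have 2: "vol 0 r \<le> vol 0 (4 * r)"
        using r kappa unfolding vol_def by (intro mult_mono powr_mono2) auto
      have "2 / k = 2 / c * (vol y (4 * r) / vol 0 (4 * r))" using v c(1) by (simp add: k_def)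
      also have "\<dots> \<le> 2 / c * ((2 * a * vol y (2 * r)) / vol 0 r)"
        using v c(1) 1 2 by (intro mult_left_mono frac_le) auto
      also have "\<dots> = C / vol 0 r * vol y (2 * r)" by (simp add: C_def)
      finally show "2 / k \<le> C / vol 0 r * vol y (2 * r)" .
    qed simp
    also have "\<dots> = ennreal (C / vol 0 r) * N * ennreal (vol y (2 * r))"
    proof -
      have "ennreal (C / vol 0 r * vol y (2 * r)) = ennreal (C / vol 0 r) * ennreal (vol y (2 * r))"
        using C v by (intro ennreal_mult) auto
      then show ?thesis by (simp only: mult_ac)
    qed
    finally have "avg (\<lambda>z. ennreal_powr (even_max f z) q) y (2 * r) \<le> ennreal (C / vol 0 r) * N"
      unfolding avg_le_iff[OF r2] .
    then have "ennreal (vol 0 r) * avg (\<lambda>z. ennreal_powr (even_max f z) q) y (2 * r) \<le> ennreal (vol 0 r) * (ennreal (C / vol 0 r) * N)"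
      by (rule mult_left_mono) simp
    also have "\<dots> = ennreal C * N"
    proof -
      have "ennreal (vol 0 r) * ennreal (C / vol 0 r) = ennreal C" using C v by (subst ennreal_mult[symmetric]) auto
      then show ?thesis by (simp only: mult.assoc[symmetric])
    qed
    finally show ?thesis unfolding N_def g_def .
  qed
  with C show ?thesis using that by blast
qed

text \<open>The local term \<open>S\<close> and the function \<open>G\<close> are both dominated by
  averages of the q-th power, the latter by Jensen's inequality after the outer norm has removed the
  maximal function. What remains is n(y) + n(-y), whose two summands have the same norm by
  reflection.\<close>

lemma amalgam_norm_at_maximal_le:
  assumes q: "1 < q" "q < \<infinity>" and p: "p > 1"
  obtains C where "C > 0" "\<And>f r. f \<in> borel_measurable borel \<Longrightarrow> r > 0 \<Longrightarrow>
    amalgam_norm_at \<kappa> r q p (dunkl_maximal \<kappa> f) \<le> ennreal C * amalgam_norm_at \<kappa> (4 * r) q p (absval f)"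
proof -
  define s where "s = enn2real q"
  have q_fin: "(q = \<infinity>) = False" using q by simp
  have s: "s > 1" using q by (cases q) (auto simp: s_def ennreal_less_iff simp flip: ennreal_1)
  obtain C3 where C3: "C3 > 0" "\<And>f r y. f \<in> borel_measurable borel \<Longrightarrow> r > 0 \<Longrightarrow> y \<noteq> 0 \<Longrightarrow>
    translate_integral \<kappa> y (\<lambda>x. ennreal_powr (dunkl_maximal \<kappa> f x) s) r \<le>
    ennreal C3 * (ennreal (vol 0 r) * (avg (\<lambda>z. ennreal_powr (even_max f z) s) y (2 * r) +
      ennreal_powr (maximal_fn \<mu> (\<lambda>z. avg (even_max f) z r) y) s))"
    by (rule maximal_translate_integral_le[OF s]) blast
  obtain C4 where C4: "C4 > 0" "\<And>f r y. f \<in> borel_measurable borel \<Longrightarrow> r > 0 \<Longrightarrow>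
    ennreal (vol 0 r) * avg (\<lambda>z. ennreal_powr (even_max f z) s) y (2 * r) \<le>
    ennreal C4 * (translate_integral \<kappa> y (\<lambda>x. ennreal_powr (absval f x) s) (4 * r) +
      translate_integral \<kappa> (- y) (\<lambda>x. ennreal_powr (absval f x) s) (4 * r))"
    by (rule avg_le_translate_integral[OF s]) blast
  obtain Cm where Cm: "Cm > 0" "\<And>G. G \<in> borel_measurable borel \<Longrightarrow> Lnorm \<mu> p (maximal_fn \<mu> G) \<le> ennreal Cm * Lnorm \<mu> p G"
    by (rule Lnorm_maximal_fn_le[OF p]) blast
  define a where "a = (2::real) powr (2 * \<kappa> + 1)"
  define e where "e = 2 powr (1 / s)"
  define C5 where "C5 = C4 powr (1 / s) * e"
  define C6 where "C6 = (4 / D + 1) * (2 * a) powr (1 / s)"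
  define C7 where "C7 = C3 powr (1 / s) * e"
  define C where "C = C7 * (4 * ((1 + Cm * C6) * (C5 * 8)))"
  have pos: "a > 0" "e > 0" "C5 > 0" "C6 > 0" "C7 > 0"
    using C4(1) C3(1) D_pos by (auto simp: a_def e_def C5_def C6_def C7_def add_pos_pos)
  have C: "C > 0" using pos Cm(1) by (auto simp: C_def intro!: mult_pos_pos add_pos_pos)
  have si: "1 / s > 0" "1 / s \<ge> 0" using s by auto
  have "amalgam_norm_at \<kappa> r q p (dunkl_maximal \<kappa> f) \<le> ennreal C * amalgam_norm_at \<kappa> (4 * r) q p (absval f)"
    if f [measurable]: "f \<in> borel_measurable borel" and r: "r > 0" for f r
  proof -
    define l where "l = (\<lambda>y. ennreal_powr (translate_integral \<kappa> y (\<lambda>x. ennreal_powr (dunkl_maximal \<kappa> f x) s) r) (1 / s))"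
    define n where "n = (\<lambda>y. ennreal_powr (translate_integral \<kappa> y (\<lambda>x. ennreal_powr (absval f x) s) (4 * r)) (1 / s))"
    define A where "A = (\<lambda>y. avg (\<lambda>z. ennreal_powr (even_max f z) s) y (2 * r))"
    define S where "S = (\<lambda>y. ennreal_powr (ennreal (vol 0 r) * A y) (1 / s))"
    define G where "G = (\<lambda>z. avg (even_max f) z r)"
    define v where "v = vol 0 r powr (1 / s)"
    have v: "v > 0" using vol_pos[OF r, of 0] by (simp add: v_def)
    have vS: "ennreal_powr (ennreal (vol 0 r)) (1 / s) = ennreal v"
      using vol_pos[OF r, of 0] by (simp add: v_def)
    have [measurable]: "dunkl_maximal \<kappa> f \<in> borel_measurable borel" by (rule dunkl_maximal_measurable) simp
    have [measurable]: "l \<in> borel_measurable borel"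
      unfolding l_def using r by (intro borel_measurable_ennreal_powr translate_integral_measurable) auto
    have [measurable]: "n \<in> borel_measurable borel"
      unfolding n_def using r by (intro borel_measurable_ennreal_powr translate_integral_measurable) auto
    have [measurable]: "A \<in> borel_measurable borel" unfolding A_def by measurable
    have [measurable]: "S \<in> borel_measurable borel" unfolding S_def by measurable
    have [measurable]: "G \<in> borel_measurable borel" unfolding G_def by measurable
    have [measurable]: "maximal_fn \<mu> G \<in> borel_measurable borel" by (rule borel_measurable_maximal_fn)
    have S_n: "S y \<le> ennreal C5 * (n y + n (- y))" for y
    proof -
      have "S y \<le> ennreal_powr (ennreal C4 * (translate_integral \<kappa> y (\<lambda>x. ennreal_powr (absval f x) s) (4 * r) +
          translate_integral \<kappa> (- y) (\<lambda>x. ennreal_powr (absval f x) s) (4 * r))) (1 / s)"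
        unfolding S_def A_def using si by (intro ennreal_powr_mono C4(2) f r)
      also have "\<dots> \<le> ennreal (C4 powr (1 / s)) * (ennreal e * (n y + n (- y)))"
        unfolding ennreal_powr_mult n_def e_def using si C4(1) by (auto intro!: mult_left_mono ennreal_powr_add_le)
      also have "\<dots> = ennreal C5 * (n y + n (- y))"
        using pos by (simp add: C5_def ennreal_mult mult.assoc)
      finally show ?thesis .
    qed
    have G_S: "ennreal v * G y \<le> ennreal C6 * S y" for y
    proof -
      \<comment> \<open>The average at radius r is enlarged to radius 2r so that one quantity
        \<open>A\<close>, bounded by translates of radius 4r, controls both terms.\<close>
      have A': "avg (\<lambda>z. ennreal_powr (even_max f z) s) y r \<le> ennreal (2 * a) * A y"
      proof -
        have "(\<integral>\<^sup>+z. ennreal_powr (even_max f z) s * indicator (annulus y r) z \<partial>\<mu>) \<le>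
            (\<integral>\<^sup>+z. ennreal_powr (even_max f z) s * indicator (annulus y (2 * r)) z \<partial>\<mu>)"
          using r by (intro nn_integral_mono mult_left_mono) (auto simp: indicator_def annulus_def)
        also have "\<dots> = A y * ennreal (vol y (2 * r))" unfolding A_def using r by (subst avg_times_vol) auto
        also have "\<dots> \<le> A y * ennreal (2 * a * vol y r)"
          unfolding a_def by (intro mult_left_mono ennreal_leI vol_double r) auto
        also have "\<dots> = ennreal (2 * a) * A y * ennreal (vol y r)"
        proof -
          have "ennreal (2 * a * vol y r) = ennreal (2 * a) * ennreal (vol y r)"
            using pos vol_pos[OF r, of y] by (intro ennreal_mult) auto
          then show ?thesis by (simp only: mult_ac)
        qed
        finally show ?thesis unfolding avg_le_iff[OF r] .
      qed
      have "G y \<le> ennreal (4 / D + 1) * ennreal_powr (avg (\<lambda>z. ennreal_powr (even_max f z) s) y r) (1 / s)"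
        unfolding G_def by (rule avg_power[OF _ s r]) simp
      also have "\<dots> \<le> ennreal (4 / D + 1) * ennreal_powr (ennreal (2 * a) * A y) (1 / s)"
        using si by (intro mult_left_mono ennreal_powr_mono A') auto
      also have "\<dots> = ennreal C6 * ennreal_powr (A y) (1 / s)"
      proof -
        have "ennreal_powr (ennreal (2 * a)) (1 / s) = ennreal ((2 * a) powr (1 / s))" using pos by (intro ennreal_powr_ennreal) auto
        moreover have "ennreal C6 = ennreal (4 / D + 1) * ennreal ((2 * a) powr (1 / s))"
          unfolding C6_def using D_pos by (intro ennreal_mult) auto
        ultimately show ?thesis unfolding ennreal_powr_mult by (simp only: mult.assoc)
      qed
      finally have "ennreal v * G y \<le> ennreal v * (ennreal C6 * ennreal_powr (A y) (1 / s))" by (rule mult_left_mono) simp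
      also have "\<dots> = ennreal C6 * S y" unfolding S_def ennreal_powr_mult vS by (simp only: mult_ac)
      finally show ?thesis .
    qed
    have l_S: "l y \<le> ennreal C7 * (S y + ennreal v * maximal_fn \<mu> G y)" if "y \<noteq> 0" for y
    proof -
      have "l y \<le> ennreal_powr (ennreal C3 * (ennreal (vol 0 r) * A y + ennreal (vol 0 r) * ennreal_powr (maximal_fn \<mu> G y) s)) (1 / s)"
        unfolding l_def A_def G_def distrib_left[symmetric] using si by (intro ennreal_powr_mono C3(2) f r that)
      also have "\<dots> \<le> ennreal (C3 powr (1 / s)) * (ennreal e * (S y + ennreal_powr (ennreal (vol 0 r) * ennreal_powr (maximal_fn \<mu> G y) s) (1 / s)))"
        unfolding ennreal_powr_mult[of "ennreal C3"] S_def e_def using si C3(1) by (auto intro!: mult_left_mono ennreal_powr_add_le)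
      also have "ennreal_powr (ennreal (vol 0 r) * ennreal_powr (maximal_fn \<mu> G y) s) (1 / s) = ennreal v * maximal_fn \<mu> G y"
        unfolding ennreal_powr_mult vS using s by (subst ennreal_powr_powr_inverse) auto
      also have "ennreal (C3 powr (1 / s)) * (ennreal e * (S y + ennreal v * maximal_fn \<mu> G y)) = ennreal C7 * (S y + ennreal v * maximal_fn \<mu> G y)"
        using pos by (simp add: C7_def ennreal_mult mult.assoc)
      finally show ?thesis .
    qed
    have LS: "Lnorm \<mu> p S \<le> ennreal (C5 * 8) * Lnorm \<mu> p n"
    proof -
      have "Lnorm \<mu> p S \<le> Lnorm \<mu> p (\<lambda>y. ennreal C5 * (n y + n (- y)))"
        using S_n by (intro Lnorm_mono_AE) auto
      also have "\<dots> \<le> ennreal C5 * Lnorm \<mu> p (\<lambda>y. n y + n (- y))" by (intro Lnorm_cmult_le p) measurable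
      also have "\<dots> \<le> ennreal C5 * (4 * (Lnorm \<mu> p n + Lnorm \<mu> p (\<lambda>y. n (- y))))"
        by (intro mult_left_mono Lnorm_add_le p) auto
      also have "\<dots> \<le> ennreal C5 * (4 * (Lnorm \<mu> p n + Lnorm \<mu> p n))"
        by (intro mult_left_mono add_left_mono Lnorm_uminus_le) auto
      also have "4 * (Lnorm \<mu> p n + Lnorm \<mu> p n) = ennreal 8 * Lnorm \<mu> p n"
        by (simp add: distrib_left flip: distrib_right)
      also have "ennreal C5 * (ennreal 8 * Lnorm \<mu> p n) = ennreal (C5 * 8) * Lnorm \<mu> p n"
        using pos by (subst ennreal_mult) (auto simp: mult.assoc)
      finally show ?thesis .
    qed
    have LM: "Lnorm \<mu> p (\<lambda>y. ennreal v * maximal_fn \<mu> G y) \<le> ennreal (Cm * C6) * Lnorm \<mu> p S"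
    proof -
      have "Lnorm \<mu> p (\<lambda>y. ennreal v * maximal_fn \<mu> G y) \<le> ennreal v * Lnorm \<mu> p (maximal_fn \<mu> G)"
        by (intro Lnorm_cmult_le p) measurable
      also have "\<dots> \<le> ennreal v * (ennreal Cm * Lnorm \<mu> p G)" by (intro mult_left_mono Cm(2)) auto
      \<comment> \<open>The power \<open>v\<close> of vol 0 r depends on r; it enters here as 1 /
        \<open>v\<close> and cancels the outer factor, which keeps the final constant independent of
        r.\<close>
      also have "Lnorm \<mu> p G \<le> Lnorm \<mu> p (\<lambda>y. ennreal (C6 / v) * S y)"
      proof (intro Lnorm_mono_AE AE_I2)
        fix y
        have "G y = ennreal (1 / v) * (ennreal v * G y)" using v by (simp add: mult.assoc[symmetric] flip: ennreal_mult)
        also have "\<dots> \<le> ennreal (1 / v) * (ennreal C6 * S y)" by (intro mult_left_mono G_S) auto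
        also have "\<dots> = ennreal (C6 / v) * S y" using v pos by (simp add: mult.assoc[symmetric] flip: ennreal_mult)
        finally show "G y \<le> ennreal (C6 / v) * S y" .
      qed simp
      also have "\<dots> \<le> ennreal (C6 / v) * Lnorm \<mu> p S" by (intro Lnorm_cmult_le p) measurable
      finally have "Lnorm \<mu> p (\<lambda>y. ennreal v * maximal_fn \<mu> G y) \<le> ennreal v * (ennreal Cm * (ennreal (C6 / v) * Lnorm \<mu> p S))"
        by (simp add: mult_left_mono)
      also have "\<dots> = ennreal (Cm * C6) * Lnorm \<mu> p S"
      proof -
        have "ennreal v * ennreal Cm * ennreal (C6 / v) = ennreal (Cm * C6)"
          using v pos Cm(1) by (simp flip: ennreal_mult)
        then show ?thesis by (simp only: mult.assoc[symmetric])
      qed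
      finally show ?thesis .
    qed
    have "Lnorm \<mu> p l \<le> Lnorm \<mu> p (\<lambda>y. ennreal C7 * (S y + ennreal v * maximal_fn \<mu> G y))"
    proof (rule Lnorm_mono_AE)
      show "AE y in \<mu>. l y \<le> ennreal C7 * (S y + ennreal v * maximal_fn \<mu> G y)"
        using AE_mu_nonzero by eventually_elim (rule l_S)
    qed measurable
    also have "\<dots> \<le> ennreal C7 * Lnorm \<mu> p (\<lambda>y. S y + ennreal v * maximal_fn \<mu> G y)" by (intro Lnorm_cmult_le p) measurable
    also have "\<dots> \<le> ennreal C7 * (4 * (Lnorm \<mu> p S + Lnorm \<mu> p (\<lambda>y. ennreal v * maximal_fn \<mu> G y)))"
      by (intro mult_left_mono Lnorm_add_le p) auto
    also have "\<dots> \<le> ennreal C7 * (4 * (Lnorm \<mu> p S + ennreal (Cm * C6) * Lnorm \<mu> p S))"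
      by (intro mult_left_mono add_left_mono LM) auto
    also have "Lnorm \<mu> p S + ennreal (Cm * C6) * Lnorm \<mu> p S = ennreal (1 + Cm * C6) * Lnorm \<mu> p S"
      using Cm(1) pos by (simp add: ennreal_plus distrib_right)
    also have "ennreal C7 * (4 * (ennreal (1 + Cm * C6) * Lnorm \<mu> p S)) \<le> ennreal C7 * (4 * (ennreal (1 + Cm * C6) * (ennreal (C5 * 8) * Lnorm \<mu> p n)))"
      by (intro mult_left_mono LS) auto
    also have "\<dots> = ennreal C * Lnorm \<mu> p n"
    proof -
      have "0 \<le> C7" "0 \<le> C5 * 8" "0 \<le> 1 + Cm * C6" using pos Cm(1) by auto
      then have "ennreal C = ennreal C7 * (ennreal 4 * (ennreal (1 + Cm * C6) * ennreal (C5 * 8)))"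
        unfolding C_def by (simp only: ennreal_mult[symmetric] mult_nonneg_nonneg zero_le_numeral)
      then show ?thesis by (simp only: mult.assoc ennreal_numeral)
    qed
    finally show ?thesis
      unfolding amalgam_norm_at_def s_def[symmetric] q_fin if_False l_def n_def .
  qed
  with C show ?thesis using that by blast
qed

section \<open>Ball volumes and the case q = \<infinity>\<close>

lemma esssup_ball_measurable:
  fixes g :: "real \<Rightarrow> ennreal"
  assumes [measurable]: "g \<in> borel_measurable borel"
  shows "(\<lambda>y. esssup \<mu> (\<lambda>x. g x * indicator (dunkl_ball y r) x)) \<in> borel_measurable borel"
proof (rule borel_measurableI_greater)
  fix t :: ennreal
  define h where "h y x = (if (y = 0 \<and> - r < x \<and> x < r) \<or> (y \<noteq> 0 \<and> max 0 (\<bar>y\<bar> - r) < \<bar>x\<bar> \<and> \<bar>x\<bar> < \<bar>y\<bar> + r) then g x else 0)" for y x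
  have h: "g x * indicator (dunkl_ball y r) x = h y x" for y x
    by (auto simp: h_def dunkl_ball_def)
  \<comment> \<open>The essential supremum exceeds t exactly if the indicator \<open>J y\<close> of
    the superlevel set has nonzero integral, and this integral is measurable in y by Tonelli's
    theorem.\<close>
  define J :: "real \<Rightarrow> real \<Rightarrow> ennreal" where "J y x = (if t < h y x then 1 else 0)" for y x
  have "(\<lambda>z. J (fst z) (snd z)) \<in> borel_measurable (borel \<Otimes>\<^sub>M borel)"
    unfolding J_def h_def by measurable
  then have [measurable]: "(\<lambda>y. \<integral>\<^sup>+x. J y x \<partial>\<mu>) \<in> borel_measurable borel"
    by (intro mu.borel_measurable_nn_integral) (simp add: split_def cong: measurable_cong_sets sets_pair_measure_cong)
  have hm [measurable]: "h y \<in> borel_measurable borel" for y unfolding h_def[abs_def] by measurable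
  have "t < esssup \<mu> (h y) \<longleftrightarrow> (\<integral>\<^sup>+x. J y x \<partial>\<mu>) \<noteq> 0" for y
  proof -
    have "esssup \<mu> (h y) \<le> t \<longleftrightarrow> (AE x in \<mu>. h y x \<le> t)"
    proof
      assume le: "esssup \<mu> (h y) \<le> t"
      show "AE x in \<mu>. h y x \<le> t"
        using esssup_AE[of "h y" \<mu>] by eventually_elim (rule order_trans[OF _ le])
    qed (auto intro!: esssup_I)
    also have "\<dots> \<longleftrightarrow> (\<integral>\<^sup>+x. J y x \<partial>\<mu>) = 0"
    proof -
      have "J y \<in> borel_measurable \<mu>" unfolding J_def[abs_def] by measurable
      then show ?thesis by (subst nn_integral_0_iff_AE) (auto simp: J_def not_less)
    qed
    finally show ?thesis by (simp add: not_le[symmetric])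
  qed
  then have "{y \<in> space borel. t < esssup \<mu> (h y)} = {y \<in> space borel. (\<integral>\<^sup>+x. J y x \<partial>\<mu>) \<noteq> 0}" by simp
  also have "\<dots> \<in> sets borel" by measurable
  finally show "{y \<in> space borel. t < esssup \<mu> (\<lambda>x. g x * indicator (dunkl_ball y r) x)} \<in> sets borel"
    unfolding h .
qed

lemma sets_dunkl_ball [measurable]: "dunkl_ball y r \<in> sets borel"
proof -
  have "dunkl_ball y r = {x. (y = 0 \<and> - r < x \<and> x < r) \<or> (y \<noteq> 0 \<and> max 0 (\<bar>y\<bar> - r) < \<bar>x\<bar> \<and> \<bar>x\<bar> < \<bar>y\<bar> + r)}"
    by (auto simp: dunkl_ball_def)
  then show ?thesis by simp
qed

lemma measure_dunkl_ball_bounds: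
  assumes r: "r > 0"
  shows "cvol * vol 0 r \<le> measure \<mu> (dunkl_ball 0 r)" "measure \<mu> (dunkl_ball 0 r) \<le> 4 / D * vol 0 r"
proof -
  have v: "vol 0 r > 0" by (rule vol_pos[OF r])
  have le: "emeasure \<mu> (dunkl_ball 0 r) \<le> ennreal (4 / D * vol 0 r)"
    unfolding dunkl_ball_0 by (rule emeasure_annulus_le[OF r])
  then have "emeasure \<mu> (dunkl_ball 0 r) < top" by (rule le_less_trans) simp
  then have eq: "emeasure \<mu> (dunkl_ball 0 r) = ennreal (measure \<mu> (dunkl_ball 0 r))"
    by (intro emeasure_eq_ennreal_measure) auto
  show "measure \<mu> (dunkl_ball 0 r) \<le> 4 / D * vol 0 r"
    using le v D_pos unfolding eq by (subst (asm) ennreal_le_iff) auto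
  have "ennreal (cvol * vol 0 r) \<le> ennreal (measure \<mu> (dunkl_ball 0 r))"
    using emeasure_annulus_ge[OF r, of 0] unfolding dunkl_ball_0[symmetric] eq .
  then show "cvol * vol 0 r \<le> measure \<mu> (dunkl_ball 0 r)" by (subst (asm) ennreal_le_iff) auto
qed

lemma measure_dunkl_ball_pos: "r > 0 \<Longrightarrow> measure \<mu> (dunkl_ball 0 r) > 0"
  using measure_dunkl_ball_bounds(1)[of r] vol_pos[of r 0] cvol_pos by (meson less_le_trans mult_pos_pos)

text \<open>Absorbs the passage from scale r to 4r in the weight of the norm. For nonnegative e
  monotonicity in the radius suffices; for negative e the inequality runs the other way and is the
  doubling property, with \<open>k\<close> the quotient of the two volume bounds.\<close>

lemma measure_dunkl_ball_powr_le:
  obtains C where "C > 0" "\<And>r. r > 0 \<Longrightarrow>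
    measure \<mu> (dunkl_ball 0 r) powr e \<le> C * measure \<mu> (dunkl_ball 0 (4 * r)) powr e"
proof -
  define k where "k = 4 / D / cvol * (4 * 4 powr (2 * \<kappa> + 1))"
  have k: "k > 0" using D_pos cvol_pos by (simp add: k_def)
  have "measure \<mu> (dunkl_ball 0 r) powr e \<le> max 1 (k powr (- e)) * measure \<mu> (dunkl_ball 0 (4 * r)) powr e"
    if r: "r > 0" for r
  proof -
    define m where "m = measure \<mu> (dunkl_ball 0 r)"
    define n where "n = measure \<mu> (dunkl_ball 0 (4 * r))"
    have m: "m > 0" and n: "n > 0" using r by (auto simp: m_def n_def intro: measure_dunkl_ball_pos)
    have "m \<le> n" unfolding m_def n_def
    proof (rule measure_mono_fmeasurable)
      have "emeasure \<mu> (dunkl_ball 0 (4 * r)) < top"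
        unfolding dunkl_ball_0 using r emeasure_annulus_le[of "4 * r" 0] by (auto intro: le_less_trans)
      then show "dunkl_ball 0 (4 * r) \<in> fmeasurable \<mu>" by (intro fmeasurableI) auto
    qed (use r in \<open>auto simp: dunkl_ball_def\<close>)
    have "n \<le> 4 / D * vol 0 (4 * r)" unfolding n_def using r by (intro measure_dunkl_ball_bounds) auto
    also have "\<dots> \<le> 4 / D * (4 * 4 powr (2 * \<kappa> + 1) * vol 0 r)"
      using r D_pos by (intro mult_left_mono vol_mono_cmult) auto
    also have "\<dots> = k * (cvol * vol 0 r)" using cvol_pos by (simp add: k_def)
    also have "\<dots> \<le> k * m" unfolding m_def using r k by (intro mult_left_mono measure_dunkl_ball_bounds) auto
    finally have nk: "n \<le> k * m" .
    show ?thesis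
    proof (cases "e \<ge> 0")
      case True
      then have "m powr e \<le> 1 * n powr e" using \<open>m \<le> n\<close> m by (simp add: powr_mono2)
      also have "\<dots> \<le> max 1 (k powr (- e)) * n powr e" by (intro mult_right_mono) auto
      finally show ?thesis unfolding m_def n_def .
    next
      case False
      have "m powr e = k powr (- e) * (k * m) powr e" using k m by (simp add: powr_mult powr_minus field_simps)
      also have "\<dots> \<le> k powr (- e) * n powr e" using False n nk by (intro mult_left_mono powr_mono2') auto
      also have "\<dots> \<le> max 1 (k powr (- e)) * n powr e" by (intro mult_right_mono) auto
      finally show ?thesis unfolding m_def n_def .
    qed
  qed
  then show ?thesis using that[of "max 1 (k powr (- e))"] by simp
qed

lemma avg_le_esssup:
  assumes [measurable]: "F \<in> borel_measurable borel" and r: "r > 0"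
  shows "avg F x r \<le> ennreal (4 / D) * esssup \<mu> F"
proof -
  have v: "vol x r > 0" by (rule vol_pos[OF r])
  have "(\<integral>\<^sup>+z. F z * indicator (annulus x r) z \<partial>\<mu>) \<le> (\<integral>\<^sup>+z. esssup \<mu> F * indicator (annulus x r) z \<partial>\<mu>)"
    using esssup_AE[of F \<mu>] by (intro nn_integral_mono_AE) (auto elim!: eventually_mono intro: mult_right_mono)
  also have "\<dots> = esssup \<mu> F * emeasure \<mu> (annulus x r)" by (rule nn_integral_cmult_indicator) simp
  also have "\<dots> \<le> esssup \<mu> F * ennreal (4 / D * vol x r)" by (intro mult_left_mono emeasure_annulus_le r) auto
  also have "\<dots> = ennreal (4 / D) * esssup \<mu> F * ennreal (vol x r)"
  proof -
    have "ennreal (4 / D * vol x r) = ennreal (4 / D) * ennreal (vol x r)" using v D_pos by (intro ennreal_mult) auto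
    then show ?thesis by (simp only: mult_ac)
  qed
  finally show ?thesis unfolding avg_le_iff[OF r] .
qed

lemma esssup_even_max_le:
  assumes [measurable]: "f \<in> borel_measurable borel"
  shows "esssup \<mu> (even_max f) \<le> esssup \<mu> (absval f)"
proof (rule esssup_I)
  have "esssup \<mu> (\<lambda>x. absval f (- x)) \<le> esssup \<mu> (absval f)"
    using Lnorm_uminus_le[of "absval f" \<infinity>] by (simp add: Lnorm_def)
  moreover have "AE x in \<mu>. absval f (- x) \<le> esssup \<mu> (\<lambda>x. absval f (- x))" by (rule esssup_AE)
  ultimately have "AE x in \<mu>. absval f (- x) \<le> esssup \<mu> (absval f)"
    by (auto elim!: eventually_mono)
  with esssup_AE[of "absval f" \<mu>] show "AE x in \<mu>. even_max f x \<le> esssup \<mu> (absval f)"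
    by eventually_elim (simp add: even_max_def)
qed simp

text \<open>An average of the even majorant is at most a constant times its essential supremum, so
  the maximal function is bounded at every point and at every scale.\<close>

lemma amalgam_norm_at_maximal_le_infty:
  obtains C where "C > 0" "\<And>f r. f \<in> borel_measurable borel \<Longrightarrow>
    amalgam_norm_at \<kappa> r \<infinity> \<infinity> (dunkl_maximal \<kappa> f) \<le> ennreal C * esssup \<mu> (absval f)"
proof -
  obtain C where C: "C > 0" "\<And>f x. f \<in> borel_measurable borel \<Longrightarrow>
    dunkl_maximal \<kappa> f x \<le> ennreal C * (SUP s\<in>{0<..}. avg (even_max f) x s)"
    by (rule dunkl_maximal_le_avg) blast
  have "amalgam_norm_at \<kappa> r \<infinity> \<infinity> (dunkl_maximal \<kappa> f) \<le> ennreal (C * (4 / D)) * esssup \<mu> (absval f)"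
    if f [measurable]: "f \<in> borel_measurable borel" for f r
  proof -
    define S where "S = ennreal (C * (4 / D)) * esssup \<mu> (absval f)"
    have [measurable]: "dunkl_maximal \<kappa> f \<in> borel_measurable borel" by (rule dunkl_maximal_measurable[OF f])
    have M: "dunkl_maximal \<kappa> f x \<le> S" for x
    proof -
      have "avg (even_max f) x s \<le> ennreal (4 / D) * esssup \<mu> (absval f)" if "s > 0" for s
        using avg_le_esssup[of "even_max f" s x] that
          mult_left_mono[OF esssup_even_max_le[OF f], of "ennreal (4 / D)"] by (auto intro: order_trans)
      then have "(SUP s\<in>{0<..}. avg (even_max f) x s) \<le> ennreal (4 / D) * esssup \<mu> (absval f)"
        by (auto intro: SUP_least)
      then have "dunkl_maximal \<kappa> f x \<le> ennreal C * (ennreal (4 / D) * esssup \<mu> (absval f))"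
        using C(2)[OF f, of x] by (meson mult_left_mono order_trans zero_le)
      moreover have "ennreal (C * (4 / D)) = ennreal C * ennreal (4 / D)"
        using C(1) D_pos by (intro ennreal_mult) auto
      ultimately show ?thesis unfolding S_def by (simp only: mult.assoc)
    qed
    have "esssup \<mu> (\<lambda>x. dunkl_maximal \<kappa> f x * indicator (dunkl_ball y r) x) \<le> S" for y
      using M by (intro esssup_I AE_I2) (auto simp: indicator_def)
    then have "esssup \<mu> (\<lambda>y. esssup \<mu> (\<lambda>x. dunkl_maximal \<kappa> f x * indicator (dunkl_ball y r) x)) \<le> S"
      by - (rule esssup_I, simp_all add: esssup_ball_measurable)
    then show ?thesis by (simp add: amalgam_norm_at_def Lnorm_def S_def)
  qed
  moreover have "C * (4 / D) > 0" using C(1) D_pos by simp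
  ultimately show ?thesis using that by blast
qed

text \<open>For 0 < |y| < r the ball around y contains all x with 0 < |x| < r, so a single such y at
  which the local norm obeys the bound controls f on the punctured ball of radius r. Integer radii
  exhaust the line up to the null set {0}.\<close>

lemma esssup_le_amalgam_norm:
  assumes [measurable]: "f \<in> borel_measurable borel"
  shows "esssup \<mu> (absval f) \<le> amalgam_norm \<kappa> \<infinity> \<infinity> \<infinity> (absval f)"
proof -
  define S where "S = amalgam_norm \<kappa> \<infinity> \<infinity> \<infinity> (absval f)"
  define h where "h r y = esssup \<mu> (\<lambda>x. absval f x * indicator (dunkl_ball y r) x)" for r y
  have ball: "AE x in \<mu>. x \<noteq> 0 \<longrightarrow> \<bar>x\<bar> < r \<longrightarrow> absval f x \<le> S" if r: "r > 0" for r
  proof -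
    have "ennreal (measure \<mu> (dunkl_ball 0 r) powr 0) * amalgam_norm_at \<kappa> r \<infinity> \<infinity> (absval f) \<le> S"
      unfolding S_def amalgam_norm_def using r by (intro SUP_upper2[of r]) auto
    then have "esssup \<mu> (h r) \<le> S"
      using measure_dunkl_ball_pos[OF r] by (simp add: amalgam_norm_at_def Lnorm_def h_def[abs_def])
    then have hS: "AE y in \<mu>. h r y \<le> S" using esssup_AE[of "h r" \<mu>] by (auto elim!: eventually_mono)
    \<comment> \<open>Almost every y obeys the bound, and the ball of radius r has positive measure,
      so some nonzero y in it does.\<close>
    obtain y where y: "y \<noteq> 0" "\<bar>y\<bar> < r" "h r y \<le> S"
    proof (rule ccontr)
      assume neg: "\<not> thesis"
      have "AE y in \<mu>. y \<notin> dunkl_ball 0 r" using hS AE_mu_nonzero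
      proof eventually_elim
        case (elim y)
        then have "\<not> \<bar>y\<bar> < r" using neg that by blast
        then show "y \<notin> dunkl_ball 0 r" by (auto simp: dunkl_ball_def)
      qed
      then have "emeasure \<mu> (dunkl_ball 0 r) = 0" by (subst (asm) AE_iff_measurable[OF _ refl]) auto
      then show False using measure_dunkl_ball_pos[OF r] by (simp add: measure_def)
    qed
    have "AE x in \<mu>. absval f x * indicator (dunkl_ball y r) x \<le> h r y" unfolding h_def by (rule esssup_AE)
    then show ?thesis
    proof eventually_elim
      fix x assume x: "absval f x * indicator (dunkl_ball y r) x \<le> h r y"
      show "x \<noteq> 0 \<longrightarrow> \<bar>x\<bar> < r \<longrightarrow> absval f x \<le> S"
      proof (intro impI)
        assume "x \<noteq> 0" "\<bar>x\<bar> < r"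
        then have "x \<in> dunkl_ball y r" using y by (auto simp: dunkl_ball_def)
        then show "absval f x \<le> S" using x y(3) by auto
      qed
    qed
  qed
  have "AE x in \<mu>. \<forall>n. x \<noteq> 0 \<longrightarrow> \<bar>x\<bar> < real (Suc n) \<longrightarrow> absval f x \<le> S"
    by (intro AE_all_countable[THEN iffD2] allI ball) simp
  with AE_mu_nonzero have "AE x in \<mu>. absval f x \<le> S"
  proof eventually_elim
    fix x :: real assume x: "x \<noteq> 0" "\<forall>n. x \<noteq> 0 \<longrightarrow> \<bar>x\<bar> < real (Suc n) \<longrightarrow> absval f x \<le> S"
    obtain n where "\<bar>x\<bar> < real n" using reals_Archimedean2 by blast
    then have "\<bar>x\<bar> < real (Suc n)" by simp
    with x show "absval f x \<le> S" by blast
  qed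
  then show ?thesis unfolding S_def by (intro esssup_I) auto
qed

lemma amalgam_norm_maximal_le:
  assumes "1 < q" "q \<le> \<alpha>" "\<alpha> \<le> p"
  obtains C where "C > 0" "\<And>f. f \<in> borel_measurable borel \<Longrightarrow>
    amalgam_norm \<kappa> q p \<alpha> (dunkl_maximal \<kappa> f) \<le> ennreal C * amalgam_norm \<kappa> q p \<alpha> (absval f)"
proof (cases "q = \<infinity>")
  case True
  \<comment> \<open>An infinite q forces the other exponents to be infinite; the exponent of the
    weight is then 0 and the weight is 1 at every scale.\<close>
  then have inf: "q = \<infinity>" "\<alpha> = \<infinity>" "p = \<infinity>" using assms by (auto simp: top_unique)
  obtain C where C: "C > 0" "\<And>f r. f \<in> borel_measurable borel \<Longrightarrow>
    amalgam_norm_at \<kappa> r \<infinity> \<infinity> (dunkl_maximal \<kappa> f) \<le> ennreal C * esssup \<mu> (absval f)"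
    by (rule amalgam_norm_at_maximal_le_infty) blast
  have "amalgam_norm \<kappa> q p \<alpha> (dunkl_maximal \<kappa> f) \<le> ennreal C * amalgam_norm \<kappa> q p \<alpha> (absval f)"
    if f: "f \<in> borel_measurable borel" for f
    unfolding inf amalgam_norm_def[of _ _ _ _ "dunkl_maximal \<kappa> f"]
  proof (rule SUP_least)
    fix r :: real assume "r \<in> {0<..}"
    then have "ennreal (measure \<mu> (dunkl_ball 0 r) powr (enn2real (1 / \<infinity>) - enn2real (1 / \<infinity>) - enn2real (1 / \<infinity>))) = 1"
      using measure_dunkl_ball_pos[of r] by simp
    moreover have "amalgam_norm_at \<kappa> r \<infinity> \<infinity> (dunkl_maximal \<kappa> f) \<le> ennreal C * amalgam_norm \<kappa> \<infinity> \<infinity> \<infinity> (absval f)"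
      using C(2)[OF f, of r] mult_left_mono[OF esssup_le_amalgam_norm[OF f], of "ennreal C"] by (auto intro: order_trans)
    ultimately show "ennreal (measure \<mu> (dunkl_ball 0 r) powr (enn2real (1 / \<infinity>) - enn2real (1 / \<infinity>) - enn2real (1 / \<infinity>))) *
        amalgam_norm_at \<kappa> r \<infinity> \<infinity> (dunkl_maximal \<kappa> f) \<le> ennreal C * amalgam_norm \<kappa> \<infinity> \<infinity> \<infinity> (absval f)"
      by (simp only: mult_1_left)
  qed
  with C(1) show ?thesis using that by blast
next
  case False
  then have q: "1 < q" "q < \<infinity>" and p: "p > 1" using assms by (auto simp: less_top)
  define e where "e = enn2real (1 / \<alpha>) - enn2real (1 / q) - enn2real (1 / p)"
  obtain C where C: "C > 0" "\<And>f r. f \<in> borel_measurable borel \<Longrightarrow> r > 0 \<Longrightarrow>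
    amalgam_norm_at \<kappa> r q p (dunkl_maximal \<kappa> f) \<le> ennreal C * amalgam_norm_at \<kappa> (4 * r) q p (absval f)"
    by (rule amalgam_norm_at_maximal_le[OF q p]) blast
  obtain B where B: "B > 0" "\<And>r. r > 0 \<Longrightarrow>
    measure \<mu> (dunkl_ball 0 r) powr e \<le> B * measure \<mu> (dunkl_ball 0 (4 * r)) powr e"
    by (rule measure_dunkl_ball_powr_le) blast
  have "amalgam_norm \<kappa> q p \<alpha> (dunkl_maximal \<kappa> f) \<le> ennreal (B * C) * amalgam_norm \<kappa> q p \<alpha> (absval f)"
    if f: "f \<in> borel_measurable borel" for f
    unfolding amalgam_norm_def[of _ _ _ _ "dunkl_maximal \<kappa> f"] e_def[symmetric]
  proof (rule SUP_least)
    fix r :: real assume "r \<in> {0<..}"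
    then have r: "r > 0" by simp
    have "ennreal (measure \<mu> (dunkl_ball 0 r) powr e) * amalgam_norm_at \<kappa> r q p (dunkl_maximal \<kappa> f) \<le>
        ennreal (B * measure \<mu> (dunkl_ball 0 (4 * r)) powr e) * (ennreal C * amalgam_norm_at \<kappa> (4 * r) q p (absval f))"
      by (intro mult_mono ennreal_leI B(2) C(2) f r) auto
    also have "\<dots> = ennreal (B * C) * (ennreal (measure \<mu> (dunkl_ball 0 (4 * r)) powr e) * amalgam_norm_at \<kappa> (4 * r) q p (absval f))"
    proof -
      have "ennreal (B * measure \<mu> (dunkl_ball 0 (4 * r)) powr e) = ennreal B * ennreal (measure \<mu> (dunkl_ball 0 (4 * r)) powr e)"
        "ennreal (B * C) = ennreal B * ennreal C" using B(1) C(1) by (auto intro!: ennreal_mult)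
      then show ?thesis by (simp only: mult_ac)
    qed
    \<comment> \<open>The radius 4r is itself admissible in the supremum over all scales that
      defines the norm of f.\<close>
    also have "\<dots> \<le> ennreal (B * C) * amalgam_norm \<kappa> q p \<alpha> (absval f)"
      unfolding amalgam_norm_def e_def using r by (intro mult_left_mono SUP_upper2[of "4 * r"]) auto
    finally show "ennreal (measure \<mu> (dunkl_ball 0 r) powr e) * amalgam_norm_at \<kappa> r q p (dunkl_maximal \<kappa> f) \<le>
        ennreal (B * C) * amalgam_norm \<kappa> q p \<alpha> (absval f)" .
  qed
  moreover have "B * C > 0" using B(1) C(1) by simp
  ultimately show ?thesis using that by blast
qed

end

theorem theorem5p1:
  fixes \<kappa> :: real and q \<alpha> p :: ennreal
  assumes "\<kappa> > - 1 / 2" and "1 < q" and "q \<le> \<alpha>" and "\<alpha> \<le> p"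
  shows "\<exists>C>0::real. \<forall>f\<in>Lspace_loc (dunkl_measure \<kappa>) q.
           amalgam_norm \<kappa> q p \<alpha> (dunkl_maximal \<kappa> f)
             \<le> ennreal C * amalgam_norm \<kappa> q p \<alpha> (absval f)"
proof -
  interpret dunkl \<kappa> using assms(1) by unfold_locales simp
  obtain C where C: "C > 0" "\<And>f. f \<in> borel_measurable borel \<Longrightarrow>
    amalgam_norm \<kappa> q p \<alpha> (dunkl_maximal \<kappa> f) \<le> ennreal C * amalgam_norm \<kappa> q p \<alpha> (absval f)"
    by (rule amalgam_norm_maximal_le[OF assms(2-4)]) blast
  moreover have "f \<in> borel_measurable borel" if "f \<in> Lspace_loc (dunkl_measure \<kappa>) q" for f
    using that by (simp add: Lspace_loc_def dunkl_measure_def)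
  ultimately show ?thesis by blast
qed

end
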